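(* Let $A$ be a $0$-sectorial operator on a Banach space $X$, and let $\beta_1,\beta_2\ge\alpha>0$ be constants such that for some $C>0$ $$\|(1+A)^{-\beta_1}e^{itA}\|\le C\langle t\rangle^{\alpha}\qquad(t\in\mathbb{R})$$ and such that the set $\{(1+A)^{-\beta_2}e^{itA}:t\in[0,1]\}$ is $\gamma$-bounded. Then $A$ has a smoothed $E^\alpha_\infty$ functional calculus in the following sense: for $\beta=\beta_1+2\beta_2$ there is a constant $C'>0$ such that $$\|(1+A)^{-\beta}f(A)\|\le C'\|f\|_{E^\alpha_\infty}$$ for all $f\in E^\alpha_\infty$ with compact support in $(0,\infty)$.
   Context: Notation: $\langle t\rangle=1+|t|$; $\hat f(t)=\int_{\mathbb{R}}f(s)e^{-ist}\,ds$, and $\check{\ }$ is the inverse Fourier transform; $\Sigma_\omega=\{z\ne0:|\arg z|<\omega\}$. $\gamma$-boundedness: with $(\gamma_k)$ independent standard Gaussian variables and $\|\sum_k\gamma_k\otimes x_k\|_{\mathrm{Gauss}(X)}=(\mathbb{E}\|\sum_k\gamma_kx_k\|_X^2)^{1/2}$, a set $\tau\subset B(X)$ is $\gamma$-bounded if there is $C\ge0$ with $\|\sum_k\gamma_k\otimes T_kx_k\|_{\mathrm{Gauss}(X)}\le C\|\sum_k\gamma_k\otimes x_k\|_{\mathrm{Gauss}(X)}$ for all finite families $T_k\in\tau$, $x_k\in X$. The space $E^\alpha_\infty$: let $\phi\in C_c^\infty(\mathbb{R})$ with $\mathrm{supp}\,\phi\subset[-1,1]$, $\phi_n=\phi(\cdot-n)$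 and $\sum_{n\in\mathbb{Z}}\phi_n=1$ on $\mathbb{R}$. Then $E^\alpha_\infty$ consists of the (bounded continuous) $f:\mathbb{R}\to\mathbb{C}$ with $\|f\|_{E^\alpha_\infty}=\sum_{n\in\mathbb{Z}}\langle n\rangle^\alpha\|f*\check\phi_n\|_\infty<\infty$. $0$-sectorial: $A$ is closed with dense range and for every $\omega>0$, $\sigma(A)\subset\overline{\Sigma_\omega}$ and for every $\theta>\omega$ there is $C_\theta$ with $\|\lambda(\lambda-A)^{-1}\|\le C_\theta$ for all $\lambda\notin\overline{\Sigma_\theta}$; $-A$ generates a $C_0$-semigroup $e^{-zA}$ that is analytic on the right half-plane. Meaning of the operators: $(1+A)^{-\beta}e^{itA}$ denotes the operator $e^{-sA}x\mapsto(1+A)^{-\beta}e^{-(s-it)A}x$ ($s>0$, $x\in X$), given on the dense subspace $\bigcup_{s>0}e^{-sA}(X)$; the hypotheses include that it extends to a bounded operator on $X$, denoted by the same symbol. For $f\in E^\alpha_\infty$ with compact support in $(0,\infty)$, $f(A)$ is given through $(1+A)^{-\beta}f(A)x=\frac1{2\pi}\int_{\mathbb{R}}\hat f(t)(1+A)^{-\beta}e^{itA}x\,dt$. *)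

theory Defs
  imports "HOL-Probability.Probability"
begin

section \<open>Complex Banach spaces and complex-linear bounded operators\<close>

class complex_banach = banach +
  fixes scaleC :: "complex \<Rightarrow> 'a \<Rightarrow> 'a"  (infixr "*\<^sub>C" 75)
  assumes scaleC_of_real: "complex_of_real r *\<^sub>C x = r *\<^sub>R x"
    and scaleC_add_right: "a *\<^sub>C (x + y) = a *\<^sub>C x + a *\<^sub>C y"
    and scaleC_add_left: "(a + b) *\<^sub>C x = a *\<^sub>C x + b *\<^sub>C x"
    and scaleC_scaleC: "a *\<^sub>C b *\<^sub>C x = (a * b) *\<^sub>C x"
    and norm_scaleC: "norm (a *\<^sub>C x) = cmod a * norm x"

instantiation complex :: complex_banach
begin

definition scaleC_complex :: "complex \<Rightarrow> complex \<Rightarrow> complex"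
  where "scaleC_complex a x = a * x"

instance
  by standard (auto simp: scaleC_complex_def scaleR_conv_of_real algebra_simps norm_mult)

end

text \<open>The type of \<open>blinfun\<close> only records real linearity; \<open>B(X)\<close> consists of those
  elements that satisfy the following predicate.\<close>

definition complex_linear :: "('a::complex_banach \<Rightarrow>\<^sub>L 'a) \<Rightarrow> bool"
  where "complex_linear S \<longleftrightarrow> (\<forall>c x. S (c *\<^sub>C x) = c *\<^sub>C S x)"

section \<open>0-sectorial operators\<close>

text \<open>An unbounded operator is given by its domain \<open>D\<close> and a function \<open>A\<close>, of which only the
  values on \<open>D\<close> matter.\<close>

definition linear_operator :: "'a::complex_banach set \<Rightarrow> ('a \<Rightarrow> 'a) \<Rightarrow> bool"
  where "linear_operator D A \<longleftrightarrow> 0 \<in> D \<and>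
    (\<forall>x\<in>D. \<forall>y\<in>D. x + y \<in> D \<and> A (x + y) = A x + A y) \<and>
    (\<forall>c. \<forall>x\<in>D. c *\<^sub>C x \<in> D \<and> A (c *\<^sub>C x) = c *\<^sub>C A x)"

definition closed_operator :: "'a::complex_banach set \<Rightarrow> ('a \<Rightarrow> 'a) \<Rightarrow> bool"
  where "closed_operator D A \<longleftrightarrow> linear_operator D A \<and> closed ((\<lambda>x. (x, A x)) ` D)"

definition is_resolvent ::
    "'a::complex_banach set \<Rightarrow> ('a \<Rightarrow> 'a) \<Rightarrow> complex \<Rightarrow> ('a \<Rightarrow>\<^sub>L 'a) \<Rightarrow> bool"
  where "is_resolvent D A z R \<longleftrightarrow> complex_linear R \<and>
    (\<forall>x. R x \<in> D \<and> z *\<^sub>C R x - A (R x) = x) \<and>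
    (\<forall>x\<in>D. R (z *\<^sub>C x - A x) = x)"

definition op_spectrum :: "'a::complex_banach set \<Rightarrow> ('a \<Rightarrow> 'a) \<Rightarrow> complex set"
  where "op_spectrum D A = {z. \<nexists>R. is_resolvent D A z R}"

definition resolvent ::
    "'a::complex_banach set \<Rightarrow> ('a \<Rightarrow> 'a) \<Rightarrow> complex \<Rightarrow> ('a \<Rightarrow>\<^sub>L 'a)"
  where "resolvent D A z = (THE R. is_resolvent D A z R)"

definition sector :: "real \<Rightarrow> complex set"
  where "sector \<omega> = {z. z \<noteq> 0 \<and> \<bar>Arg z\<bar> < \<omega>}"

definition zero_sectorial :: "'a::complex_banach set \<Rightarrow> ('a \<Rightarrow> 'a) \<Rightarrow> bool"
  where "zero_sectorial D A \<longleftrightarrow> closed_operator D A \<and> closure (A ` D) = UNIV \<and>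
    (\<forall>\<omega>>0. op_spectrum D A \<subseteq> closure (sector \<omega>) \<and>
      (\<forall>\<theta>>\<omega>. \<exists>C. \<forall>z. z \<notin> closure (sector \<theta>) \<longrightarrow> cmod z * norm (resolvent D A z) \<le> C))"

text \<open>\<open>T z\<close> stands for \<open>e\<^bsup>-zA\<^esup>\<close>. Only its values at \<open>0\<close> and on the open right half-plane are
  constrained. Analyticity is complex differentiability of all orbits, which is
  equivalent to analyticity in operator norm.\<close>

definition analytic_semigroup_of ::
    "'a::complex_banach set \<Rightarrow> ('a \<Rightarrow> 'a) \<Rightarrow> (complex \<Rightarrow> ('a \<Rightarrow>\<^sub>L 'a)) \<Rightarrow> bool"
  where "analytic_semigroup_of D A T \<longleftrightarrow>
    (\<forall>z. z = 0 \<or> 0 < Re z \<longrightarrow> complex_linear (T z)) \<and>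
    T 0 = id_blinfun \<and>
    (\<forall>z w. (z = 0 \<or> 0 < Re z) \<and> (w = 0 \<or> 0 < Re w) \<longrightarrow> T (z + w) = T z o\<^sub>L T w) \<and>
    (\<forall>x. ((\<lambda>s. T (complex_of_real s) x) \<longlongrightarrow> x) (at_right 0)) \<and>
    D = {x. \<exists>y. ((\<lambda>s. (1 / s) *\<^sub>R (T (complex_of_real s) x - x)) \<longlongrightarrow> y) (at_right 0)} \<and>
    (\<forall>x\<in>D. ((\<lambda>s. (1 / s) *\<^sub>R (T (complex_of_real s) x - x)) \<longlongrightarrow> - A x) (at_right 0)) \<and>
    (\<forall>z x. 0 < Re z \<longrightarrow> (\<exists>y. ((\<lambda>h. (1 / h) *\<^sub>C (T (z + h) x - T z x)) \<longlongrightarrow> y) (at 0)))"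

section \<open>The operators \<open>(1+A)\<^bsup>-\<beta>\<^esup>\<close> and \<open>(1+A)\<^bsup>-\<beta>\<^esup> e\<^bsup>itA\<^esup>\<close>\<close>

text \<open>For \<open>\<beta> > 0\<close> the fractional power is given by
  \<open>(1+A)\<^bsup>-\<beta>\<^esup> x = 1/\<Gamma>(\<beta>) \<integral>\<^sub>0\<^sup>\<infinity> s\<^bsup>\<beta>-1\<^esup> e\<^bsup>-s(1+A)\<^esup> x ds\<close>. The integral exists because the semigroup of a
  0-sectorial operator is bounded on the positive half-line. It is written as a
  Henstock-Kurzweil integral since the library's Bochner integral needs a second countable
  target space.\<close>

definition frac_power :: "(complex \<Rightarrow> ('a::complex_banach \<Rightarrow>\<^sub>L 'a)) \<Rightarrow> real \<Rightarrow> 'a \<Rightarrow> 'a"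
  where "frac_power T \<beta> x =
    (1 / Gamma \<beta>) *\<^sub>R integral {0..} (\<lambda>s. (s powr (\<beta> - 1) * exp (- s)) *\<^sub>R T (complex_of_real s) x)"

definition is_reg_group ::
    "(complex \<Rightarrow> ('a::complex_banach \<Rightarrow>\<^sub>L 'a)) \<Rightarrow> real \<Rightarrow> real \<Rightarrow> ('a \<Rightarrow>\<^sub>L 'a) \<Rightarrow> bool"
  where "is_reg_group T \<beta> t U \<longleftrightarrow> complex_linear U \<and>
    (\<forall>s>0. \<forall>x. U (T (complex_of_real s) x) = frac_power T \<beta> (T (complex_of_real s - \<i> * complex_of_real t) x))"

definition reg_group_bounded :: "(complex \<Rightarrow> ('a::complex_banach \<Rightarrow>\<^sub>L 'a)) \<Rightarrow> real \<Rightarrow> real \<Rightarrow> bool"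
  where "reg_group_bounded T \<beta> t \<longleftrightarrow> (\<exists>U. is_reg_group T \<beta> t U)"

text \<open>The bounded extension is unique, as the union of the ranges of \<open>T s\<close>, \<open>s > 0\<close>, is dense.\<close>

definition reg_group ::
    "(complex \<Rightarrow> ('a::complex_banach \<Rightarrow>\<^sub>L 'a)) \<Rightarrow> real \<Rightarrow> real \<Rightarrow> ('a \<Rightarrow>\<^sub>L 'a)"
  where "reg_group T \<beta> t = (THE U. is_reg_group T \<beta> t U)"

section \<open>\<open>\<gamma>\<close>-boundedness\<close>

definition gauss_norm :: "nat \<Rightarrow> (nat \<Rightarrow> 'a::real_normed_vector) \<Rightarrow> real"
  where "gauss_norm n x =
    sqrt (\<integral>g. (norm (\<Sum>k<n. g k *\<^sub>R x k))\<^sup>2 \<partial>(\<Pi>\<^sub>M k\<in>{..<n}. density lborel std_normal_density))"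

definition gamma_bounded :: "('a::real_normed_vector \<Rightarrow>\<^sub>L 'a) set \<Rightarrow> bool"
  where "gamma_bounded \<tau> \<longleftrightarrow> (\<exists>C\<ge>0. \<forall>n S x. (\<forall>k<n. S k \<in> \<tau>) \<longrightarrow>
    gauss_norm n (\<lambda>k. blinfun_apply (S k) (x k)) \<le> C * gauss_norm n x)"

section \<open>The space \<open>E\<^sup>\<alpha>\<^sub>\<infinity>\<close>\<close>

definition smooth :: "(real \<Rightarrow> complex) \<Rightarrow> bool"
  where "smooth \<phi> \<longleftrightarrow>
    (\<exists>d. d 0 = \<phi> \<and> (\<forall>n t. ((d n :: real \<Rightarrow> complex) has_vector_derivative d (Suc n) t) (at t)))"

definition unit_partition :: "(real \<Rightarrow> complex) \<Rightarrow> bool"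
  where "unit_partition \<phi> \<longleftrightarrow> smooth \<phi> \<and> closure {t. \<phi> t \<noteq> 0} \<subseteq> {-1..1} \<and>
    (\<forall>t. ((\<lambda>n::int. \<phi> (t - of_int n)) has_sum 1) UNIV)"

definition fourier :: "(real \<Rightarrow> complex) \<Rightarrow> real \<Rightarrow> complex"
  where "fourier f t = (\<integral>s. f s * exp (- \<i> * complex_of_real (s * t)) \<partial>lborel)"

definition inv_fourier :: "(real \<Rightarrow> complex) \<Rightarrow> real \<Rightarrow> complex"
  where "inv_fourier g s =
    (1 / (2 * complex_of_real pi)) * (\<integral>t. g t * exp (\<i> * complex_of_real (s * t)) \<partial>lborel)"

definition convolve :: "(real \<Rightarrow> complex) \<Rightarrow> (real \<Rightarrow> complex) \<Rightarrow> real \<Rightarrow> complex"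
  where "convolve f g x = (\<integral>y. f y * g (x - y) \<partial>lborel)"

definition sup_norm :: "(real \<Rightarrow> complex) \<Rightarrow> real"
  where "sup_norm f = (SUP x. cmod (f x))"

definition E_term :: "(real \<Rightarrow> complex) \<Rightarrow> real \<Rightarrow> (real \<Rightarrow> complex) \<Rightarrow> int \<Rightarrow> real"
  where "E_term \<phi> \<alpha> f n = (1 + \<bar>of_int n\<bar>) powr \<alpha> *
    sup_norm (convolve f (inv_fourier (\<lambda>t. \<phi> (t - of_int n))))"

definition E_space :: "(real \<Rightarrow> complex) \<Rightarrow> real \<Rightarrow> (real \<Rightarrow> complex) set"
  where "E_space \<phi> \<alpha> = {f. continuous_on UNIV f \<and> bounded (range f) \<and> E_term \<phi> \<alpha> f summable_on UNIV}"

definition E_norm :: "(real \<Rightarrow> complex) \<Rightarrow> real \<Rightarrow> (real \<Rightarrow> complex) \<Rightarrow> real"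
  where "E_norm \<phi> \<alpha> f = (\<Sum>\<^sub>\<infinity>n. E_term \<phi> \<alpha> f n)"

definition compact_support_pos :: "(real \<Rightarrow> complex) \<Rightarrow> bool"
  where "compact_support_pos f \<longleftrightarrow>
    compact (closure {s. f s \<noteq> 0}) \<and> closure {s. f s \<noteq> 0} \<subseteq> {0<..}"

section \<open>The operator \<open>(1+A)\<^bsup>-\<beta>\<^esup> f(A)\<close>\<close>

text \<open>\<open>S\<close> is the bounded operator
  \<open>(1+A)\<^bsup>-\<beta>\<^esup> f(A) x = 1/(2\<pi>) \<integral> F(t) (1+A)\<^bsup>-\<beta>\<^esup> e\<^bsup>itA\<^esup> x dt\<close>, where \<open>F\<close> is the Fourier
  transform of \<open>f\<close>. The integrability of the norm expresses that the integral converges absolutely.\<close>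

definition is_smoothed_calculus ::
    "(complex \<Rightarrow> ('a::complex_banach \<Rightarrow>\<^sub>L 'a)) \<Rightarrow> real \<Rightarrow> (real \<Rightarrow> complex) \<Rightarrow> ('a \<Rightarrow>\<^sub>L 'a) \<Rightarrow> bool"
  where "is_smoothed_calculus T \<beta> f S \<longleftrightarrow> complex_linear S \<and>
    (\<forall>x. (\<lambda>t. norm (fourier f t *\<^sub>C reg_group T \<beta> t x)) integrable_on UNIV \<and>
      (\<lambda>t. fourier f t *\<^sub>C reg_group T \<beta> t x) integrable_on UNIV \<and>
      S x = (1 / (2 * pi)) *\<^sub>R integral UNIV (\<lambda>t. fourier f t *\<^sub>C reg_group T \<beta> t x))"

end

theory Submission
  imports Defs
begin

text \<open>Decompose the line by the unit tents centred at the integers. On the tent centred at \<open>k + 1\<close>,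
  write the time as \<open>t = k + s + r\<close> with \<open>s, r \<in> [0, 1]\<close>, so that
  \<open>(1+A)\<^bsup>-\<beta>\<^esup> e\<^bsup>itA\<^esup> = (1+A)\<^bsup>-\<beta>\<^sub>1\<^esup> e\<^bsup>ikA\<^esup> \<cdot> (1+A)\<^bsup>-\<beta>\<^sub>2\<^esup> e\<^bsup>isA\<^esup> \<cdot> (1+A)\<^bsup>-\<beta>\<^sub>2\<^esup> e\<^bsup>irA\<^esup>\<close>. The first factor
  costs \<open>\<langle>k\<rangle>\<^sup>\<alpha>\<close>. The unit tent is the convolution of the indicator of \<open>[0, 1]\<close> with itself, hence the
  integral of \<open>h\<close> against the other two factors is the limit of Hankel sums
  \<open>\<Sum> M\<^sub>a\<^sub>b S\<^sub>a S\<^sub>b\<close> in which \<open>S\<^sub>a\<close> runs through the \<open>\<gamma>\<close>-bounded set. By \<open>\<gamma>\<close>-boundedness of both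
  factors such a sum is at most a multiple of \<open>N\<close> times the norm of \<open>M\<close> on \<open>\<ell>\<^sup>2\<close>, and since the
  tent has a positive Fourier transform this norm is at most \<open>2\<pi>/N\<close> times the supremum of the
  inverse Fourier transform of \<open>h\<close>. With \<open>h\<close> a piece of the Fourier transform of \<open>f\<close>, localised
  by the partition of unity, the supremum is the one occurring in the \<open>E\<close>-norm. Absolute convergence
  of the defining integral comes from the compact support of \<open>f\<close>: it gives a
  reproducing formula whose rapidly decreasing kernel turns the \<open>E\<close>-norm into a weighted
  \<open>L\<^sup>1\<close> bound. The fractional powers exist because the sectorial resolvent bound and
  Laplace inversion yield \<open>\<parallel>e\<^bsup>-sA\<^esup>\<parallel> \<le> K e\<^bsup>s/2\<^esup>\<close>.\<close>

section \<open>Functional analysis\<close>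

text \<open>Taking norms inside the defining integral would leave a weighted L1 norm of the Fourier
  transform. The bound for it in \<open>weighted_fourier_integrable\<close> depends on the support
  of f through a cut-off, so it serves convergence only; the estimate itself has to keep the
  cancellation between times. Gaussian sums do this, because a real matrix acts on them with its
  norm on l2. The mesh 1/N then drops out: N copies of x have Gaussian norm sqrt N times that of x,
  summation costs another sqrt N, and the Hankel matrix has norm of order 1/N. One \<gamma>-bounded
  factor creates the vectors and a second one sums them, hence the exponent
  \<open>2 * \<beta>\<^sub>2\<close>. In the growth bound the obstacle is that a resolvent of size
  M/|z| is not integrable along a vertical line. Division by z^2 leaves |z|^-3 and controls the
  twice integrated semigroup; analyticity permits writing orbits from time 2 on as such integrals.
  The line Re z = 1/2 is chosen because the growth rate has to stay below the rate 1 of the weight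
  e^-s in the fractional powers.\<close>

text \<open>\<open>G\<close> is the graph of a functional dominated by the norm, to be extended to
  \<open>x0\<close> with value \<open>c\<close>. Every admissible \<open>c\<close> lies above all
  \<open>r - norm (x - x0)\<close> and below all \<open>norm (y + x0) - s\<close>, and the triangle
  inequality makes the first family lie below the second. Domination also makes graphs
  single-valued, since (0, r) and (0, -r) occur together.\<close>

lemma hahn_banach_step:
  fixes G :: "('a::real_normed_vector \<times> real) set"
  assumes G: "subspace G" "\<And>x r. (x, r) \<in> G \<Longrightarrow> r \<le> norm x"
  obtains c where "\<And>x r. (x, r) \<in> span (insert (x0, c) G) \<Longrightarrow> r \<le> norm x"
proof -
  define S where "S = (\<lambda>(x, r). r - norm (x - x0)) ` G"
  have zero: "(0, 0) \<in> G" using subspace_0[OF G(1)] by (simp add: zero_prod_def)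
  have sep: "r - norm (x - x0) \<le> norm (y + x0) - s" if "(x, r) \<in> G" "(y, s) \<in> G" for x r y s
  proof -
    have "(x + y, r + s) \<in> G" using subspace_add[OF G(1) that] by simp
    from G(2)[OF this] have "r + s \<le> norm ((x - x0) + (y + x0))" by simp
    also have "\<dots> \<le> norm (x - x0) + norm (y + x0)" by (rule norm_triangle_ineq)
    finally show ?thesis by simp
  qed
  define c where "c = Sup S"
  have S_ne: "S \<noteq> {}" using zero by (auto simp: S_def)
  have "bdd_above S"
    using sep[OF _ zero] by (force simp: S_def bdd_above_def)
  then have lower: "r - norm (x - x0) \<le> c" if "(x, r) \<in> G" for x r
    unfolding c_def by (rule cSup_upper[rotated]) (use that in \<open>force simp: S_def\<close>)
  have upper: "c \<le> norm (y + x0) - s" if "(y, s) \<in> G" for y s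
    unfolding c_def by (rule cSup_least[OF S_ne]) (use sep[OF _ that] in \<open>auto simp: S_def\<close>)
  show thesis
  proof
    fix x r assume "(x, r) \<in> span (insert (x0, c) G)"
    then obtain k where "(x, r) - k *\<^sub>R (x0, c) \<in> span G"
      by (auto simp: span_insert)
    then have k: "(x - k *\<^sub>R x0, r - k * c) \<in> G" unfolding span_eq_iff[THEN iffD2, OF G(1)] by simp
    show "r \<le> norm x"
    proof (cases "k = 0")
      case True with k G(2) show ?thesis by auto
    next
      case False
      \<comment> \<open>Division by |k| reduces the coefficient of \<open>x0\<close> to 1 or -1;
        \<open>upper\<close> settles the first case and \<open>lower\<close> the second.\<close>
      define y s where "y = (1 / \<bar>k\<bar>) *\<^sub>R (x - k *\<^sub>R x0)" and "s = (r - k * c) / \<bar>k\<bar>"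
      have ys: "(y, s) \<in> G" using subspace_scale[OF G(1) k, of "1 / \<bar>k\<bar>"] by (simp add: y_def s_def)
      have xe: "x = \<bar>k\<bar> *\<^sub>R (y + (if k > 0 then x0 else - x0))"
        and re: "r = \<bar>k\<bar> * (s + (if k > 0 then c else - c))"
        using False by (auto simp: y_def s_def scaleR_right_diff_distrib scaleR_right_distrib field_simps)
      have "s + (if k > 0 then c else - c) \<le> norm (y + (if k > 0 then x0 else - x0))"
        using lower[OF ys] upper[OF ys] by auto
      then have "\<bar>k\<bar> * (s + (if k > 0 then c else - c)) \<le> \<bar>k\<bar> * norm (y + (if k > 0 then x0 else - x0))"
        by (rule mult_left_mono) simp
      then show ?thesis
        by (subst re, subst xe) (simp only: norm_scaleR abs_abs)
    qed
  qed
qed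

text \<open>Zorn's lemma is applied to dominated graphs that contain \<open>(z, norm z)\<close>. A
  maximal graph has full domain, because \<open>hahn_banach_step\<close> would otherwise enlarge
  it.\<close>

theorem separating_functional:
  fixes z :: "'a::real_normed_vector"
  assumes "z \<noteq> 0"
  obtains l :: "'a \<Rightarrow> real" where "bounded_linear l" "l z \<noteq> 0"
proof -
  define \<G> where "\<G> = {G :: ('a \<times> real) set. subspace G \<and> (z, norm z) \<in> G \<and> (\<forall>x r. (x, r) \<in> G \<longrightarrow> r \<le> norm x)}"
  have start: "span {(z, norm z)} \<in> \<G>"
  proof -
    have "r \<le> norm x" if "(x, r) \<in> span {(z, norm z)}" for x r
      using that by (auto simp: span_singleton mult_right_mono)
    then show ?thesis
      by (simp add: \<G>_def span_base)
  qed
  have "\<exists>M\<in>\<G>. \<forall>X\<in>\<G>. M \<subseteq> X \<longrightarrow> X = M"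
  proof (rule subset_Zorn_nonempty)
    show "\<G> \<noteq> {}" using start by auto
    fix \<C> assume ne: "\<C> \<noteq> {}" and chain: "subset.chain \<G> \<C>"
    have mem: "C \<in> \<G>" if "C \<in> \<C>" for C using chain that by (auto simp: subset_chain_def)
    have two: "\<exists>C\<in>\<C>. a \<in> C \<and> b \<in> C" if ab: "a \<in> \<Union>\<C>" "b \<in> \<Union>\<C>" for a b
    proof -
      obtain C1 C2 where C: "C1 \<in> \<C>" "a \<in> C1" "C2 \<in> \<C>" "b \<in> C2" using ab by blast
      moreover have "C1 \<subseteq> C2 \<or> C2 \<subseteq> C1" using chain C(1,3) by (simp add: subset_chain_def)
      ultimately show ?thesis by blast
    qed
    have "subspace (\<Union>\<C>)"
      unfolding subspace_def
    proof (intro conjI ballI allI)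
      show "0 \<in> \<Union>\<C>" using ne mem by (auto simp: \<G>_def subspace_def)
      show "a + b \<in> \<Union>\<C>" if ab: "a \<in> \<Union>\<C>" "b \<in> \<Union>\<C>" for a b
      proof -
        obtain C where "C \<in> \<C>" "a \<in> C" "b \<in> C" using two[OF ab] by blast
        moreover from this mem have "subspace C" by (simp add: \<G>_def)
        ultimately show ?thesis using subspace_add by blast
      qed
      show "c *\<^sub>R a \<in> \<Union>\<C>" if "a \<in> \<Union>\<C>" for a c
      proof -
        obtain C where "C \<in> \<C>" "a \<in> C" using \<open>a \<in> \<Union>\<C>\<close> by blast
        moreover from this mem have "subspace C" by (simp add: \<G>_def)
        ultimately show ?thesis using subspace_scale by blast
      qed
    qed
    then show "\<Union>\<C> \<in> \<G>" using ne mem by (auto simp: \<G>_def)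
  qed
  then obtain G where G: "G \<in> \<G>" and maximal: "\<And>X. X \<in> \<G> \<Longrightarrow> G \<subseteq> X \<Longrightarrow> X = G" by blast
  have sub: "subspace G" and zG: "(z, norm z) \<in> G" and le: "\<And>x r. (x, r) \<in> G \<Longrightarrow> r \<le> norm x"
    using G by (auto simp: \<G>_def)
  have total: "\<exists>r. (x, r) \<in> G" for x
  proof -
    obtain c where c: "\<And>y r. (y, r) \<in> span (insert (x, c) G) \<Longrightarrow> r \<le> norm y"
      using hahn_banach_step[OF sub le] by blast
    have "span (insert (x, c) G) \<in> \<G>"
      using c zG by (auto simp: \<G>_def intro: span_base)
    with maximal have "span (insert (x, c) G) = G" by (meson span_superset subset_insertI subset_trans)
    then have "(x, c) \<in> G" by (metis insertI1 span_base)
    then show ?thesis ..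
  qed
  have abs_le: "\<bar>r\<bar> \<le> norm x" if "(x, r) \<in> G" for x r
    using le[OF that] le[of "- x" "- r"] subspace_neg[OF sub that] by auto
  have unique: "r = s" if "(x, r) \<in> G" "(x, s) \<in> G" for x r s
    using abs_le[of 0 "r - s"] subspace_diff[OF sub that] by simp
  define l where "l x = (THE r. (x, r) \<in> G)" for x
  have l: "(x, l x) \<in> G" for x
    unfolding l_def using total unique by (metis the_equality)
  have leq: "l x = r" if "(x, r) \<in> G" for x r using unique[OF l that] .
  have "bounded_linear l"
  proof
    show "l (x + y) = l x + l y" for x y
      using subspace_add[OF sub l[of x] l[of y]] by (intro leq) simp
    show "l (k *\<^sub>R x) = k *\<^sub>R l x" for k x
      using subspace_scale[OF sub l[of x], of k] by (intro leq) simp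
    show "\<exists>K. \<forall>x. norm (l x) \<le> norm x * K"
      using abs_le[OF l] by (intro exI[of _ 1]) simp
  qed
  moreover have "l z \<noteq> 0" using leq[OF zG] assms by simp
  ultimately show thesis by (rule that)
qed

corollary functionals_separate_points:
  fixes x y :: "'a::real_normed_vector"
  assumes "\<And>l :: 'a \<Rightarrow> real. bounded_linear l \<Longrightarrow> l x = l y"
  shows "x = y"
proof (rule ccontr)
  assume "x \<noteq> y"
  then have "x - y \<noteq> 0" by simp
  then obtain l :: "'a \<Rightarrow> real" where l: "bounded_linear l" "l (x - y) \<noteq> 0"
    by (rule separating_functional)
  then show False using assms[OF l(1)] by (simp add: linear_diff[OF bounded_linear.linear[OF l(1)]])
qed

text \<open>The gliding hump argument: every ball contains a point at which the operator is
  almost as large as its norm allows.\<close>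

lemma blinfun_large_in_ball:
  fixes S :: "'a::real_normed_vector \<Rightarrow>\<^sub>L 'b::real_normed_vector"
  assumes "0 < r" "k < norm S"
  shows "\<exists>y. norm (y - x) \<le> r \<and> k * r \<le> norm (S y)"
proof (rule ccontr)
  assume "\<not> ?thesis"
  then have less: "norm (S y) < k * r" if "norm (y - x) \<le> r" for y
    using that not_le_imp_less by blast
  have "norm (S v) \<le> k * norm v" for v
  proof (cases "v = 0")
    case False
    \<comment> \<open>A vector of length \<open>r\<close> in the direction of \<open>v\<close>:
      subtracting the values at \<open>x + w\<close> and \<open>x - w\<close> removes the centre
      \<open>x\<close>, so both cannot be small.\<close>
    define w where "w = (r / norm v) *\<^sub>R v"
    have nw: "norm w = r" using False assms by (simp add: w_def)
    have "2 *\<^sub>R S w = S (x + w) - S (x - w)"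
      by (simp add: blinfun.add_right blinfun.diff_right scaleR_2)
    then have "2 * norm (S w) \<le> norm (S (x + w)) + norm (S (x - w))"
      by (metis abs_numeral norm_scaleR norm_triangle_ineq4)
    also have "\<dots> \<le> 2 * (k * r)"
      using less[of "x + w"] less[of "x - w"] nw by simp
    finally have "r / norm v * norm (S v) \<le> k * r"
      using assms by (simp add: w_def blinfun.scaleR_right)
    then show ?thesis using assms False by (simp add: field_simps)
  qed simp
  moreover have "0 < k * r" using less[of x] assms(1) by (auto intro: order.strict_trans1[OF norm_ge_zero])
  then have "0 \<le> k" using assms(1) by (simp add: zero_less_mult_iff)
  ultimately have "norm S \<le> k" by (intro norm_blinfun_bound)
  with assms show False by simp
qed

text \<open>If the norms are unbounded, choose \<open>S n\<close> of norm above
  \<open>6 * 6 ^ n\<close> and move from \<open>x n\<close> by at most \<open>(1/3)^n\<close> to a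
  point where \<open>S n\<close> attains 2/3 of its possible size. All later moves together have
  length at most half of \<open>(1/3)^n\<close>, so the limit keeps \<open>2/3 - 1/2 = 1/6\<close>
  of that size, and \<open>6 * 6^n * (1/6) * (1/3)^n = 2^n\<close> contradicts pointwise
  boundedness.\<close>

theorem uniform_boundedness:
  fixes F :: "('a::banach \<Rightarrow>\<^sub>L 'b::real_normed_vector) set"
  assumes "\<And>x. \<exists>K. \<forall>S\<in>F. norm (S x) \<le> K"
  obtains K where "K > 0" "\<And>S. S \<in> F \<Longrightarrow> norm S \<le> K"
proof (cases "\<exists>K. \<forall>S\<in>F. norm S \<le> K")
  case True
  then obtain K where "\<forall>S\<in>F. norm S \<le> K" by blast
  then show thesis by (intro that[of "max K 1"]) auto
next
  case False
  then have "\<exists>S\<in>F. 6 * 6 ^ n < norm S" for n :: nat by (meson not_le)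
  then obtain S where S: "\<And>n. S n \<in> F" "\<And>n. 6 * 6 ^ n < norm (S n)" by metis
  have "\<exists>y. norm (y - x) \<le> (1 / 3) ^ n \<and> 6 * 6 ^ n * (1 / 3) ^ n \<le> norm (S n y) \<and>
      norm (S n) * (2 / 3) * (1 / 3) ^ n \<le> norm (S n y)" for n x
  proof -
    have pos: "0 < norm (S n)" using S(2)[of n] by (smt (verit) zero_less_power mult_pos_pos)
    define k where "k = max (6 * 6 ^ n) (norm (S n) * (2 / 3))"
    have "k < norm (S n)" using S(2)[of n] pos by (simp add: k_def)
    from blinfun_large_in_ball[OF _ this, of "(1 / 3) ^ n" x]
    obtain y where y: "norm (y - x) \<le> (1 / 3) ^ n" "k * (1 / 3) ^ n \<le> norm (S n y)" by auto
    have "6 * 6 ^ n * (1 / 3) ^ n \<le> k * (1 / 3 :: real) ^ n"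
      "norm (S n) * (2 / 3) * (1 / 3) ^ n \<le> k * (1 / 3 :: real) ^ n"
      by (intro mult_right_mono; simp add: k_def)+
    with y show ?thesis by (intro exI[of _ y]) linarith
  qed
  then have "\<exists>h. \<forall>n x. norm (h n x - x) \<le> (1 / 3) ^ n \<and> norm (S n) * (2 / 3) * (1 / 3) ^ n \<le> norm (S n (h n x))"
    by (intro choice allI) blast
  then obtain h where h: "\<And>n x. norm (h n x - x) \<le> (1 / 3) ^ n"
    "\<And>n x. norm (S n) * (2 / 3) * (1 / 3) ^ n \<le> norm (S n (h n x))" by blast
  define x where "x = rec_nat 0 (\<lambda>n v. h n v)"
  have x_Suc: "x (Suc n) = h n (x n)" for n by (simp add: x_def)
  have step: "norm (x (Suc n) - x n) \<le> (1 / 3) ^ n" for n using h(1) by (simp add: x_Suc)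
  have geo: "norm (x (n + k) - x n) \<le> (3 / 2) * (1 / 3) ^ n * (1 - (1 / 3) ^ k)" for n k
  proof (induction k)
    case (Suc k)
    have "norm (x (n + Suc k) - x n) \<le> norm (x (Suc (n + k)) - x (n + k)) + norm (x (n + k) - x n)"
      by (simp add: norm_triangle_ineq[of "x (Suc (n + k)) - x (n + k)" "x (n + k) - x n", simplified])
    also have "\<dots> \<le> (1 / 3) ^ (n + k) + (3 / 2) * (1 / 3) ^ n * (1 - (1 / 3) ^ k)"
      using step[of "n + k"] Suc by linarith
    also have "\<dots> = (3 / 2) * (1 / 3) ^ n * (1 - (1 / 3) ^ Suc k)"
      by (simp add: power_add field_simps)
    finally show ?case .
  qed simp
  have geo': "norm (x m - x n) \<le> (3 / 2) * (1 / 3) ^ n" if "n \<le> m" for m n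
  proof -
    have "(3 / 2) * (1 / 3) ^ n * (1 - (1 / 3) ^ (m - n)) \<le> (3 / 2) * (1 / 3) ^ n * (1::real)"
      by (intro mult_left_mono) auto
    with geo[of n "m - n", unfolded le_add_diff_inverse[OF that]] show ?thesis by linarith
  qed
  have "(\<lambda>n. (3 / 2) * (1 / 3 :: real) ^ n) \<longlonglongrightarrow> 0"
    by (intro tendsto_mult_right_zero LIMSEQ_power_zero) simp
  have "Cauchy x"
  proof (rule metric_CauchyI)
    fix e :: real assume "0 < e"
    then obtain N where N: "(3 / 2) * (1 / 3) ^ N < e / 2"
      using LIMSEQ_D[OF \<open>(\<lambda>n. (3 / 2) * (1 / 3 :: real) ^ n) \<longlonglongrightarrow> 0\<close>, of "e / 2"] by auto
    have "dist (x m) (x n) < e" if "N \<le> m" "N \<le> n" for m n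
      using geo'[OF that(1)] geo'[OF that(2)] N norm_triangle_ineq4[of "x m - x N" "x n - x N"]
      by (simp add: dist_norm)
    then show "\<exists>M. \<forall>m\<ge>M. \<forall>n\<ge>M. dist (x m) (x n) < e" by blast
  qed
  then obtain y where y: "x \<longlonglongrightarrow> y" using Cauchy_convergent convergentD by blast
  have near: "norm (y - x n) \<le> (3 / 2) * (1 / 3) ^ n" for n
  proof (rule tendsto_upperbound[OF tendsto_norm[OF tendsto_diff[OF y tendsto_const]]])
    show "\<forall>\<^sub>F m in sequentially. norm (x m - x n) \<le> (3 / 2) * (1 / 3) ^ n"
      using geo' by (auto intro: eventually_sequentiallyI[of n])
  qed simp
  obtain K where K: "\<And>S. S \<in> F \<Longrightarrow> norm (S y) \<le> K" using assms[of y] by blast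
  have "2 ^ n \<le> K" for n :: nat
  proof -
    have "norm (S n) * (2 / 3) * (1 / 3) ^ n \<le> norm (S n (x (Suc n)))" using h(2) by (simp add: x_Suc)
    also have "\<dots> \<le> norm (S n y) + norm (S n (y - x (Suc n)))"
      by (metis add.commute blinfun.diff_right norm_minus_commute norm_triangle_sub)
    also have "\<dots> \<le> K + norm (S n) * ((3 / 2) * (1 / 3) ^ Suc n)"
      by (intro add_mono K S(1) order.trans[OF norm_blinfun] mult_left_mono near) auto
    finally have "norm (S n) * (1 / 6) * (1 / 3) ^ n \<le> K" by (simp add: field_simps)
    moreover have "6 * 6 ^ n * (1 / 6) * (1 / 3) ^ n \<le> norm (S n) * (1 / 6) * (1 / 3) ^ n"
      using S(2)[of n] by (intro mult_right_mono) auto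
    ultimately show ?thesis by (simp add: power_mult_distrib[symmetric] mult.assoc)
  qed
  moreover obtain n :: nat where "K < 2 ^ n" using real_arch_pow[of 2 K] by auto
  ultimately show thesis by (meson not_le)
qed

section \<open>Gaussian sums\<close>

abbreviation gauss_measure :: "nat \<Rightarrow> (nat \<Rightarrow> real) measure"
  where "gauss_measure n \<equiv> (\<Pi>\<^sub>M k\<in>{..<n}. std_normal_distribution)"

interpretation std_normal: prob_space std_normal_distribution
  by (rule prob_space_normal_density) simp

interpretation gauss: product_sigma_finite "\<lambda>_::nat. std_normal_distribution"
  by unfold_locales

text \<open>The target space need not be second countable, so measurability is obtained from
  continuity on \<open>nat \<Rightarrow> real\<close> with the product topology.\<close>

lemma measurable_gauss_sum:
  fixes x :: "nat \<Rightarrow> 'a::real_normed_vector"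
  assumes "J \<subseteq> I"
  shows "(\<lambda>g. norm (\<Sum>k\<in>J. g k *\<^sub>R x k)) \<in> borel_measurable (Pi\<^sub>M I (\<lambda>_::nat. std_normal_distribution))"
proof -
  have "continuous_on UNIV (\<lambda>g. norm (\<Sum>k\<in>J. g k *\<^sub>R x k))"
    by (intro continuous_intros continuous_on_product_coordinates)
  then have m: "(\<lambda>g::nat \<Rightarrow> real. norm (\<Sum>k\<in>J. g k *\<^sub>R x k)) \<in> borel_measurable (Pi\<^sub>M UNIV (\<lambda>_. borel))"
    using borel_measurable_continuous_onI measurable_cong_sets[OF sets_PiM_equal_borel refl] by blast
  have "(\<lambda>g k. if k \<in> I then g k else 0) \<in> measurable (Pi\<^sub>M I (\<lambda>_. std_normal_distribution)) (Pi\<^sub>M UNIV (\<lambda>_. borel))"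
  proof (rule measurable_PiM_single')
    fix k :: nat
    show "(\<lambda>g. if k \<in> I then g k else 0) \<in> borel_measurable (Pi\<^sub>M I (\<lambda>_. std_normal_distribution))"
      by (cases "k \<in> I") (simp_all add: measurable_component_singleton[of k I "\<lambda>_. std_normal_distribution", simplified])
  qed auto
  from measurable_compose[OF this m]
  have "(\<lambda>g. norm (\<Sum>k\<in>J. (if k \<in> I then g k else 0) *\<^sub>R x k)) \<in> borel_measurable (Pi\<^sub>M I (\<lambda>_. std_normal_distribution))" .
  moreover have "(\<Sum>k\<in>J. (if k \<in> I then g k else 0) *\<^sub>R x k) = (\<Sum>k\<in>J. g k *\<^sub>R x k)" for g
    using assms by (intro sum.cong) auto
  ultimately show ?thesis by simp
qed

text \<open>The square is kept as a nonnegative integral so that coordinates can be split off by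
  Tonelli without integrability; finiteness comes later in \<open>gauss_sq_finite\<close>.\<close>

definition gauss_sq :: "nat \<Rightarrow> (nat \<Rightarrow> 'a::real_normed_vector) \<Rightarrow> ennreal"
  where "gauss_sq n x = (\<integral>\<^sup>+g. ennreal ((norm (\<Sum>k<n. g k *\<^sub>R x k))\<^sup>2) \<partial>gauss_measure n)"

lemma gauss_sq_cong: "(\<And>k. k < n \<Longrightarrow> x k = y k) \<Longrightarrow> gauss_sq n x = gauss_sq n y"
  unfolding gauss_sq_def by (intro nn_integral_cong arg_cong[where f=ennreal] arg_cong[where f="\<lambda>v. (norm v)\<^sup>2"] sum.cong) auto

lemma gauss_norm_eq: "gauss_norm n x = sqrt (enn2real (gauss_sq n x))"
  unfolding gauss_norm_def gauss_sq_def
  by (subst integral_eq_nn_integral) (auto intro!: borel_measurable_power measurable_gauss_sum)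

lemma nn_integral_std_normal_sq: "(\<integral>\<^sup>+y. ennreal (y\<^sup>2) \<partial>std_normal_distribution) = 1"
proof -
  have "(\<integral>\<^sup>+y. ennreal (y\<^sup>2) \<partial>std_normal_distribution) = (\<integral>\<^sup>+y. ennreal (std_normal_density y * y\<^sup>2) \<partial>lborel)"
    by (subst nn_integral_density) (auto simp: ennreal_mult')
  also have "\<dots> = ennreal (\<integral>y. std_normal_density y * y\<^sup>2 \<partial>lborel)"
    using integrable_std_normal_moment[of 2] by (intro nn_integral_eq_integral) auto
  also have "(\<integral>y. std_normal_density y * y\<^sup>2 \<partial>lborel) = 1"
    using integral_std_normal_moment_even[of 1] by simp
  finally show ?thesis by simp
qed

lemma nn_integral_std_normal_reflect:
  assumes [measurable]: "f \<in> borel_measurable borel"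
  shows "(\<integral>\<^sup>+y. f (- y) \<partial>std_normal_distribution) = (\<integral>\<^sup>+y. f y \<partial>std_normal_distribution)"
  by (simp add: nn_integral_density, subst (2) nn_integral_real_affine[where c="-1" and t=0])
    (auto simp: std_normal_density_def)

lemma gauss_sq_split:
  assumes "i < n"
  shows "gauss_sq n x = (\<integral>\<^sup>+g. (\<integral>\<^sup>+y. ennreal ((norm ((\<Sum>k\<in>{..<n}-{i}. g k *\<^sub>R x k) + y *\<^sub>R x i))\<^sup>2)
    \<partial>std_normal_distribution) \<partial>Pi\<^sub>M ({..<n}-{i}) (\<lambda>_. std_normal_distribution))"
proof -
  have ins: "insert i ({..<n} - {i}) = {..<n}" using assms by auto
  have sum: "(\<Sum>k<n. (g(i := y)) k *\<^sub>R x k) = (\<Sum>k\<in>{..<n}-{i}. g k *\<^sub>R x k) + y *\<^sub>R x i" for g y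
    using assms by (subst sum.remove[of _ i]) (auto simp: add.commute intro!: sum.cong)
  have "gauss_sq n x = (\<integral>\<^sup>+g. ennreal ((norm (\<Sum>k<n. g k *\<^sub>R x k))\<^sup>2) \<partial>Pi\<^sub>M (insert i ({..<n} - {i})) (\<lambda>_. std_normal_distribution))"
    by (simp only: gauss_sq_def ins)
  also have "\<dots> = (\<integral>\<^sup>+g. (\<integral>\<^sup>+y. ennreal ((norm (\<Sum>k<n. (g(i := y)) k *\<^sub>R x k))\<^sup>2)
    \<partial>std_normal_distribution) \<partial>Pi\<^sub>M ({..<n}-{i}) (\<lambda>_. std_normal_distribution))"
    by (rule gauss.product_nn_integral_insert)
      (auto simp: ins intro!: measurable_compose[OF _ measurable_ennreal] borel_measurable_power measurable_gauss_sum)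
  finally show ?thesis unfolding sum .
qed

lemma gauss_sq_flip:
  assumes "i < n"
  shows "gauss_sq n (x(i := - x i)) = gauss_sq n x"
proof -
  have "(\<integral>\<^sup>+y. ennreal ((norm (v + y *\<^sub>R - x i))\<^sup>2) \<partial>std_normal_distribution) =
      (\<integral>\<^sup>+y. ennreal ((norm (v + y *\<^sub>R x i))\<^sup>2) \<partial>std_normal_distribution)" for v
    using nn_integral_std_normal_reflect[of "\<lambda>y. ennreal ((norm (v + y *\<^sub>R x i))\<^sup>2)"]
    by (simp add: borel_measurable_continuous_onI continuous_intros)
  moreover have "(\<Sum>k\<in>{..<n}-{i}. g k *\<^sub>R (x(i := - x i)) k) = (\<Sum>k\<in>{..<n}-{i}. g k *\<^sub>R x k)" for g
    by (intro sum.cong) auto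
  ultimately show ?thesis using assms by (simp add: gauss_sq_split[of i])
qed

text \<open>Jensen's inequality in the coordinate \<open>i\<close>: by symmetry y and -y may be
  averaged, and the average of \<open>v + y x_i\<close> and \<open>v - y x_i\<close> is
  \<open>v\<close>.\<close>

lemma gauss_sq_drop:
  assumes "i < n"
  shows "gauss_sq n (x(i := 0)) \<le> gauss_sq n x"
proof -
  have le: "ennreal ((norm v)\<^sup>2) \<le> (\<integral>\<^sup>+y. ennreal ((norm (v + y *\<^sub>R x i))\<^sup>2) \<partial>std_normal_distribution)" for v
  proof -
    let ?I = "\<integral>\<^sup>+y. ennreal ((norm (v + y *\<^sub>R x i))\<^sup>2) \<partial>std_normal_distribution"
    have [measurable]: "(\<lambda>y. norm (v + y *\<^sub>R x i)) \<in> borel_measurable borel"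
      by (intro borel_measurable_continuous_onI continuous_intros)
    have [measurable]: "(\<lambda>y. norm (v - y *\<^sub>R x i)) \<in> borel_measurable borel"
      by (intro borel_measurable_continuous_onI continuous_intros)
    have "2 * ennreal ((norm v)\<^sup>2) = (\<integral>\<^sup>+y. ennreal (2 * (norm v)\<^sup>2) \<partial>std_normal_distribution)"
      using std_normal.emeasure_space_1 by (simp add: ennreal_mult')
    also have "\<dots> \<le> (\<integral>\<^sup>+y. ennreal ((norm (v + y *\<^sub>R x i))\<^sup>2) + ennreal ((norm (v + (- y) *\<^sub>R x i))\<^sup>2) \<partial>std_normal_distribution)"
    proof (rule nn_integral_mono)
      fix y
      let ?a = "norm (v + y *\<^sub>R x i)" and ?b = "norm (v + (- y) *\<^sub>R x i)"
      have "2 *\<^sub>R v = (v + y *\<^sub>R x i) + (v + (- y) *\<^sub>R x i)" by (simp add: scaleR_2)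
      then have "2 * norm v \<le> ?a + ?b"
        by (metis abs_numeral norm_scaleR norm_triangle_ineq)
      then have "(2 * norm v)\<^sup>2 \<le> (?a + ?b)\<^sup>2" by (intro power_mono) auto
      also have "\<dots> \<le> 2 * (?a\<^sup>2 + ?b\<^sup>2)" using sum_squares_bound[of ?a ?b] by (simp add: power2_sum)
      finally have "2 * (norm v)\<^sup>2 \<le> ?a\<^sup>2 + ?b\<^sup>2" by (simp add: power2_eq_square)
      then show "ennreal (2 * (norm v)\<^sup>2) \<le> ennreal (?a\<^sup>2) + ennreal (?b\<^sup>2)"
        by (simp add: ennreal_plus[symmetric] del: ennreal_plus)
    qed
    also have "\<dots> = ?I + ?I"
      using nn_integral_std_normal_reflect[of "\<lambda>y. ennreal ((norm (v + y *\<^sub>R x i))\<^sup>2)"]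
      by (simp add: nn_integral_add)
    finally have "2 * ennreal ((norm v)\<^sup>2) \<le> 2 * ?I" by (simp add: mult_2)
    then show ?thesis by (simp add: ennreal_mult_le_mult_iff)
  qed
  have "gauss_sq n (x(i := 0)) = (\<integral>\<^sup>+g. ennreal ((norm (\<Sum>k\<in>{..<n}-{i}. g k *\<^sub>R x k))\<^sup>2)
    \<partial>Pi\<^sub>M ({..<n}-{i}) (\<lambda>_. std_normal_distribution))"
  proof -
    have "(\<Sum>k\<in>{..<n}-{i}. g k *\<^sub>R (x(i := 0)) k) = (\<Sum>k\<in>{..<n}-{i}. g k *\<^sub>R x k)" for g
      by (intro sum.cong) auto
    then show ?thesis using assms std_normal.emeasure_space_1 by (simp add: gauss_sq_split[of i])
  qed
  also have "\<dots> \<le> gauss_sq n x"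
    using assms le by (simp add: gauss_sq_split[of i] nn_integral_mono)
  finally show ?thesis .
qed

lemma gauss_sq_Suc_zero: "x n = 0 \<Longrightarrow> gauss_sq (Suc n) x = gauss_sq n x"
proof -
  assume "x n = 0"
  moreover have "{..<Suc n} - {n} = {..<n}" by auto
  ultimately show ?thesis
    using std_normal.emeasure_space_1
    by (subst gauss_sq_split[of n]) (simp_all add: gauss_sq_def)
qed

lemma gauss_sq_extend_zero:
  assumes "m \<le> n"
  shows "gauss_sq n (\<lambda>k. if k < m then x k else 0) = gauss_sq m x"
  using assms
proof (induction n rule: dec_induct)
  case base
  show ?case by (rule gauss_sq_cong) simp
next
  case (step n)
  then show ?case by (subst gauss_sq_Suc_zero) auto
qed

lemma gauss_sq_mono: "m \<le> n \<Longrightarrow> gauss_sq m x \<le> gauss_sq n x"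
proof (induction n rule: dec_induct)
  case (step n)
  have "gauss_sq n x = gauss_sq n (x(n := 0))" by (rule gauss_sq_cong) simp
  also have "\<dots> = gauss_sq (Suc n) (x(n := 0))" by (rule gauss_sq_Suc_zero[symmetric]) simp
  also have "\<dots> \<le> gauss_sq (Suc n) x" by (rule gauss_sq_drop) simp
  finally show ?case using step by (meson order_trans)
qed simp

section \<open>Rotation invariance\<close>

text \<open>A plane rotation is a product of three shears, each of which is a translation in one
  variable while the other is fixed. The outer shears have parameter \<open>t = s / (1 + c)\<close>,
  the tangent of half the angle, so the half turn \<open>c = -1\<close> is excluded.\<close>

lemma nn_integral_rotation:
  fixes H :: "real \<Rightarrow> real \<Rightarrow> ennreal"
  assumes [measurable]: "case_prod H \<in> borel_measurable (borel \<Otimes>\<^sub>M borel)"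
    and cs: "c\<^sup>2 + s\<^sup>2 = 1" "c \<noteq> -1"
  shows "(\<integral>\<^sup>+x. \<integral>\<^sup>+y. H (c * x - s * y) (s * x + c * y) \<partial>lborel \<partial>lborel) = (\<integral>\<^sup>+x. \<integral>\<^sup>+y. H x y \<partial>lborel \<partial>lborel)"
proof -
  have shear1: "(\<integral>\<^sup>+x. \<integral>\<^sup>+y. H (x - t * y) y \<partial>lborel \<partial>lborel) = (\<integral>\<^sup>+x. \<integral>\<^sup>+y. H x y \<partial>lborel \<partial>lborel)"
    if [measurable]: "case_prod H \<in> borel_measurable (borel \<Otimes>\<^sub>M borel)" for t and H :: "real \<Rightarrow> real \<Rightarrow> ennreal"
  proof -
    have "(\<integral>\<^sup>+x. \<integral>\<^sup>+y. H (x - t * y) y \<partial>lborel \<partial>lborel) = (\<integral>\<^sup>+y. \<integral>\<^sup>+x. H (x - t * y) y \<partial>lborel \<partial>lborel)"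
      by (rule lborel_pair.Fubini'[symmetric]) measurable
    also have "\<dots> = (\<integral>\<^sup>+y. \<integral>\<^sup>+x. H x y \<partial>lborel \<partial>lborel)"
    proof (rule nn_integral_cong)
      fix y
      show "(\<integral>\<^sup>+x. H (x - t * y) y \<partial>lborel) = (\<integral>\<^sup>+x. H x y \<partial>lborel)"
        by (subst (2) nn_integral_real_affine[where c=1 and t="- t * y"]) (simp_all add: algebra_simps)
    qed
    also have "\<dots> = (\<integral>\<^sup>+x. \<integral>\<^sup>+y. H x y \<partial>lborel \<partial>lborel)"
      by (rule lborel_pair.Fubini') measurable
    finally show ?thesis .
  qed
  have shear2: "(\<integral>\<^sup>+x. \<integral>\<^sup>+y. H x (y + t * x) \<partial>lborel \<partial>lborel) = (\<integral>\<^sup>+x. \<integral>\<^sup>+y. H x y \<partial>lborel \<partial>lborel)"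
    if [measurable]: "case_prod H \<in> borel_measurable (borel \<Otimes>\<^sub>M borel)" for t and H :: "real \<Rightarrow> real \<Rightarrow> ennreal"
  proof (rule nn_integral_cong)
    fix x
    show "(\<integral>\<^sup>+y. H x (y + t * x) \<partial>lborel) = (\<integral>\<^sup>+y. H x y \<partial>lborel)"
      by (subst (2) nn_integral_real_affine[where c=1 and t="t * x"]) (simp_all add: algebra_simps)
  qed
  define t where "t = s / (1 + c)"
  have c1: "1 + c \<noteq> 0" using cs(2) by (metis add.commute add_eq_0_iff)
  have tc: "t * (1 + c) = s" using c1 by (simp add: t_def)
  have ts: "t * s = 1 - c"
  proof -
    have "(t * s) * (1 + c) = s\<^sup>2" using tc by (metis mult.assoc mult.commute power2_eq_square)
    also have "\<dots> = (1 - c) * (1 + c)" using cs(1) by (simp add: algebra_simps power2_eq_square)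
    finally show ?thesis using c1 by simp
  qed
  have "c * x - s * y = ((x - t * y) - t * (y + s * (x - t * y)))" for x y
  proof -
    have "((x - t * y) - t * (y + s * (x - t * y))) = (1 - t * s) * x - (2 * t - t * (t * s)) * y"
      by (simp add: algebra_simps)
    also have "2 * t - t * (t * s) = t * (1 + c)" by (subst ts) (simp add: algebra_simps)
    finally show ?thesis by (simp add: ts tc)
  qed
  moreover have "s * x + c * y = y + s * (x - t * y)" for x y
  proof -
    have "y + s * (x - t * y) = s * x + (1 - t * s) * y" by (simp add: algebra_simps)
    then show ?thesis by (simp add: ts)
  qed
  ultimately have "(\<integral>\<^sup>+x. \<integral>\<^sup>+y. H (c * x - s * y) (s * x + c * y) \<partial>lborel \<partial>lborel) =
    (\<integral>\<^sup>+x. \<integral>\<^sup>+y. H ((x - t * y) - t * (y + s * (x - t * y))) (y + s * (x - t * y)) \<partial>lborel \<partial>lborel)"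
    by simp
  also have "\<dots> = (\<integral>\<^sup>+x. \<integral>\<^sup>+y. H (x - t * (y + s * x)) (y + s * x) \<partial>lborel \<partial>lborel)"
    by (rule shear1[of "\<lambda>x y. H (x - t * (y + s * x)) (y + s * x)"]) measurable
  also have "\<dots> = (\<integral>\<^sup>+x. \<integral>\<^sup>+y. H (x - t * y) y \<partial>lborel \<partial>lborel)"
    by (rule shear2[of "\<lambda>x y. H (x - t * y) y"]) measurable
  also have "\<dots> = (\<integral>\<^sup>+x. \<integral>\<^sup>+y. H x y \<partial>lborel \<partial>lborel)"
    by (rule shear1) measurable
  finally show ?thesis .
qed

lemma nn_integral_std_normal_rotation:
  fixes G :: "real \<Rightarrow> real \<Rightarrow> ennreal"
  assumes [measurable]: "case_prod G \<in> borel_measurable (borel \<Otimes>\<^sub>M borel)"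
    and cs: "c\<^sup>2 + s\<^sup>2 = 1" "c \<noteq> -1"
  shows "(\<integral>\<^sup>+x. \<integral>\<^sup>+y. G (c * x - s * y) (s * x + c * y) \<partial>std_normal_distribution \<partial>std_normal_distribution) =
    (\<integral>\<^sup>+x. \<integral>\<^sup>+y. G x y \<partial>std_normal_distribution \<partial>std_normal_distribution)"
proof -
  define H where "H x y = ennreal (std_normal_density x * std_normal_density y) * G x y" for x y
  have [measurable]: "case_prod H \<in> borel_measurable (borel \<Otimes>\<^sub>M borel)"
    unfolding H_def by measurable
  have conv: "(\<integral>\<^sup>+x. \<integral>\<^sup>+y. G' x y \<partial>std_normal_distribution \<partial>std_normal_distribution) =
    (\<integral>\<^sup>+x. \<integral>\<^sup>+y. ennreal (std_normal_density x * std_normal_density y) * G' x y \<partial>lborel \<partial>lborel)"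
    if [measurable]: "case_prod G' \<in> borel_measurable (borel \<Otimes>\<^sub>M borel)" for G' :: "real \<Rightarrow> real \<Rightarrow> ennreal"
    by (simp add: nn_integral_density nn_integral_cmult[symmetric] ennreal_mult' mult.assoc)
  have inv: "std_normal_density (c * x - s * y) * std_normal_density (s * x + c * y) =
    std_normal_density x * std_normal_density y" for x y
  proof -
    have "(c * x - s * y)\<^sup>2 + (s * x + c * y)\<^sup>2 = (c\<^sup>2 + s\<^sup>2) * (x\<^sup>2 + y\<^sup>2)"
      by (simp add: power2_eq_square algebra_simps)
    then have "- (c * x - s * y)\<^sup>2 / 2 + - (s * x + c * y)\<^sup>2 / 2 = - x\<^sup>2 / 2 + - y\<^sup>2 / 2"
      using cs by simp
    then show ?thesis by (simp add: std_normal_density_def exp_add[symmetric])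
  qed
  have "(\<integral>\<^sup>+x. \<integral>\<^sup>+y. G (c * x - s * y) (s * x + c * y) \<partial>std_normal_distribution \<partial>std_normal_distribution) =
    (\<integral>\<^sup>+x. \<integral>\<^sup>+y. H (c * x - s * y) (s * x + c * y) \<partial>lborel \<partial>lborel)"
    unfolding H_def inv by (rule conv) measurable
  also have "\<dots> = (\<integral>\<^sup>+x. \<integral>\<^sup>+y. H x y \<partial>lborel \<partial>lborel)"
    by (rule nn_integral_rotation[OF _ cs]) measurable
  also have "\<dots> = (\<integral>\<^sup>+x. \<integral>\<^sup>+y. G x y \<partial>std_normal_distribution \<partial>std_normal_distribution)"
    unfolding H_def by (rule conv[symmetric]) measurable
  finally show ?thesis .
qed

lemma gauss_sq_split2:
  assumes "i < n" "j < n" "i \<noteq> j"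
  shows "gauss_sq n x = (\<integral>\<^sup>+g. (\<integral>\<^sup>+a. \<integral>\<^sup>+b. ennreal ((norm ((\<Sum>k\<in>{..<n}-{i,j}. g k *\<^sub>R x k) + (a *\<^sub>R x i + b *\<^sub>R x j)))\<^sup>2)
    \<partial>std_normal_distribution \<partial>std_normal_distribution) \<partial>Pi\<^sub>M ({..<n}-{i,j}) (\<lambda>_. std_normal_distribution))"
proof -
  let ?K = "{..<n} - {i,j}"
  have un: "?K \<union> {i,j} = {..<n}" using assms by auto
  have merge: "(\<Sum>k<n. merge ?K {i,j} (g, \<sigma>) k *\<^sub>R x k) = (\<Sum>k\<in>?K. g k *\<^sub>R x k) + (\<sigma> i *\<^sub>R x i + \<sigma> j *\<^sub>R x j)" for g \<sigma>
  proof -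
    have "(\<Sum>k<n. merge ?K {i,j} (g, \<sigma>) k *\<^sub>R x k) =
      (\<Sum>k\<in>?K. merge ?K {i,j} (g, \<sigma>) k *\<^sub>R x k) + (\<Sum>k\<in>{i,j}. merge ?K {i,j} (g, \<sigma>) k *\<^sub>R x k)"
      by (subst un[symmetric], rule sum.union_disjoint) auto
    also have "(\<Sum>k\<in>?K. merge ?K {i,j} (g, \<sigma>) k *\<^sub>R x k) = (\<Sum>k\<in>?K. g k *\<^sub>R x k)"
      by (intro sum.cong) (auto simp: merge_def)
    also have "(\<Sum>k\<in>{i,j}. merge ?K {i,j} (g, \<sigma>) k *\<^sub>R x k) = \<sigma> i *\<^sub>R x i + \<sigma> j *\<^sub>R x j"
      using assms by (simp add: merge_def)
    finally show ?thesis .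
  qed
  have pair: "(\<integral>\<^sup>+\<sigma>. ennreal ((norm (v + (\<sigma> i *\<^sub>R x i + \<sigma> j *\<^sub>R x j)))\<^sup>2) \<partial>Pi\<^sub>M {i,j} (\<lambda>_. std_normal_distribution)) =
    (\<integral>\<^sup>+a. \<integral>\<^sup>+b. ennreal ((norm (v + (a *\<^sub>R x i + b *\<^sub>R x j)))\<^sup>2) \<partial>std_normal_distribution \<partial>std_normal_distribution)" for v
  proof -
    have [measurable]: "(\<lambda>(a, b). norm (v + (a *\<^sub>R x i + b *\<^sub>R x j))) \<in> borel_measurable (borel \<Otimes>\<^sub>M borel)"
      unfolding borel_prod case_prod_beta by (intro borel_measurable_continuous_onI continuous_intros)
    have m: "(\<lambda>(a, b). ennreal ((norm (v + (a *\<^sub>R x i + b *\<^sub>R x j)))\<^sup>2)) \<in> borel_measurable (std_normal_distribution \<Otimes>\<^sub>M std_normal_distribution)"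
      by (subst measurable_cong_sets[OF sets_pair_measure_cong[of _ borel _ borel] refl]) (simp_all add: case_prod_beta', measurable)
    show ?thesis
      using gauss.product_nn_integral_pair[OF m assms(3)] std_normal.nn_integral_fst[OF m] by (simp add: case_prod_beta')
  qed
  have "gauss_sq n x = (\<integral>\<^sup>+g. ennreal ((norm (\<Sum>k<n. g k *\<^sub>R x k))\<^sup>2) \<partial>Pi\<^sub>M (?K \<union> {i,j}) (\<lambda>_. std_normal_distribution))"
    by (simp only: gauss_sq_def un)
  also have "\<dots> = (\<integral>\<^sup>+g. (\<integral>\<^sup>+\<sigma>. ennreal ((norm (\<Sum>k<n. merge ?K {i,j} (g, \<sigma>) k *\<^sub>R x k))\<^sup>2)
    \<partial>Pi\<^sub>M {i,j} (\<lambda>_. std_normal_distribution)) \<partial>Pi\<^sub>M ?K (\<lambda>_. std_normal_distribution))"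
    by (rule gauss.product_nn_integral_fold)
      (auto simp: un intro!: measurable_compose[OF _ measurable_ennreal] borel_measurable_power measurable_gauss_sum)
  also have "\<dots> = (\<integral>\<^sup>+g. (\<integral>\<^sup>+a. \<integral>\<^sup>+b. ennreal ((norm ((\<Sum>k\<in>?K. g k *\<^sub>R x k) + (a *\<^sub>R x i + b *\<^sub>R x j)))\<^sup>2)
    \<partial>std_normal_distribution \<partial>std_normal_distribution) \<partial>Pi\<^sub>M ?K (\<lambda>_. std_normal_distribution))"
    unfolding merge pair ..
  finally show ?thesis .
qed

text \<open>Rotating the pair of vectors amounts to rotating their two Gaussian coefficients, whose
  joint law is rotation invariant.\<close>

lemma gauss_sq_rotate:
  assumes "i < n" "j < n" "i \<noteq> j" "c\<^sup>2 + s\<^sup>2 = 1" "c \<noteq> -1"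
  shows "gauss_sq n (x(i := c *\<^sub>R x i + s *\<^sub>R x j, j := c *\<^sub>R x j - s *\<^sub>R x i)) = gauss_sq n x"
proof -
  let ?y = "x(i := c *\<^sub>R x i + s *\<^sub>R x j, j := c *\<^sub>R x j - s *\<^sub>R x i)"
  have y: "?y i = c *\<^sub>R x i + s *\<^sub>R x j" "?y j = c *\<^sub>R x j - s *\<^sub>R x i" using assms(3) by auto
  have sum: "(\<Sum>k\<in>{..<n}-{i,j}. g k *\<^sub>R ?y k) = (\<Sum>k\<in>{..<n}-{i,j}. g k *\<^sub>R x k)" for g
    by (intro sum.cong) auto
  have "(\<integral>\<^sup>+a. \<integral>\<^sup>+b. ennreal ((norm (v + (a *\<^sub>R ?y i + b *\<^sub>R ?y j)))\<^sup>2) \<partial>std_normal_distribution \<partial>std_normal_distribution) =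
    (\<integral>\<^sup>+a. \<integral>\<^sup>+b. ennreal ((norm (v + (a *\<^sub>R x i + b *\<^sub>R x j)))\<^sup>2) \<partial>std_normal_distribution \<partial>std_normal_distribution)" for v
  proof -
    have [measurable]: "(\<lambda>(a, b). norm (v + (a *\<^sub>R x i + b *\<^sub>R x j))) \<in> borel_measurable (borel \<Otimes>\<^sub>M borel)"
      unfolding borel_prod case_prod_beta by (intro borel_measurable_continuous_onI continuous_intros)
    have "a *\<^sub>R ?y i + b *\<^sub>R ?y j = (c * a - s * b) *\<^sub>R x i + (s * a + c * b) *\<^sub>R x j" for a b
      unfolding y by (simp add: algebra_simps)
    then show ?thesis
      using nn_integral_std_normal_rotation[of "\<lambda>a b. ennreal ((norm (v + (a *\<^sub>R x i + b *\<^sub>R x j)))\<^sup>2)" c s] assms(4,5)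
      by (simp add: case_prod_beta')
  qed
  then show ?thesis
    unfolding gauss_sq_split2[OF assms(1-3)] sum by simp
qed

section \<open>Orthonormal systems and matrices acting on Gaussian sums\<close>

text \<open>Here \<open>w b\<close> is read as a vector with coordinates \<open>w b a\<close>, so
  this family represents the tensor with terms \<open>w b\<close> times \<open>z b\<close>. Its
  Gaussian norm depends on the vectors \<open>w b\<close> only through their inner products
  \<open>gram\<close>; for orthonormal vectors this is \<open>gauss_sq_orthonormal\<close>.\<close>

definition tensor :: "nat \<Rightarrow> (nat \<Rightarrow> nat \<Rightarrow> real) \<Rightarrow> (nat \<Rightarrow> 'a::real_vector) \<Rightarrow> nat \<Rightarrow> 'a"
  where "tensor m w z a = (\<Sum>b<m. w b a *\<^sub>R z b)"

definition gram :: "nat \<Rightarrow> (nat \<Rightarrow> nat \<Rightarrow> real) \<Rightarrow> nat \<Rightarrow> nat \<Rightarrow> real"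
  where "gram n w b b' = (\<Sum>a<n. w b a * w b' a)"

lemma gram_rotate:
  assumes "i < n" "j < n" "i \<noteq> j" "c\<^sup>2 + s\<^sup>2 = 1"
  shows "gram n (\<lambda>b. (w b)(i := c * w b i + s * w b j, j := c * w b j - s * w b i)) = gram n w"
proof (intro ext)
  fix b b'
  let ?r = "\<lambda>b. (w b)(i := c * w b i + s * w b j, j := c * w b j - s * w b i)"
  have split: "gram n v b b' = (\<Sum>a\<in>{..<n}-{i,j}. v b a * v b' a) + (v b i * v b' i + v b j * v b' j)" for v
  proof -
    have "{..<n} = ({..<n} - {i,j}) \<union> {i,j}" using assms by auto
    then have "gram n v b b' = (\<Sum>a\<in>({..<n}-{i,j}) \<union> {i,j}. v b a * v b' a)" by (simp add: gram_def)
    also have "\<dots> = (\<Sum>a\<in>{..<n}-{i,j}. v b a * v b' a) + (\<Sum>a\<in>{i,j}. v b a * v b' a)"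
      by (rule sum.union_disjoint) auto
    finally show ?thesis using assms by simp
  qed
  have "(c * p + s * q) * (c * p' + s * q') + (c * q - s * p) * (c * q' - s * p') = (c\<^sup>2 + s\<^sup>2) * (p * p' + q * q')" for p q p' q'
    by (simp add: power2_eq_square algebra_simps)
  moreover have "(\<Sum>a\<in>{..<n}-{i,j}. ?r b a * ?r b' a) = (\<Sum>a\<in>{..<n}-{i,j}. w b a * w b' a)"
    by (intro sum.cong) auto
  ultimately show "gram n ?r b b' = gram n w b b'"
    using assms by (simp add: split)
qed

lemma gauss_sq_tensor_rotate:
  assumes "i < n" "j < n" "i \<noteq> j" "c\<^sup>2 + s\<^sup>2 = 1" "c \<noteq> -1"
  shows "gauss_sq n (tensor m (\<lambda>b. (w b)(i := c * w b i + s * w b j, j := c * w b j - s * w b i)) z) =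
    gauss_sq n (tensor m w z)"
proof -
  have "tensor m (\<lambda>b. (w b)(i := c * w b i + s * w b j, j := c * w b j - s * w b i)) z =
    (tensor m w z)(i := c *\<^sub>R tensor m w z i + s *\<^sub>R tensor m w z j, j := c *\<^sub>R tensor m w z j - s *\<^sub>R tensor m w z i)"
    using assms(3)
    by (auto simp: fun_eq_iff tensor_def scaleR_sum_right sum.distrib[symmetric] sum_subtractf[symmetric] algebra_simps)
  then show ?thesis using gauss_sq_rotate[OF assms] by simp
qed

text \<open>Givens rotations in the coordinates \<open>j, \<dots>, t - 1\<close> clear the entries of the column \<open>p\<close>
  below \<open>j\<close>.\<close>

lemma givens_elimination:
  fixes z :: "nat \<Rightarrow> 'a::real_normed_vector"
  assumes "j < t" "t \<le> n"
  shows "\<exists>w'. gram n w' = gram n w \<and> gauss_sq n (tensor m w' z) = gauss_sq n (tensor m w z) \<and>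
    (\<forall>b. \<forall>a<j. w' b a = w b a) \<and>
    (\<forall>b. (\<forall>a. j \<le> a \<and> a < n \<longrightarrow> w b a = 0) \<longrightarrow> (\<forall>a. j \<le> a \<and> a < n \<longrightarrow> w' b a = 0)) \<and>
    (\<forall>a. j < a \<and> a < t \<longrightarrow> w' p a = 0)"
  using assms
proof (induction t rule: nat_induct_at_least[of "Suc j", OF Suc_leI])
  case 1
  show ?case using assms by simp
next
  case 2
  then show ?case by (intro exI[of _ w]) auto
next
  case (3 t)
  then obtain w' where w': "gram n w' = gram n w" "gauss_sq n (tensor m w' z) = gauss_sq n (tensor m w z)"
    "\<And>b a. a < j \<Longrightarrow> w' b a = w b a"
    "\<And>b a. \<lbrakk>\<forall>a. j \<le> a \<and> a < n \<longrightarrow> w b a = 0; j \<le> a; a < n\<rbrakk> \<Longrightarrow> w' b a = 0"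
    "\<And>a. j < a \<Longrightarrow> a < t \<Longrightarrow> w' p a = 0"
    by (auto 0 0 simp: Suc_le_eq)
  have jt: "j < n" "t < n" "j \<noteq> t" using 3 by auto
  show ?case
  proof (cases "w' p t = 0")
    case True
    with w' show ?thesis
      by (intro exI[of _ w']) (auto simp: less_Suc_eq)
  next
    case False
    define r where "r = sqrt ((w' p j)\<^sup>2 + (w' p t)\<^sup>2)"
    \<comment> \<open>The sign of the first entry is included in \<open>\<rho>\<close>, which makes
      \<open>c\<close> nonnegative and keeps the rotation away from the half turn.\<close>
    define \<rho> where "\<rho> = (if w' p j \<ge> 0 then r else - r)"
    have "r > 0" using False by (simp add: r_def add_nonneg_pos)
    then have \<rho>: "\<rho> \<noteq> 0" by (simp add: \<rho>_def)
    have \<rho>2: "\<rho>\<^sup>2 = (w' p j)\<^sup>2 + (w' p t)\<^sup>2" by (simp add: \<rho>_def r_def)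
    define c s where "c = w' p j / \<rho>" and "s = w' p t / \<rho>"
    have cs: "c\<^sup>2 + s\<^sup>2 = 1" 
      unfolding c_def s_def power_divide add_divide_distrib[symmetric] \<rho>2[symmetric] using \<rho> by simp
    have "c \<ge> 0" using \<open>r > 0\<close> by (auto simp: c_def \<rho>_def divide_nonpos_pos)
    then have c1: "c \<noteq> -1" by simp
    define w'' where "w'' = (\<lambda>b. (w' b)(j := c * w' b j + s * w' b t, t := c * w' b t - s * w' b j))"
    have "gram n w'' = gram n w" unfolding w''_def using gram_rotate[OF jt cs] w'(1) by simp
    moreover have "gauss_sq n (tensor m w'' z) = gauss_sq n (tensor m w z)"
      unfolding w''_def
      by (rule trans[OF gauss_sq_tensor_rotate[OF jt cs c1] w'(2)])
    moreover have "w'' b a = w b a" if "a < j" for a b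
      using that 3 w'(3) by (auto simp: w''_def)
    moreover have "w'' b a = 0" if z: "\<forall>a. j \<le> a \<and> a < n \<longrightarrow> w b a = 0" and a: "j \<le> a" "a < n" for a b
      using w'(4)[OF z] a jt 3 by (auto simp: w''_def)
    moreover have "w'' p a = 0" if "j < a" "a < Suc t" for a
    proof (cases "a = t")
      case True
      then show ?thesis by (simp add: w''_def c_def s_def)
    next
      case False
      then show ?thesis using that w'(5)[of a] by (simp add: w''_def)
    qed
    ultimately show ?thesis by (intro exI[of _ w'']) auto
  qed
qed

lemma gauss_sq_signs:
  assumes "\<And>k. k < n \<Longrightarrow> e k = 1 \<or> e k = (-1::real)"
  shows "gauss_sq n (\<lambda>k. e k *\<^sub>R x k) = gauss_sq n x"
proof -
  have "gauss_sq n (\<lambda>k. if k < p then e k *\<^sub>R x k else x k) = gauss_sq n x" if "p \<le> n" for p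
    using that
  proof (induction p)
    case (Suc p)
    let ?y = "\<lambda>k. if k < p then e k *\<^sub>R x k else x k"
    have "(\<lambda>k. if k < Suc p then e k *\<^sub>R x k else x k) = (if e p = 1 then ?y else ?y(p := - ?y p))"
      using assms[of p] Suc.prems by (auto simp: fun_eq_iff less_Suc_eq)
    then show ?case using Suc gauss_sq_flip[of p n ?y] by (auto split: if_splits)
  qed simp
  from this[of n] show ?thesis by (simp cong: gauss_sq_cong)
qed

text \<open>Rotations of the coordinate space change neither side. Eliminating one vector after the
  other makes the system triangular, and an orthonormal triangular system is diagonal with entries 1
  or -1; the remaining signs are absorbed by the symmetry of the Gaussians.\<close>

lemma gauss_sq_orthonormal:
  fixes z :: "nat \<Rightarrow> 'a::real_normed_vector"
  assumes "\<And>b b'. b < m \<Longrightarrow> b' < m \<Longrightarrow> gram n w b b' = (if b = b' then 1 else 0)"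
  shows "gauss_sq n (tensor m w z) = gauss_sq m z"
proof -
  have "\<exists>w'. gram n w' = gram n w \<and> gauss_sq n (tensor m w' z) = gauss_sq n (tensor m w z) \<and>
    (\<forall>b<q. \<forall>a<n. a \<noteq> b \<longrightarrow> w' b a = 0) \<and> q \<le> n" if "q \<le> m" for q
    using that
  proof (induction q)
    case 0
    show ?case by (intro exI[of _ w]) simp
  next
    case (Suc q)
    then obtain w' where w': "gram n w' = gram n w" "gauss_sq n (tensor m w' z) = gauss_sq n (tensor m w z)"
      "\<And>b a. \<lbrakk>b < q; a < n; a \<noteq> b\<rbrakk> \<Longrightarrow> w' b a = 0" "q \<le> n" by auto
    have g: "gram n w' b b' = (if b = b' then 1 else 0)" if "b < m" "b' < m" for b b'
      using assms[OF that] w'(1) by simp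
    \<comment> \<open>The vectors treated so far are multiples of unit vectors, so orthogonality to
      them annihilates the first \<open>q\<close> coordinates of \<open>w' q\<close>.\<close>
    have zero: "w' q a = 0" if a: "a < q" for a
    proof -
      have an: "a < n" using a w'(4) by simp
      have single: "gram n w' b a = w' b a * w' a a" for b
        unfolding gram_def using an w'(3)[OF a] by (subst sum.remove[of _ a]) (auto intro!: sum.neutral)
      have "w' q a * w' a a = 0" "w' a a * w' a a = 1"
        using g[of q a] g[of a a] a Suc.prems by (simp_all add: single)
      then show ?thesis by auto
    qed
    \<comment> \<open>If all \<open>n\<close> coordinates were used up, the next vector would vanish
      although its length is 1. This also yields \<open>m \<le> n\<close> at the end.\<close>
    have qn: "q < n"
    proof (rule ccontr)
      assume "\<not> q < n"
      then have "gram n w' q q = 0" unfolding gram_def by (intro sum.neutral) (use zero w'(4) in auto)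
      then show False using g[of q q] Suc.prems by simp
    qed
    obtain w'' where w'': "gram n w'' = gram n w'" "gauss_sq n (tensor m w'' z) = gauss_sq n (tensor m w' z)"
      "\<And>b a. a < q \<Longrightarrow> w'' b a = w' b a"
      "\<And>b a. \<lbrakk>\<forall>a. q \<le> a \<and> a < n \<longrightarrow> w' b a = 0; q \<le> a; a < n\<rbrakk> \<Longrightarrow> w'' b a = 0"
      "\<And>a. q < a \<Longrightarrow> a < n \<Longrightarrow> w'' q a = 0"
      using givens_elimination[OF qn order_refl, of w' m z q] by (elim exE conjE) (metis)
    have "w'' b a = 0" if "b < Suc q" "a < n" "a \<noteq> b" for a b
    proof (cases "b = q")
      case True
      then show ?thesis using that w''(3,5) zero by (metis nat_neq_iff)
    next
      case False
      then have "b < q" using that by simp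
      then show ?thesis using that w'(3) w''(3)[of a b] w''(4)[of b a] by (cases "a < q") auto
    qed
    then show ?case using w' w'' qn by (intro exI[of _ w'']) auto
  qed
  from this[of m] obtain w' where w': "gram n w' = gram n w" "gauss_sq n (tensor m w' z) = gauss_sq n (tensor m w z)"
    "\<And>b a. \<lbrakk>b < m; a < n; a \<noteq> b\<rbrakk> \<Longrightarrow> w' b a = 0" "m \<le> n" by auto
  have sq: "w' b b = 1 \<or> w' b b = -1" if "b < m" for b
  proof -
    have "gram n w' b b = w' b b * w' b b"
      unfolding gram_def using that w'(3)[OF that] w'(4) by (subst sum.remove[of _ b]) (auto intro!: sum.neutral)
    then have "(w' b b)\<^sup>2 = 1" using assms[OF that that] w'(1) by (simp add: power2_eq_square)
    then show ?thesis by (simp add: power2_eq_1_iff)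
  qed
  have "gauss_sq n (tensor m w z) = gauss_sq n (\<lambda>a. if a < m then w' a a *\<^sub>R z a else 0)"
    unfolding w'(2)[symmetric]
  proof (rule gauss_sq_cong)
    fix a assume "a < n"
    show "tensor m w' z a = (if a < m then w' a a *\<^sub>R z a else 0)"
    proof (cases "a < m")
      case True
      then show ?thesis
        unfolding tensor_def using w'(3) \<open>a < n\<close>
        by (subst sum.remove[of _ a]) (auto intro!: sum.neutral)
    next
      case False
      then show ?thesis unfolding tensor_def using w'(3) \<open>a < n\<close> by (auto intro!: sum.neutral)
    qed
  qed
  also have "\<dots> = gauss_sq m (\<lambda>a. w' a a *\<^sub>R z a)" by (rule gauss_sq_extend_zero[OF w'(4)])
  also have "\<dots> = gauss_sq m z" by (rule gauss_sq_signs[OF sq])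
  finally show ?thesis .
qed

text \<open>Cholesky factorisation by induction. If the last diagonal entry is positive, the Schur
  complement \<open>K'\<close> is again positive semidefinite and receives one more column; if it is
  zero, positivity forces the whole last column to vanish.\<close>

lemma psd_factor:
  fixes K :: "nat \<Rightarrow> nat \<Rightarrow> real"
  assumes "\<And>i j. i < m \<Longrightarrow> j < m \<Longrightarrow> K i j = K j i"
    and "\<And>v. 0 \<le> (\<Sum>i<m. \<Sum>j<m. K i j * v i * v j)"
  shows "\<exists>r. \<forall>i<m. \<forall>j<m. (\<Sum>k<m. r i k * r j k) = K i j"
  using assms
proof (induction m arbitrary: K)
  case (Suc m)
  have sym: "K i j = K j i" if "i \<le> m" "j \<le> m" for i j
    using that by (intro Suc.prems(1)) auto
  have form: "(\<Sum>i<Suc m. \<Sum>j<Suc m. K i j * v i * v j) =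
    (\<Sum>i<m. \<Sum>j<m. K i j * v i * v j) + 2 * (\<Sum>i<m. K i m * v i) * v m + K m m * (v m)\<^sup>2" for v
  proof -
    have "(\<Sum>j<m. K m j * v m * v j) = (\<Sum>i<m. K i m * v i) * v m"
      unfolding sum_distrib_right by (intro sum.cong) (auto simp: sym[of m])
    then show ?thesis
      by (simp add: sum.distrib sum_distrib_right power2_eq_square)
  qed
  have diag: "K m m \<ge> 0"
    using Suc.prems(2)[of "\<lambda>i. if i = m then 1 else 0"] unfolding form by (simp add: sum.neutral)
  show ?case
  proof (cases "K m m = 0")
    case True
    have Kim: "K i m = 0" if "i < m" for i
    proof (rule ccontr)
      assume ne: "K i m \<noteq> 0"
      \<comment> \<open>With this \<open>t\<close> the quadratic form at \<open>e_i + t e_m\<close>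
        equals \<open>K i i + 2 * K i m * t = -1\<close>.\<close>
      define t where "t = - (K i i + 1) / (2 * K i m)"
      let ?v = "\<lambda>k. if k = i then 1 else if k = m then t else 0"
      have "(\<Sum>p<m. \<Sum>q<m. K p q * ?v p * ?v q) = (\<Sum>p<m. \<Sum>q<m. if q = i then (if p = i then K p i else 0) else 0)"
        by (intro sum.cong) auto
      also have "\<dots> = K i i" using that by simp
      finally have 1: "(\<Sum>p<m. \<Sum>q<m. K p q * ?v p * ?v q) = K i i" .
      have "(\<Sum>p<m. K p m * ?v p) = (\<Sum>p<m. if p = i then K i m else 0)" by (intro sum.cong) auto
      then have 2: "(\<Sum>p<m. K p m * ?v p) = K i m" using that by simp
      have "0 \<le> K i i + 2 * K i m * t"
        using Suc.prems(2)[of ?v] that True unfolding form 1 2 by simp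
      also have "\<dots> = -1" using ne by (simp add: t_def)
      finally show False by simp
    qed
    have "0 \<le> (\<Sum>i<m. \<Sum>j<m. K i j * v i * v j)" for v
      using Suc.prems(2)[of v] True Kim unfolding form by simp
    then have "\<exists>r. \<forall>i<m. \<forall>j<m. (\<Sum>k<m. r i k * r j k) = K i j"
      by (intro Suc.IH sym) auto
    then obtain r where r: "\<And>i j. i < m \<Longrightarrow> j < m \<Longrightarrow> (\<Sum>k<m. r i k * r j k) = K i j"
      by blast
    show ?thesis
      by (intro exI[of _ "\<lambda>i k. if i < m \<and> k < m then r i k else 0"] allI impI)
        (auto simp: less_Suc_eq r True Kim sym[of m])
  next
    case False
    then have pos: "K m m > 0" using diag by simp
    define K' where "K' i j = K i j - K i m * K j m / K m m" for i j
    have "0 \<le> (\<Sum>i<m. \<Sum>j<m. K' i j * v i * v j)" for v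
    proof -
      define S where "S = (\<Sum>i<m. K i m * v i)"
      \<comment> \<open>The last coordinate is the minimiser of the quadratic form when the others
        are given; the minimal value is the form of the Schur complement.\<close>
      define u where "u = v(m := - S / K m m)"
      have "0 \<le> (\<Sum>i<m. \<Sum>j<m. K i j * v i * v j) + 2 * S * (- S / K m m) + K m m * (S / K m m)\<^sup>2"
      proof -
        have "(\<Sum>i<m. \<Sum>j<m. K i j * u i * u j) = (\<Sum>i<m. \<Sum>j<m. K i j * v i * v j)"
          "(\<Sum>i<m. K i m * u i) = S"
          unfolding S_def by (auto simp: u_def intro!: sum.cong)
        then show ?thesis using Suc.prems(2)[of u] unfolding form by (simp add: u_def)
      qed
      also have "\<dots> = (\<Sum>i<m. \<Sum>j<m. K i j * v i * v j) - S * S / K m m"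
        using pos by (simp add: power2_eq_square)
      also have "S * S / K m m = (\<Sum>i<m. \<Sum>j<m. K i m * K j m / K m m * v i * v j)"
        unfolding S_def sum_product sum_divide_distrib by (intro sum.cong) auto
      finally show ?thesis by (simp add: K'_def sum_subtractf algebra_simps)
    qed
    moreover have "K' i j = K' j i" if "i < m" "j < m" for i j
      using that sym[of i j] by (simp add: K'_def)
    ultimately have "\<exists>r. \<forall>i<m. \<forall>j<m. (\<Sum>k<m. r i k * r j k) = K' i j"
      by (rule Suc.IH[rotated])
    then obtain r where r: "\<And>i j. i < m \<Longrightarrow> j < m \<Longrightarrow> (\<Sum>k<m. r i k * r j k) = K' i j"
      by blast
    have sq: "sqrt (K m m) * sqrt (K m m) = K m m" using pos by simp
    define r' where "r' i k = (if i < m then (if k < m then r i k else K i m / sqrt (K m m)) else if k < m then 0 else sqrt (K m m))" for i k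
    have "(\<Sum>k<Suc m. r' i k * r' j k) = K i j" if "i < Suc m" "j < Suc m" for i j
    proof -
      have "(\<Sum>k<m. r' i k * r' j k) = (if i < m \<and> j < m then K' i j else 0)"
        using r by (auto simp: r'_def)
      moreover have "K m j = K j m" using that by (intro sym) auto
      ultimately show ?thesis using that pos sq
        by (auto simp: r'_def less_Suc_eq K'_def field_simps)
    qed
    then show ?thesis by blast
  qed
qed simp

text \<open>A contraction is completed to an isometry by appending a factor of the defect
  \<open>1 - M\<^sup>T M\<close>; the appended coordinates can afterwards be dropped.\<close>

lemma gauss_sq_contraction:
  fixes z :: "nat \<Rightarrow> 'a::real_normed_vector"
  assumes "\<And>v. (\<Sum>a<n. (\<Sum>b<m. M a b * v b)\<^sup>2) \<le> (\<Sum>b<m. (v b)\<^sup>2)"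
  shows "gauss_sq n (\<lambda>a. \<Sum>b<m. M a b *\<^sub>R z b) \<le> gauss_sq m z"
proof -
  define K where "K i j = (if i = j then 1 else 0) - (\<Sum>a<n. M a i * M a j)" for i j
  have "0 \<le> (\<Sum>i<m. \<Sum>j<m. K i j * v i * v j)" for v
  proof -
    have "(\<Sum>a<n. (\<Sum>b<m. M a b * v b)\<^sup>2) = (\<Sum>a<n. \<Sum>i<m. \<Sum>j<m. M a i * M a j * v i * v j)"
      unfolding power2_eq_square sum_product by (intro sum.cong) auto
    also have "\<dots> = (\<Sum>i<m. \<Sum>a<n. \<Sum>j<m. M a i * M a j * v i * v j)" by (rule sum.swap)
    also have "\<dots> = (\<Sum>i<m. \<Sum>j<m. \<Sum>a<n. M a i * M a j * v i * v j)" by (intro sum.cong sum.swap) simp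
    also have "\<dots> = (\<Sum>i<m. \<Sum>j<m. (\<Sum>a<n. M a i * M a j) * v i * v j)" by (simp add: sum_distrib_right)
    finally have 1: "(\<Sum>a<n. (\<Sum>b<m. M a b * v b)\<^sup>2) = \<dots>" .
    have "(\<Sum>i<m. \<Sum>j<m. (if i = j then 1 else 0) * v i * v j) = (\<Sum>i<m. \<Sum>j<m. if j = i then (v i)\<^sup>2 else 0)"
      by (intro sum.cong) (auto simp: power2_eq_square)
    then have 2: "(\<Sum>i<m. \<Sum>j<m. (if i = j then 1 else 0) * v i * v j) = (\<Sum>b<m. (v b)\<^sup>2)" by simp
    have "(\<Sum>i<m. \<Sum>j<m. K i j * v i * v j) = (\<Sum>b<m. (v b)\<^sup>2) - (\<Sum>a<n. (\<Sum>b<m. M a b * v b)\<^sup>2)"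
      unfolding 1 2[symmetric] K_def by (simp add: left_diff_distrib sum_subtractf)
    then show ?thesis using assms[of v] by simp
  qed
  moreover have "K i j = K j i" for i j unfolding K_def by (simp only: mult.commute eq_commute)
  ultimately obtain r where r: "\<And>i j. i < m \<Longrightarrow> j < m \<Longrightarrow> (\<Sum>k<m. r i k * r j k) = K i j"
    using psd_factor[of m K] by blast
  define w where "w b a = (if a < n then M a b else r b (a - n))" for b a
  have "gram (n + m) w b b' = (if b = b' then 1 else 0)" if "b < m" "b' < m" for b b'
  proof -
    have "gram (n + m) w b b' = (\<Sum>a<n. w b a * w b' a) + (\<Sum>k<m. w b (n + k) * w b' (n + k))"
      unfolding gram_def lessThan_atLeast0
      by (subst sum.atLeastLessThan_concat[of 0 n "n + m", symmetric])
        (simp_all add: sum.shift_bounds_nat_ivl[of _ 0 n m, simplified add.commute add_0] add.commute)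
    then show ?thesis using r[OF that] by (simp add: w_def K_def)
  qed
  from gauss_sq_orthonormal[OF this, where z = z]
  have "gauss_sq (n + m) (tensor m w z) = gauss_sq m z" by simp
  moreover have "gauss_sq n (\<lambda>a. \<Sum>b<m. M a b *\<^sub>R z b) = gauss_sq n (tensor m w z)"
    by (rule gauss_sq_cong) (simp add: tensor_def w_def)
  moreover have "gauss_sq n (tensor m w z) \<le> gauss_sq (n + m) (tensor m w z)"
    by (rule gauss_sq_mono) simp
  ultimately show ?thesis by simp
qed

lemma gauss_sq_contraction_scaled:
  fixes z :: "nat \<Rightarrow> 'a::real_normed_vector"
  assumes "0 < \<kappa>" "\<And>v. (\<Sum>a<n. (\<Sum>b<m. M a b * v b)\<^sup>2) \<le> \<kappa>\<^sup>2 * (\<Sum>b<m. (v b)\<^sup>2)"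
  shows "gauss_sq n (\<lambda>a. \<Sum>b<m. M a b *\<^sub>R z b) \<le> ennreal (\<kappa>\<^sup>2) * gauss_sq m z"
proof -
  have scale: "gauss_sq m (\<lambda>b. \<kappa> *\<^sub>R z b) = ennreal (\<kappa>\<^sup>2) * gauss_sq m z"
  proof -
    have "(norm (\<Sum>k<m. g k *\<^sub>R \<kappa> *\<^sub>R z k))\<^sup>2 = \<kappa>\<^sup>2 * (norm (\<Sum>k<m. g k *\<^sub>R z k))\<^sup>2" for g
    proof -
      have "(\<Sum>k<m. g k *\<^sub>R \<kappa> *\<^sub>R z k) = \<kappa> *\<^sub>R (\<Sum>k<m. g k *\<^sub>R z k)"
        by (simp add: scaleR_sum_right mult.commute)
      then show ?thesis by (simp add: power_mult_distrib)
    qed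
    then show ?thesis unfolding gauss_sq_def
      by (simp add: ennreal_mult' nn_integral_cmult measurable_compose[OF _ measurable_ennreal] borel_measurable_power measurable_gauss_sum)
  qed
  have "(\<Sum>a<n. (\<Sum>b<m. M a b / \<kappa> * v b)\<^sup>2) \<le> (\<Sum>b<m. (v b)\<^sup>2)" for v
  proof -
    have "(\<Sum>a<n. (\<Sum>b<m. M a b / \<kappa> * v b)\<^sup>2) = (\<Sum>a<n. (\<Sum>b<m. M a b * v b)\<^sup>2) / \<kappa>\<^sup>2"
      by (simp add: sum_divide_distrib power_divide[symmetric])
    then show ?thesis using assms(2)[of v] assms(1) by (simp add: divide_le_eq mult.commute)
  qed
  from gauss_sq_contraction[OF this, where z = "\<lambda>b. \<kappa> *\<^sub>R z b"] show ?thesis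
    using assms(1) by (simp add: scale)
qed

lemma gauss_sq_add:
  "gauss_sq n (\<lambda>k. x k + y k) \<le> 2 * gauss_sq n x + 2 * gauss_sq n y"
proof -
  note measurable_gauss_sum[OF order_refl, measurable]
  have "gauss_sq n (\<lambda>k. x k + y k) \<le> (\<integral>\<^sup>+g. 2 * ennreal ((norm (\<Sum>k<n. g k *\<^sub>R x k))\<^sup>2) +
    2 * ennreal ((norm (\<Sum>k<n. g k *\<^sub>R y k))\<^sup>2) \<partial>gauss_measure n)"
    unfolding gauss_sq_def
  proof (rule nn_integral_mono)
    fix g
    let ?u = "\<Sum>k<n. g k *\<^sub>R x k" and ?v = "\<Sum>k<n. g k *\<^sub>R y k"
    have "(\<Sum>k<n. g k *\<^sub>R (x k + y k)) = ?u + ?v" by (simp add: scaleR_right_distrib sum.distrib)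
    then have "(norm (\<Sum>k<n. g k *\<^sub>R (x k + y k)))\<^sup>2 \<le> (norm ?u + norm ?v)\<^sup>2"
      by (simp add: norm_triangle_ineq power_mono)
    also have "\<dots> \<le> 2 * (norm ?u)\<^sup>2 + 2 * (norm ?v)\<^sup>2"
      using sum_squares_bound[of "norm ?u" "norm ?v"] by (simp add: power2_sum)
    finally have "ennreal ((norm (\<Sum>k<n. g k *\<^sub>R (x k + y k)))\<^sup>2) \<le> ennreal (2 * (norm ?u)\<^sup>2 + 2 * (norm ?v)\<^sup>2)"
      by (rule ennreal_leI)
    then show "ennreal ((norm (\<Sum>k<n. g k *\<^sub>R (x k + y k)))\<^sup>2) \<le> 2 * ennreal ((norm ?u)\<^sup>2) + 2 * ennreal ((norm ?v)\<^sup>2)"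
      by (simp add: ennreal_plus ennreal_mult')
  qed
  also have "\<dots> = 2 * gauss_sq n x + 2 * gauss_sq n y"
    unfolding gauss_sq_def by (simp add: nn_integral_add nn_integral_cmult)
  finally show ?thesis .
qed

lemma gauss_sq_single:
  assumes "i < n" "\<And>k. k < n \<Longrightarrow> k \<noteq> i \<Longrightarrow> x k = 0"
  shows "gauss_sq n x = ennreal ((norm (x i))\<^sup>2)"
proof -
  interpret P: prob_space "Pi\<^sub>M ({..<n}-{i}) (\<lambda>_. std_normal_distribution)"
    by (rule prob_space_PiM) (rule prob_space_normal_density, simp)
  have "(\<Sum>k\<in>{..<n}-{i}. g k *\<^sub>R x k) = 0" for g using assms(2) by (intro sum.neutral) auto
  moreover have "(\<integral>\<^sup>+y. ennreal ((norm (y *\<^sub>R x i))\<^sup>2) \<partial>std_normal_distribution) = ennreal ((norm (x i))\<^sup>2)"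
    using nn_integral_std_normal_sq
    by (simp add: power_mult_distrib ennreal_mult' nn_integral_multc)
  ultimately show ?thesis using P.emeasure_space_1 by (simp add: gauss_sq_split[OF assms(1)])
qed

lemma gauss_sq_finite: "gauss_sq n x < \<top>"
proof (induction n)
  case 0
  then show ?case by (simp add: gauss_sq_def)
next
  case (Suc n)
  let ?y = "\<lambda>k. if k < n then x k else 0" and ?z = "\<lambda>k. if k = n then x n else 0"
  have "gauss_sq (Suc n) x = gauss_sq (Suc n) (\<lambda>k. ?y k + ?z k)" by (rule gauss_sq_cong) auto
  also have "\<dots> \<le> 2 * gauss_sq (Suc n) ?y + 2 * gauss_sq (Suc n) ?z" by (rule gauss_sq_add)
  also have "\<dots> = 2 * gauss_sq n x + 2 * ennreal ((norm (x n))\<^sup>2)"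
    by (subst gauss_sq_extend_zero, simp, subst gauss_sq_single[of n]) auto
  also have "\<dots> < \<top>" using Suc by (simp add: ennreal_mult_less_top)
  finally show ?case .
qed

lemma gauss_sq_eq_norm: "gauss_sq n x = ennreal ((gauss_norm n x)\<^sup>2)"
  using gauss_sq_finite[of n x] by (simp add: gauss_norm_eq)

lemma gauss_norm_nonneg: "0 \<le> gauss_norm n x"
  by (simp add: gauss_norm_eq)

section \<open>From Gaussian sums to operator sums\<close>

text \<open>The constant family is the tensor of the unit vector with entries
  \<open>1 / sqrt n\<close> and the vector \<open>sqrt n\<close> times \<open>x\<close>.\<close>

lemma gauss_norm_const: "gauss_norm n (\<lambda>_. x) = sqrt n * norm x"
proof (cases "n = 0")
  case False
  define w where "w = (\<lambda>(b::nat) (a::nat). 1 / sqrt n)"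
  have "gauss_sq n (tensor 1 w (\<lambda>_. sqrt n *\<^sub>R x)) = gauss_sq 1 (\<lambda>_. sqrt n *\<^sub>R x)"
    by (rule gauss_sq_orthonormal) (use False in \<open>simp add: gram_def w_def\<close>)
  also have "tensor 1 w (\<lambda>_. sqrt n *\<^sub>R x) = (\<lambda>_. x)" using False by (simp add: tensor_def w_def fun_eq_iff)
  also have "gauss_sq 1 (\<lambda>_. sqrt n *\<^sub>R x) = ennreal ((norm (sqrt n *\<^sub>R x))\<^sup>2)" by (rule gauss_sq_single) auto
  finally have "(gauss_norm n (\<lambda>_. x))\<^sup>2 = (sqrt n * norm x)\<^sup>2" by (simp add: gauss_sq_eq_norm)
  then show ?thesis by (simp add: power2_eq_iff_nonneg gauss_norm_nonneg)
qed (simp add: gauss_norm_def)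

text \<open>Summation is the 1-by-n matrix with all entries 1, whose norm is \<open>sqrt n\<close>;
  a Gaussian sum with a single term is the norm itself.\<close>

lemma norm_sum_le_gauss_norm: "norm (\<Sum>a<n. z a) \<le> sqrt n * gauss_norm n z"
proof (cases "n = 0")
  case False
  have "(\<Sum>a<1::nat. (\<Sum>b<n. 1 * v b)\<^sup>2) \<le> (sqrt n)\<^sup>2 * (\<Sum>b<n. (v b)\<^sup>2)" for v :: "nat \<Rightarrow> real"
    using Cauchy_Schwarz_ineq_sum[of "\<lambda>_. 1" v "{..<n}"] by simp
  from gauss_sq_contraction_scaled[OF _ this, where z = z]
  have "gauss_sq 1 (\<lambda>a. \<Sum>b<n. z b) \<le> ennreal ((sqrt n)\<^sup>2) * gauss_sq n z"
    using False by simp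
  then have "(norm (\<Sum>b<n. z b))\<^sup>2 \<le> (sqrt n * gauss_norm n z)\<^sup>2"
    by (subst (asm) gauss_sq_single[of 0]) (auto simp: gauss_sq_eq_norm ennreal_mult'[symmetric] power_mult_distrib)
  then show ?thesis by (rule power2_le_imp_le) (simp add: gauss_norm_nonneg)
qed simp

text \<open>The hypothesis carries the arithmetic mean of the two squared lengths, the form in which
  \<open>hankel_bound\<close> delivers it. The test vector \<open>u = M v / \<kappa>\<close> turns
  it into the bound for \<open>M v\<close>.\<close>

lemma bilinear_bound_imp_operator_bound:
  fixes M :: "nat \<Rightarrow> nat \<Rightarrow> real"
  assumes "0 < \<kappa>" "\<And>u v. (\<Sum>a<n. \<Sum>b<m. M a b * u a * v b) \<le> \<kappa> * ((\<Sum>a<n. (u a)\<^sup>2) + (\<Sum>b<m. (v b)\<^sup>2)) / 2"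
  shows "(\<Sum>a<n. (\<Sum>b<m. M a b * v b)\<^sup>2) \<le> \<kappa>\<^sup>2 * (\<Sum>b<m. (v b)\<^sup>2)"
proof -
  define y where "y a = (\<Sum>b<m. M a b * v b)" for a
  define Y where "Y = (\<Sum>a<n. (y a)\<^sup>2)"
  have "(\<Sum>a<n. \<Sum>b<m. M a b * (y a / \<kappa>) * v b) = Y / \<kappa>"
    unfolding Y_def sum_divide_distrib power2_eq_square
    by (intro sum.cong) (auto simp: y_def sum_distrib_left sum_distrib_right sum_divide_distrib mult_ac)
  moreover have "(\<Sum>a<n. (y a / \<kappa>)\<^sup>2) = Y / \<kappa>\<^sup>2"
    by (simp add: Y_def sum_divide_distrib power_divide)
  ultimately have "Y / \<kappa> \<le> \<kappa> * (Y / \<kappa>\<^sup>2 + (\<Sum>b<m. (v b)\<^sup>2)) / 2"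
    using assms(2)[of "\<lambda>a. y a / \<kappa>" v] by simp
  then have "Y \<le> \<kappa>\<^sup>2 * (\<Sum>b<m. (v b)\<^sup>2)"
    using assms(1) by (simp add: field_simps power2_eq_square)
  then show ?thesis by (simp add: Y_def y_def)
qed

text \<open>The Gaussians are real, so real and imaginary part are treated as two real matrices;
  real test vectors bound both. Multiplication by the imaginary unit preserves the Gaussian norm,
  and \<open>gauss_sq_add\<close> gives
  \<open>2 \<kappa>^2 + 2 \<kappa>^2 = (2 \<kappa>)^2\<close>.\<close>

lemma gauss_norm_complex_matrix:
  fixes M :: "nat \<Rightarrow> nat \<Rightarrow> complex" and z :: "nat \<Rightarrow> 'a::complex_banach"
  assumes "0 < \<kappa>"
    and "\<And>u v. cmod (\<Sum>a<n. \<Sum>b<m. M a b * complex_of_real (u a * v b)) \<le>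
      \<kappa> * ((\<Sum>a<n. (u a)\<^sup>2) + (\<Sum>b<m. (v b)\<^sup>2)) / 2"
  shows "gauss_norm n (\<lambda>a. \<Sum>b<m. M a b *\<^sub>C z b) \<le> 2 * \<kappa> * gauss_norm m z"
proof -
  have part: "gauss_sq n (\<lambda>a. \<Sum>b<m. P (M a b) *\<^sub>R z' b) \<le> ennreal (\<kappa>\<^sup>2) * gauss_sq m z'"
    if "P = Re \<or> P = Im" for P and z' :: "nat \<Rightarrow> 'a"
  proof (rule gauss_sq_contraction_scaled[OF assms(1)], rule bilinear_bound_imp_operator_bound[OF assms(1)])
    fix u v
    have "(\<Sum>a<n. \<Sum>b<m. P (M a b) * u a * v b) = P (\<Sum>a<n. \<Sum>b<m. M a b * complex_of_real (u a * v b))"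
      using that by (auto simp: mult.assoc)
    also have "\<dots> \<le> cmod (\<Sum>a<n. \<Sum>b<m. M a b * complex_of_real (u a * v b))"
      using that complex_Re_le_cmod abs_Im_le_cmod abs_le_D1 by blast
    also note assms(2)
    finally show "(\<Sum>a<n. \<Sum>b<m. P (M a b) * u a * v b) \<le> \<kappa> * ((\<Sum>a<n. (u a)\<^sup>2) + (\<Sum>b<m. (v b)\<^sup>2)) / 2" .
  qed
  have rot: "gauss_sq m (\<lambda>b. \<i> *\<^sub>C z b) = gauss_sq m z"
  proof -
    have C0: "\<i> *\<^sub>C 0 = (0::'a)" by (metis norm_scaleC norm_eq_zero mult_zero_right norm_zero)
    have "(\<Sum>k<j. g k *\<^sub>R \<i> *\<^sub>C z k) = \<i> *\<^sub>C (\<Sum>k<j. g k *\<^sub>R z k)" for g j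
      by (induction j) (simp_all add: C0 scaleC_add_right, simp add: scaleC_of_real[symmetric] scaleC_scaleC mult.commute)
    then show ?thesis unfolding gauss_sq_def by (simp add: norm_scaleC)
  qed
  have "M a b *\<^sub>C z b = Re (M a b) *\<^sub>R z b + Im (M a b) *\<^sub>R \<i> *\<^sub>C z b" for a b
    by (subst complex_eq[of "M a b"]) (simp only: scaleC_add_left scaleC_of_real[symmetric] scaleC_scaleC mult.commute)
  then have "gauss_sq n (\<lambda>a. \<Sum>b<m. M a b *\<^sub>C z b) =
    gauss_sq n (\<lambda>a. (\<Sum>b<m. Re (M a b) *\<^sub>R z b) + (\<Sum>b<m. Im (M a b) *\<^sub>R \<i> *\<^sub>C z b))"
    by (simp add: sum.distrib)
  also have "\<dots> \<le> 2 * (ennreal (\<kappa>\<^sup>2) * gauss_sq m z) + 2 * (ennreal (\<kappa>\<^sup>2) * gauss_sq m (\<lambda>b. \<i> *\<^sub>C z b))"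
    by (intro order.trans[OF gauss_sq_add] add_mono mult_left_mono part) auto
  also have "\<dots> = ennreal ((2 * \<kappa> * gauss_norm m z)\<^sup>2)"
    unfolding rot by (simp add: gauss_sq_eq_norm power_mult_distrib ennreal_mult' mult.assoc[symmetric] distrib_right[symmetric])
  finally have "(gauss_norm n (\<lambda>a. \<Sum>b<m. M a b *\<^sub>C z b))\<^sup>2 \<le> (2 * \<kappa> * gauss_norm m z)\<^sup>2"
    by (simp add: gauss_sq_eq_norm)
  then show ?thesis by (rule power2_le_imp_le) (use assms(1) in \<open>simp add: gauss_norm_nonneg\<close>)
qed

text \<open>The discrete transference estimate: the sum factors as \<open>x \<mapsto> (S\<^sub>b x)\<^sub>b \<mapsto> M (S\<^sub>b x)\<^sub>b\<close>
  followed by summation against the operators \<open>S\<^sub>a\<close>, and both outer maps are controlled by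
  \<open>\<gamma>\<close>-boundedness.\<close>

lemma gamma_bounded_transference:
  fixes S :: "nat \<Rightarrow> 'a::complex_banach \<Rightarrow>\<^sub>L 'a"
  assumes \<gamma>: "\<And>n R x. (\<And>k. k < n \<Longrightarrow> R k \<in> \<tau>) \<Longrightarrow>
      gauss_norm n (\<lambda>k. blinfun_apply (R k) (x k)) \<le> K * gauss_norm n x"
    and "0 \<le> K" "\<And>k. k < N \<Longrightarrow> S k \<in> \<tau>" "\<And>k. k < N \<Longrightarrow> complex_linear (S k)" "0 < \<kappa>"
    and M: "\<And>u v. cmod (\<Sum>a<N. \<Sum>b<N. M a b * complex_of_real (u a * v b)) \<le>
      \<kappa> * ((\<Sum>a<N. (u a)\<^sup>2) + (\<Sum>b<N. (v b)\<^sup>2)) / 2"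
  shows "norm (\<Sum>a<N. \<Sum>b<N. M a b *\<^sub>C S a (S b x)) \<le> 2 * K\<^sup>2 * \<kappa> * real N * norm x"
proof -
  have "(\<Sum>b<N. M a b *\<^sub>C S a (S b x)) = S a (\<Sum>b<N. M a b *\<^sub>C S b x)" if "a < N" for a
    using assms(4)[OF that] by (simp add: complex_linear_def blinfun.sum_right)
  then have "norm (\<Sum>a<N. \<Sum>b<N. M a b *\<^sub>C S a (S b x)) = norm (\<Sum>a<N. S a (\<Sum>b<N. M a b *\<^sub>C S b x))"
    by simp
  also have "\<dots> \<le> sqrt N * gauss_norm N (\<lambda>a. S a (\<Sum>b<N. M a b *\<^sub>C S b x))"
    by (rule norm_sum_le_gauss_norm)
  also have "\<dots> \<le> sqrt N * (K * gauss_norm N (\<lambda>a. \<Sum>b<N. M a b *\<^sub>C S b x))"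
    by (intro mult_left_mono \<gamma> assms) auto
  also have "\<dots> \<le> sqrt N * (K * (2 * \<kappa> * gauss_norm N (\<lambda>b. S b x)))"
    using assms(2) by (intro mult_left_mono gauss_norm_complex_matrix[OF assms(5) M]) auto
  also have "\<dots> \<le> sqrt N * (K * (2 * \<kappa> * (K * gauss_norm N (\<lambda>_. x))))"
    using assms by (intro mult_left_mono \<gamma>) auto
  also have "\<dots> = 2 * K\<^sup>2 * \<kappa> * (sqrt N * sqrt N) * norm x"
    by (simp add: gauss_norm_const power2_eq_square)
  finally show ?thesis by simp
qed

section \<open>Fourier analysis\<close>

lemma integrable_inverse_square: "integrable lborel (\<lambda>x::real. inverse (1 + x\<^sup>2))"
proof -
  have "einterval (-\<infinity>) \<infinity> = (UNIV :: real set)" by (auto simp: einterval_def)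
  with integrable_inverse_1_plus_square show ?thesis by (simp add: set_integrable_def)
qed

lemma integrable_continuous_compact_support:
  fixes f :: "real \<Rightarrow> complex"
  assumes "continuous_on UNIV f" "\<And>x. \<bar>x\<bar> > R \<Longrightarrow> f x = 0"
  shows "integrable lborel f"
proof -
  have "integrable lborel (\<lambda>x. indicator {-R..R} x *\<^sub>R f x)"
    using assms(1) by (intro borel_integrable_compact) (auto intro: continuous_on_subset)
  also have "(\<lambda>x. indicator {-R..R} x *\<^sub>R f x) = f"
    using assms(2) by (fastforce simp: indicator_def fun_eq_iff abs_if)
  finally show ?thesis .
qed

lemma integrable_kernel:
  fixes g w :: "real \<Rightarrow> complex" and K :: "real \<Rightarrow> real \<Rightarrow> complex"
  assumes g: "integrable lborel g" and w: "integrable lborel w"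
    and K[measurable]: "case_prod K \<in> borel_measurable (borel \<Otimes>\<^sub>M borel)"
    and B: "\<And>s t. cmod (K s t) \<le> B"
  shows "integrable (lborel \<Otimes>\<^sub>M lborel) (\<lambda>(s, t). g s * w t * K s t)"
proof -
  note borel_measurable_integrable[OF g, measurable] borel_measurable_integrable[OF w, measurable]
  have "integrable (lborel \<Otimes>\<^sub>M lborel) (\<lambda>(s, t). B *\<^sub>R (g s * w t))"
  proof (rule lborel_pair.Fubini_integrable)
    show "integrable lborel (\<lambda>x. \<integral>y. norm (case (x, y) of (s, t) \<Rightarrow> B *\<^sub>R (g s * w t)) \<partial>lborel)"
      using g by (simp add: norm_mult)
    show "AE x in lborel. integrable lborel (\<lambda>y. case (x, y) of (s, t) \<Rightarrow> B *\<^sub>R (g s * w t))"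
      using w by simp
  qed measurable
  then show ?thesis
  proof (rule Bochner_Integration.integrable_bound)
    have "0 \<le> B" using B norm_ge_zero order.trans by blast
    have "norm (g u * w v * K u v) \<le> norm (B *\<^sub>R (g u * w v))" for u v
    proof -
      have "norm (g u * w v * K u v) = norm (g u * w v) * norm (K u v)" by (simp add: norm_mult)
      also have "\<dots> \<le> norm (g u * w v) * B" by (intro mult_left_mono B) simp
      finally show ?thesis using \<open>0 \<le> B\<close> by (simp add: mult.commute)
    qed
    then show "AE z in lborel \<Otimes>\<^sub>M lborel. norm (case z of (s, t) \<Rightarrow> g s * w t * K s t) \<le> norm (case z of (s, t) \<Rightarrow> B *\<^sub>R (g s * w t))"
      by (intro AE_I2) (auto split: prod.split)
  qed measurable
qed

text \<open>The exchanges in the Fourier arguments have this shape: two integrable factors coupled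
  by a bounded kernel, mostly an exponential of modulus 1.\<close>

lemma fubini_kernel:
  fixes g w :: "real \<Rightarrow> complex" and K :: "real \<Rightarrow> real \<Rightarrow> complex"
  assumes "integrable lborel g" "integrable lborel w"
    and "case_prod K \<in> borel_measurable (borel \<Otimes>\<^sub>M borel)" "\<And>s t. cmod (K s t) \<le> B"
  shows "(\<integral>s. g s * (\<integral>t. w t * K s t \<partial>lborel) \<partial>lborel) = (\<integral>t. w t * (\<integral>s. g s * K s t \<partial>lborel) \<partial>lborel)"
proof -
  have "(\<integral>s. g s * (\<integral>t. w t * K s t \<partial>lborel) \<partial>lborel) = (\<integral>s. \<integral>t. g s * w t * K s t \<partial>lborel \<partial>lborel)"
    by (simp add: mult.assoc)
  also have "\<dots> = (\<integral>t. \<integral>s. g s * w t * K s t \<partial>lborel \<partial>lborel)"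
    by (rule lborel_pair.Fubini_integral[OF integrable_kernel[OF assms], symmetric])
  also have "\<dots> = (\<integral>t. \<integral>s. w t * (g s * K s t) \<partial>lborel \<partial>lborel)"
    by (simp add: mult_ac)
  finally show ?thesis by simp
qed

lemma borel_measurable_fourier [measurable]:
  assumes [measurable]: "f \<in> borel_measurable borel"
  shows "fourier f \<in> borel_measurable borel"
  unfolding fourier_def by measurable

lemma norm_fourier_le: "cmod (fourier f t) \<le> (\<integral>s. cmod (f s) \<partial>lborel)"
  unfolding fourier_def by (rule order.trans[OF integral_norm_bound]) (simp add: norm_mult)

lemma integrable_times_exp:
  assumes "integrable lborel f"
  shows "integrable lborel (\<lambda>s. f s * exp (\<i> * complex_of_real (s * t)))"
    and "integrable lborel (\<lambda>s. f s * exp (- \<i> * complex_of_real (s * t)))"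
  using assms by (auto intro!: Bochner_Integration.integrable_bound[OF assms] simp: norm_mult)

lemma continuous_on_fourier:
  assumes f: "integrable lborel f"
  shows "continuous_on UNIV (fourier f)"
proof (rule continuous_at_imp_continuous_on, rule ballI, rule continuous_at_sequentiallyI)
  fix t :: real and u :: "nat \<Rightarrow> real" assume u: "u \<longlonglongrightarrow> t"
  show "(\<lambda>n. fourier f (u n)) \<longlonglongrightarrow> fourier f t"
    unfolding fourier_def
  proof (rule integral_dominated_convergence[where w = "\<lambda>s. norm (f s)"])
    show "AE s in lborel. (\<lambda>n. f s * exp (- \<i> * complex_of_real (s * u n))) \<longlonglongrightarrow> f s * exp (- \<i> * complex_of_real (s * t))"
      by (intro AE_I2 tendsto_intros u)
  qed (use f in \<open>auto simp: norm_mult\<close>)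
qed

lemma fourier_gaussian:
  assumes "n > 0"
  shows "(\<integral>t. exp (\<i> * complex_of_real (y * t)) * complex_of_real (exp (- (t / n)\<^sup>2 / 2)) \<partial>lborel) =
    complex_of_real (2 * pi * n * std_normal_density (n * y))"
proof -
  have "(\<integral>t. exp (\<i> * complex_of_real (y * t)) * complex_of_real (exp (- (t / n)\<^sup>2 / 2)) \<partial>lborel) =
    n *\<^sub>R (\<integral>t. exp (\<i> * complex_of_real (y * (n * t))) * complex_of_real (exp (- t\<^sup>2 / 2)) \<partial>lborel)"
    using assms by (subst lborel_integral_real_affine[where c = n and t = 0]) auto
  also have "(\<integral>t. exp (\<i> * complex_of_real (y * (n * t))) * complex_of_real (exp (- t\<^sup>2 / 2)) \<partial>lborel) =
    sqrt (2 * pi) * (\<integral>t. std_normal_density t *\<^sub>R iexp (n * y * t) \<partial>lborel)"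
    by (subst Bochner_Integration.integral_mult_right_zero[symmetric])
      (auto simp: std_normal_density_def scaleR_conv_of_real mult_ac intro!: Bochner_Integration.integral_cong)
  also have "(\<integral>t. std_normal_density t *\<^sub>R iexp (n * y * t) \<partial>lborel) = char std_normal_distribution (n * y)"
    unfolding char_def by (subst integral_density) (auto simp: normal_density_nonneg)
  also have "\<dots> = complex_of_real (exp (- (n * y)\<^sup>2 / 2))"
    by (simp add: char_std_normal_distribution)
  finally have "(\<integral>t. exp (\<i> * complex_of_real (y * t)) * complex_of_real (exp (- (t / n)\<^sup>2 / 2)) \<partial>lborel) =
    complex_of_real (n * (sqrt (2 * pi) * exp (- (n * y)\<^sup>2 / 2)))"
    by (simp add: scaleR_conv_of_real)
  also have "n * (sqrt (2 * pi) * exp (- (n * y)\<^sup>2 / 2)) = 2 * pi * n * std_normal_density (n * y)"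
    by (subst real_div_sqrt[of "2 * pi", symmetric]) (simp_all add: std_normal_density_def)
  finally show ?thesis .
qed

text \<open>A Gaussian factor \<open>w n\<close> makes the double integral absolutely convergent.
  After Fubini its transform is an approximate identity around \<open>x\<close>, and both sides pass
  to the limit by dominated convergence.\<close>

theorem fourier_inversion:
  fixes g :: "real \<Rightarrow> complex"
  assumes g: "integrable lborel g" "continuous_on UNIV g" "\<And>x. cmod (g x) \<le> B"
    and fg: "integrable lborel (fourier g)"
  shows "inv_fourier (fourier g) x = g x"
proof -
  define w where "w n t = exp (- (t / real (Suc n))\<^sup>2 / 2)" for n t
  have w_int: "integrable lborel (\<lambda>t. complex_of_real (w n t))" for n
  proof -
    have "integrable lborel (\<lambda>t. sqrt (2 * pi) * std_normal_density (0 + (1 / real (Suc n)) * t))"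
      by (intro integrable_mult_right lborel_integrable_real_affine) (auto intro: integrable_normal_density)
    then show ?thesis by (simp add: w_def std_normal_density_def)
  qed
  have w01: "0 \<le> w n t" "w n t \<le> 1" for n t by (auto simp: w_def)
  have [measurable]: "g \<in> borel_measurable borel" "fourier g \<in> borel_measurable borel" "\<And>n. w n \<in> borel_measurable borel"
    using borel_measurable_integrable[OF g(1)] borel_measurable_integrable[OF fg] by (auto simp: w_def[abs_def])
  have lim1: "(\<lambda>n. \<integral>t. fourier g t * exp (\<i> * complex_of_real (x * t)) * complex_of_real (w n t) \<partial>lborel) \<longlonglongrightarrow>
    (\<integral>t. fourier g t * exp (\<i> * complex_of_real (x * t)) \<partial>lborel)"
  proof (rule integral_dominated_convergence[where w = "\<lambda>t. cmod (fourier g t)"])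
    have "(\<lambda>n. w n t) \<longlonglongrightarrow> 1" for t
      unfolding w_def by (rule tendsto_eq_intros refl LIMSEQ_Suc[OF lim_const_over_n] | simp)+
    then have "(\<lambda>n. complex_of_real (w n t)) \<longlonglongrightarrow> 1" for t
      using tendsto_of_real by fastforce
    from tendsto_mult[OF tendsto_const this]
    show "AE t in lborel. (\<lambda>n. fourier g t * exp (\<i> * complex_of_real (x * t)) * complex_of_real (w n t)) \<longlonglongrightarrow>
      fourier g t * exp (\<i> * complex_of_real (x * t))" by fastforce
    show "AE t in lborel. cmod (fourier g t * exp (\<i> * complex_of_real (x * t)) * complex_of_real (w n t)) \<le> cmod (fourier g t)" for n
      using w01[of n] by (auto simp: norm_mult mult_left_le)
  qed (use fg in auto)
  have eq: "(\<integral>t. fourier g t * exp (\<i> * complex_of_real (x * t)) * complex_of_real (w n t) \<partial>lborel) =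
    2 * pi * (\<integral>r. std_normal_density r *\<^sub>R g (x - r / Suc n) \<partial>lborel)" for n
  proof -
    have gauss: "(\<integral>t. w n t * exp (\<i> * complex_of_real ((x - s) * t)) \<partial>lborel) =
      complex_of_real (2 * pi * real (Suc n) * std_normal_density (real (Suc n) * (x - s)))" for s
      using fourier_gaussian[of "real (Suc n)" "x - s"] by (simp add: w_def mult.commute)
    have "(\<integral>t. fourier g t * exp (\<i> * complex_of_real (x * t)) * complex_of_real (w n t) \<partial>lborel) =
      (\<integral>t. w n t * (\<integral>s. g s * exp (\<i> * complex_of_real ((x - s) * t)) \<partial>lborel) \<partial>lborel)"
    proof (rule Bochner_Integration.integral_cong[OF refl])
      fix t
      have "fourier g t * exp (\<i> * complex_of_real (x * t)) = (\<integral>s. g s * exp (\<i> * complex_of_real ((x - s) * t)) \<partial>lborel)"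
        unfolding fourier_def
        by (subst Bochner_Integration.integral_mult_left_zero[symmetric])
          (auto intro!: Bochner_Integration.integral_cong simp: exp_add[symmetric] algebra_simps)
      then show "fourier g t * exp (\<i> * complex_of_real (x * t)) * complex_of_real (w n t) =
        w n t * (\<integral>s. g s * exp (\<i> * complex_of_real ((x - s) * t)) \<partial>lborel)" by simp
    qed
    also have "\<dots> = (\<integral>s. g s * (\<integral>t. w n t * exp (\<i> * complex_of_real ((x - s) * t)) \<partial>lborel) \<partial>lborel)"
      by (rule fubini_kernel[OF g(1) w_int, symmetric, where B = 1]) auto
    also have "\<dots> = (\<integral>s. g s * complex_of_real (2 * pi * real (Suc n) * std_normal_density (real (Suc n) * (x - s))) \<partial>lborel)"
      unfolding gauss ..
    also have "(\<integral>s. g s * complex_of_real (2 * pi * real (Suc n) * std_normal_density (real (Suc n) * (x - s))) \<partial>lborel) =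
      (1 / Suc n) *\<^sub>R (\<integral>r. g (x - r / Suc n) * complex_of_real (2 * pi * real (Suc n) * std_normal_density r) \<partial>lborel)"
      by (subst lborel_integral_real_affine[where c = "- 1 / real (Suc n)" and t = x]) auto
    also have "(\<integral>r. g (x - r / Suc n) * complex_of_real (2 * pi * real (Suc n) * std_normal_density r) \<partial>lborel) =
      complex_of_real (2 * pi * real (Suc n)) * (\<integral>r. std_normal_density r *\<^sub>R g (x - r / Suc n) \<partial>lborel)"
      by (subst Bochner_Integration.integral_mult_right_zero[symmetric])
        (intro Bochner_Integration.integral_cong refl, simp only: scaleR_conv_of_real of_real_mult mult_ac)
    also have "(1 / Suc n) *\<^sub>R (complex_of_real (2 * pi * real (Suc n)) * (\<integral>r. std_normal_density r *\<^sub>R g (x - r / Suc n) \<partial>lborel)) =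
      2 * pi * (\<integral>r. std_normal_density r *\<^sub>R g (x - r / Suc n) \<partial>lborel)"
      by (simp add: scaleR_conv_of_real del: of_nat_Suc)
    finally show ?thesis .
  qed
  have lim2: "(\<lambda>n. \<integral>r. std_normal_density r *\<^sub>R g (x - r / Suc n) \<partial>lborel) \<longlonglongrightarrow> (\<integral>r. std_normal_density r *\<^sub>R g x \<partial>lborel)"
  proof (rule integral_dominated_convergence[where w = "\<lambda>r. B * std_normal_density r"])
    have "(\<lambda>n. x - r / Suc n) \<longlonglongrightarrow> x" for r
      using tendsto_diff[OF tendsto_const LIMSEQ_Suc[OF lim_const_over_n]] by simp
    then have "(\<lambda>n. g (x - r / Suc n)) \<longlonglongrightarrow> g x" for r
      using continuous_on_tendsto_compose[OF g(2)] by auto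
    then show "AE r in lborel. (\<lambda>n. std_normal_density r *\<^sub>R g (x - r / Suc n)) \<longlonglongrightarrow> std_normal_density r *\<^sub>R g x"
      by (auto intro!: tendsto_scaleR)
    show "AE r in lborel. norm (std_normal_density r *\<^sub>R g (x - r / Suc n)) \<le> B * std_normal_density r" for n
      using g(3) by (auto simp: mult.commute[of B] normal_density_nonneg intro!: mult_left_mono)
    show "integrable lborel (\<lambda>r. B * std_normal_density r)"
      by (auto intro: integrable_normal_density)
  qed measurable
  have "(\<integral>r. std_normal_density r *\<^sub>R g x \<partial>lborel) = g x"
    using integral_normal_density[of 1 0] integrable_normal_density[of 1 0] by simp
  with tendsto_mult[OF tendsto_const[of "complex_of_real (2 * pi)"] lim2]
  have "(\<integral>t. fourier g t * exp (\<i> * complex_of_real (x * t)) \<partial>lborel) = 2 * pi * g x"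
    using LIMSEQ_unique[OF lim1] unfolding eq by simp
  then show ?thesis by (simp add: inv_fourier_def)
qed

section \<open>Tents and Fejer kernels\<close>

definition tent :: "real \<Rightarrow> real \<Rightarrow> real"
  where "tent L t = max 0 (L - \<bar>t\<bar>)"

text \<open>The Fourier transform of \<open>tent L\<close>, equal to the square of
  \<open>2 sin(L x / 2) / x\<close>; the value at 0 is the limit. Nonnegativity is what the later
  estimates exploit.\<close>

definition fejer :: "real \<Rightarrow> real \<Rightarrow> real"
  where "fejer L x = (if x = 0 then L\<^sup>2 else 2 * (1 - cos (L * x)) / x\<^sup>2)"

lemma tent_nonneg: "0 \<le> tent L t" by (simp add: tent_def)

lemma continuous_on_tent [continuous_intros]:
  "continuous_on S f \<Longrightarrow> continuous_on S (\<lambda>t. tent L (f t))"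
  unfolding tent_def by (intro continuous_intros)

lemma tent_zero: "L \<le> \<bar>t\<bar> \<Longrightarrow> tent L t = 0" by (simp add: tent_def)

lemma tent_le: "0 \<le> L \<Longrightarrow> tent L t \<le> L" by (simp add: tent_def)

lemma integrable_tent: "integrable lborel (\<lambda>t. complex_of_real (tent L t))"
  by (rule integrable_continuous_compact_support[where R = L])
    (auto intro!: continuous_intros simp: tent_def)

lemma fejer_nonneg: "0 \<le> fejer L x"
  by (simp add: fejer_def)

lemma borel_measurable_fejer [measurable]: "fejer L \<in> borel_measurable borel"
  unfolding fejer_def by measurable

lemma integrable_fejer: "integrable lborel (fejer L)"
proof (rule Bochner_Integration.integrable_bound)
  show "integrable lborel (\<lambda>x. (L\<^sup>2 + 4) * inverse (1 + x\<^sup>2))"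
    by (intro integrable_mult_right integrable_inverse_square)
  have "fejer L x \<le> (L\<^sup>2 + 4) * inverse (1 + x\<^sup>2)" for x
  proof (cases "x = 0")
    case False
    have "1 - cos (L * x) \<le> (L * x)\<^sup>2 / 2" 
    proof -
      have "1 - cos (L * x) = 2 * (sin (L * x / 2))\<^sup>2" using cos_double_sin[of "L * x / 2"] by simp
      also have "\<dots> \<le> 2 * (L * x / 2)\<^sup>2" 
        by (intro mult_left_mono abs_le_square_iff[THEN iffD1] abs_sin_x_le_abs_x) simp
      finally show ?thesis by (simp add: power_divide)
    qed
    then have "2 * (1 - cos (L * x)) \<le> L\<^sup>2 * x\<^sup>2" by (simp add: power_mult_distrib)
    moreover have "2 * (1 - cos (L * x)) \<le> 2 * (1 - (- 1))"
      by (intro mult_left_mono diff_mono cos_ge_minus_one order_refl) simp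
    ultimately have "2 * (1 - cos (L * x)) * (1 + x\<^sup>2) \<le> (L\<^sup>2 + 4) * x\<^sup>2"
      using mult_right_mono[of "2 * (1 - cos (L * x))" 4 "x\<^sup>2"] by (simp add: distrib_left distrib_right)
    then show ?thesis using False
      by (simp add: fejer_def field_simps add_pos_nonneg)
  qed (simp add: fejer_def)
  then show "AE x in lborel. norm (fejer L x) \<le> norm ((L\<^sup>2 + 4) * inverse (1 + x\<^sup>2))"
    using fejer_nonneg by (auto simp: add_nonneg_nonneg)
qed measurable

lemma fourier_tent:
  assumes "0 \<le> L" "x \<noteq> 0"
  shows "fourier (\<lambda>t. complex_of_real (tent L t)) x = complex_of_real (fejer L x)"
proof -
  define f where "f t = complex_of_real (tent L t) * exp (- \<i> * complex_of_real (t * x))" for t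
  define a where "a = - \<i> * complex_of_real x"
  have a: "a \<noteq> 0" "a\<^sup>2 = - complex_of_real (x\<^sup>2)" using assms(2) by (auto simp: a_def power_mult_distrib)
  have f: "f t = complex_of_real (tent L t) * exp (a * t)" for t by (simp add: f_def a_def mult_ac)
  have e: "((\<lambda>t. exp (a * complex_of_real t)) has_vector_derivative a * exp (a * complex_of_real t)) (at t within S)" for t S
    by (rule has_vector_derivative_real_field) (auto intro!: derivative_eq_intros)
  have pos: "(f has_integral (exp (a * L) / a\<^sup>2 - (L / a + 1 / a\<^sup>2))) {0..L}"
  proof -
    define P where "P t = complex_of_real (L - t) * exp (a * complex_of_real t) / a + exp (a * complex_of_real t) / a\<^sup>2" for t
    have "((\<lambda>t. complex_of_real (L - t) * exp (a * complex_of_real t)) has_integral (P L - P 0)) {0..L}"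
      using assms(1)
    proof (rule fundamental_theorem_of_calculus)
      fix t assume "t \<in> {0..L}"
      show "(P has_vector_derivative complex_of_real (L - t) * exp (a * complex_of_real t)) (at t within {0..L})"
        unfolding P_def using a(1)
        by (auto intro!: derivative_eq_intros e has_vector_derivative_of_real simp: field_simps power2_eq_square scaleR_conv_of_real)
    qed
    then have "(f has_integral (P L - P 0)) {0..L}"
      by (rule has_integral_eq[rotated]) (auto simp: f tent_def)
    then show ?thesis by (simp add: P_def)
  qed
  have neg: "(f has_integral ((L / a - 1 / a\<^sup>2) + exp (- a * L) / a\<^sup>2)) {-L..0}"
  proof -
    define P where "P t = complex_of_real (L + t) * exp (a * complex_of_real t) / a - exp (a * complex_of_real t) / a\<^sup>2" for t
    have "((\<lambda>t. complex_of_real (L + t) * exp (a * complex_of_real t)) has_integral (P 0 - P (-L))) {-L..0}"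
    proof (rule fundamental_theorem_of_calculus)
      show "- L \<le> 0" using assms(1) by simp
      fix t assume "t \<in> {-L..0}"
      show "(P has_vector_derivative complex_of_real (L + t) * exp (a * complex_of_real t)) (at t within {-L..0})"
        unfolding P_def using a(1)
        by (auto intro!: derivative_eq_intros e has_vector_derivative_of_real simp: field_simps power2_eq_square scaleR_conv_of_real)
    qed
    then have "(f has_integral (P 0 - P (-L))) {-L..0}"
      by (rule has_integral_eq[rotated]) (auto simp: f tent_def)
    then show ?thesis by (simp add: P_def)
  qed
  have "(f has_integral ((L / a - 1 / a\<^sup>2) + exp (- a * L) / a\<^sup>2) + (exp (a * L) / a\<^sup>2 - (L / a + 1 / a\<^sup>2))) {-L..L}"
    using assms by (intro has_integral_combine[OF _ _ neg pos]) auto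
  also have "((L / a - 1 / a\<^sup>2) + exp (- a * L) / a\<^sup>2) + (exp (a * L) / a\<^sup>2 - (L / a + 1 / a\<^sup>2)) = fejer L x"
  proof -
    have "exp (a * L) + exp (- a * L) = 2 * cos (L * x)"
      by (simp add: a_def cos_of_real[symmetric] cos_exp_eq mult_ac)
    moreover have "((L / a - 1 / a\<^sup>2) + exp (- a * L) / a\<^sup>2) + (exp (a * L) / a\<^sup>2 - (L / a + 1 / a\<^sup>2)) =
      ((exp (a * L) + exp (- a * L)) - 2) / a\<^sup>2"
      by (simp add: diff_divide_distrib add_divide_distrib)
    ultimately show ?thesis using assms(2) by (simp add: a(2) fejer_def field_simps)
  qed
  finally have "(f has_integral fejer L x) {-L..L}" .
  then have "(f has_integral fejer L x) UNIV"
    by (rule has_integral_on_superset) (auto simp: f tent_def)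
  moreover have "integrable lborel f"
    unfolding f_def by (rule integrable_times_exp) (rule integrable_tent)
  ultimately show ?thesis
    unfolding fourier_def f_def[symmetric] using integral_lborel integral_unique by metis
qed

text \<open>Fourier inversion for the tent. \<open>fourier_tent\<close> divides by x and so leaves
  out the point 0, which is a null set under the integral.\<close>

lemma fejer_pairing_point:
  assumes "0 \<le> L"
  shows "(\<integral>x. complex_of_real (fejer L x) * exp (\<i> * complex_of_real (t * x)) \<partial>lborel) = complex_of_real (2 * pi * tent L t)"
proof -
  let ?g = "\<lambda>t. complex_of_real (tent L t)"
  note borel_measurable_integrable[OF integrable_tent, simplified, measurable]
  have ae: "AE x in lborel. fourier ?g x = complex_of_real (fejer L x)"
    using AE_lborel_singleton[of 0] by eventually_elim (rule fourier_tent[OF assms])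
  have "integrable lborel (\<lambda>x. complex_of_real (fejer L x))"
    using integrable_fejer by simp
  then have int: "integrable lborel (fourier ?g)"
    by (rule integrable_cong_AE_imp) (use ae in auto)
  have "inv_fourier (fourier ?g) t = ?g t"
    by (rule fourier_inversion[OF integrable_tent _ _ int, where B = L])
      (use assms in \<open>auto intro!: continuous_intros simp: tent_nonneg tent_le\<close>)
  moreover have "(\<integral>x. fourier ?g x * exp (\<i> * complex_of_real (t * x)) \<partial>lborel) =
    (\<integral>x. complex_of_real (fejer L x) * exp (\<i> * complex_of_real (t * x)) \<partial>lborel)"
    by (rule integral_cong_AE) (use ae in auto)
  ultimately show ?thesis by (simp add: inv_fourier_def field_simps)
qed

text \<open>Parseval's identity for \<open>h\<close> and a translated tent. Since the Fejer kernel
  is nonnegative with mass \<open>2 * pi * L\<close>, a uniform bound on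
  \<open>inv_fourier h\<close> bounds the pairing without any L1 norm of \<open>h\<close>.\<close>

lemma tent_pairing:
  assumes "0 \<le> L" and h: "integrable lborel h"
  shows "(\<integral>t. h t * complex_of_real (tent L (t - c)) \<partial>lborel) =
    (\<integral>x. complex_of_real (fejer L x) * exp (- \<i> * complex_of_real (c * x)) * inv_fourier h x \<partial>lborel)"
proof -
  note [measurable] = borel_measurable_integrable[OF h]
  have F: "integrable lborel (\<lambda>x. complex_of_real (fejer L x))" using integrable_fejer by simp
  have "complex_of_real (tent L (t - c)) = (1 / (2 * pi)) * (\<integral>x. complex_of_real (fejer L x) * exp (\<i> * complex_of_real ((t - c) * x)) \<partial>lborel)" for t
    using fejer_pairing_point[OF assms(1), of "t - c"] by simp
  then have "(\<integral>t. h t * complex_of_real (tent L (t - c)) \<partial>lborel) =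
    (1 / (2 * pi)) * (\<integral>t. h t * (\<integral>x. complex_of_real (fejer L x) * exp (\<i> * complex_of_real ((t - c) * x)) \<partial>lborel) \<partial>lborel)"
    by (simp add: mult_ac)
  also have "(\<integral>t. h t * (\<integral>x. complex_of_real (fejer L x) * exp (\<i> * complex_of_real ((t - c) * x)) \<partial>lborel) \<partial>lborel) =
    (\<integral>x. complex_of_real (fejer L x) * (\<integral>t. h t * exp (\<i> * complex_of_real ((t - c) * x)) \<partial>lborel) \<partial>lborel)"
    by (rule fubini_kernel[OF h F, where B = 1]) auto
  also have "(\<lambda>x. \<integral>t. h t * exp (\<i> * complex_of_real ((t - c) * x)) \<partial>lborel) =
    (\<lambda>x. 2 * pi * exp (- \<i> * complex_of_real (c * x)) * inv_fourier h x)"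
  proof
    fix x
    have "(\<integral>t. h t * exp (\<i> * complex_of_real ((t - c) * x)) \<partial>lborel) =
      (\<integral>t. exp (- \<i> * complex_of_real (c * x)) * (h t * exp (\<i> * complex_of_real (x * t))) \<partial>lborel)"
      by (intro Bochner_Integration.integral_cong refl) (simp add: algebra_simps exp_add[symmetric])
    then show "(\<integral>t. h t * exp (\<i> * complex_of_real ((t - c) * x)) \<partial>lborel) =
      2 * pi * exp (- \<i> * complex_of_real (c * x)) * inv_fourier h x"
      by (simp add: inv_fourier_def)
  qed
  also have "(\<integral>x. complex_of_real (fejer L x) * (2 * pi * exp (- \<i> * complex_of_real (c * x)) * inv_fourier h x) \<partial>lborel) =
    2 * pi * (\<integral>x. complex_of_real (fejer L x) * exp (- \<i> * complex_of_real (c * x)) * inv_fourier h x \<partial>lborel)"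
    by (subst Bochner_Integration.integral_mult_right_zero[symmetric])
      (intro Bochner_Integration.integral_cong refl, simp only: mult_ac)
  finally show ?thesis by simp
qed

lemma borel_measurable_inv_fourier [measurable]:
  assumes [measurable]: "f \<in> borel_measurable borel"
  shows "inv_fourier f \<in> borel_measurable borel"
  unfolding inv_fourier_def by measurable

lemma fejer_integral: "0 \<le> L \<Longrightarrow> (\<integral>x. fejer L x \<partial>lborel) = 2 * pi * L"
proof -
  assume "0 \<le> L"
  from fejer_pairing_point[OF this, of 0] have "complex_of_real (\<integral>x. fejer L x \<partial>lborel) = complex_of_real (2 * pi * L)"
    using \<open>0 \<le> L\<close> by (simp add: tent_def)
  then show ?thesis using of_real_eq_iff by blast
qed

lemma tent_pairing_bound:
  assumes "0 \<le> L" and h: "integrable lborel h" and a: "\<And>x. cmod (inv_fourier h x) \<le> a"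
  shows "cmod (\<integral>t. h t * complex_of_real (tent L (t - c)) \<partial>lborel) \<le> 2 * pi * L * a"
proof -
  note [measurable] = borel_measurable_integrable[OF h]
  have a0: "0 \<le> a" using a norm_ge_zero order.trans by blast
  have "cmod (\<integral>t. h t * complex_of_real (tent L (t - c)) \<partial>lborel) \<le> (\<integral>x. fejer L x * a \<partial>lborel)"
    unfolding tent_pairing[OF assms(1,2)]
  proof (rule Bochner_Integration.integral_norm_bound_integral)
    show "cmod (complex_of_real (fejer L x) * exp (- \<i> * complex_of_real (c * x)) * inv_fourier h x) \<le> fejer L x * a" for x
      using a[of x] fejer_nonneg[of L x] by (simp add: norm_mult mult_left_mono)
    then show "integrable lborel (\<lambda>x. complex_of_real (fejer L x) * exp (- \<i> * complex_of_real (c * x)) * inv_fourier h x)"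
      by (intro Bochner_Integration.integrable_bound[OF integrable_mult_left[OF integrable_fejer[of L], of a]] AE_I2)
        (measurable, simp only: real_norm_def abs_of_nonneg[OF mult_nonneg_nonneg[OF fejer_nonneg a0]])
  qed (use integrable_fejer in auto)
  also have "\<dots> = 2 * pi * L * a" using fejer_integral[OF assms(1)] by simp
  finally show ?thesis .
qed

text \<open>The exponentials are orthogonal for the Fejer weight: their inner products are values of
  a tent of half-width 1/N at multiples of 1/N, which vanish off the diagonal.\<close>

lemma trig_sum_square:
  assumes "0 < N"
  shows "(\<integral>x. fejer (1 / N) x * (cmod (\<Sum>j<n. complex_of_real (u j) * exp (- \<i> * complex_of_real (real j / N * x))))\<^sup>2 \<partial>lborel) =
      2 * pi / N * (\<Sum>j<n. (u j)\<^sup>2)"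
    and "integrable lborel (\<lambda>x. fejer (1 / N) x * (cmod (\<Sum>j<n. complex_of_real (u j) * exp (- \<i> * complex_of_real (real j / N * x))))\<^sup>2)"
proof -
  let ?p = "\<lambda>x. \<Sum>j<n. complex_of_real (u j) * exp (- \<i> * complex_of_real (real j / N * x))"
  have sq: "complex_of_real ((cmod (?p x))\<^sup>2) =
    (\<Sum>j<n. \<Sum>k<n. complex_of_real (u j * u k) * exp (\<i> * complex_of_real ((real k - real j) / N * x)))" for x
    unfolding complex_norm_square cnj_sum sum_product
    by (intro sum.cong refl) (simp add: exp_cnj exp_add[symmetric] mult_ac, simp add: algebra_simps diff_divide_distrib)
  have F: "integrable lborel (\<lambda>x. complex_of_real (fejer (1 / N) x))" using integrable_fejer by simp
  have term_int: "integrable lborel (\<lambda>x. complex_of_real (fejer (1 / N) x) * exp (\<i> * complex_of_real (s * x)))" for s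
    using integrable_times_exp(1)[OF F, of s] by (simp add: mult.commute)
  have expand: "complex_of_real (fejer (1 / N) x * (cmod (?p x))\<^sup>2) =
    (\<Sum>j<n. \<Sum>k<n. complex_of_real (u j * u k) * (complex_of_real (fejer (1 / N) x) * exp (\<i> * complex_of_real ((real k - real j) / N * x))))" for x
    unfolding of_real_mult[of "fejer (1 / N) x" "(cmod (?p x))\<^sup>2"] sq sum_distrib_left
    by (simp only: mult.left_commute)
  have int: "integrable lborel (\<lambda>x. complex_of_real (fejer (1 / N) x * (cmod (?p x))\<^sup>2))"
    unfolding expand by (intro Bochner_Integration.integrable_sum integrable_mult_right term_int)
  then show "integrable lborel (\<lambda>x. fejer (1 / N) x * (cmod (?p x))\<^sup>2)"
    using complex_of_real_integrable_eq by blast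
  have "complex_of_real (\<integral>x. fejer (1 / N) x * (cmod (?p x))\<^sup>2 \<partial>lborel) =
    (\<integral>x. (\<Sum>j<n. \<Sum>k<n. complex_of_real (u j * u k) * (complex_of_real (fejer (1 / N) x) * exp (\<i> * complex_of_real ((real k - real j) / N * x)))) \<partial>lborel)"
    unfolding expand[symmetric] by (rule integral_complex_of_real[symmetric])
  also have "\<dots> = (\<Sum>j<n. \<Sum>k<n. complex_of_real (u j * u k) * complex_of_real (2 * pi * tent (1 / N) ((real k - real j) / N)))"
  proof -
    have "(\<integral>x. (\<Sum>j<n. \<Sum>k<n. complex_of_real (u j * u k) * (complex_of_real (fejer (1 / N) x) * exp (\<i> * complex_of_real ((real k - real j) / N * x)))) \<partial>lborel) =
      (\<Sum>j<n. \<Sum>k<n. \<integral>x. complex_of_real (u j * u k) * (complex_of_real (fejer (1 / N) x) * exp (\<i> * complex_of_real ((real k - real j) / N * x))) \<partial>lborel)"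
      by (subst Bochner_Integration.integral_sum, intro Bochner_Integration.integrable_sum integrable_mult_right term_int,
        intro sum.cong refl Bochner_Integration.integral_sum integrable_mult_right term_int)
    also have "\<dots> = (\<Sum>j<n. \<Sum>k<n. complex_of_real (u j * u k) * complex_of_real (2 * pi * tent (1 / N) ((real k - real j) / N)))"
      using assms by (simp only: Bochner_Integration.integral_mult_right_zero fejer_pairing_point[of "1 / N"] zero_le_divide_1_iff less_imp_le)
    finally show ?thesis .
  qed
  also have "\<dots> = (\<Sum>j<n. \<Sum>k<n. if k = j then complex_of_real (2 * pi / N * (u j)\<^sup>2) else 0)"
  proof (intro sum.cong refl)
    fix j k
    show "complex_of_real (u j * u k) * complex_of_real (2 * pi * tent (1 / N) ((real k - real j) / N)) =
      (if k = j then complex_of_real (2 * pi / N * (u j)\<^sup>2) else 0)"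
    proof (cases "k = j")
      case True
      then show ?thesis using assms by (simp add: tent_def power2_eq_square)
    next
      case False
      then have "1 \<le> \<bar>real k - real j\<bar>" by linarith
      then have "tent (1 / N) ((real k - real j) / N) = 0"
        using assms by (intro tent_zero) (simp add: divide_right_mono abs_divide)
      then show ?thesis using False by simp
    qed
  qed
  also have "\<dots> = complex_of_real (2 * pi / N * (\<Sum>j<n. (u j)\<^sup>2))"
    by (simp add: sum_distrib_left)
  finally show "(\<integral>x. fejer (1 / N) x * (cmod (?p x))\<^sup>2 \<partial>lborel) = 2 * pi / N * (\<Sum>j<n. (u j)\<^sup>2)"
    using of_real_eq_iff by blast
qed

text \<open>By Parseval the entry (i, j) is an integral against an exponential with frequency (i + j
  + 1)/N, which splits into a factor for i, one for j and a common one. The form thus becomes the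
  weighted integral of \<open>inv_fourier h\<close> against a product of two trigonometric sums; the
  inequality between geometric and arithmetic mean and \<open>trig_sum_square\<close> finish
  it.\<close>

lemma hankel_bound:
  fixes h :: "real \<Rightarrow> complex" and N :: nat
  assumes "0 < N" and h: "integrable lborel h" and a: "\<And>x. cmod (inv_fourier h x) \<le> a"
  shows "cmod (\<Sum>i<N. \<Sum>j<N. (\<integral>t. h t * complex_of_real (tent (1 / N) (t - real (i + j + 1) / N)) \<partial>lborel) * complex_of_real (u i * v j))
    \<le> (2 * pi / N * a) * ((\<Sum>i<N. (u i)\<^sup>2) + (\<Sum>j<N. (v j)\<^sup>2)) / 2"
proof -
  note [measurable] = borel_measurable_integrable[OF h]
  have N0: "0 \<le> 1 / real N" by simp
  have a0: "0 \<le> a" using a norm_ge_zero order.trans by blast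
  let ?p = "\<lambda>w x. \<Sum>j<N. complex_of_real (w j) * exp (- \<i> * complex_of_real (real j / N * x))"
  let ?G = "\<lambda>x. complex_of_real (fejer (1 / N) x) * exp (- \<i> * complex_of_real (1 / N * x)) * inv_fourier h x"
  let ?E = "\<lambda>i j x. complex_of_real (fejer (1 / N) x) * exp (- \<i> * complex_of_real (real (i + j + 1) / N * x)) * inv_fourier h x"
  have E_int: "integrable lborel (?E i j)" for i j
    by (intro Bochner_Integration.integrable_bound[OF integrable_mult_left[OF integrable_fejer[of "1 / N"], of a]])
      (use a fejer_nonneg in \<open>auto simp: norm_mult abs_of_nonneg[OF mult_nonneg_nonneg[OF fejer_nonneg a0]] intro!: mult_left_mono\<close>)
  have E: "?E i j x * complex_of_real (u i * v j) =
     ?G x * ((complex_of_real (u i) * exp (- \<i> * complex_of_real (real i / N * x))) * (complex_of_real (v j) * exp (- \<i> * complex_of_real (real j / N * x))))" for i j x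
  proof -
    have "- \<i> * complex_of_real (real (i + j + 1) / N * x) =
      - \<i> * complex_of_real (1 / N * x) + (- \<i> * complex_of_real (real i / N * x) + - \<i> * complex_of_real (real j / N * x))"
      by (simp add: add_divide_distrib algebra_simps)
    then show ?thesis by (simp only: exp_add of_real_mult mult_ac)
  qed
  have "(\<Sum>i<N. \<Sum>j<N. (\<integral>t. h t * complex_of_real (tent (1 / N) (t - real (i + j + 1) / N)) \<partial>lborel) * complex_of_real (u i * v j)) =
    (\<Sum>i<N. \<Sum>j<N. \<integral>x. ?E i j x * complex_of_real (u i * v j) \<partial>lborel)"
    unfolding tent_pairing[OF N0 h] by (simp only: Bochner_Integration.integral_mult_left_zero)
  also have "\<dots> = (\<integral>x. (\<Sum>i<N. \<Sum>j<N. ?E i j x * complex_of_real (u i * v j)) \<partial>lborel)"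
    by (subst Bochner_Integration.integral_sum, intro Bochner_Integration.integrable_sum integrable_mult_left E_int,
      intro sum.cong refl Bochner_Integration.integral_sum[symmetric] integrable_mult_left E_int)
  also have "(\<lambda>x. \<Sum>i<N. \<Sum>j<N. ?E i j x * complex_of_real (u i * v j)) = (\<lambda>x. ?G x * (?p u x * ?p v x))"
    unfolding E by (rule ext) (subst sum_product, simp only: sum_distrib_left)
  finally have eq: "(\<Sum>i<N. \<Sum>j<N. (\<integral>t. h t * complex_of_real (tent (1 / N) (t - real (i + j + 1) / N)) \<partial>lborel) * complex_of_real (u i * v j)) =
    (\<integral>x. ?G x * (?p u x * ?p v x) \<partial>lborel)" .
  let ?D = "\<lambda>x. a / 2 * (fejer (1 / N) x * (cmod (?p u x))\<^sup>2 + fejer (1 / N) x * (cmod (?p v x))\<^sup>2)"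
  have le: "cmod (?G x * (?p u x * ?p v x)) \<le> ?D x" for x
  proof -
    have "cmod (?G x * (?p u x * ?p v x)) = fejer (1 / N) x * cmod (inv_fourier h x) * (cmod (?p u x) * cmod (?p v x))"
      using fejer_nonneg[of "1 / N" x] by (simp add: norm_mult)
    also have "\<dots> \<le> fejer (1 / N) x * a * (((cmod (?p u x))\<^sup>2 + (cmod (?p v x))\<^sup>2) / 2)"
      using a[of x] fejer_nonneg[of "1 / N" x] a0 sum_squares_bound[of "cmod (?p u x)" "cmod (?p v x)"]
      by (intro mult_mono mult_left_mono) auto
    finally show ?thesis by (simp add: algebra_simps)
  qed
  have U: "integrable lborel (\<lambda>x. fejer (1 / N) x * (cmod (?p w x))\<^sup>2)"
    "(\<integral>x. fejer (1 / N) x * (cmod (?p w x))\<^sup>2 \<partial>lborel) = 2 * pi / N * (\<Sum>j<N. (w j)\<^sup>2)" for w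
    using trig_sum_square[where N = "real N" and n = N and u = w] assms(1) by simp_all
  have D_int: "integrable lborel ?D"
    by (intro integrable_mult_right Bochner_Integration.integrable_add U(1))
  have "integrable lborel (\<lambda>x. ?G x * (?p u x * ?p v x))"
  proof (rule Bochner_Integration.integrable_bound[OF D_int])
    show "AE x in lborel. cmod (?G x * (?p u x * ?p v x)) \<le> norm (?D x)"
      by (rule AE_I2, rule order.trans[OF le]) simp
  qed measurable
  then have "cmod (\<integral>x. ?G x * (?p u x * ?p v x) \<partial>lborel) \<le> (\<integral>x. ?D x \<partial>lborel)"
    by (rule Bochner_Integration.integral_norm_bound_integral[OF _ D_int le])
  also have "\<dots> = a / 2 * (2 * pi / N * (\<Sum>j<N. (u j)\<^sup>2) + 2 * pi / N * (\<Sum>j<N. (v j)\<^sup>2))"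
    unfolding Bochner_Integration.integral_mult_right_zero Bochner_Integration.integral_add[OF U(1) U(1)] U(2) ..
  also have "\<dots> = (2 * pi / N * a) * ((\<Sum>i<N. (u i)\<^sup>2) + (\<Sum>j<N. (v j)\<^sup>2)) / 2"
    by (simp add: algebra_simps)
  finally show ?thesis unfolding eq .
qed

lemma tent_eq_abs: "0 \<le> L \<Longrightarrow> tent L t = (\<bar>t + L\<bar> - 2 * \<bar>t\<bar> + \<bar>t - L\<bar>) / 2"
  by (auto simp: tent_def max_def abs_if)

text \<open>Writing the tent as a second difference of \<open>\<bar>t\<bar>\<close> makes both identities below telescope.\<close>

lemma tent_sum_grid:
  fixes N :: nat
  assumes "0 < N"
  shows "(\<Sum>i<N. \<Sum>j<N. tent (1 / N) (t - real (i + j + 1) / N)) = tent 1 (t - 1)"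
proof -
  define P where "P m = \<bar>t - real m / N\<bar>" for m
  define d where "d m = P m - P (Suc m)" for m
  have "tent (1 / N) (t - real (i + j + 1) / N) = (d (i + j) - d (i + Suc j)) / 2" for i j
  proof -
    have e: "t - real (i + j + 1) / N + 1 / N = t - real (i + j) / N"
      "t - real (i + j + 1) / N - 1 / N = t - real (Suc (Suc (i + j))) / N"
      by (simp_all add: add_divide_distrib)
    have "tent (1 / N) (t - real (i + j + 1) / N) = (P (i + j) - 2 * P (Suc (i + j)) + P (Suc (Suc (i + j)))) / 2"
      unfolding P_def by (subst tent_eq_abs, simp, subst e(1), subst e(2)) simp
    then show ?thesis by (simp add: d_def)
  qed
  then have "(\<Sum>j<N. tent (1 / N) (t - real (i + j + 1) / N)) = (d i - d (i + N)) / 2" for i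
    by (simp only: sum_divide_distrib[symmetric] sum_lessThan_telescope'[of "\<lambda>j. d (i + j)"] add_0_right)
  then have "(\<Sum>i<N. \<Sum>j<N. tent (1 / N) (t - real (i + j + 1) / N)) = ((\<Sum>i<N. d i) - (\<Sum>i<N. d (i + N))) / 2"
    by (simp only: sum_divide_distrib[symmetric] sum_subtractf)
  also have "(\<Sum>i<N. d i) = \<bar>t\<bar> - \<bar>t - 1\<bar>"
    unfolding d_def using sum_lessThan_telescope'[of P N] assms by (simp add: P_def)
  also have "(\<Sum>i<N. d (i + N)) = \<bar>t - 1\<bar> - \<bar>t - 2\<bar>"
    unfolding d_def using sum_lessThan_telescope'[of "\<lambda>m. P (m + N)" N] assms by (simp add: P_def add_divide_distrib)
  also have "(\<bar>t\<bar> - \<bar>t - 1\<bar> - (\<bar>t - 1\<bar> - \<bar>t - 2\<bar>)) / 2 = tent 1 (t - 1)"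
    by (simp add: tent_eq_abs)
  finally show ?thesis .
qed

lemma tent_partition: "\<bar>t\<bar> \<le> real K \<Longrightarrow> (\<Sum>k=-int K..int K. tent 1 (t - of_int k)) = 1"
  and tent_partition_le: "(\<Sum>k=-int K..int K. tent 1 (t - of_int k)) \<le> 1"
proof -
  have "(\<Sum>k=-int K..int K. tent 1 (t - of_int k)) = (\<bar>t + real K + 1\<bar> - \<bar>t + real K\<bar> - \<bar>t - real K\<bar> + \<bar>t - real K - 1\<bar>) / 2"
  proof (induction K)
    case 0
    show ?case by (simp add: tent_eq_abs)
  next
    case (Suc K)
    have "{-int (Suc K)..int (Suc K)} = insert (- int (Suc K)) (insert (int (Suc K)) {-int K..int K})" by auto
    then have "(\<Sum>k=-int (Suc K)..int (Suc K). tent 1 (t - of_int k)) =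
      tent 1 (t + real (Suc K)) + (tent 1 (t - real (Suc K)) + (\<Sum>k=-int K..int K. tent 1 (t - of_int k)))"
      by (simp add: algebra_simps)
    also have "tent 1 (t + real (Suc K)) = (\<bar>t + real K + 2\<bar> - 2 * \<bar>t + real K + 1\<bar> + \<bar>t + real K\<bar>) / 2"
      by (subst tent_eq_abs) (simp_all add: algebra_simps)
    also have "tent 1 (t - real (Suc K)) = (\<bar>t - real K\<bar> - 2 * \<bar>t - real K - 1\<bar> + \<bar>t - real K - 2\<bar>) / 2"
      by (subst tent_eq_abs) (simp_all add: algebra_simps)
    finally have step: "(\<Sum>k=-int (Suc K)..int (Suc K). tent 1 (t - of_int k)) =
      (\<bar>t + real K + 2\<bar> - 2 * \<bar>t + real K + 1\<bar> + \<bar>t + real K\<bar>) / 2 +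
      ((\<bar>t - real K\<bar> - 2 * \<bar>t - real K - 1\<bar> + \<bar>t - real K - 2\<bar>) / 2 + (\<Sum>k=-int K..int K. tent 1 (t - of_int k)))" .
    have "t + real K + 2 = t + real (Suc K) + 1" "t - real K - 2 = t - real (Suc K) - 1"
      "t + real (Suc K) = t + real K + 1" "t - real (Suc K) = t - real K - 1" by simp_all
    then show ?case unfolding step Suc by (simp only:) argo
  qed
  note eq = this
  show "(\<Sum>k=-int K..int K. tent 1 (t - of_int k)) = 1" if "\<bar>t\<bar> \<le> real K"
  proof -
    have "0 \<le> t + real K" "t - real K \<le> 0" using that by linarith+
    then show ?thesis unfolding eq by (simp add: abs_of_nonneg abs_of_nonpos)
  qed
  show "(\<Sum>k=-int K..int K. tent 1 (t - of_int k)) \<le> 1"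
  proof -
    have "\<bar>t + real K + 1\<bar> \<le> \<bar>t + real K\<bar> + 1" "\<bar>t - real K - 1\<bar> \<le> \<bar>t - real K\<bar> + 1" by linarith+
    then show ?thesis unfolding eq by argo
  qed
qed

section \<open>Smooth cut-offs and the decay of their Fourier transforms\<close>

lemma convolve_inv_fourier:
  assumes f: "integrable lborel f" and \<psi>: "integrable lborel \<psi>"
  shows "convolve f (inv_fourier \<psi>) x = inv_fourier (\<lambda>t. fourier f t * \<psi> t) x"
proof -
  have "convolve f (inv_fourier \<psi>) x =
    (\<integral>y. (1 / (2 * complex_of_real pi)) * (f y * (\<integral>t. \<psi> t * exp (\<i> * complex_of_real ((x - y) * t)) \<partial>lborel)) \<partial>lborel)"
    unfolding convolve_def inv_fourier_def by (simp only: mult_ac)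
  also have "\<dots> = (1 / (2 * complex_of_real pi)) * (\<integral>y. f y * (\<integral>t. \<psi> t * exp (\<i> * complex_of_real ((x - y) * t)) \<partial>lborel) \<partial>lborel)"
    by (rule Bochner_Integration.integral_mult_right_zero)
  also have "(\<integral>y. f y * (\<integral>t. \<psi> t * exp (\<i> * complex_of_real ((x - y) * t)) \<partial>lborel) \<partial>lborel) =
    (\<integral>t. \<psi> t * (\<integral>y. f y * exp (\<i> * complex_of_real ((x - y) * t)) \<partial>lborel) \<partial>lborel)"
    by (rule fubini_kernel[OF f \<psi>, where B = 1]) auto
  also have "(\<lambda>t. \<integral>y. f y * exp (\<i> * complex_of_real ((x - y) * t)) \<partial>lborel) = (\<lambda>t. fourier f t * exp (\<i> * complex_of_real (x * t)))"
    unfolding fourier_def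
    by (rule ext, subst Bochner_Integration.integral_mult_left_zero[symmetric])
      (auto intro!: Bochner_Integration.integral_cong simp: exp_add[symmetric] algebra_simps)
  also have "(1 / (2 * complex_of_real pi)) * (\<integral>t. \<psi> t * (fourier f t * exp (\<i> * complex_of_real (x * t))) \<partial>lborel) =
    inv_fourier (\<lambda>t. fourier f t * \<psi> t) x"
    unfolding inv_fourier_def by (simp only: mult_ac)
  finally show ?thesis .
qed

lemma norm_inv_fourier_le: "cmod (inv_fourier h x) \<le> (\<integral>t. cmod (h t) \<partial>lborel) / (2 * pi)"
proof -
  have "cmod (\<integral>t. h t * exp (\<i> * complex_of_real (x * t)) \<partial>lborel) \<le> (\<integral>t. cmod (h t) \<partial>lborel)"
    by (rule order.trans[OF integral_norm_bound]) (simp add: norm_mult)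
  then show ?thesis by (simp add: inv_fourier_def norm_mult norm_divide divide_right_mono)
qed

lemma smooth_continuous: "smooth g \<Longrightarrow> continuous_on UNIV g"
proof -
  assume "smooth g"
  then obtain d :: "nat \<Rightarrow> real \<Rightarrow> complex" where "d 0 = g" "\<And>n t. (d n has_vector_derivative d (Suc n) t) (at t)"
    by (auto simp: smooth_def)
  then show ?thesis
    by (metis has_vector_derivative_continuous continuous_at_imp_continuous_on)
qed

lemma smooth_shift:
  assumes "smooth g"
  shows "smooth (\<lambda>x. g (x - c))"
proof -
  obtain d where d: "d 0 = g" "\<And>n t. (d n has_vector_derivative d (Suc n) t) (at t)"
    using assms by (auto simp: smooth_def)
  have "((\<lambda>x. d n (x - c)) has_vector_derivative d (Suc n) (t - c)) (at t)" for n t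
  proof -
    have "((\<lambda>x. x - c) has_vector_derivative 1) (at t)" by (auto intro!: derivative_eq_intros)
    from vector_diff_chain_at[OF this d(2)] show ?thesis by (simp add: o_def)
  qed
  with d(1) show ?thesis unfolding smooth_def by (intro exI[of _ "\<lambda>n x. d n (x - c)"]) auto
qed

lemma smooth_sum:
  assumes "\<And>i. i \<in> I \<Longrightarrow> smooth (g i)"
  shows "smooth (\<lambda>x. \<Sum>i\<in>I. g i x)"
proof -
  have "\<forall>i\<in>I. \<exists>d. d 0 = g i \<and> (\<forall>n t. ((d n :: real \<Rightarrow> complex) has_vector_derivative d (Suc n) t) (at t))"
    using assms by (simp add: smooth_def)
  from bchoice[OF this] obtain d :: "_ \<Rightarrow> nat \<Rightarrow> real \<Rightarrow> complex" where d: "\<And>i. i \<in> I \<Longrightarrow> d i 0 = g i"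
    "\<And>i n t. i \<in> I \<Longrightarrow> (d i n has_vector_derivative d i (Suc n) t) (at t)" by blast
  then show ?thesis unfolding smooth_def
    by (intro exI[of _ "\<lambda>n x. \<Sum>i\<in>I. d i n x"]) (auto intro!: has_vector_derivative_sum)
qed

lemma smooth_times_id:
  assumes "smooth g"
  shows "smooth (\<lambda>x. complex_of_real x * g x)"
proof -
  obtain d where d: "d 0 = g" "\<And>n t. (d n has_vector_derivative d (Suc n) t) (at t)"
    using assms by (auto simp: smooth_def)
  \<comment> \<open>Leibniz rule for x times g. At n = 0 the truncated index \<open>n - 1\<close> is
    harmless because its coefficient is 0.\<close>
  define e where "e n x = complex_of_real x * d n x + of_nat n * d (n - 1) x" for n x
  have id: "(complex_of_real has_vector_derivative 1) (at t)" for t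
    using has_vector_derivative_of_real[OF DERIV_ident] by simp
  have "(e n has_vector_derivative e (Suc n) t) (at t)" for n t
  proof -
    have "((\<lambda>x. complex_of_real x * d n x + of_nat n * d (n - 1) x) has_vector_derivative
      (complex_of_real t * d (Suc n) t + 1 * d n t) + of_nat n * d (Suc (n - 1)) t) (at t)"
      by (intro has_vector_derivative_add has_vector_derivative_mult has_vector_derivative_mult_right d id)
    moreover have "(complex_of_real t * d (Suc n) t + 1 * d n t) + of_nat n * d (Suc (n - 1)) t = e (Suc n) t"
      by (cases n) (simp_all add: e_def algebra_simps)
    moreover have "e n = (\<lambda>x. complex_of_real x * d n x + of_nat n * d (n - 1) x)" by (simp add: e_def fun_eq_iff)
    ultimately show ?thesis by (simp only:)
  qed
  moreover have "e 0 = (\<lambda>x. complex_of_real x * g x)" by (simp add: e_def d fun_eq_iff)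
  ultimately show ?thesis unfolding smooth_def by blast
qed

lemma fourier_decay:
  assumes "smooth g" and R: "\<And>x. \<bar>x\<bar> > R \<Longrightarrow> g x = 0"
  obtains C where "C \<ge> 0" "\<And>\<tau>. cmod (fourier g \<tau>) * (1 + \<bar>\<tau>\<bar>) ^ k \<le> C"
proof -
  obtain d where d0: "d 0 = g" and d: "\<And>n t. (d n has_vector_derivative d (Suc n) t) (at t)"
    using assms(1) by (auto simp: smooth_def)
  have supp: "d n x = 0" if "\<bar>x\<bar> > R" for n x
    using that
  proof (induction n arbitrary: x)
    case 0
    then show ?case using R d0 by simp
  next
    case (Suc n)
    have op: "open {x::real. \<bar>x\<bar> > R}" by (intro open_Collect_less continuous_intros)
    have "((\<lambda>_. 0) has_vector_derivative d (Suc n) x) (at x)"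
      by (rule has_vector_derivative_transform_within_open[OF d op]) (use Suc in auto)
    then show ?case using vector_derivative_unique_at has_vector_derivative_const by blast
  qed
  have cont: "continuous_on S (d n)" for n S
    by (meson d has_vector_derivative_continuous continuous_at_imp_continuous_on)
  have int: "integrable lborel (d n)" for n
    by (rule integrable_continuous_compact_support[OF cont supp])
  have step: "fourier (d (Suc n)) \<tau> = \<i> * complex_of_real \<tau> * fourier (d n) \<tau>" for n \<tau>
  proof -
    define a where "a = - \<i> * complex_of_real \<tau>"
    define Q where "Q s = d n s * exp (a * complex_of_real s)" for s
    let ?q = "\<lambda>s. d (Suc n) s * exp (a * complex_of_real s) + a * (d n s * exp (a * complex_of_real s))"
    \<comment> \<open>The support condition speaks of points strictly beyond \<open>R\<close>, and
      \<open>R\<close> may be negative; this endpoint is outside the support in every case.\<close>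
    define r where "r = \<bar>R\<bar> + 1"
    have "((\<lambda>s. exp (a * complex_of_real s)) has_vector_derivative a * exp (a * complex_of_real s)) (at s)" for s
      by (rule has_vector_derivative_real_field) (auto intro!: derivative_eq_intros)
    from has_vector_derivative_mult[OF d this]
    have "(Q has_vector_derivative ?q s) (at s)" for s
      unfolding Q_def by (rule has_vector_derivative_eq_rhs) (simp add: algebra_simps)
    then have "(?q has_integral Q r - Q (- r)) {-r..r}"
      by (intro fundamental_theorem_of_calculus) (auto simp: r_def intro: has_vector_derivative_at_within)
    moreover have "Q r = 0" "Q (- r) = 0" using supp[of r n] supp[of "- r" n] by (auto simp: Q_def r_def)
    ultimately have "(?q has_integral 0) {-r..r}" by simp
    then have "(?q has_integral 0) UNIV"
      by (rule has_integral_on_superset) (auto simp: r_def supp)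
    moreover have e: "exp (a * complex_of_real s) = exp (- \<i> * complex_of_real (s * \<tau>))" for s
      by (simp add: a_def mult_ac)
    have i1: "integrable lborel (\<lambda>s. d n s * exp (a * complex_of_real s))" for n
      unfolding e by (rule integrable_times_exp(2)[OF int])
    then have "integrable lborel ?q" by simp
    ultimately have "(\<integral>s. ?q s \<partial>lborel) = 0"
      using integral_lborel integral_unique by metis
    then have "fourier (d (Suc n)) \<tau> + a * fourier (d n) \<tau> = 0"
      using i1 unfolding fourier_def e[symmetric] by (simp add: Bochner_Integration.integral_add)
    then show ?thesis by (simp add: a_def eq_neg_iff_add_eq_0)
  qed
  have power: "fourier (d n) \<tau> = (\<i> * complex_of_real \<tau>) ^ n * fourier g \<tau>" for n \<tau>
    by (induction n) (simp_all add: d0 step)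
  \<comment> \<open>The power of 2 stems from
    \<open>1 + \<bar>\<tau>\<bar> \<le> 2 * max 1 \<bar>\<tau>\<bar>\<close>; the two integrals
    bound the transforms of g and of its k-th derivative.\<close>
  define C where "C = 2 ^ k * ((\<integral>s. cmod (g s) \<partial>lborel) + (\<integral>s. cmod (d k s) \<partial>lborel))"
  have "cmod (fourier g \<tau>) * (1 + \<bar>\<tau>\<bar>) ^ k \<le> C" for \<tau>
  proof -
    have "(1 + \<bar>\<tau>\<bar>) ^ k \<le> (2 * max 1 \<bar>\<tau>\<bar>) ^ k" by (intro power_mono) auto
    also have "\<dots> = 2 ^ k * (max 1 \<bar>\<tau>\<bar>) ^ k" by (rule power_mult_distrib)
    also have "(max 1 \<bar>\<tau>\<bar>) ^ k \<le> 1 + \<bar>\<tau>\<bar> ^ k" by (auto simp: max_def)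
    finally have "cmod (fourier g \<tau>) * (1 + \<bar>\<tau>\<bar>) ^ k \<le> cmod (fourier g \<tau>) * (2 ^ k * (1 + \<bar>\<tau>\<bar> ^ k))"
      by (intro mult_left_mono) auto
    also have "\<dots> = 2 ^ k * (cmod (fourier g \<tau>) + cmod (fourier (d k) \<tau>))"
      by (simp add: power norm_mult norm_power algebra_simps)
    also have "\<dots> \<le> C" unfolding C_def
      by (intro mult_left_mono add_mono norm_fourier_le) simp
    finally show ?thesis .
  qed
  moreover have "C \<ge> 0" by (simp add: C_def)
  ultimately show thesis using that by blast
qed

text \<open>Taylor's formula of order two with integral remainder. The kernel, the positive part of
  \<sigma> - u, is written as \<open>tent (2 - u) (\<sigma> - 2)\<close>, which agrees with it for
  \<sigma> up to 2: as a function of \<sigma> it is a tent and can be handled by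
  \<open>tent_pairing_bound\<close>.\<close>

lemma exp_taylor:
  assumes "0 \<le> \<sigma>" "\<sigma> \<le> 2"
  shows "exp (\<i> * complex_of_real (x * \<sigma>)) = 1 + \<i> * complex_of_real x * complex_of_real \<sigma> -
    (complex_of_real x)\<^sup>2 * (\<integral>u. complex_of_real (indicator {0..2} u * tent (2 - u) (\<sigma> - 2)) * exp (\<i> * complex_of_real (x * u)) \<partial>lborel)"
proof -
  define a where "a = \<i> * complex_of_real x"
  define Q where "Q u = exp (a * complex_of_real u) * (a * complex_of_real (\<sigma> - u) + 1)" for u
  have e: "exp (a * complex_of_real u) = exp (\<i> * complex_of_real (x * u))" for u by (simp add: a_def mult_ac)
  have d: "(Q has_vector_derivative a\<^sup>2 * (complex_of_real (\<sigma> - u) * exp (a * complex_of_real u))) (at u within S)" for u S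
  proof -
    have 1: "((\<lambda>s. exp (a * complex_of_real s)) has_vector_derivative a * exp (a * complex_of_real u)) (at u within S)"
      by (rule has_vector_derivative_real_field) (auto intro!: derivative_eq_intros)
    have 2: "((\<lambda>s. a * complex_of_real (\<sigma> - s) + 1) has_vector_derivative - a) (at u within S)"
      by (auto intro!: derivative_eq_intros has_vector_derivative_of_real simp: scaleR_conv_of_real)
    show ?thesis unfolding Q_def
      by (rule has_vector_derivative_eq_rhs[OF has_vector_derivative_mult[OF 1 2]])
        (simp add: algebra_simps power2_eq_square)
  qed
  let ?w = "\<lambda>u. complex_of_real (indicator {0..2} u * tent (2 - u) (\<sigma> - 2)) * exp (\<i> * complex_of_real (x * u))"
  have "((\<lambda>u. a\<^sup>2 * (complex_of_real (\<sigma> - u) * exp (a * complex_of_real u))) has_integral Q \<sigma> - Q 0) {0..\<sigma>}"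
    by (rule fundamental_theorem_of_calculus[OF assms(1) d])
  then have "((\<lambda>u. a\<^sup>2 * ?w u) has_integral Q \<sigma> - Q 0) {0..\<sigma>}"
    by (rule has_integral_eq[rotated]) (use assms in \<open>auto simp: e tent_def\<close>)
  then have H: "((\<lambda>u. a\<^sup>2 * ?w u) has_integral Q \<sigma> - Q 0) UNIV"
    by (rule has_integral_on_superset) (use assms in \<open>auto simp: tent_def indicator_def\<close>)
  have "integrable lborel ?w"
  proof -
    have "integrable lborel (\<lambda>u. indicator {0..2} u *\<^sub>R complex_of_real (tent (2 - u) (\<sigma> - 2)))"
      by (rule borel_integrable_compact) (auto simp: tent_def intro!: continuous_intros)
    from integrable_times_exp(1)[OF this, of x]
    show ?thesis by (simp add: scaleR_conv_of_real mult_ac)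
  qed
  then have I: "integrable lborel (\<lambda>u. a\<^sup>2 * ?w u)" by (rule integrable_mult_right)
  have "(\<integral>u. a\<^sup>2 * ?w u \<partial>lborel) = Q \<sigma> - Q 0"
    by (rule trans[OF integral_lborel[OF I, symmetric] integral_unique[OF H]])
  then have "(\<integral>u. a\<^sup>2 * ?w u \<partial>lborel) = exp (a * complex_of_real \<sigma>) - (a * complex_of_real \<sigma> + 1)"
    by (simp only: Q_def) simp
  moreover have "(\<integral>u. a\<^sup>2 * ?w u \<partial>lborel) = a\<^sup>2 * (\<integral>u. ?w u \<partial>lborel)"
    by (rule Bochner_Integration.integral_mult_right_zero)
  moreover define I where "I = (\<integral>u. ?w u \<partial>lborel)"
  moreover have "a\<^sup>2 = - (complex_of_real x)\<^sup>2" by (simp add: a_def power_mult_distrib)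
  ultimately have "exp (a * complex_of_real \<sigma>) = 1 + a * complex_of_real \<sigma> - (complex_of_real x)\<^sup>2 * I"
    by (simp add: algebra_simps)
  then show ?thesis unfolding e I_def by (simp only: a_def)
qed

lemma fourier_taylor:
  fixes \<eta> :: "real \<Rightarrow> complex"
  assumes "0 \<le> \<sigma>" "\<sigma> \<le> 2"
    and int: "integrable lborel \<eta>" "integrable lborel (\<lambda>x. complex_of_real x * \<eta> x)"
      "integrable lborel (\<lambda>x. complex_of_real x * (complex_of_real x * \<eta> x))"
  shows "fourier \<eta> (s - \<sigma>) = fourier \<eta> s + \<i> * complex_of_real \<sigma> * fourier (\<lambda>x. complex_of_real x * \<eta> x) s -
    (\<integral>u. complex_of_real (indicator {0..2} u * tent (2 - u) (\<sigma> - 2)) *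
      fourier (\<lambda>x. complex_of_real x * (complex_of_real x * \<eta> x)) (s - u) \<partial>lborel)"
proof -
  let ?w = "\<lambda>u. complex_of_real (indicator {0..2} u * tent (2 - u) (\<sigma> - 2))"
  let ?X2 = "\<lambda>x. complex_of_real x * (complex_of_real x * \<eta> x)"
  have w: "integrable lborel ?w"
  proof -
    have "integrable lborel (\<lambda>u. indicator {0..2} u *\<^sub>R complex_of_real (tent (2 - u) (\<sigma> - 2)))"
      by (rule borel_integrable_compact) (auto simp: tent_def intro!: continuous_intros)
    then show ?thesis by (simp add: scaleR_conv_of_real)
  qed
  let ?I = "\<lambda>x. \<integral>u. ?w u * exp (\<i> * complex_of_real (x * u)) \<partial>lborel"
  let ?e = "\<lambda>x. exp (- \<i> * complex_of_real (x * s))"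
  have pt: "\<eta> x * exp (- \<i> * complex_of_real (x * (s - \<sigma>))) =
    \<eta> x * ?e x + \<i> * complex_of_real \<sigma> * ((complex_of_real x * \<eta> x) * ?e x) - (?X2 x * ?e x) * ?I x" for x
  proof -
    have "exp (- \<i> * complex_of_real (x * (s - \<sigma>))) = ?e x * exp (\<i> * complex_of_real (x * \<sigma>))"
      by (simp add: exp_add[symmetric] algebra_simps)
    moreover define E I where "E = ?e x" and "I = ?I x"
    ultimately have A: "exp (- \<i> * complex_of_real (x * (s - \<sigma>))) = E * (1 + \<i> * complex_of_real x * complex_of_real \<sigma> - (complex_of_real x)\<^sup>2 * I)"
      unfolding exp_taylor[OF assms(1,2)] by simp
    show ?thesis unfolding A unfolding E_def[symmetric] I_def[symmetric] by (simp add: algebra_simps power2_eq_square)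
  qed
  have Iint: "integrable lborel (\<lambda>x. (?X2 x * ?e x) * ?I x)"
  proof -
    have "integrable (lborel \<Otimes>\<^sub>M lborel) (\<lambda>(x, u). (?X2 x * ?e x) * ?w u * exp (\<i> * complex_of_real (x * u)))"
      by (rule integrable_kernel[OF integrable_times_exp(2)[OF int(3)] w, where B = 1]) auto
    from lborel_pair.integrable_fst'[OF this] show ?thesis by (simp add: mult.assoc)
  qed
  have "fourier \<eta> (s - \<sigma>) = fourier \<eta> s + \<i> * complex_of_real \<sigma> * fourier (\<lambda>x. complex_of_real x * \<eta> x) s - (\<integral>x. (?X2 x * ?e x) * ?I x \<partial>lborel)"
  proof -
    note i1 = integrable_times_exp(2)[OF int(1), of s]
    note i2 = integrable_mult_right[OF integrable_times_exp(2)[OF int(2), of s], of "\<i> * complex_of_real \<sigma>"]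
    have "fourier \<eta> (s - \<sigma>) = (\<integral>x. (\<eta> x * ?e x + \<i> * complex_of_real \<sigma> * ((complex_of_real x * \<eta> x) * ?e x)) - (?X2 x * ?e x) * ?I x \<partial>lborel)"
      unfolding fourier_def by (intro Bochner_Integration.integral_cong refl pt)
    also have "\<dots> = (\<integral>x. \<eta> x * ?e x + \<i> * complex_of_real \<sigma> * ((complex_of_real x * \<eta> x) * ?e x) \<partial>lborel) - (\<integral>x. (?X2 x * ?e x) * ?I x \<partial>lborel)"
      by (rule Bochner_Integration.integral_diff[OF Bochner_Integration.integrable_add[OF i1 i2] Iint])
    also have "(\<integral>x. \<eta> x * ?e x + \<i> * complex_of_real \<sigma> * ((complex_of_real x * \<eta> x) * ?e x) \<partial>lborel) =
      (\<integral>x. \<eta> x * ?e x \<partial>lborel) + (\<integral>x. \<i> * complex_of_real \<sigma> * ((complex_of_real x * \<eta> x) * ?e x) \<partial>lborel)"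
      by (rule Bochner_Integration.integral_add[OF i1 i2])
    also have "(\<integral>x. \<i> * complex_of_real \<sigma> * ((complex_of_real x * \<eta> x) * ?e x) \<partial>lborel) = \<i> * complex_of_real \<sigma> * (\<integral>x. (complex_of_real x * \<eta> x) * ?e x \<partial>lborel)"
      by (rule Bochner_Integration.integral_mult_right_zero)
    finally show ?thesis unfolding fourier_def .
  qed
  also have "(\<integral>x. (?X2 x * ?e x) * ?I x \<partial>lborel) = (\<integral>u. ?w u * (\<integral>x. (?X2 x * ?e x) * exp (\<i> * complex_of_real (x * u)) \<partial>lborel) \<partial>lborel)"
    by (rule fubini_kernel[OF integrable_times_exp(2)[OF int(3)] w, where B = 1]) auto
  also have "(\<lambda>u. \<integral>x. (?X2 x * ?e x) * exp (\<i> * complex_of_real (x * u)) \<partial>lborel) = (\<lambda>u. fourier ?X2 (s - u))"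
    unfolding fourier_def by (intro ext Bochner_Integration.integral_cong refl) (simp add: mult.assoc exp_add[symmetric] algebra_simps)
  finally show ?thesis .
qed

text \<open>The bound may see \<open>h\<close> only through the supremum of its inverse transform,
  while \<open>fourier \<eta> (t - \<tau>)\<close> is not a tent in \<tau>. On the support
  [n - 1, n + 1] it is expanded in \<sigma> = \<tau> - n + 1, and every term is made of tents: the
  constant 1 is \<open>tent 2 - tent 1\<close> centred at n, \<sigma> is \<open>tent 2\<close>
  centred at n + 1, and the remainder is a superposition of tents of half-width 2 - u. Rapid decay
  comes from the Taylor coefficients, which are Fourier transforms of smooth functions.\<close>

lemma fourier_pairing_decay:
  fixes \<eta> :: "real \<Rightarrow> complex"
  assumes "smooth \<eta>" and supp: "\<And>x. \<bar>x\<bar> > R \<Longrightarrow> \<eta> x = 0"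
  obtains C where "C \<ge> 0"
    "\<And>h a n t. \<lbrakk>integrable lborel h; \<And>\<tau>. \<bar>\<tau> - n\<bar> > 1 \<Longrightarrow> h \<tau> = 0; \<And>x. cmod (inv_fourier h x) \<le> a\<rbrakk>
      \<Longrightarrow> cmod (\<integral>\<tau>. h \<tau> * fourier \<eta> (t - \<tau>) \<partial>lborel) * (1 + \<bar>t - n\<bar>) ^ k \<le> C * a"
proof -
  let ?X1 = "\<lambda>x. complex_of_real x * \<eta> x" and ?X2 = "\<lambda>x. complex_of_real x * (complex_of_real x * \<eta> x)"
  have sm: "smooth ?X1" "smooth ?X2" by (intro smooth_times_id assms)+
  have supp': "?X1 x = 0" "?X2 x = 0" if "\<bar>x\<bar> > R" for x using supp[OF that] by simp_all
  have int: "integrable lborel \<eta>" "integrable lborel ?X1" "integrable lborel ?X2"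
    using integrable_continuous_compact_support[where R = R, OF smooth_continuous[OF assms(1)] supp]
      integrable_continuous_compact_support[where R = R, OF smooth_continuous[OF sm(1)] supp'(1)]
      integrable_continuous_compact_support[where R = R, OF smooth_continuous[OF sm(2)] supp'(2)] by blast+
  obtain C0 where C0: "C0 \<ge> 0" "\<And>\<tau>. cmod (fourier \<eta> \<tau>) * (1 + \<bar>\<tau>\<bar>) ^ k \<le> C0"
    using fourier_decay[OF assms(1) supp] by blast
  obtain C1 where C1: "C1 \<ge> 0" "\<And>\<tau>. cmod (fourier ?X1 \<tau>) * (1 + \<bar>\<tau>\<bar>) ^ k \<le> C1"
    using fourier_decay[OF sm(1) supp'(1)] by blast
  obtain C2 where C2: "C2 \<ge> 0" "\<And>\<tau>. cmod (fourier ?X2 \<tau>) * (1 + \<bar>\<tau>\<bar>) ^ k \<le> C2"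
    using fourier_decay[OF sm(2) supp'(2)] by blast
  \<comment> \<open>By \<open>tent_pairing_bound\<close> the pairings cost
    \<open>2 * pi * (2 + 1)\<close>, \<open>2 * pi * 2\<close> and at most
    \<open>2 * pi * 2\<close>; the last factor 2 is the length of the interval of u. The power of 2
    comes from \<open>near\<close>.\<close>
  define C where "C = 2 ^ k * (C0 * (6 * pi) + C1 * (4 * pi) + C2 * (4 * pi) * 2)"
  have "cmod (\<integral>\<tau>. h \<tau> * fourier \<eta> (t - \<tau>) \<partial>lborel) * (1 + \<bar>t - n\<bar>) ^ k \<le> C * a"
    if h: "integrable lborel h" and hs: "\<And>\<tau>. \<bar>\<tau> - n\<bar> > 1 \<Longrightarrow> h \<tau> = 0" and a: "\<And>x. cmod (inv_fourier h x) \<le> a" for h a n t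
  proof -
    have a0: "0 \<le> a" using a norm_ge_zero order.trans by blast
    note borel_measurable_integrable[OF h, measurable]
    \<comment> \<open>The expansion point belongs to the left end of the support. All points s - u
      with u in [0, 2] then lie within distance 1 of t - n, as \<open>dec\<close> demands.\<close>
    define s where "s = t - n + 1"
    let ?w = "\<lambda>\<tau> u. complex_of_real (indicator {0..2} u * tent (2 - u) (\<tau> - (n + 1)))"
    let ?J = "\<lambda>\<tau>. \<integral>u. ?w \<tau> u * fourier ?X2 (s - u) \<partial>lborel"
    let ?A0 = "\<integral>\<tau>. h \<tau> * complex_of_real (tent 2 (\<tau> - n)) \<partial>lborel - \<integral>\<tau>. h \<tau> * complex_of_real (tent 1 (\<tau> - n)) \<partial>lborel"
    let ?A1 = "\<integral>\<tau>. h \<tau> * complex_of_real (tent 2 (\<tau> - (n + 1))) \<partial>lborel"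
    let ?B = "\<lambda>u. \<integral>\<tau>. h \<tau> * ?w \<tau> u \<partial>lborel"
    have ht: "integrable lborel (\<lambda>\<tau>. h \<tau> * complex_of_real (tent L (\<tau> - c)))" if "0 \<le> L" for L c
      using that tent_nonneg tent_le[OF that]
      by (intro Bochner_Integration.integrable_bound[OF integrable_mult_right[OF h, of "complex_of_real L"]])
        (auto simp: norm_mult mult.commute[of L] tent_def intro!: mult_left_mono)
    have X2w: "integrable lborel (\<lambda>u. complex_of_real (indicator {0..2} u) * fourier ?X2 (s - u))"
    proof -
      have "continuous_on {0..2} (\<lambda>u. fourier ?X2 (s - u))"
        by (rule continuous_on_compose2[OF continuous_on_fourier[OF int(3)]]) (auto intro!: continuous_intros)
      from borel_integrable_compact[OF _ this] show ?thesis by (simp add: scaleR_conv_of_real)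
    qed
    \<comment> \<open>The cut-off in u appears in the integrable factor and again in the kernel,
      where it provides the bound 2 required for Fubini.\<close>
    let ?K = "\<lambda>\<tau> u. complex_of_real (if u \<in> {0..2} then tent (2 - u) (\<tau> - (n + 1)) else 0)"
    have Kb: "cmod (?K \<tau> u) \<le> 2" for \<tau> u by (auto simp: tent_def)
    have Km: "case_prod ?K \<in> borel_measurable (borel \<Otimes>\<^sub>M borel)" unfolding tent_def by measurable
    have wK: "?w \<tau> u * fourier ?X2 (s - u) = complex_of_real (indicator {0..2} u) * fourier ?X2 (s - u) * ?K \<tau> u" for \<tau> u
      by (simp add: indicator_def)
    have Jint: "integrable lborel (\<lambda>\<tau>. h \<tau> * ?J \<tau>)"
      using lborel_pair.integrable_fst'[OF integrable_kernel[OF h X2w Km Kb]] unfolding wK by (simp add: mult.assoc)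
    have pt: "h \<tau> * fourier \<eta> (t - \<tau>) = fourier \<eta> s * (h \<tau> * complex_of_real (tent 2 (\<tau> - n)) - h \<tau> * complex_of_real (tent 1 (\<tau> - n))) +
      \<i> * fourier ?X1 s * (h \<tau> * complex_of_real (tent 2 (\<tau> - (n + 1)))) - h \<tau> * ?J \<tau>" for \<tau>
    proof (cases "\<bar>\<tau> - n\<bar> > 1")
      case False
      define \<sigma> where "\<sigma> = \<tau> - n + 1"
      have \<sigma>: "0 \<le> \<sigma>" "\<sigma> \<le> 2" using False by (auto simp: \<sigma>_def)
      have e: "t - \<tau> = s - \<sigma>" "\<tau> - (n + 1) = \<sigma> - 2" by (simp_all add: s_def \<sigma>_def)
      define J where "J = ?J \<tau>"
      have T: "fourier \<eta> (t - \<tau>) = fourier \<eta> s + \<i> * complex_of_real \<sigma> * fourier ?X1 s - J"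
        unfolding J_def e by (rule fourier_taylor[OF \<sigma> int])
      have "tent 2 (\<tau> - n) - tent 1 (\<tau> - n) = 1" and b: "tent 2 (\<tau> - (n + 1)) = \<sigma>"
        using False by (auto simp: tent_def \<sigma>_def)
      then have a: "complex_of_real (tent 2 (\<tau> - n)) - complex_of_real (tent 1 (\<tau> - n)) = 1"
        unfolding of_real_diff[symmetric] by simp
      have c: "h \<tau> * complex_of_real (tent 2 (\<tau> - n)) - h \<tau> * complex_of_real (tent 1 (\<tau> - n)) = h \<tau>"
        by (simp only: right_diff_distrib[symmetric] a mult_1_right)
      show ?thesis unfolding J_def[symmetric] T c b by (simp add: algebra_simps)
    qed (simp add: hs)
    have "(\<integral>\<tau>. h \<tau> * fourier \<eta> (t - \<tau>) \<partial>lborel) = fourier \<eta> s * ?A0 + \<i> * fourier ?X1 s * ?A1 - (\<integral>\<tau>. h \<tau> * ?J \<tau> \<partial>lborel)"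
    proof -
      let ?f0 = "\<lambda>\<tau>. fourier \<eta> s * (h \<tau> * complex_of_real (tent 2 (\<tau> - n)) - h \<tau> * complex_of_real (tent 1 (\<tau> - n)))"
      let ?f1 = "\<lambda>\<tau>. \<i> * fourier ?X1 s * (h \<tau> * complex_of_real (tent 2 (\<tau> - (n + 1))))"
      have i2: "integrable lborel (\<lambda>\<tau>. h \<tau> * complex_of_real (tent 2 (\<tau> - n)))" by (rule ht) simp
      have i1: "integrable lborel (\<lambda>\<tau>. h \<tau> * complex_of_real (tent 1 (\<tau> - n)))" by (rule ht) simp
      have f0: "integrable lborel ?f0" by (intro integrable_mult_right Bochner_Integration.integrable_diff i1 i2)
      have f1: "integrable lborel ?f1" by (intro integrable_mult_right ht) simp
      have "(\<integral>\<tau>. h \<tau> * fourier \<eta> (t - \<tau>) \<partial>lborel) = (\<integral>\<tau>. (?f0 \<tau> + ?f1 \<tau>) - h \<tau> * ?J \<tau> \<partial>lborel)"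
        by (intro Bochner_Integration.integral_cong refl pt)
      also have "\<dots> = (\<integral>\<tau>. ?f0 \<tau> + ?f1 \<tau> \<partial>lborel) - (\<integral>\<tau>. h \<tau> * ?J \<tau> \<partial>lborel)"
        by (rule Bochner_Integration.integral_diff[OF Bochner_Integration.integrable_add[OF f0 f1] Jint])
      also have "(\<integral>\<tau>. ?f0 \<tau> + ?f1 \<tau> \<partial>lborel) = (\<integral>\<tau>. ?f0 \<tau> \<partial>lborel) + (\<integral>\<tau>. ?f1 \<tau> \<partial>lborel)"
        by (rule Bochner_Integration.integral_add[OF f0 f1])
      also have "(\<integral>\<tau>. ?f0 \<tau> \<partial>lborel) = fourier \<eta> s * ?A0"
        by (subst Bochner_Integration.integral_mult_right_zero) (simp only: Bochner_Integration.integral_diff[OF i2 i1])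
      also have "(\<integral>\<tau>. ?f1 \<tau> \<partial>lborel) = \<i> * fourier ?X1 s * ?A1"
        by (rule Bochner_Integration.integral_mult_right_zero)
      finally show ?thesis .
    qed
    also have "(\<integral>\<tau>. h \<tau> * ?J \<tau> \<partial>lborel) = (\<integral>u. (complex_of_real (indicator {0..2} u) * fourier ?X2 (s - u)) * (\<integral>\<tau>. h \<tau> * ?K \<tau> u \<partial>lborel) \<partial>lborel)"
      unfolding wK by (rule fubini_kernel[OF h X2w Km Kb])
    finally have eq: "(\<integral>\<tau>. h \<tau> * fourier \<eta> (t - \<tau>) \<partial>lborel) = fourier \<eta> s * ?A0 + \<i> * fourier ?X1 s * ?A1 -
      (\<integral>u. (complex_of_real (indicator {0..2} u) * fourier ?X2 (s - u)) * (\<integral>\<tau>. h \<tau> * ?K \<tau> u \<partial>lborel) \<partial>lborel)" .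
    define P where "P = (1 + \<bar>t - n\<bar>) ^ k"
    have P0: "0 \<le> P" by (simp add: P_def)
    have near: "P \<le> 2 ^ k * (1 + \<bar>\<tau>\<bar>) ^ k" if "\<bar>\<tau> - (t - n)\<bar> \<le> 1" for \<tau>
    proof -
      have "\<bar>t - n\<bar> \<le> \<bar>\<tau>\<bar> + \<bar>\<tau> - (t - n)\<bar>" using abs_triangle_ineq4[of \<tau> "\<tau> - (t - n)"] by simp
      then have "1 + \<bar>t - n\<bar> \<le> 2 * (1 + \<bar>\<tau>\<bar>)" using that by argo
      then have "P \<le> (2 * (1 + \<bar>\<tau>\<bar>)) ^ k" unfolding P_def by (intro power_mono) auto
      then show ?thesis unfolding power_mult_distrib .
    qed
    have dec: "cmod (fourier g \<tau>) * P \<le> 2 ^ k * c" if "\<bar>\<tau> - (t - n)\<bar> \<le> 1" "cmod (fourier g \<tau>) * (1 + \<bar>\<tau>\<bar>) ^ k \<le> c" for g \<tau> c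
    proof -
      have "cmod (fourier g \<tau>) * P \<le> cmod (fourier g \<tau>) * (2 ^ k * (1 + \<bar>\<tau>\<bar>) ^ k)"
        by (intro mult_left_mono near that) simp
      also have "\<dots> = 2 ^ k * (cmod (fourier g \<tau>) * (1 + \<bar>\<tau>\<bar>) ^ k)" by simp
      also have "\<dots> \<le> 2 ^ k * c" by (intro mult_left_mono that) simp
      finally show ?thesis .
    qed
    have ss: "\<bar>s - (t - n)\<bar> \<le> 1" by (simp add: s_def)
    have A0: "cmod ?A0 \<le> 6 * pi * a"
      using norm_triangle_ineq4[of "\<integral>\<tau>. h \<tau> * complex_of_real (tent 2 (\<tau> - n)) \<partial>lborel" "\<integral>\<tau>. h \<tau> * complex_of_real (tent 1 (\<tau> - n)) \<partial>lborel"]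
        tent_pairing_bound[OF _ h a, of 2 n] tent_pairing_bound[OF _ h a, of 1 n] by simp
    have A1: "cmod ?A1 \<le> 4 * pi * a"
      using tent_pairing_bound[OF _ h a, of 2 "n + 1"] by simp
    have B: "cmod (\<integral>\<tau>. h \<tau> * ?K \<tau> u \<partial>lborel) \<le> 4 * pi * a" for u
    proof (cases "u \<in> {0..2}")
      case True
      then have "cmod (\<integral>\<tau>. h \<tau> * ?K \<tau> u \<partial>lborel) \<le> 2 * pi * (2 - u) * a"
        using tent_pairing_bound[OF _ h a, of "2 - u" "n + 1"] by simp
      also have "\<dots> \<le> 2 * pi * 2 * a" using True a0 by (intro mult_right_mono mult_left_mono) auto
      finally show ?thesis by simp
    next
      case False
      then have z: "(\<lambda>\<tau>. h \<tau> * ?K \<tau> u) = (\<lambda>_. 0)" by auto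
      show ?thesis unfolding z using a0 by simp
    qed
    have T0: "cmod (fourier \<eta> s * ?A0) * P \<le> 2 ^ k * (C0 * (6 * pi)) * a"
    proof -
      have "cmod (fourier \<eta> s * ?A0) * P = (cmod (fourier \<eta> s) * P) * cmod ?A0" by (simp add: norm_mult)
      also have "\<dots> \<le> (2 ^ k * C0) * (6 * pi * a)" using C0 ss A0 P0 by (intro mult_mono dec) auto
      finally show ?thesis by (simp add: mult_ac)
    qed
    have T1: "cmod (\<i> * fourier ?X1 s * ?A1) * P \<le> 2 ^ k * (C1 * (4 * pi)) * a"
    proof -
      have "cmod (\<i> * fourier ?X1 s * ?A1) * P = (cmod (fourier ?X1 s) * P) * cmod ?A1" by (simp add: norm_mult)
      also have "\<dots> \<le> (2 ^ k * C1) * (4 * pi * a)" using C1 ss A1 P0 by (intro mult_mono dec) auto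
      finally show ?thesis by (simp add: mult_ac)
    qed
    have T2: "cmod (\<integral>u. (complex_of_real (indicator {0..2} u) * fourier ?X2 (s - u)) * (\<integral>\<tau>. h \<tau> * ?K \<tau> u \<partial>lborel) \<partial>lborel) * P \<le>
      2 ^ k * (C2 * (4 * pi) * 2) * a"
    proof -
      let ?f = "\<lambda>u. (complex_of_real (indicator {0..2} u) * fourier ?X2 (s - u)) * (\<integral>\<tau>. h \<tau> * ?K \<tau> u \<partial>lborel)"
      have "cmod (\<integral>u. ?f u \<partial>lborel) * P \<le> (\<integral>u. cmod (?f u) * P \<partial>lborel)"
        using integral_norm_bound[of lborel ?f] P0 by (simp add: mult_right_mono)
      also have "\<dots> \<le> (\<integral>u. indicator {0..2::real} u * (2 ^ k * C2 * (4 * pi * a)) \<partial>lborel)"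
      proof (rule integral_mono')
        show "integrable lborel (\<lambda>u. indicator {0..2::real} u * (2 ^ k * C2 * (4 * pi * a)))"
          by (rule integrable_mult_left) simp
        fix u
        show "cmod (?f u) * P \<le> indicator {0..2} u * (2 ^ k * C2 * (4 * pi * a))"
        proof (cases "u \<in> {0..2}")
          case True
          then have "cmod (?f u) * P = (cmod (fourier ?X2 (s - u)) * P) * cmod (\<integral>\<tau>. h \<tau> * ?K \<tau> u \<partial>lborel)"
            by (simp add: norm_mult)
          also have "\<dots> \<le> (2 ^ k * C2) * (4 * pi * a)"
            using True C2 P0 by (intro mult_mono dec B) (auto simp: s_def)
          finally show ?thesis using True by simp
        qed simp
      qed (use a0 C2 P0 in auto)
      also have "\<dots> = 2 ^ k * (C2 * (4 * pi) * 2) * a" by simp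
      finally show ?thesis .
    qed
    have "cmod (\<integral>\<tau>. h \<tau> * fourier \<eta> (t - \<tau>) \<partial>lborel) * P \<le> cmod (fourier \<eta> s * ?A0) * P + cmod (\<i> * fourier ?X1 s * ?A1) * P +
      cmod (\<integral>u. (complex_of_real (indicator {0..2} u) * fourier ?X2 (s - u)) * (\<integral>\<tau>. h \<tau> * ?K \<tau> u \<partial>lborel) \<partial>lborel) * P"
      unfolding eq distrib_right[symmetric]
      by (intro mult_right_mono order.trans[OF norm_triangle_ineq4] add_right_mono norm_triangle_ineq P0)
    also have "\<dots> \<le> C * a" using T0 T1 T2 unfolding C_def by (simp add: algebra_simps)
    finally show ?thesis by (simp add: P_def)
  qed
  moreover have "0 \<le> C" using C0 C1 C2 by (simp add: C_def)
  ultimately show thesis using that by blast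
qed

text \<open>The identity \<open>f * \<eta> = f\<close> becomes a convolution on the Fourier side.
  Inversion is applied to the smooth \<eta> alone, as the transform of f is not yet known to be
  integrable.\<close>

lemma fourier_reproducing:
  fixes \<eta> f :: "real \<Rightarrow> complex"
  assumes "smooth \<eta>" and supp: "\<And>x. \<bar>x\<bar> > R \<Longrightarrow> \<eta> x = 0"
    and f: "integrable lborel f" and id: "\<And>x. f x * \<eta> x = f x"
  shows "2 * pi * fourier f t = (\<integral>\<tau>. fourier f \<tau> * fourier \<eta> (t - \<tau>) \<partial>lborel)"
    and "integrable lborel (fourier \<eta>)"
proof -
  have cont: "continuous_on UNIV \<eta>" by (rule smooth_continuous[OF assms(1)])
  have \<eta>: "integrable lborel \<eta>" by (rule integrable_continuous_compact_support[OF cont supp])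
  note [measurable] = borel_measurable_integrable[OF \<eta>, simplified] borel_measurable_integrable[OF f, simplified]
  obtain C where C: "C \<ge> 0" "\<And>\<tau>. cmod (fourier \<eta> \<tau>) * (1 + \<bar>\<tau>\<bar>) ^ 2 \<le> C"
    using fourier_decay[OF assms(1) supp] by blast
  show F: "integrable lborel (fourier \<eta>)"
  proof (rule Bochner_Integration.integrable_bound)
    show "integrable lborel (\<lambda>\<tau>. C * inverse (1 + \<tau>\<^sup>2))" by (intro integrable_mult_right integrable_inverse_square)
    have "cmod (fourier \<eta> \<tau>) \<le> C * inverse (1 + \<tau>\<^sup>2)" for \<tau>
    proof -
      have "cmod (fourier \<eta> \<tau>) * (1 + \<tau>\<^sup>2) \<le> cmod (fourier \<eta> \<tau>) * (1 + \<bar>\<tau>\<bar>)\<^sup>2"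
        by (intro mult_left_mono) (auto simp: power2_sum)
      also have "\<dots> \<le> C" by (rule C)
      finally show ?thesis by (simp add: field_simps add_pos_nonneg)
    qed
    then show "AE \<tau> in lborel. cmod (fourier \<eta> \<tau>) \<le> norm (C * inverse (1 + \<tau>\<^sup>2))"
      using C(1) by (auto simp: abs_mult)
  qed measurable
  have "\<exists>B. \<forall>x. cmod (\<eta> x) \<le> B"
  proof -
    have "compact (\<eta> ` {-\<bar>R\<bar>..\<bar>R\<bar>})" by (intro compact_continuous_image continuous_on_subset[OF cont]) auto
    then have "bounded (\<eta> ` {-\<bar>R\<bar>..\<bar>R\<bar>})" by (rule compact_imp_bounded)
    then obtain B where B: "\<And>x. x \<in> {-\<bar>R\<bar>..\<bar>R\<bar>} \<Longrightarrow> cmod (\<eta> x) \<le> B" unfolding bounded_iff by blast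
    have "cmod (\<eta> x) \<le> max B 0" for x
    proof (cases "\<bar>x\<bar> > R")
      case False
      then have "x \<in> {-\<bar>R\<bar>..\<bar>R\<bar>}" by auto
      from B[OF this] show ?thesis by simp
    qed (simp add: supp)
    then show ?thesis by blast
  qed
  then obtain B where B: "\<And>x. cmod (\<eta> x) \<le> B" by blast
  have inv: "2 * pi * \<eta> x = (\<integral>\<sigma>. fourier \<eta> \<sigma> * exp (\<i> * complex_of_real (x * \<sigma>)) \<partial>lborel)" for x
    using fourier_inversion[OF \<eta> cont B F, of x] by (simp add: inv_fourier_def field_simps)
  have "2 * pi * fourier f t = (\<integral>x. 2 * pi * (f x * exp (- \<i> * complex_of_real (x * t))) \<partial>lborel)"
    unfolding fourier_def by (rule Bochner_Integration.integral_mult_right_zero[symmetric])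
  also have "\<dots> = (\<integral>x. (f x * exp (- \<i> * complex_of_real (x * t))) * (\<integral>\<sigma>. fourier \<eta> \<sigma> * exp (\<i> * complex_of_real (x * \<sigma>)) \<partial>lborel) \<partial>lborel)"
  proof (intro Bochner_Integration.integral_cong refl)
    fix x
    have "2 * pi * (f x * exp (- \<i> * complex_of_real (x * t))) = 2 * pi * ((f x * \<eta> x) * exp (- \<i> * complex_of_real (x * t)))"
      by (simp only: id)
    also have "\<dots> = (f x * exp (- \<i> * complex_of_real (x * t))) * (2 * pi * \<eta> x)" by (simp only: mult_ac)
    finally show "2 * pi * (f x * exp (- \<i> * complex_of_real (x * t))) =
      (f x * exp (- \<i> * complex_of_real (x * t))) * (\<integral>\<sigma>. fourier \<eta> \<sigma> * exp (\<i> * complex_of_real (x * \<sigma>)) \<partial>lborel)"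
      unfolding inv .
  qed
  also have "\<dots> = (\<integral>\<sigma>. fourier \<eta> \<sigma> * (\<integral>x. (f x * exp (- \<i> * complex_of_real (x * t))) * exp (\<i> * complex_of_real (x * \<sigma>)) \<partial>lborel) \<partial>lborel)"
    by (rule fubini_kernel[OF integrable_times_exp(2)[OF f] F, where B = 1]) auto
  also have "(\<lambda>\<sigma>. \<integral>x. (f x * exp (- \<i> * complex_of_real (x * t))) * exp (\<i> * complex_of_real (x * \<sigma>)) \<partial>lborel) = (\<lambda>\<sigma>. fourier f (t - \<sigma>))"
    unfolding fourier_def by (intro ext Bochner_Integration.integral_cong refl) (simp add: mult.assoc exp_add[symmetric] algebra_simps)
  also have "(\<integral>\<sigma>. fourier \<eta> \<sigma> * fourier f (t - \<sigma>) \<partial>lborel) = (\<integral>\<tau>. fourier \<eta> (t - \<tau>) * fourier f \<tau> \<partial>lborel)"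
    by (subst lborel_integral_real_affine[where c = "-1" and t = t]) auto
  finally show "2 * pi * fourier f t = (\<integral>\<tau>. fourier f \<tau> * fourier \<eta> (t - \<tau>) \<partial>lborel)" by (simp only: mult.commute)
qed

section \<open>Frequency localisation and the weighted L1 bound\<close>

lemma unit_partition_smooth: "unit_partition \<phi> \<Longrightarrow> smooth \<phi>"
  unfolding unit_partition_def by (elim conjE)

lemma unit_partition_support:
  assumes "unit_partition \<phi>" "1 < \<bar>t\<bar>"
  shows "\<phi> t = 0"
proof (rule ccontr)
  assume "\<phi> t \<noteq> 0"
  then have "t \<in> closure {t. \<phi> t \<noteq> 0}" by (intro subsetD[OF closure_subset]) simp
  also have "\<dots> \<subseteq> {-1..1}" using assms(1) unfolding unit_partition_def by (elim conjE)
  finally show False using assms(2) unfolding atLeastAtMost_iff by linarith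
qed

lemma unit_partition_sum:
  assumes "unit_partition \<phi>" "finite J" "\<And>n. n \<notin> J \<Longrightarrow> \<phi> (t - of_int n) = 0"
  shows "(\<Sum>n\<in>J. \<phi> (t - of_int n)) = 1"
proof -
  have "((\<lambda>n::int. \<phi> (t - of_int n)) has_sum 1) UNIV" using assms(1) unfolding unit_partition_def by blast
  moreover have "((\<lambda>n::int. \<phi> (t - of_int n)) has_sum 1) UNIV \<longleftrightarrow> ((\<lambda>n::int. \<phi> (t - of_int n)) has_sum 1) J"
  proof (rule has_sum_cong_neutral)
    show "\<phi> (t - of_int n) = 0" if "n \<in> UNIV - J" for n using assms(3)[of n] that by blast
  qed auto
  ultimately have "((\<lambda>n::int. \<phi> (t - of_int n)) has_sum 1) J" by blast
  from infsumI[OF this] show ?thesis unfolding infsum_finite[OF assms(2)] .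
qed

lemma unit_partition_sum_interval:
  assumes "unit_partition \<phi>" "a \<le> t - 1" "t + 1 \<le> b"
  shows "(\<Sum>n\<in>{\<lceil>a\<rceil>..\<lfloor>b\<rfloor>}. \<phi> (t - of_int n)) = 1"
proof (rule unit_partition_sum[OF assms(1)])
  fix n :: int assume "n \<notin> {\<lceil>a\<rceil>..\<lfloor>b\<rfloor>}"
  then have "of_int n < a \<or> b < of_int n" 
    unfolding atLeastAtMost_iff ceiling_le_iff le_floor_iff by linarith
  then have "1 < \<bar>t - of_int n\<bar>" using assms(2,3) by linarith
  then show "\<phi> (t - of_int n) = 0" by (rule unit_partition_support[OF assms(1)])
qed simp

lemma unit_partition_bound:
  assumes "unit_partition \<phi>"
  obtains B where "0 \<le> B" "\<And>t. cmod (\<phi> t) \<le> B"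
proof -
  note cont = smooth_continuous[OF unit_partition_smooth[OF assms]]
  have "compact (\<phi> ` {-1..1})" by (intro compact_continuous_image continuous_on_subset[OF cont]) auto
  then have "bounded (\<phi> ` {-1..1})" by (rule compact_imp_bounded)
  then obtain B where B: "\<And>x. x \<in> {-1..1} \<Longrightarrow> cmod (\<phi> x) \<le> B" unfolding bounded_iff by blast
  have "cmod (\<phi> t) \<le> max B 0" for t
  proof (cases "\<bar>t\<bar> > 1")
    case False
    then have "t \<in> {-1..1}" by auto
    from B[OF this] show ?thesis by simp
  next
    case True
    then show ?thesis using unit_partition_support[OF assms True] by simp
  qed
  then show thesis by (intro that[of "max B 0"]) auto
qed

lemma compact_support_posE:
  assumes "compact_support_pos f"
  obtains R where "\<And>x. \<bar>x\<bar> > real R \<Longrightarrow> f x = 0"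
proof -
  have "bounded (closure {s. f s \<noteq> 0})"
    using assms unfolding compact_support_pos_def by (intro compact_imp_bounded) (elim conjE)
  then have "bounded {s. f s \<noteq> 0}" by (rule bounded_subset[OF _ closure_subset])
  then obtain r where "\<And>x. x \<in> {s. f s \<noteq> 0} \<Longrightarrow> norm x \<le> r" unfolding bounded_iff by blast
  then have r: "\<And>x. f x \<noteq> 0 \<Longrightarrow> \<bar>x\<bar> \<le> r" by simp
  obtain R :: nat where "r \<le> real R" using real_arch_simple by blast
  with r have "f x = 0" if "\<bar>x\<bar> > real R" for x using that by fastforce
  then show thesis using that by blast
qed

text \<open>The convolution in the \<open>E\<close>-norm is the inverse transform of the localised
  function \<open>h n\<close>, so the norm bounds exactly the quantity that
  \<open>hankel_bound\<close> and \<open>fourier_pairing_decay\<close> consume. The supremum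
  dominates single values because \<open>inv_fourier (h n)\<close> is bounded.\<close>

lemma frequency_piece:
  assumes \<phi>: "unit_partition \<phi>" and f: "integrable lborel f"
  defines "h \<equiv> \<lambda>n t. fourier f t * \<phi> (t - of_int n)"
  shows "integrable lborel (h n)" "1 < \<bar>t - of_int n\<bar> \<Longrightarrow> h n t = 0" "continuous_on UNIV (h n)"
    and "(1 + \<bar>of_int n\<bar>) powr \<alpha> * cmod (inv_fourier (h n) x) \<le> E_term \<phi> \<alpha> f n" "0 \<le> E_term \<phi> \<alpha> f n"
proof -
  have c\<phi>: "continuous_on UNIV (\<lambda>t. \<phi> (t - of_int n))"
    by (intro smooth_continuous smooth_shift unit_partition_smooth[OF \<phi>])
  have "\<phi> (t - of_int n) = 0" if "\<bar>t\<bar> > \<bar>of_int n\<bar> + 1" for t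
    using that by (intro unit_partition_support[OF \<phi>]) auto
  then have i\<phi>: "integrable lborel (\<lambda>t. \<phi> (t - of_int n))"
    using integrable_continuous_compact_support[OF c\<phi>] by blast
  show ch: "continuous_on UNIV (h n)" unfolding h_def
    by (intro continuous_on_mult continuous_on_fourier f c\<phi>)
  show z: "h n t = 0" if "1 < \<bar>t - of_int n\<bar>" for t
    using that unit_partition_support[OF \<phi>] by (simp add: h_def)
  show "integrable lborel (h n)"
    by (rule integrable_continuous_compact_support[OF ch, of "\<bar>of_int n\<bar> + 1"]) (auto intro!: z)
  have conv: "convolve f (inv_fourier (\<lambda>t. \<phi> (t - of_int n))) = inv_fourier (h n)"
    unfolding h_def by (rule ext) (rule convolve_inv_fourier[OF f i\<phi>])
  have "bdd_above (range (\<lambda>x. cmod (inv_fourier (h n) x)))"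
    by (rule bdd_aboveI2) (rule norm_inv_fourier_le)
  then have le: "cmod (inv_fourier (h n) x) \<le> sup_norm (inv_fourier (h n))" for x
    unfolding sup_norm_def by (rule cSUP_upper[rotated]) simp
  then show "(1 + \<bar>of_int n\<bar>) powr \<alpha> * cmod (inv_fourier (h n) x) \<le> E_term \<phi> \<alpha> f n"
    unfolding E_term_def conv by (intro mult_left_mono) auto
  have "0 \<le> sup_norm (inv_fourier (h n))" using le[of 0] norm_ge_zero order.trans by blast
  then show "0 \<le> E_term \<phi> \<alpha> f n" by (simp add: E_term_def conv)
qed

text \<open>Uniform bounds on \<open>inv_fourier (h n)\<close> say nothing about the size of
  \<open>h n\<close> itself. Reproducing \<open>fourier f\<close> by convolution with
  \<open>fourier \<eta>\<close> replaces \<open>h n\<close> by \<open>q n\<close>, which decays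
  rapidly away from n with a factor \<open>E_term \<phi> \<alpha> f n\<close>; the weighted
  integrals of the \<open>q n\<close> are therefore summable.\<close>

theorem weighted_fourier_integrable:
  assumes \<phi>: "unit_partition \<phi>" and \<alpha>: "0 < \<alpha>" and f: "f \<in> E_space \<phi> \<alpha>" "compact_support_pos f"
  shows "integrable lborel (\<lambda>t. cmod (fourier f t) * (1 + \<bar>t\<bar>) powr \<alpha>)"
proof -
  obtain R where R: "\<And>x. \<bar>x\<bar> > real R \<Longrightarrow> f x = 0" using compact_support_posE[OF f(2)] by blast
  have cf: "continuous_on UNIV f" and sf: "E_term \<phi> \<alpha> f summable_on UNIV" using f(1) by (auto simp: E_space_def)
  have fi: "integrable lborel f" by (rule integrable_continuous_compact_support[OF cf R])
  note [measurable] = borel_measurable_integrable[OF fi, simplified]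
  define h where "h n t = fourier f t * \<phi> (t - of_int n)" for n t
  note h = frequency_piece[OF \<phi> fi, folded h_def]
  \<comment> \<open>A sum of translates of \<phi> that equals 1 on [-R, R] and vanishes outside
    [-R-2, R+2].\<close>
  define \<eta> where "\<eta> x = (\<Sum>j\<in>{\<lceil>- real R - 1\<rceil>..\<lfloor>real R + 1\<rfloor>}. \<phi> (x - of_int j))" for x
  have \<eta>: "smooth \<eta>"
    unfolding \<eta>_def by (intro smooth_sum smooth_shift unit_partition_smooth[OF \<phi>])
  have \<eta>_supp: "\<eta> x = 0" if "\<bar>x\<bar> > real R + 2" for x
    unfolding \<eta>_def
  proof (intro sum.neutral ballI)
    fix j assume "j \<in> {\<lceil>- real R - 1\<rceil>..\<lfloor>real R + 1\<rfloor>}"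
    then have "- real R - 1 \<le> of_int j" "of_int j \<le> real R + 1"
      by (simp_all only: atLeastAtMost_iff ceiling_le_iff le_floor_iff)
    then show "\<phi> (x - of_int j) = 0" using that by (intro unit_partition_support[OF \<phi>]) linarith
  qed
  have id: "f x * \<eta> x = f x" for x
  proof (cases "\<bar>x\<bar> > real R")
    case False
    then have "\<eta> x = 1" unfolding \<eta>_def by (intro unit_partition_sum_interval[OF \<phi>]) auto
    then show ?thesis by simp
  qed (simp add: R)
  note rep = fourier_reproducing[where R = "real R + 2", OF \<eta> \<eta>_supp fi id]
  \<comment> \<open>At least \<alpha> powers absorb the weight through \<open>1 + \<bar>t\<bar>
    \<le> (1 + \<bar>t - n\<bar>) (1 + \<bar>n\<bar>)\<close>; two more powers make the remaining
    factor integrable.\<close>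
  define k where "k = nat \<lceil>\<alpha>\<rceil> + 2"
  obtain C where C: "C \<ge> 0" "\<And>h a n t. \<lbrakk>integrable lborel h; \<And>\<tau>. \<bar>\<tau> - n\<bar> > 1 \<Longrightarrow> h \<tau> = 0; \<And>x. cmod (inv_fourier h x) \<le> a\<rbrakk>
      \<Longrightarrow> cmod (\<integral>\<tau>. h \<tau> * fourier \<eta> (t - \<tau>) \<partial>lborel) * (1 + \<bar>t - n\<bar>) ^ k \<le> C * a"
    using fourier_pairing_decay[OF \<eta> \<eta>_supp] by blast
  define q where "q n t = (\<integral>\<tau>. h n \<tau> * fourier \<eta> (t - \<tau>) \<partial>lborel)" for n t
  define b where "b = E_term \<phi> \<alpha> f"
  have b0: "0 \<le> b n" for n using h(5) by (simp add: b_def)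
  have q_le: "cmod (q n t) * (1 + \<bar>t\<bar>) powr \<alpha> \<le> C * b n * inverse (1 + (t - of_int n)\<^sup>2)" for n t
  proof -
    define u w where "u = 1 + \<bar>t - of_int n\<bar>" and "w = 1 + \<bar>real_of_int n\<bar>"
    have uw: "1 \<le> u" "1 \<le> w" by (auto simp: u_def w_def)
    have "cmod (inv_fourier (h n) x) \<le> b n / w powr \<alpha>" for x
      using h(4)[of n \<alpha> x] uw by (simp add: b_def w_def field_simps)
    from C(2)[OF h(1) h(2) this] have 1: "cmod (q n t) * u ^ k \<le> C * (b n / w powr \<alpha>)"
      by (simp add: q_def u_def)
    have "(1 + \<bar>t\<bar>) \<le> u * w"
    proof -
      have "1 + \<bar>t\<bar> \<le> 1 + \<bar>t - of_int n\<bar> + \<bar>real_of_int n\<bar>" by linarith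
      also have "\<dots> \<le> u * w" by (simp add: u_def w_def algebra_simps)
      finally show ?thesis .
    qed
    then have "(1 + \<bar>t\<bar>) powr \<alpha> \<le> u powr \<alpha> * w powr \<alpha>"
      using \<alpha> uw by (simp add: powr_mono2 powr_mult[symmetric])
    moreover have "u powr \<alpha> \<le> u ^ (nat \<lceil>\<alpha>\<rceil>)"
    proof -
      have "\<alpha> \<le> real (nat \<lceil>\<alpha>\<rceil>)" using \<alpha> by linarith
      then have "u powr \<alpha> \<le> u powr real (nat \<lceil>\<alpha>\<rceil>)" using uw by (intro powr_mono)
      then show ?thesis using uw by (simp add: powr_realpow)
    qed
    ultimately have "(1 + \<bar>t\<bar>) powr \<alpha> \<le> u ^ (nat \<lceil>\<alpha>\<rceil>) * w powr \<alpha>"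
      by (smt (verit) mult_right_mono powr_ge_zero)
    then have "cmod (q n t) * (1 + \<bar>t\<bar>) powr \<alpha> * u\<^sup>2 \<le> cmod (q n t) * (u ^ (nat \<lceil>\<alpha>\<rceil>) * w powr \<alpha>) * u\<^sup>2"
      by (intro mult_right_mono mult_left_mono) auto
    also have "\<dots> = (cmod (q n t) * u ^ k) * w powr \<alpha>" by (simp only: k_def power_add mult_ac)
    also have "\<dots> \<le> C * (b n / w powr \<alpha>) * w powr \<alpha>" by (intro mult_right_mono 1) simp
    also have "\<dots> = C * b n" using uw by simp
    finally have 2: "cmod (q n t) * (1 + \<bar>t\<bar>) powr \<alpha> * u\<^sup>2 \<le> C * b n" .
    have "cmod (q n t) * (1 + \<bar>t\<bar>) powr \<alpha> * (1 + (t - of_int n)\<^sup>2) \<le> cmod (q n t) * (1 + \<bar>t\<bar>) powr \<alpha> * u\<^sup>2"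
      by (intro mult_left_mono) (auto simp: u_def power2_sum)
    with 2 show ?thesis by (simp add: field_simps add_pos_nonneg)
  qed
  define Q where "Q N t = (\<Sum>n\<in>{-int N..int N}. q n t)" for N t
  obtain B where B: "0 \<le> B" "\<And>t. cmod (\<phi> t) \<le> B" using unit_partition_bound[OF \<phi>] by blast
  have \<phi>_meas [measurable]: "\<phi> \<in> borel_measurable borel"
    by (intro borel_measurable_continuous_onI smooth_continuous unit_partition_smooth[OF \<phi>])
  have \<eta>_int: "integrable lborel (\<lambda>\<tau>. fourier \<eta> (t - \<tau>))" for t
    using lborel_integrable_real_affine[OF rep(2), of "-1" t] by simp
  note \<eta>_meas [measurable] = borel_measurable_integrable[OF rep(2), simplified]
  \<comment> \<open>At most three translates of \<phi> are nonzero at a given point, so the partial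
    sums have a bound independent of \<open>N\<close>, which dominated convergence needs.\<close>
  have few: "cmod (\<Sum>n\<in>{-int N..int N}. \<phi> (\<tau> - of_int n)) \<le> 3 * B" for N \<tau>
  proof -
    have "(\<Sum>n\<in>{-int N..int N}. \<phi> (\<tau> - of_int n)) = (\<Sum>n\<in>{-int N..int N} \<inter> {\<lfloor>\<tau>\<rfloor>-1..\<lfloor>\<tau>\<rfloor>+1}. \<phi> (\<tau> - of_int n))"
    proof (rule sum.mono_neutral_right)
      show "\<forall>i\<in>{-int N..int N} - {-int N..int N} \<inter> {\<lfloor>\<tau>\<rfloor>-1..\<lfloor>\<tau>\<rfloor>+1}. \<phi> (\<tau> - of_int i) = 0"
      proof
        fix i assume "i \<in> {-int N..int N} - {-int N..int N} \<inter> {\<lfloor>\<tau>\<rfloor>-1..\<lfloor>\<tau>\<rfloor>+1}"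
        then have "i < \<lfloor>\<tau>\<rfloor> - 1 \<or> i > \<lfloor>\<tau>\<rfloor> + 1" by auto
        then show "\<phi> (\<tau> - of_int i) = 0" by (intro unit_partition_support[OF \<phi>]) linarith
      qed
    qed auto
    also have "cmod \<dots> \<le> real (card ({-int N..int N} \<inter> {\<lfloor>\<tau>\<rfloor>-1..\<lfloor>\<tau>\<rfloor>+1})) * B"
      by (intro sum_norm_bound B)
    also have "\<dots> \<le> 3 * B"
    proof -
      have "card ({-int N..int N} \<inter> {\<lfloor>\<tau>\<rfloor>-1..\<lfloor>\<tau>\<rfloor>+1}) \<le> card {\<lfloor>\<tau>\<rfloor>-1..\<lfloor>\<tau>\<rfloor>+1}" by (intro card_mono) auto
      then show ?thesis using B(1) by (intro mult_right_mono) auto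
    qed
    finally show ?thesis .
  qed
  have Qlim: "(\<lambda>N. Q N t) \<longlonglongrightarrow> 2 * pi * fourier f t" for t
  proof -
    have hint: "integrable lborel (\<lambda>\<tau>. h n \<tau> * fourier \<eta> (t - \<tau>))" for n
    proof (rule Bochner_Integration.integrable_bound)
      show "integrable lborel (\<lambda>\<tau>. complex_of_real ((\<integral>s. cmod (f s) \<partial>lborel) * B) * fourier \<eta> (t - \<tau>))"
        by (intro integrable_mult_right \<eta>_int)
      have "cmod (h n \<tau>) \<le> (\<integral>s. cmod (f s) \<partial>lborel) * B" for \<tau>
        unfolding h_def norm_mult by (intro mult_mono norm_fourier_le B) auto
      then show "AE \<tau> in lborel. cmod (h n \<tau> * fourier \<eta> (t - \<tau>)) \<le> cmod (complex_of_real ((\<integral>s. cmod (f s) \<partial>lborel) * B) * fourier \<eta> (t - \<tau>))"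
        using B(1) by (auto simp: norm_mult abs_mult intro!: mult_right_mono)
    qed (simp add: h_def[abs_def])
    have Q: "Q N t = (\<integral>\<tau>. (\<Sum>n\<in>{-int N..int N}. \<phi> (\<tau> - of_int n)) * (fourier f \<tau> * fourier \<eta> (t - \<tau>)) \<partial>lborel)" for N
    proof -
      have "Q N t = (\<integral>\<tau>. (\<Sum>n\<in>{-int N..int N}. h n \<tau> * fourier \<eta> (t - \<tau>)) \<partial>lborel)"
        unfolding Q_def q_def by (rule Bochner_Integration.integral_sum[symmetric]) (rule hint)
      then show ?thesis unfolding sum_distrib_right h_def by (simp only: mult_ac)
    qed
    have "(\<lambda>N. Q N t) \<longlonglongrightarrow> (\<integral>\<tau>. fourier f \<tau> * fourier \<eta> (t - \<tau>) \<partial>lborel)"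
      unfolding Q
    proof (rule integral_dominated_convergence[where w = "\<lambda>\<tau>. 3 * B * (\<integral>s. cmod (f s) \<partial>lborel) * cmod (fourier \<eta> (t - \<tau>))"])
      show "integrable lborel (\<lambda>\<tau>. 3 * B * (\<integral>s. cmod (f s) \<partial>lborel) * cmod (fourier \<eta> (t - \<tau>)))"
        by (intro integrable_mult_right integrable_norm \<eta>_int)
      show "AE \<tau> in lborel. (\<lambda>N. (\<Sum>n\<in>{-int N..int N}. \<phi> (\<tau> - of_int n)) * (fourier f \<tau> * fourier \<eta> (t - \<tau>))) \<longlonglongrightarrow>
        fourier f \<tau> * fourier \<eta> (t - \<tau>)"
      proof (rule AE_I2, rule tendsto_eventually)
        fix \<tau>
        obtain M :: nat where M: "\<bar>\<tau>\<bar> + 1 \<le> real M" using real_arch_simple by blast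
        show "\<forall>\<^sub>F N in sequentially. (\<Sum>n\<in>{-int N..int N}. \<phi> (\<tau> - of_int n)) * (fourier f \<tau> * fourier \<eta> (t - \<tau>)) =
          fourier f \<tau> * fourier \<eta> (t - \<tau>)"
        proof (rule eventually_sequentiallyI[of M])
          fix N assume "M \<le> N"
          then have "\<bar>\<tau>\<bar> + 1 \<le> real N" using M by linarith
          then have "(\<Sum>n\<in>{-int N..int N}. \<phi> (\<tau> - of_int n)) = 1"
            
            using unit_partition_sum_interval[OF \<phi>, of "- real N" \<tau> "real N"] by (simp add: ceiling_minus)
          then show "(\<Sum>n\<in>{-int N..int N}. \<phi> (\<tau> - of_int n)) * (fourier f \<tau> * fourier \<eta> (t - \<tau>)) = fourier f \<tau> * fourier \<eta> (t - \<tau>)"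
            by simp
        qed
      qed
      show "AE \<tau> in lborel. cmod ((\<Sum>n\<in>{-int N..int N}. \<phi> (\<tau> - of_int n)) * (fourier f \<tau> * fourier \<eta> (t - \<tau>))) \<le>
        3 * B * (\<integral>s. cmod (f s) \<partial>lborel) * cmod (fourier \<eta> (t - \<tau>))" for N
        using few B(1) unfolding norm_mult mult.assoc[symmetric]
        by (intro AE_I2 mult_right_mono mult_mono norm_fourier_le) auto
    qed measurable
    then show ?thesis using rep(1) by simp
  qed
  define I where "I = (integral\<^sup>L lborel (\<lambda>s::real. inverse (1 + s\<^sup>2)))"
  have I: "integrable lborel (\<lambda>t. inverse (1 + (t - c)\<^sup>2))" "(\<integral>t. inverse (1 + (t - c)\<^sup>2) \<partial>lborel) = I" for c :: real
    using lborel_integrable_real_affine[OF integrable_inverse_square, of 1 "- c"]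
      lborel_integral_real_affine[of 1 "\<lambda>s. inverse (1 + s\<^sup>2)" "- c"] by (simp_all add: I_def)
  have I0: "0 \<le> I" unfolding I_def by (rule integral_nonneg_AE) simp
  have [measurable]: "q n \<in> borel_measurable borel" for n
    unfolding q_def[abs_def] h_def[abs_def] by measurable
  \<comment> \<open>Fatou's lemma is applied to these functions: their integrals are bounded
    uniformly in \<open>N\<close>, and they converge pointwise to \<open>2 * pi\<close> times the
    weighted modulus of \<open>fourier f\<close>.\<close>
  define F where "F N t = cmod (Q N t) * (1 + \<bar>t\<bar>) powr \<alpha>" for N t
  have [measurable]: "F N \<in> borel_measurable borel" for N
    unfolding F_def[abs_def] Q_def[abs_def] by measurable
  have Fb: "(\<integral>\<^sup>+t. ennreal (F N t) \<partial>lborel) \<le> ennreal (C * I * infsum b UNIV)" for N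
  proof -
    have "F N t \<le> (\<Sum>n\<in>{-int N..int N}. C * b n * inverse (1 + (t - of_int n)\<^sup>2))" for t
    proof -
      have "F N t \<le> (\<Sum>n\<in>{-int N..int N}. cmod (q n t)) * (1 + \<bar>t\<bar>) powr \<alpha>"
        unfolding F_def Q_def by (intro mult_right_mono norm_sum) auto
      also have "\<dots> \<le> (\<Sum>n\<in>{-int N..int N}. C * b n * inverse (1 + (t - of_int n)\<^sup>2))"
        unfolding sum_distrib_right by (intro sum_mono q_le)
      finally show ?thesis .
    qed
    then have "(\<integral>\<^sup>+t. ennreal (F N t) \<partial>lborel) \<le> (\<integral>\<^sup>+t. ennreal (\<Sum>n\<in>{-int N..int N}. C * b n * inverse (1 + (t - of_int n)\<^sup>2)) \<partial>lborel)"
      by (intro nn_integral_mono ennreal_leI)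
    also have "\<dots> = ennreal (\<integral>t. (\<Sum>n\<in>{-int N..int N}. C * b n * inverse (1 + (t - of_int n)\<^sup>2)) \<partial>lborel)"
      using C(1) b0 by (intro nn_integral_eq_integral Bochner_Integration.integrable_sum integrable_mult_right I AE_I2 sum_nonneg) auto
    also have "(\<integral>t. (\<Sum>n\<in>{-int N..int N}. C * b n * inverse (1 + (t - of_int n)\<^sup>2)) \<partial>lborel) = (\<Sum>n\<in>{-int N..int N}. C * b n * I)"
      by (subst Bochner_Integration.integral_sum) (auto intro!: integrable_mult_right I sum.cong simp: I(2))
    also have "\<dots> = C * I * sum b {-int N..int N}" by (simp add: sum_distrib_left mult_ac)
    also have "\<dots> \<le> C * I * infsum b UNIV"
      using C(1) I0 b0 sf by (intro mult_left_mono finite_sum_le_infsum) (auto simp: b_def)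
    finally show ?thesis by (simp add: ennreal_leI)
  qed
  have "(\<integral>\<^sup>+t. ennreal (2 * pi * (cmod (fourier f t) * (1 + \<bar>t\<bar>) powr \<alpha>)) \<partial>lborel) =
    (\<integral>\<^sup>+t. liminf (\<lambda>N. ennreal (F N t)) \<partial>lborel)"
  proof (rule nn_integral_cong)
    fix t
    have "(\<lambda>N. F N t) \<longlonglongrightarrow> cmod (2 * pi * fourier f t) * (1 + \<bar>t\<bar>) powr \<alpha>"
      unfolding F_def by (intro tendsto_mult tendsto_norm Qlim tendsto_const)
    then have "(\<lambda>N. ennreal (F N t)) \<longlonglongrightarrow> ennreal (2 * pi * (cmod (fourier f t) * (1 + \<bar>t\<bar>) powr \<alpha>))"
      by (intro tendsto_ennrealI) (simp add: norm_mult mult_ac)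
    then show "ennreal (2 * pi * (cmod (fourier f t) * (1 + \<bar>t\<bar>) powr \<alpha>)) = liminf (\<lambda>N. ennreal (F N t))"
      by (intro lim_imp_Liminf[symmetric]) auto
  qed
  also have "\<dots> \<le> liminf (\<lambda>N. \<integral>\<^sup>+t. ennreal (F N t) \<partial>lborel)"
    by (rule nn_integral_liminf) measurable
  also have "\<dots> \<le> ennreal (C * I * infsum b UNIV)"
    by (rule order.trans[OF Liminf_le_Limsup Limsup_bounded]) (use Fb in auto)
  finally have "(\<integral>\<^sup>+t. ennreal (2 * pi * (cmod (fourier f t) * (1 + \<bar>t\<bar>) powr \<alpha>)) \<partial>lborel) < \<infinity>"
    by (rule order.strict_trans1) simp
  then have "integrable lborel (\<lambda>t. 2 * pi * (cmod (fourier f t) * (1 + \<bar>t\<bar>) powr \<alpha>))"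
    by (intro integrableI_nonneg) auto
  then show ?thesis by simp
qed

section \<open>Laplace inversion on a vertical line\<close>

abbreviation vline :: "real \<Rightarrow> real \<Rightarrow> complex"
  where "vline c \<tau> \<equiv> complex_of_real c + \<i> * complex_of_real \<tau>"

lemma cmod_vline_square: "(cmod (vline c \<tau>))\<^sup>2 = c\<^sup>2 + \<tau>\<^sup>2"
  by (simp add: cmod_power2)

lemma integrable_inverse_vline_square:
  assumes "0 < c"
  shows "integrable lborel (\<lambda>\<tau>. inverse ((vline c \<tau>)\<^sup>2))"
proof (rule Bochner_Integration.integrable_bound)
  show "integrable lborel (\<lambda>\<tau>. (1 + inverse (c\<^sup>2)) * inverse (1 + \<tau>\<^sup>2))"
    by (intro integrable_mult_right integrable_inverse_square)
  have "inverse (c\<^sup>2 + \<tau>\<^sup>2) \<le> (1 + inverse (c\<^sup>2)) * inverse (1 + \<tau>\<^sup>2)" for \<tau>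
  proof -
    have "1 + \<tau>\<^sup>2 \<le> (1 + inverse (c\<^sup>2)) * (c\<^sup>2 + \<tau>\<^sup>2)"
      using assms by (simp add: algebra_simps)
    moreover define k where "k = 1 + inverse (c\<^sup>2)"
    moreover have "0 < c\<^sup>2 + \<tau>\<^sup>2" "0 < 1 + \<tau>\<^sup>2" using assms by (simp_all add: add_pos_nonneg)
    ultimately show ?thesis unfolding k_def[symmetric] by (simp add: field_simps)
  qed
  then show "AE \<tau> in lborel. cmod (inverse ((vline c \<tau>)\<^sup>2)) \<le> norm ((1 + inverse (c\<^sup>2)) * inverse (1 + \<tau>\<^sup>2))"
    by (auto simp: norm_inverse norm_power cmod_vline_square abs_mult)
qed measurable

text \<open>The positive part of r, damped by e^(-c r): its Fourier transform is the Laplace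
  transform of r along the line with real part c, namely
  \<open>inverse ((vline c t)^2)\<close>.\<close>

definition ramp :: "real \<Rightarrow> real \<Rightarrow> complex"
  where "ramp c r = complex_of_real (max 0 r * exp (- (c * r)))"

lemma integrable_ramp: "0 < c \<Longrightarrow> integrable lborel (ramp c)"
proof -
  assume c: "0 < c"
  have "integrable lborel (\<lambda>x::real. x ^ 1 * exp (- x) * indicator {0<..} x)"
    using has_bochner_integral_I0i_power_exp_m[of 1] has_bochner_integral_iff by blast
  from lborel_integrable_real_affine[OF this, of c 0] c
  have "integrable lborel (\<lambda>r. (c * r) * exp (- (c * r)) * indicator {0<..} (c * r))" by simp
  then have "integrable lborel (\<lambda>r. complex_of_real ((1 / c) * ((c * r) * exp (- (c * r)) * indicator {0<..} (c * r))))"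
    unfolding complex_of_real_integrable_eq by (rule integrable_mult_right)
  also have "(\<lambda>r. complex_of_real ((1 / c) * ((c * r) * exp (- (c * r)) * indicator {0<..} (c * r)))) = ramp c"
    using c by (auto simp: ramp_def fun_eq_iff indicator_def max_def zero_less_mult_iff)
  finally show ?thesis .
qed

lemma fourier_ramp:
  assumes c: "0 < c"
  shows "fourier (ramp c) t = inverse ((vline c t)\<^sup>2)"
proof -
  define a where "a = vline c t"
  have a: "a \<noteq> 0" "Re a = c" using c by (auto simp: a_def complex_eq_iff)
  let ?f = "\<lambda>r. ramp c r * exp (- \<i> * complex_of_real (r * t))"
  have int: "integrable lborel ?f" by (rule integrable_times_exp(2)[OF integrable_ramp[OF c]])
  define P where "P r = - ((complex_of_real r / a + inverse (a\<^sup>2)) * exp (- a * complex_of_real r))" for r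
  have part: "(\<integral>r. indicator {0..real n} r *\<^sub>R ?f r \<partial>lborel) = P (real n) - P 0" for n :: nat
  proof -
    have "(?f has_integral P (real n) - P 0) {0..real n}"
    proof (rule fundamental_theorem_of_calculus)
      fix r :: real assume r: "r \<in> {0..real n}"
      have 1: "((\<lambda>r. exp (- a * complex_of_real r)) has_vector_derivative - a * exp (- a * complex_of_real r)) (at r within {0..real n})"
        by (rule has_vector_derivative_real_field) (auto intro!: derivative_eq_intros)
      have 2: "((\<lambda>r. complex_of_real r / a + inverse (a\<^sup>2)) has_vector_derivative 1 / a) (at r within {0..real n})"
        by (rule has_vector_derivative_real_field) (use a in \<open>auto intro!: derivative_eq_intros\<close>)
      have "(P has_vector_derivative - ((complex_of_real r / a + inverse (a\<^sup>2)) * (- a * exp (- a * complex_of_real r)) +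
        (1 / a) * exp (- a * complex_of_real r))) (at r within {0..real n})"
        unfolding P_def by (intro has_vector_derivative_minus has_vector_derivative_mult 1 2)
      moreover have "- ((complex_of_real r / a + inverse (a\<^sup>2)) * (- a * exp (- a * complex_of_real r)) + (1 / a) * exp (- a * complex_of_real r)) =
        complex_of_real r * exp (- a * complex_of_real r)"
        using a by (simp add: field_simps power2_eq_square)
      moreover have "exp (- a * complex_of_real r) = complex_of_real (exp (- (c * r))) * exp (- \<i> * complex_of_real (r * t))"
        by (simp add: a_def exp_of_real[symmetric] exp_add[symmetric] algebra_simps del: exp_of_real)
      ultimately show "(P has_vector_derivative ?f r) (at r within {0..real n})"
        using r by (simp add: ramp_def mult.assoc)
    qed simp
    moreover have "set_integrable lborel {0..real n} ?f"
      unfolding set_integrable_def by (rule integrable_mult_indicator[OF _ int]) simp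
    ultimately show ?thesis
      using set_borel_integral_eq_integral(2)[of "{0..real n}" ?f] by (simp add: set_lebesgue_integral_def integral_unique)
  qed
  have "(\<lambda>n. \<integral>r. indicator {0..real n} r *\<^sub>R ?f r \<partial>lborel) \<longlonglongrightarrow> (\<integral>r. ?f r \<partial>lborel)"
  proof (rule integral_dominated_convergence[where w = "\<lambda>r. cmod (?f r)"])
    show "AE r in lborel. (\<lambda>n. indicator {0..real n} r *\<^sub>R ?f r) \<longlonglongrightarrow> ?f r"
    proof (rule AE_I2, rule tendsto_eventually)
      fix r
      obtain m :: nat where m: "r \<le> real m" using real_arch_simple by blast
      show "\<forall>\<^sub>F n in sequentially. indicator {0..real n} r *\<^sub>R ?f r = ?f r"
        by (rule eventually_sequentiallyI[of m]) (use m in \<open>auto simp: indicator_def ramp_def\<close>)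
    qed
  qed (use int in \<open>auto simp: indicator_def\<close>)
  moreover have "(\<lambda>n. P (real n) - P 0) \<longlonglongrightarrow> 0 - P 0"
  proof (intro tendsto_diff tendsto_const)
    have "(\<lambda>n. (real n / cmod a + inverse ((cmod a)\<^sup>2)) * exp (- (c * real n))) \<longlonglongrightarrow> 0"
      using c a by real_asymp
    then show "(\<lambda>n. P (real n)) \<longlonglongrightarrow> 0"
    proof (rule Lim_null_comparison[rotated], intro always_eventually allI)
      fix n
      have "norm (P (real n)) = cmod (complex_of_real (real n) / a + inverse (a\<^sup>2)) * exp (- (c * real n))"
        using a by (simp add: P_def norm_mult)
      also have "\<dots> \<le> (real n / cmod a + inverse ((cmod a)\<^sup>2)) * exp (- (c * real n))"
        by (intro mult_right_mono order.trans[OF norm_triangle_ineq]) (auto simp: norm_divide norm_inverse norm_power)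
      finally show "norm (P (real n)) \<le> (real n / cmod a + inverse ((cmod a)\<^sup>2)) * exp (- (c * real n))" .
    qed
  qed
  ultimately have "(\<integral>r. ?f r \<partial>lborel) = - P 0" unfolding part using LIMSEQ_unique by fastforce
  then show ?thesis by (simp add: fourier_def P_def a_def)
qed

lemma laplace_inversion_ramp:
  assumes c: "0 < c" and r: "0 \<le> r"
  shows "(\<integral>\<tau>. exp (vline c \<tau> * complex_of_real r) * inverse ((vline c \<tau>)\<^sup>2) \<partial>lborel) = complex_of_real (2 * pi * r)"
proof -
  have "ramp c x \<noteq> 0 \<Longrightarrow> cmod (ramp c x) \<le> 1 / c" for x
  proof -
    have "c * x \<le> exp (c * x)" using exp_ge_add_one_self[of "c * x"] by linarith
    then have "max 0 x * c \<le> exp (c * x)" by (auto simp: max_def mult.commute)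
    then have "max 0 x * c * exp (- (c * x)) \<le> exp (c * x) * exp (- (c * x))" by (intro mult_right_mono) auto
    then show ?thesis using c by (simp add: ramp_def exp_minus_inverse field_simps del: of_real_mult)
  qed
  then have bound: "cmod (ramp c x) \<le> 1 / c" for x using c by (cases "ramp c x = 0") auto
  have cont: "continuous_on UNIV (ramp c)" unfolding ramp_def by (intro continuous_intros)
  have "inv_fourier (fourier (ramp c)) r = ramp c r"
    by (rule fourier_inversion[OF integrable_ramp[OF c] cont bound])
      (use integrable_inverse_vline_square[OF c] in \<open>simp add: fourier_ramp[OF c, abs_def]\<close>)
  then have "(\<integral>\<tau>. inverse ((vline c \<tau>)\<^sup>2) * exp (\<i> * complex_of_real (r * \<tau>)) \<partial>lborel) = 2 * pi * (r * exp (- (c * r)))"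
    using r by (simp add: inv_fourier_def fourier_ramp[OF c, abs_def] ramp_def field_simps max_def)
  then have "exp (complex_of_real (c * r)) * (\<integral>\<tau>. inverse ((vline c \<tau>)\<^sup>2) * exp (\<i> * complex_of_real (r * \<tau>)) \<partial>lborel) =
    complex_of_real (exp (c * r)) * (2 * pi * (r * exp (- (c * r))))"
    by (simp only: exp_of_real)
  also have "\<dots> = complex_of_real (2 * pi * r)"
    by (simp add: exp_minus field_simps)
  also have "exp (complex_of_real (c * r)) * (\<integral>\<tau>. inverse ((vline c \<tau>)\<^sup>2) * exp (\<i> * complex_of_real (r * \<tau>)) \<partial>lborel) =
    (\<integral>\<tau>. exp (vline c \<tau> * complex_of_real r) * inverse ((vline c \<tau>)\<^sup>2) \<partial>lborel)"
    by (subst Bochner_Integration.integral_mult_right_zero[symmetric])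
      (intro Bochner_Integration.integral_cong refl, simp add: exp_add algebra_simps)
  finally show ?thesis .
qed

text \<open>Over a bounded range of \<tau> the vector-valued integrals to come run over compact
  rectangles with continuous integrands. The error is the tail of the integral of |vline|^-2, and up
  to the factor e^(c r) it is uniform in \<open>r\<close>.\<close>

lemma laplace_inversion_ramp_truncated:
  assumes c: "0 < c"
  obtains \<delta> :: "nat \<Rightarrow> real" where "\<delta> \<longlonglongrightarrow> 0"
    "\<And>N r. 0 \<le> r \<Longrightarrow> cmod (integral {-real N..real N} (\<lambda>\<tau>. exp (vline c \<tau> * complex_of_real r) * inverse ((vline c \<tau>)\<^sup>2)) - complex_of_real (2 * pi * r)) \<le> exp (c * r) * \<delta> N"
proof -
  define \<delta> where "\<delta> N = (\<integral>\<tau>. indicator (- {-real N..real N}) \<tau> * cmod (inverse ((vline c \<tau>)\<^sup>2)) \<partial>lborel)" for N :: nat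
  note int = integrable_inverse_vline_square[OF c]
  have "(\<lambda>N. \<delta> N) \<longlonglongrightarrow> (integral\<^sup>L lborel (\<lambda>\<tau>::real. 0 :: real))"
    unfolding \<delta>_def
  proof (rule integral_dominated_convergence[where w = "\<lambda>\<tau>. cmod (inverse ((vline c \<tau>)\<^sup>2))"])
    show "AE \<tau> in lborel. (\<lambda>N. indicator (- {-real N..real N}) \<tau> * cmod (inverse ((vline c \<tau>)\<^sup>2))) \<longlonglongrightarrow> 0"
    proof (rule AE_I2, rule tendsto_eventually)
      fix \<tau> :: real
      obtain m :: nat where m: "\<bar>\<tau>\<bar> \<le> real m" using real_arch_simple by blast
      show "\<forall>\<^sub>F N in sequentially. indicator (- {-real N..real N}) \<tau> * cmod (inverse ((vline c \<tau>)\<^sup>2)) = 0"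
        by (rule eventually_sequentiallyI[of m]) (use m in \<open>auto simp: indicator_def\<close>)
    qed
  qed (use integrable_norm[OF int] in \<open>auto simp: indicator_def\<close>)
  then have lim: "\<delta> \<longlonglongrightarrow> 0" by simp
  have "cmod (integral {-real N..real N} (\<lambda>\<tau>. exp (vline c \<tau> * complex_of_real r) * inverse ((vline c \<tau>)\<^sup>2)) - complex_of_real (2 * pi * r)) \<le> exp (c * r) * \<delta> N"
    if r: "0 \<le> r" for N r
  proof -
    let ?G = "\<lambda>\<tau>. exp (vline c \<tau> * complex_of_real r) * inverse ((vline c \<tau>)\<^sup>2)"
    let ?S = "{-real N..real N}"
    have n: "cmod (?G \<tau>) = exp (c * r) * cmod (inverse ((vline c \<tau>)\<^sup>2))" for \<tau>
      by (simp add: norm_mult)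
    have G: "integrable lborel ?G"
      by (rule Bochner_Integration.integrable_bound[OF integrable_mult_right[OF integrable_norm[OF int], of "exp (c * r)"]])
        (auto simp: n norm_mult)
    have Gs: "integrable lborel (\<lambda>\<tau>. indicator ?S \<tau> *\<^sub>R ?G \<tau>)" by (rule integrable_mult_indicator[OF _ G]) simp
    have Gc: "integrable lborel (\<lambda>\<tau>. indicator (- ?S) \<tau> *\<^sub>R ?G \<tau>)" by (rule integrable_mult_indicator[OF _ G]) simp
    have "integral ?S ?G = (\<integral>\<tau>. indicator ?S \<tau> *\<^sub>R ?G \<tau> \<partial>lborel)"
      using set_borel_integral_eq_integral(2)[of ?S ?G] Gs by (simp add: set_lebesgue_integral_def set_integrable_def)
    moreover have "(\<integral>\<tau>. ?G \<tau> \<partial>lborel) = (\<integral>\<tau>. indicator ?S \<tau> *\<^sub>R ?G \<tau> \<partial>lborel) + (\<integral>\<tau>. indicator (- ?S) \<tau> *\<^sub>R ?G \<tau> \<partial>lborel)"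
      unfolding Bochner_Integration.integral_add[OF Gs Gc, symmetric]
      by (intro Bochner_Integration.integral_cong refl) (auto simp: indicator_def)
    ultimately have "integral ?S ?G - complex_of_real (2 * pi * r) = - (\<integral>\<tau>. indicator (- ?S) \<tau> *\<^sub>R ?G \<tau> \<partial>lborel)"
      using laplace_inversion_ramp[OF c r] by (simp only:) simp
    then have "cmod (integral ?S ?G - complex_of_real (2 * pi * r)) \<le> (\<integral>\<tau>. cmod (indicator (- ?S) \<tau> *\<^sub>R ?G \<tau>) \<partial>lborel)"
      by (simp only: norm_minus_cancel integral_norm_bound)
    also have "\<dots> = (\<integral>\<tau>. exp (c * r) * (indicator (- ?S) \<tau> * cmod (inverse ((vline c \<tau>)\<^sup>2))) \<partial>lborel)"
      by (intro Bochner_Integration.integral_cong refl) (unfold norm_scaleR n abs_indicator, simp only: mult_ac)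
    also have "\<dots> = exp (c * r) * \<delta> N"
      unfolding \<delta>_def by (rule Bochner_Integration.integral_mult_right_zero)
    finally show ?thesis .
  qed
  with lim show thesis using that by blast
qed

section \<open>Growth of the semigroup\<close>

lemma bounded_bilinear_scaleC: "bounded_bilinear (scaleC :: complex \<Rightarrow> 'a::complex_banach \<Rightarrow> 'a)"
proof
  fix a b :: complex and x y :: 'a and r :: real
  show "(a + b) *\<^sub>C x = a *\<^sub>C x + b *\<^sub>C x" by (rule scaleC_add_left)
  show "a *\<^sub>C (x + y) = a *\<^sub>C x + a *\<^sub>C y" by (rule scaleC_add_right)
  show "(r *\<^sub>R a) *\<^sub>C x = r *\<^sub>R (a *\<^sub>C x)"
    by (simp add: scaleR_conv_of_real scaleC_scaleC[symmetric] scaleC_of_real)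
  show "a *\<^sub>C (r *\<^sub>R x) = r *\<^sub>R (a *\<^sub>C x)"
    by (simp add: scaleC_of_real[symmetric] scaleC_scaleC mult.commute)
  show "\<exists>K. \<forall>(a::complex) (x::'a). norm (a *\<^sub>C x) \<le> norm a * norm x * K"
    by (intro exI[of _ 1]) (simp add: norm_scaleC)
qed

interpretation scaleC: bounded_bilinear "scaleC :: complex \<Rightarrow> 'a::complex_banach \<Rightarrow> 'a"
  by (rule bounded_bilinear_scaleC)

lemma scaleC_one: "1 *\<^sub>C x = (x :: 'a::complex_banach)"
  using scaleC_of_real[of 1 x] by simp

lemma scaleC_minus_one: "(- 1) *\<^sub>C x = - (x :: 'a::complex_banach)"
  by (simp add: scaleC.minus_left scaleC_one)

lemma complex_linear_scaleC: "complex_linear S \<Longrightarrow> S (c *\<^sub>C x) = c *\<^sub>C S x"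
  by (simp add: complex_linear_def)

lemma complex_linear_comp: "complex_linear S \<Longrightarrow> complex_linear S' \<Longrightarrow> complex_linear (S o\<^sub>L S')"
  by (simp add: complex_linear_def)

lemma closure_sector_subset: "\<omega> \<le> pi / 2 \<Longrightarrow> closure (sector \<omega>) \<subseteq> {z. 0 \<le> Re z}"
proof (rule closure_minimal)
  assume "\<omega> \<le> pi / 2"
  show "sector \<omega> \<subseteq> {z. 0 \<le> Re z}"
  proof
    fix z assume "z \<in> sector \<omega>"
    then have "\<bar>Arg z\<bar> < pi / 2" using \<open>\<omega> \<le> pi / 2\<close> by (auto simp: sector_def)
    then have "0 \<le> cos (Arg z)" by (intro cos_ge_zero) auto
    moreover have "Re z = cmod z * cos (Arg z)"
      by (metis Re_rcis rcis_cmod_Arg)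
    ultimately show "z \<in> {z. 0 \<le> Re z}" by simp
  qed
  show "closed {z. 0 \<le> Re z}" by (rule closed_halfspace_Re_ge)
qed

lemma resolvent_unique:
  assumes "is_resolvent D A z R1" "is_resolvent D A z R2"
  shows "R1 = R2"
proof (rule blinfun_eqI)
  fix x
  have "R2 x \<in> D" "z *\<^sub>C R2 x - A (R2 x) = x" using assms(2) by (auto simp: is_resolvent_def)
  moreover have "R1 (z *\<^sub>C R2 x - A (R2 x)) = R2 x" using assms(1) \<open>R2 x \<in> D\<close> by (auto simp: is_resolvent_def)
  ultimately show "R1 x = R2 x" by simp
qed

locale sectorial_semigroup =
  fixes D :: "'a::complex_banach set" and A :: "'a \<Rightarrow> 'a" and T :: "complex \<Rightarrow> 'a \<Rightarrow>\<^sub>L 'a"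
  assumes sectorial: "zero_sectorial D A" and semigroup: "analytic_semigroup_of D A T"
begin

lemma T_linear: "z = 0 \<or> 0 < Re z \<Longrightarrow> complex_linear (T z)"
  and T_0: "T 0 = id_blinfun"
  and T_add: "z = 0 \<or> 0 < Re z \<Longrightarrow> w = 0 \<or> 0 < Re w \<Longrightarrow> T (z + w) = T z o\<^sub>L T w"
  and T_at_zero: "((\<lambda>s. T (complex_of_real s) x) \<longlongrightarrow> x) (at_right 0)"
  and T_generator: "x \<in> D \<Longrightarrow> ((\<lambda>s. (1 / s) *\<^sub>R (T (complex_of_real s) x - x)) \<longlongrightarrow> - A x) (at_right 0)"
  and T_differentiable: "0 < Re z \<Longrightarrow> \<exists>y. ((\<lambda>h. (1 / h) *\<^sub>C (T (z + h) x - T z x)) \<longlongrightarrow> y) (at 0)"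
  using semigroup unfolding analytic_semigroup_of_def by blast+

lemma T_add_apply: "0 < Re z \<or> z = 0 \<Longrightarrow> 0 < Re w \<or> w = 0 \<Longrightarrow> T z (T w x) = T (z + w) x"
  by (subst T_add) auto

lemma T_isCont:
  assumes "0 < Re z"
  shows "isCont (\<lambda>z. T z x) z"
proof -
  obtain y where y: "((\<lambda>h. (1 / h) *\<^sub>C (T (z + h) x - T z x)) \<longlongrightarrow> y) (at 0)"
    using T_differentiable[OF assms] by blast
  have "((\<lambda>h. T z x + h *\<^sub>C ((1 / h) *\<^sub>C (T (z + h) x - T z x))) \<longlongrightarrow> T z x + 0 *\<^sub>C y) (at 0)"
    by (intro tendsto_add tendsto_const scaleC.tendsto y tendsto_ident_at)
  then have "((\<lambda>h. T (z + h) x) \<longlongrightarrow> T z x) (at 0)"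
  proof (rule Lim_transform_eventually[OF tendsto_eq_rhs])
    show "T z x + 0 *\<^sub>C y = T z x" by (simp add: scaleC.zero_left)
    show "\<forall>\<^sub>F h in at 0. T z x + h *\<^sub>C ((1 / h) *\<^sub>C (T (z + h) x - T z x)) = T (z + h) x"
      by (auto simp: eventually_at_filter scaleC_scaleC scaleC_one)
  qed
  then show ?thesis by (simp add: isCont_iff)
qed

lemma T_continuous_on:
  assumes "continuous_on S g" "\<And>s. s \<in> S \<Longrightarrow> 0 < Re (g s)"
  shows "continuous_on S (\<lambda>s. T (g s) x)"
proof (rule continuous_on_compose2[OF _ assms(1)])
  show "continuous_on {z. 0 < Re z} (\<lambda>z. T z x)"
    using T_isCont by (simp add: continuous_at_imp_continuous_on)
qed (use assms(2) in auto)

lemma T_continuous_real: "continuous_on {0..} (\<lambda>s. T (complex_of_real s) x)"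
proof (rule continuous_on_eq_continuous_within[THEN iffD2], rule ballI)
  fix s :: real assume s: "s \<in> {0..}"
  show "continuous (at s within {0..}) (\<lambda>s. T (complex_of_real s) x)"
  proof (cases "s = 0")
    case True
    have "((\<lambda>s. T (complex_of_real s) x) \<longlongrightarrow> x) (at 0 within {0..})"
    proof -
      have "at (0::real) within {0..} = at_right 0"
      proof -
        have "{0..} - {0::real} = {0<..} - {0}" by auto
        then show ?thesis by (simp only: at_within_def)
      qed
      then show ?thesis using T_at_zero by simp
    qed
    then show ?thesis using True by (simp add: continuous_within T_0)
  next
    case False
    then have "0 < Re (complex_of_real s)" using s by simp
    from isCont_o2[where f = complex_of_real and a = s and g = "\<lambda>z. T z x", OF _ T_isCont[OF this]]
    show ?thesis by (auto intro: continuous_at_imp_continuous_at_within)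
  qed
qed

lemma T_continuous_real_compose:
  assumes "continuous_on S g" "\<And>s. s \<in> S \<Longrightarrow> 0 \<le> g s"
  shows "continuous_on S (\<lambda>s. T (complex_of_real (g s)) x)"
  by (rule continuous_on_compose2[OF T_continuous_real assms(1)]) (use assms(2) in auto)

lemma T_real_derivative:
  assumes "0 < Re z"
  shows "\<exists>y. ((\<lambda>h. (1 / h) *\<^sub>R (T (z + complex_of_real h) x - T z x)) \<longlongrightarrow> y) (at 0)"
proof -
  obtain y where y: "((\<lambda>h. (1 / h) *\<^sub>C (T (z + h) x - T z x)) \<longlongrightarrow> y) (at 0)"
    using T_differentiable[OF assms] by blast
  have "filterlim complex_of_real (at 0) (at 0)"
    by (rule filterlim_atI) (auto simp: eventually_at_filter intro!: tendsto_eq_intros)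
  from filterlim_compose[OF y this]
  have "((\<lambda>h. (1 / complex_of_real h) *\<^sub>C (T (z + complex_of_real h) x - T z x)) \<longlongrightarrow> y) (at 0)" .
  moreover have "(1 / complex_of_real h) *\<^sub>C v = (1 / h) *\<^sub>R v" for h and v :: 'a
    using scaleC_of_real[of "1 / h" v] by simp
  ultimately show ?thesis by auto
qed

lemma has_vector_derivative_iff_quotient:
  fixes g :: "real \<Rightarrow> 'b::real_normed_vector"
  shows "(g has_vector_derivative y) (at s) \<longleftrightarrow> ((\<lambda>h. (1 / h) *\<^sub>R (g (s + h) - g s)) \<longlongrightarrow> y) (at 0)"
proof -
  have "(g has_vector_derivative y) (at s) \<longleftrightarrow> ((\<lambda>h. norm (g (s + h) - g s - h *\<^sub>R y) / norm h) \<longlongrightarrow> 0) (at 0)"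
    unfolding has_vector_derivative_def has_derivative_at by (auto intro: bounded_linear_intros)
  also have "\<dots> \<longleftrightarrow> ((\<lambda>h. norm ((1 / h) *\<^sub>R (g (s + h) - g s) - y)) \<longlongrightarrow> 0) (at 0)"
  proof (rule filterlim_cong[OF refl refl])
    have "norm (g (s + h) - g s - h *\<^sub>R y) / norm h = norm ((1 / h) *\<^sub>R (g (s + h) - g s) - y)" if "h \<noteq> 0" for h
    proof -
      have "(1 / h) *\<^sub>R (g (s + h) - g s) - y = (1 / h) *\<^sub>R (g (s + h) - g s - h *\<^sub>R y)"
        using that by (simp add: scaleR_right_diff_distrib)
      then show ?thesis by simp
    qed
    then show "\<forall>\<^sub>F h in at 0. norm (g (s + h) - g s - h *\<^sub>R y) / norm h = norm ((1 / h) *\<^sub>R (g (s + h) - g s) - y)"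
      by (auto simp: eventually_at_filter)
  qed
  finally show ?thesis by (simp add: tendsto_norm_zero_iff LIM_zero_iff)
qed

text \<open>Analyticity guarantees a two-sided derivative, so it can be identified from the right,
  where the semigroup law reduces the quotient to the one at time 0.\<close>

lemma T_derivative_domain:
  assumes "x \<in> D" "0 < s"
  shows "((\<lambda>s. T (complex_of_real s) x) has_vector_derivative - T (complex_of_real s) (A x)) (at s)"
proof -
  let ?q = "\<lambda>h. (1 / h) *\<^sub>R (T (complex_of_real (s + h)) x - T (complex_of_real s) x)"
  obtain y where y: "(?q \<longlongrightarrow> y) (at 0)"
    using T_real_derivative[of "complex_of_real s" x] assms(2) by auto
  have "((\<lambda>h. T (complex_of_real s) ((1 / h) *\<^sub>R (T (complex_of_real h) x - x))) \<longlongrightarrow> T (complex_of_real s) (- A x)) (at_right 0)"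
    by (intro tendsto_intros T_generator assms)
  moreover have "\<forall>\<^sub>F h in at_right 0. T (complex_of_real s) ((1 / h) *\<^sub>R (T (complex_of_real h) x - x)) = ?q h"
    using assms(2) by (auto simp: eventually_at_filter blinfun.scaleR_right blinfun.diff_right T_add_apply)
  ultimately have "(?q \<longlongrightarrow> T (complex_of_real s) (- A x)) (at_right 0)"
    by (rule Lim_transform_eventually)
  moreover have "(?q \<longlongrightarrow> y) (at_right 0)" using y by (rule tendsto_mono[rotated]) (simp add: at_le)
  ultimately have "y = T (complex_of_real s) (- A x)" by (intro tendsto_unique[of "at_right (0::real)"]) auto
  then show ?thesis using y by (simp add: has_vector_derivative_iff_quotient blinfun.minus_right)
qed

text \<open>The inverse of \<zeta> + A, which is the resolvent of the generator -A; the two signs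
  translate it into the resolvent of A at -\<zeta>.\<close>

definition R :: "complex \<Rightarrow> 'a \<Rightarrow>\<^sub>L 'a"
  where "R \<zeta> = - resolvent D A (- \<zeta>)"

lemma linear_op: "linear_operator D A"
  using sectorial by (simp add: zero_sectorial_def closed_operator_def)

lemma D_minus: "x \<in> D \<Longrightarrow> - x \<in> D" "x \<in> D \<Longrightarrow> A (- x) = - A x"
  using linear_op unfolding linear_operator_def by (metis scaleC_minus_one)+

lemma
  assumes "0 < Re \<zeta>"
  shows R_domain: "R \<zeta> x \<in> D" and R_right: "\<zeta> *\<^sub>C R \<zeta> x + A (R \<zeta> x) = x"
    and R_left: "x \<in> D \<Longrightarrow> R \<zeta> (\<zeta> *\<^sub>C x + A x) = x" and R_linear: "complex_linear (R \<zeta>)"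
proof -
  \<comment> \<open>The half-angle 1 is less than pi/2, so the closed sector stays in the closed
    right half-plane.\<close>
  have "- \<zeta> \<notin> closure (sector 1)" using closure_sector_subset[of 1] assms pi_gt3 by auto
  moreover have "op_spectrum D A \<subseteq> closure (sector 1)" using sectorial by (simp add: zero_sectorial_def)
  ultimately obtain R' where R': "is_resolvent D A (- \<zeta>) R'" by (auto simp: op_spectrum_def)
  then have "is_resolvent D A (- \<zeta>) (resolvent D A (- \<zeta>))"
    unfolding resolvent_def by (rule theI) (rule resolvent_unique[OF _ R'])
  then have r: "complex_linear (resolvent D A (- \<zeta>))" "\<And>x. resolvent D A (- \<zeta>) x \<in> D"
    "\<And>x. (- \<zeta>) *\<^sub>C resolvent D A (- \<zeta>) x - A (resolvent D A (- \<zeta>) x) = x"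
    "\<And>x. x \<in> D \<Longrightarrow> resolvent D A (- \<zeta>) ((- \<zeta>) *\<^sub>C x - A x) = x"
    unfolding is_resolvent_def by blast+
  show "R \<zeta> x \<in> D" using r(2) D_minus(1) by (simp add: R_def blinfun.minus_left)
  show "\<zeta> *\<^sub>C R \<zeta> x + A (R \<zeta> x) = x"
    using r(3)[of x] D_minus(2)[OF r(2)] by (simp add: R_def blinfun.minus_left scaleC.minus_left scaleC.minus_right)
  show "R \<zeta> (\<zeta> *\<^sub>C x + A x) = x" if "x \<in> D"
  proof -
    have "R \<zeta> (\<zeta> *\<^sub>C x + A x) = resolvent D A (- \<zeta>) (- (\<zeta> *\<^sub>C x + A x))"
      by (simp only: R_def blinfun.minus_left blinfun.minus_right)
    also have "- (\<zeta> *\<^sub>C x + A x) = (- \<zeta>) *\<^sub>C x - A x" by (simp add: scaleC.minus_left)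
    finally show ?thesis using r(4)[OF that] by simp
  qed
  show "complex_linear (R \<zeta>)" using r(1) by (simp add: R_def complex_linear_def blinfun.minus_left scaleC.minus_right)
qed

lemma R_bound: obtains M where "0 < M" "\<And>\<zeta>. 0 < Re \<zeta> \<Longrightarrow> cmod \<zeta> * norm (R \<zeta>) \<le> M"
proof -
  have "\<forall>\<omega>>0. (\<forall>\<theta>>\<omega>. \<exists>C. \<forall>z. z \<notin> closure (sector \<theta>) \<longrightarrow> cmod z * norm (resolvent D A z) \<le> C)"
    using sectorial unfolding zero_sectorial_def by blast
  then obtain C where C: "\<And>z. z \<notin> closure (sector (pi / 2)) \<Longrightarrow> cmod z * norm (resolvent D A z) \<le> C"
    using pi_gt3 by (metis divide_pos_pos half_gt_zero_iff field_sum_of_halves less_add_same_cancel1 zero_less_numeral pi_gt_zero)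
  have "cmod \<zeta> * norm (R \<zeta>) \<le> max C 1" if "0 < Re \<zeta>" for \<zeta>
  proof -
    have "- \<zeta> \<notin> closure (sector (pi / 2))" using closure_sector_subset[of "pi / 2"] that by auto
    from C[OF this] show ?thesis by (simp add: R_def)
  qed
  then show thesis by (intro that[of "max C 1"]) auto
qed

lemma R_identity:
  assumes "0 < Re \<zeta>" "0 < Re \<mu>"
  shows "R \<zeta> x - R \<mu> x = (\<mu> - \<zeta>) *\<^sub>C R \<zeta> (R \<mu> x)"
proof -
  let ?y = "R \<mu> x"
  have "(\<zeta> *\<^sub>C ?y + A ?y) + (\<mu> - \<zeta>) *\<^sub>C ?y = \<mu> *\<^sub>C ?y + A ?y"
    by (simp add: scaleC.diff_left)
  then have "x = (\<zeta> *\<^sub>C ?y + A ?y) + (\<mu> - \<zeta>) *\<^sub>C ?y"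
    by (simp only: R_right[OF assms(2)])
  then have "R \<zeta> x = R \<zeta> (\<zeta> *\<^sub>C ?y + A ?y) + R \<zeta> ((\<mu> - \<zeta>) *\<^sub>C ?y)"
    by (metis blinfun.add_right)
  then show ?thesis
    by (simp add: R_left[OF assms(1) R_domain[OF assms(2)]] complex_linear_scaleC[OF R_linear[OF assms(1)]])
qed

lemma R_continuous: "continuous_on {\<zeta>. 0 < Re \<zeta>} R"
proof -
  obtain M where M: "0 < M" "\<And>\<zeta>. 0 < Re \<zeta> \<Longrightarrow> cmod \<zeta> * norm (R \<zeta>) \<le> M" using R_bound by blast
  have "isCont R \<mu>" if \<mu>: "0 < Re \<mu>" for \<mu>
    unfolding isCont_def
  proof (rule Lim_null[THEN iffD2], rule Lim_null_comparison)
    let ?B = "\<lambda>\<zeta>. cmod (\<mu> - \<zeta>) * (M / cmod \<zeta>) * (M / cmod \<mu>)"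
    have nz: "\<mu> \<noteq> 0" using \<mu> by auto
    have "(?B \<longlongrightarrow> cmod (\<mu> - \<mu>) * (M / cmod \<mu>) * (M / cmod \<mu>)) (at \<mu>)"
      using nz by (intro tendsto_intros) auto
    then show "(?B \<longlongrightarrow> 0) (at \<mu>)" by simp
    have "open {\<zeta>. 0 < Re \<zeta>}" by (rule open_halfspace_Re_gt)
    then have "\<forall>\<^sub>F \<zeta> in at \<mu>. 0 < Re \<zeta>" using \<mu> eventually_at_in_open'[of "{\<zeta>. 0 < Re \<zeta>}" \<mu>] by simp
    then show "\<forall>\<^sub>F \<zeta> in at \<mu>. norm (R \<zeta> - R \<mu>) \<le> ?B \<zeta>"
    proof eventually_elim
      fix \<zeta> assume \<zeta>: "0 < Re \<zeta>"
      have Rn: "norm (R \<nu>) \<le> M / cmod \<nu>" if "0 < Re \<nu>" for \<nu>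
        using M(2)[OF that] that by (cases "\<nu> = 0") (auto simp: field_simps)
      show "norm (R \<zeta> - R \<mu>) \<le> ?B \<zeta>"
      proof (rule norm_blinfun_bound)
        show "0 \<le> ?B \<zeta>" using M(1) by simp
        fix x
        have "norm ((R \<zeta> - R \<mu>) x) = cmod (\<mu> - \<zeta>) * norm (R \<zeta> (R \<mu> x))"
          using R_identity[OF \<zeta> \<mu>] by (simp add: blinfun.diff_left norm_scaleC)
        also have "\<dots> \<le> cmod (\<mu> - \<zeta>) * (M / cmod \<zeta> * (M / cmod \<mu> * norm x))"
          using M(1) by (intro mult_left_mono order.trans[OF norm_blinfun] mult_mono Rn \<zeta> \<mu>) auto
        finally show "norm ((R \<zeta> - R \<mu>) x) \<le> ?B \<zeta> * norm x" by (simp add: mult_ac)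
      qed
    qed
  qed
  then show ?thesis by (simp add: continuous_at_imp_continuous_on)
qed

text \<open>By the resolvent identity the remainder divided by |h| is the norm of
  \<open>R (\<zeta> + h) - R \<zeta>\<close> applied to \<open>R \<zeta> x\<close>, so continuity of
  \<open>R\<close> suffices.\<close>

lemma R_has_derivative:
  assumes \<zeta>: "0 < Re \<zeta>"
  shows "((\<lambda>\<zeta>. R \<zeta> x) has_derivative (\<lambda>h. h *\<^sub>C (- R \<zeta> (R \<zeta> x)))) (at \<zeta>)"
  unfolding has_derivative_at
proof (intro conjI)
  show "bounded_linear (\<lambda>h. h *\<^sub>C (- R \<zeta> (R \<zeta> x)))" by (rule scaleC.bounded_linear_left)
  have op: "open {\<zeta>. 0 < Re \<zeta>}" by (rule open_halfspace_Re_gt)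
  have "isCont R \<zeta>" using R_continuous \<zeta> op by (simp add: continuous_on_eq_continuous_at)
  then have "((\<lambda>h. R (\<zeta> + h)) \<longlongrightarrow> R \<zeta>) (at 0)" by (simp add: isCont_iff)
  then have "((\<lambda>h. norm (R (\<zeta> + h) (R \<zeta> x) - R \<zeta> (R \<zeta> x))) \<longlongrightarrow> norm (R \<zeta> (R \<zeta> x) - R \<zeta> (R \<zeta> x))) (at 0)"
    by (intro tendsto_intros)
  then have "((\<lambda>h. norm (R (\<zeta> + h) (R \<zeta> x) - R \<zeta> (R \<zeta> x))) \<longlongrightarrow> 0) (at 0)" by simp
  moreover have "\<forall>\<^sub>F h in at 0. norm (R (\<zeta> + h) (R \<zeta> x) - R \<zeta> (R \<zeta> x)) =
    norm (R (\<zeta> + h) x - R \<zeta> x - h *\<^sub>C (- R \<zeta> (R \<zeta> x))) / norm h"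
  proof -
    have "open ((\<lambda>h. \<zeta> + h) -` {\<zeta>. 0 < Re \<zeta>})" by (intro open_vimage op continuous_intros)
    then have "\<forall>\<^sub>F h in at 0. h \<in> (\<lambda>h. \<zeta> + h) -` {\<zeta>. 0 < Re \<zeta>}" using \<zeta> by (intro eventually_at_in_open') auto
    moreover have "\<forall>\<^sub>F h::complex in at 0. h \<noteq> 0" by (auto simp: eventually_at_filter)
    ultimately show ?thesis
    proof eventually_elim
      case (elim h)
      then have "R (\<zeta> + h) x - R \<zeta> x = (- h) *\<^sub>C R (\<zeta> + h) (R \<zeta> x)"
        using R_identity[of "\<zeta> + h" \<zeta> x] \<zeta> by simp
      then have "R (\<zeta> + h) x - R \<zeta> x - h *\<^sub>C (- R \<zeta> (R \<zeta> x)) = (- h) *\<^sub>C (R (\<zeta> + h) (R \<zeta> x) - R \<zeta> (R \<zeta> x))"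
        by (simp add: scaleC.diff_right scaleC.minus_left scaleC.minus_right)
      then show ?case using elim(2) by (simp add: norm_scaleC)
    qed
  qed
  ultimately show "((\<lambda>h. norm (R (\<zeta> + h) x - R \<zeta> x - h *\<^sub>C (- R \<zeta> (R \<zeta> x))) / norm h) \<longlongrightarrow> 0) (at 0)"
    by (rule Lim_transform_eventually)
qed

section \<open>Truncated Laplace transforms and the growth bound\<close>

text \<open>The function \<open>w r\<close>, with \<open>R \<zeta> y\<close> carried along the orbit
  and multiplied by e^(\<zeta> r), has as derivative the integrand, because \<zeta> + A cancels the
  resolvent. The formula lives on [0, s] and presupposes no growth bound, which is what is being
  proved.\<close>

lemma laplace_truncated:
  assumes \<zeta>: "0 < Re \<zeta>" and s: "0 \<le> s"
  shows "integral {0..s} (\<lambda>r. exp (\<zeta> * complex_of_real r) *\<^sub>C T (complex_of_real (s - r)) y) =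
    exp (\<zeta> * complex_of_real s) *\<^sub>C R \<zeta> y - T (complex_of_real s) (R \<zeta> y)"
proof -
  let ?x = "R \<zeta> y"
  define w where "w r = exp (\<zeta> * complex_of_real r) *\<^sub>C T (complex_of_real (s - r)) ?x" for r
  have "((\<lambda>r. exp (\<zeta> * complex_of_real r) *\<^sub>C T (complex_of_real (s - r)) y) has_integral w s - w 0) {0..s}"
  proof (rule fundamental_theorem_of_calculus_interior[OF s])
    show "continuous_on {0..s} w"
      unfolding w_def by (intro scaleC.continuous_on T_continuous_real_compose continuous_intros) auto
    fix r assume r: "r \<in> {0<..<s}"
    have e: "((\<lambda>r. exp (\<zeta> * complex_of_real r)) has_vector_derivative \<zeta> * exp (\<zeta> * complex_of_real r)) (at r)"
      by (rule has_vector_derivative_real_field) (auto intro!: derivative_eq_intros)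
    have "((\<lambda>r. s - r) has_vector_derivative - 1) (at r)" by (auto intro!: derivative_eq_intros)
    from vector_diff_chain_at[OF this T_derivative_domain[OF R_domain[OF \<zeta>]]] r
    have t: "((\<lambda>r. T (complex_of_real (s - r)) ?x) has_vector_derivative T (complex_of_real (s - r)) (A ?x)) (at r)"
      by (simp add: o_def)
    have "(w has_vector_derivative exp (\<zeta> * complex_of_real r) *\<^sub>C T (complex_of_real (s - r)) (A ?x) +
      (\<zeta> * exp (\<zeta> * complex_of_real r)) *\<^sub>C T (complex_of_real (s - r)) ?x) (at r)"
      unfolding w_def by (rule scaleC.has_vector_derivative[OF e t])
    moreover have "exp (\<zeta> * complex_of_real r) *\<^sub>C T (complex_of_real (s - r)) (A ?x) +
      (\<zeta> * exp (\<zeta> * complex_of_real r)) *\<^sub>C T (complex_of_real (s - r)) ?x =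
      exp (\<zeta> * complex_of_real r) *\<^sub>C T (complex_of_real (s - r)) y"
    proof -
      have "T (complex_of_real (s - r)) y = T (complex_of_real (s - r)) (\<zeta> *\<^sub>C ?x + A ?x)"
        by (simp add: R_right[OF \<zeta>])
      also have "\<dots> = \<zeta> *\<^sub>C T (complex_of_real (s - r)) ?x + T (complex_of_real (s - r)) (A ?x)"
        using r by (simp add: blinfun.add_right complex_linear_scaleC[OF T_linear])
      finally show ?thesis by (simp add: scaleC.add_right scaleC_scaleC mult.commute)
    qed
    ultimately show "(w has_vector_derivative exp (\<zeta> * complex_of_real r) *\<^sub>C T (complex_of_real (s - r)) y) (at r)"
      by simp
  qed
  then show ?thesis by (simp add: integral_unique w_def T_0 scaleC_one)
qed

text \<open>The Laplace transform of the ramp convolved with the orbit of \<open>y\<close>. Its size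
  |\<zeta>|^-3 makes the line integral converge absolutely.\<close>

definition H :: "'a \<Rightarrow> complex \<Rightarrow> 'a"
  where "H y \<zeta> = inverse (\<zeta>\<^sup>2) *\<^sub>C R \<zeta> y"

definition H' :: "'a \<Rightarrow> complex \<Rightarrow> 'a"
  where "H' y \<zeta> = inverse (\<zeta>\<^sup>2) *\<^sub>C (- R \<zeta> (R \<zeta> y)) + (- 2 * inverse (\<zeta> ^ 3)) *\<^sub>C R \<zeta> y"

lemma H_has_derivative:
  assumes "0 < Re \<zeta>"
  shows "(H y has_derivative (\<lambda>h. h *\<^sub>C H' y \<zeta>)) (at \<zeta>)"
proof -
  have nz: "\<zeta> \<noteq> 0" using assms by auto
  have "((\<lambda>\<zeta>. inverse (\<zeta>\<^sup>2)) has_field_derivative (- 2 * inverse (\<zeta> ^ 3))) (at \<zeta>)"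
    using nz by (auto intro!: derivative_eq_intros simp: field_simps power2_eq_square power3_eq_cube)
  then have "((\<lambda>\<zeta>. inverse (\<zeta>\<^sup>2)) has_derivative (\<lambda>h. (- 2 * inverse (\<zeta> ^ 3)) * h)) (at \<zeta>)"
    by (simp only: has_field_derivative_def)
  from scaleC.FDERIV[OF this R_has_derivative[OF assms, of y]]
  have "(H y has_derivative (\<lambda>h. inverse (\<zeta>\<^sup>2) *\<^sub>C h *\<^sub>C (- R \<zeta> (R \<zeta> y)) + ((- 2 * inverse (\<zeta> ^ 3)) * h) *\<^sub>C R \<zeta> y)) (at \<zeta>)"
    by (simp add: H_def[abs_def])
  moreover have "inverse (\<zeta>\<^sup>2) *\<^sub>C h *\<^sub>C (- R \<zeta> (R \<zeta> y)) + ((- 2 * inverse (\<zeta> ^ 3)) * h) *\<^sub>C R \<zeta> y = h *\<^sub>C H' y \<zeta>" for h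
    by (simp only: H'_def scaleC.add_right scaleC_scaleC mult.commute)
  ultimately show ?thesis by simp
qed

lemma H_continuous: "continuous_on {\<zeta>. 0 < Re \<zeta>} (H y)" "continuous_on {\<zeta>. 0 < Re \<zeta>} (H' y)"
proof -
  have 1: "continuous_on {\<zeta>. 0 < Re \<zeta>} (\<lambda>\<zeta>. R \<zeta> x)" for x
    by (intro continuous_intros R_continuous)
  have 2: "continuous_on {\<zeta>. 0 < Re \<zeta>} (\<lambda>\<zeta>. R \<zeta> (R \<zeta> y))"
    by (intro bounded_bilinear.continuous_on[OF bounded_bilinear_blinfun_apply] R_continuous 1)
  show "continuous_on {\<zeta>. 0 < Re \<zeta>} (H y)"
    unfolding H_def by (intro scaleC.continuous_on 1 continuous_intros) auto
  show "continuous_on {\<zeta>. 0 < Re \<zeta>} (H' y)"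
    unfolding H'_def by (intro scaleC.continuous_on continuous_on_add continuous_on_minus 1 2 continuous_intros) auto
qed

lemma H_norm:
  assumes M: "0 < M" "\<And>\<zeta>. 0 < Re \<zeta> \<Longrightarrow> cmod \<zeta> * norm (R \<zeta>) \<le> M" and \<zeta>: "0 < Re \<zeta>"
  shows "norm (H y \<zeta>) \<le> M * norm y / cmod \<zeta> ^ 3"
proof -
  have nz: "cmod \<zeta> > 0" using \<zeta> by auto
  have "norm (H y \<zeta>) \<le> inverse (cmod \<zeta> ^ 2) * (norm (R \<zeta>) * norm y)"
    unfolding H_def norm_scaleC norm_inverse norm_power by (intro mult_left_mono norm_blinfun) simp
  also have "\<dots> = (cmod \<zeta> * norm (R \<zeta>)) * (inverse (cmod \<zeta> ^ 3) * norm y)"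
    using nz by (simp add: field_simps power2_eq_square power3_eq_cube)
  also have "\<dots> \<le> M * (inverse (cmod \<zeta> ^ 3) * norm y)"
    by (intro mult_right_mono M \<zeta>) simp
  finally show ?thesis by (simp add: field_simps)
qed

text \<open>Cauchy's theorem for a rectangle, by interchanging the two integrations of \<open>H'\<close>; moving the
  line of integration to the right makes the integral vanish.\<close>

lemma H_line_integral_bound:
  assumes M: "0 < M" "\<And>\<zeta>. 0 < Re \<zeta> \<Longrightarrow> cmod \<zeta> * norm (R \<zeta>) \<le> M" and N: "1 \<le> N" and c: "0 < c" "c \<le> 1"
  shows "norm (integral {-N..N} (\<lambda>\<tau>. H y (vline c \<tau>))) \<le> 4 * M * norm y / N\<^sup>2"
proof -
  note Hb = H_norm[OF M]
  have cont: "continuous_on S (\<lambda>z. H y (g z))" "continuous_on S (\<lambda>z. H' y (g z))"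
    if "continuous_on S g" "\<And>z. z \<in> S \<Longrightarrow> 0 < Re (g z)" for S :: "'b::topological_space set" and g
    using that by (auto intro!: continuous_on_compose2[OF H_continuous(1)] continuous_on_compose2[OF H_continuous(2)])
  let ?J = "\<lambda>c. integral {-N..N} (\<lambda>\<tau>. H y (vline c \<tau>))"
  have NH: "c \<le> N" using N c by simp
  have d_c: "integral {c..N} (\<lambda>b. H' y (vline b \<tau>)) = H y (vline N \<tau>) - H y (vline c \<tau>)" for \<tau>
  proof (rule integral_unique, rule fundamental_theorem_of_calculus[OF NH])
    fix b assume "b \<in> {c..N}"
    then have "0 < Re (vline b \<tau>)" using c by simp
    from H_has_derivative[OF this, of y]
    have "((\<lambda>b. H y (vline b \<tau>)) has_derivative (\<lambda>h. (complex_of_real h) *\<^sub>C H' y (vline b \<tau>))) (at b within {c..N})"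
      by (rule has_derivative_compose[rotated]) (auto intro!: derivative_eq_intros)
    then show "((\<lambda>b. H y (vline b \<tau>)) has_vector_derivative H' y (vline b \<tau>)) (at b within {c..N})"
      by (simp add: has_vector_derivative_def scaleC_of_real)
  qed
  have d_\<tau>: "integral {-N..N} (\<lambda>\<tau>. H' y (vline b \<tau>)) = (- \<i>) *\<^sub>C (H y (vline b N) - H y (vline b (- N)))" if "0 < b" for b
  proof -
    have "((\<lambda>\<tau>. \<i> *\<^sub>C H' y (vline b \<tau>)) has_integral H y (vline b N) - H y (vline b (- N))) {-N..N}"
    proof (rule fundamental_theorem_of_calculus)
      fix \<tau>
      have "0 < Re (vline b \<tau>)" using that by simp
      from H_has_derivative[OF this, of y]
      have "((\<lambda>\<tau>. H y (vline b \<tau>)) has_derivative (\<lambda>h. (\<i> * complex_of_real h) *\<^sub>C H' y (vline b \<tau>))) (at \<tau> within {-N..N})"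
        by (rule has_derivative_compose[rotated]) (auto intro!: derivative_eq_intros)
      then show "((\<lambda>\<tau>. H y (vline b \<tau>)) has_vector_derivative \<i> *\<^sub>C H' y (vline b \<tau>)) (at \<tau> within {-N..N})"
        by (simp add: has_vector_derivative_def scaleC_of_real[symmetric] scaleC_scaleC mult.commute)
    qed (use N in simp)
    from has_integral_linear[OF this scaleC.bounded_linear_right[of "- \<i>"]]
    show ?thesis by (intro integral_unique) (simp add: o_def scaleC_scaleC scaleC_one)
  qed
  have "?J N - ?J c = integral {-N..N} (\<lambda>\<tau>. integral {c..N} (\<lambda>b. H' y (vline b \<tau>)))"
    unfolding d_c
    by (subst Henstock_Kurzweil_Integration.integral_diff)
      (use N c in \<open>auto intro!: integrable_continuous_real cont continuous_intros\<close>)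
  also have "\<dots> = integral {c..N} (\<lambda>b. integral {-N..N} (\<lambda>\<tau>. H' y (vline b \<tau>)))"
    unfolding box_real[symmetric]
    by (rule integral_swap_continuous)
      (use c in \<open>auto simp: case_prod_beta cbox_Pair_eq intro!: cont continuous_intros\<close>)
  finally have diff: "?J N - ?J c = integral {c..N} (\<lambda>b. integral {-N..N} (\<lambda>\<tau>. H' y (vline b \<tau>)))" .
  \<comment> \<open>The integral over a vertical segment is a difference of values on the two
    horizontal sides, where |\<zeta>| is at least N. Integrated over a length at most N this gives
    the first 2 M / N^2; the line with real part N, of length 2 N, gives the second.\<close>
  have e: "norm (integral {-N..N} (\<lambda>\<tau>. H' y (vline b \<tau>))) \<le> 2 * M * norm y / N ^ 3" if b0: "0 < b" for b
  proof -
    have "norm (H y (vline b \<tau>)) \<le> M * norm y / N ^ 3" if "\<bar>\<tau>\<bar> = N" for \<tau>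
    proof -
      have "N \<le> cmod (vline b \<tau>)" using abs_Im_le_cmod[of "vline b \<tau>"] that by simp
      then have "N ^ 3 \<le> cmod (vline b \<tau>) ^ 3" using N by (intro power_mono) auto
      then have "M * norm y / cmod (vline b \<tau>) ^ 3 \<le> M * norm y / N ^ 3"
        using M N by (intro divide_left_mono) (auto intro!: mult_pos_pos)
      moreover have "norm (H y (vline b \<tau>)) \<le> M * norm y / cmod (vline b \<tau>) ^ 3"
      proof (rule Hb)
        have "Re (vline b \<tau>) = b" by simp
        then show "0 < Re (vline b \<tau>)" using b0 by (simp only:)
      qed
      ultimately show ?thesis by simp
    qed
    from this[of N] this[of "- N"] N show ?thesis
      unfolding d_\<tau>[OF b0] norm_scaleC
      using norm_triangle_ineq4[of "H y (vline b N)" "H y (vline b (- N))"] by simp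
  qed
  have "norm (?J N - ?J c) \<le> 2 * M * norm y / N ^ 3 * (N - c)"
    unfolding diff
  proof (rule integral_bound[OF NH])
    show "continuous_on {c..N} (\<lambda>b. integral {-N..N} (\<lambda>\<tau>. H' y (vline b \<tau>)))"
    proof (rule continuous_on_eq)
      show "continuous_on {c..N} (\<lambda>b. (- \<i>) *\<^sub>C (H y (vline b N) - H y (vline b (- N))))"
        using c by (intro scaleC.continuous_on continuous_on_diff cont continuous_intros) auto
    qed (use d_\<tau> c in auto)
  qed (use e c in auto)
  also have "\<dots> \<le> 2 * M * norm y / N ^ 3 * N" using M N c by (intro mult_left_mono) auto
  also have "\<dots> = 2 * M * norm y / N\<^sup>2" using N by (simp add: power2_eq_square power3_eq_cube)
  finally have 1: "norm (?J N - ?J c) \<le> 2 * M * norm y / N\<^sup>2" .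
  have "norm (?J N) \<le> M * norm y / N ^ 3 * (N - - N)"
  proof (rule integral_bound)
    show "continuous_on {-N..N} (\<lambda>\<tau>. H y (vline N \<tau>))" using N by (intro cont continuous_intros) auto
    fix \<tau>
    have "N \<le> cmod (vline N \<tau>)" using abs_Re_le_cmod[of "vline N \<tau>"] N by simp
    then have "N ^ 3 \<le> cmod (vline N \<tau>) ^ 3" using N by (intro power_mono) auto
    then have "M * norm y / cmod (vline N \<tau>) ^ 3 \<le> M * norm y / N ^ 3"
      using M N by (intro divide_left_mono) (auto intro!: mult_pos_pos)
    moreover have "norm (H y (vline N \<tau>)) \<le> M * norm y / cmod (vline N \<tau>) ^ 3"
    proof (rule Hb)
      have "Re (vline N \<tau>) = N" by simp
      then show "0 < Re (vline N \<tau>)" using N by linarith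
    qed
    ultimately show "norm (H y (vline N \<tau>)) \<le> M * norm y / N ^ 3" by simp
  qed (use N in simp)
  also have "\<dots> = 2 * M * norm y / N\<^sup>2" using N by (simp add: power2_eq_square power3_eq_cube)
  finally have 2: "norm (?J N) \<le> 2 * M * norm y / N\<^sup>2" .
  have "norm (?J c) \<le> norm (?J N) + norm (?J N - ?J c)"
    using norm_triangle_ineq4[of "?J N" "?J N - ?J c"] by simp
  also have "\<dots> \<le> 2 * M * norm y / N\<^sup>2 + 2 * M * norm y / N\<^sup>2" using 1 2 by (rule add_mono[rotated])
  finally show ?thesis by (simp add: field_simps)
qed

end

context sectorial_semigroup
begin

text \<open>Divide \<open>laplace_truncated\<close> by \<zeta>^2 and integrate over |\<tau>| up to
  N. The left side tends to \<open>2 * pi\<close> times the ramp integral; on the right the term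
  with \<open>T s\<close> vanishes by \<open>H_line_integral_bound\<close>, which leaves the
  integral of e^(\<zeta> s) \<open>H y\<close>, of size e^(s/2). The unknown size of the semigroup
  enters only terms that disappear as N grows.\<close>

lemma ramp_bound:
  obtains C where "0 < C" "\<And>s y. 0 \<le> s \<Longrightarrow>
    norm (integral {0..s} (\<lambda>r. r *\<^sub>R T (complex_of_real (s - r)) y)) \<le> C * exp (s / 2) * norm y"
proof -
  obtain M where M: "0 < M" "\<And>\<zeta>. 0 < Re \<zeta> \<Longrightarrow> cmod \<zeta> * norm (R \<zeta>) \<le> M" using R_bound by blast
  \<comment> \<open>The real part of the line is the resulting exponential rate; 1/2 is below the
    rate 1 of the weight e^-s.\<close>
  define c :: real where "c = 1 / 2"
  have c: "0 < c" "c \<le> 1" by (simp_all add: c_def)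
  obtain \<delta> :: "nat \<Rightarrow> real" where \<delta>: "\<delta> \<longlonglongrightarrow> 0"
    "\<And>N r. 0 \<le> r \<Longrightarrow> cmod (integral {-real N..real N} (\<lambda>\<tau>. exp (vline c \<tau> * complex_of_real r) * inverse ((vline c \<tau>)\<^sup>2)) - complex_of_real (2 * pi * r)) \<le> exp (c * r) * \<delta> N"
    using laplace_inversion_ramp_truncated[OF c(1)] by blast
  have Re_v: "0 < Re (vline c \<tau>)" "vline c \<tau> \<noteq> 0" for \<tau>
  proof -
    show 1: "0 < Re (vline c \<tau>)" using c by simp
    then show "vline c \<tau> \<noteq> 0" by force
  qed
  have Hc: "continuous_on S (\<lambda>\<tau>. H y (vline c \<tau>))" for S y
    by (rule continuous_on_compose2[OF H_continuous(1)]) (use c in \<open>auto intro!: continuous_intros\<close>)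
  have main: "norm (integral {0..s} (\<lambda>r. r *\<^sub>R T (complex_of_real (s - r)) y)) \<le> 8 * M * exp (s / 2) * norm y"
    if s: "0 \<le> s" for s y
  proof -
    let ?W = "integral {0..s} (\<lambda>r. complex_of_real (2 * pi * r) *\<^sub>C T (complex_of_real (s - r)) y)"
    have Tc: "continuous_on {0..s} (\<lambda>r. T (complex_of_real (s - r)) y)"
      by (intro T_continuous_real_compose continuous_intros) auto
    have "compact ((\<lambda>r. T (complex_of_real (s - r)) y) ` {0..s})" by (intro compact_continuous_image Tc) simp
    then have "bounded ((\<lambda>r. T (complex_of_real (s - r)) y) ` {0..s})" by (rule compact_imp_bounded)
    then obtain B where B: "\<And>r. r \<in> {0..s} \<Longrightarrow> norm (T (complex_of_real (s - r)) y) \<le> B" unfolding bounded_iff by blast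
    have "0 \<in> {0..s}" using s by simp
    from order.trans[OF norm_ge_zero B[OF this]] have B0: "0 \<le> B" .
    \<comment> \<open>The truncated inversion integral, which approximates \<open>2 * pi * r\<close>
      on [0, s].\<close>
    define p where "p N r = integral {-real N..real N} (\<lambda>\<tau>. exp (vline c \<tau> * complex_of_real r) * inverse ((vline c \<tau>)\<^sup>2))" for N :: nat and r
    have bound: "norm ?W \<le> 8 * M * pi * exp (s / 2) * norm y + (norm (T (complex_of_real s)) * (4 * M * norm y / (real N)\<^sup>2) + exp (c * s) * \<bar>\<delta> N\<bar> * B * s)"
      if N: "1 \<le> N" for N :: nat
    proof -
      let ?I = "{-real N..real N}"
      let ?V = "integral ?I (\<lambda>\<tau>. exp (vline c \<tau> * complex_of_real s) *\<^sub>C H y (vline c \<tau>))"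
      let ?J = "integral ?I (\<lambda>\<tau>. H y (vline c \<tau>))"
      let ?k = "\<lambda>\<tau> r. (exp (vline c \<tau> * complex_of_real r) * inverse ((vline c \<tau>)\<^sup>2)) *\<^sub>C T (complex_of_real (s - r)) y"
      have kc: "continuous_on (cbox (- real N, 0) (real N, s)) (\<lambda>(\<tau>, r). ?k \<tau> r)"
        unfolding case_prod_beta
        by (intro scaleC.continuous_on T_continuous_real_compose continuous_intros) (auto simp: Re_v cbox_Pair_eq)
      have inner: "integral {0..s} (?k \<tau>) = exp (vline c \<tau> * complex_of_real s) *\<^sub>C H y (vline c \<tau>) - T (complex_of_real s) (H y (vline c \<tau>))" for \<tau>
      proof -
        have "integral {0..s} (?k \<tau>) = inverse ((vline c \<tau>)\<^sup>2) *\<^sub>C integral {0..s} (\<lambda>r. exp (vline c \<tau> * complex_of_real r) *\<^sub>C T (complex_of_real (s - r)) y)"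
        proof -
          have "(\<lambda>r. exp (vline c \<tau> * complex_of_real r) *\<^sub>C T (complex_of_real (s - r)) y) integrable_on {0..s}"
            by (intro integrable_continuous_real scaleC.continuous_on Tc continuous_intros)
          from integral_linear[OF this scaleC.bounded_linear_right[of "inverse ((vline c \<tau>)\<^sup>2)"]]
          show ?thesis by (simp add: o_def scaleC_scaleC mult.commute)
        qed
        moreover have "complex_linear (T (complex_of_real s))"
          by (rule T_linear) (use s in \<open>auto simp: le_less\<close>)
        ultimately show ?thesis
          unfolding laplace_truncated[OF Re_v(1) s]
          by (simp add: H_def scaleC.diff_right complex_linear_scaleC scaleC_scaleC mult.commute)
      qed
      have "?V - T (complex_of_real s) ?J = integral ?I (\<lambda>\<tau>. integral {0..s} (?k \<tau>))"
      proof -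
        have 1: "(\<lambda>\<tau>. exp (vline c \<tau> * complex_of_real s) *\<^sub>C H y (vline c \<tau>)) integrable_on ?I"
          by (intro integrable_continuous_real scaleC.continuous_on Hc continuous_intros)
        have 2: "(\<lambda>\<tau>. H y (vline c \<tau>)) integrable_on ?I" by (intro integrable_continuous_real Hc)
        have 3: "(\<lambda>\<tau>. T (complex_of_real s) (H y (vline c \<tau>))) integrable_on ?I"
          by (intro integrable_continuous_real continuous_intros Hc)
        have "T (complex_of_real s) ?J = integral ?I (\<lambda>\<tau>. T (complex_of_real s) (H y (vline c \<tau>)))"
          using integral_linear[OF 2 blinfun.bounded_linear_right[of "T (complex_of_real s)"]] by (simp add: o_def)
        then show ?thesis unfolding inner by (simp only: Henstock_Kurzweil_Integration.integral_diff[OF 1 3])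
      qed
      also have "\<dots> = integral {0..s} (\<lambda>r. integral ?I (\<lambda>\<tau>. ?k \<tau> r))"
        using integral_swap_continuous[OF kc] by (simp only: box_real)
      also have "\<dots> = integral {0..s} (\<lambda>r. p N r *\<^sub>C T (complex_of_real (s - r)) y)"
      proof (rule Henstock_Kurzweil_Integration.integral_cong)
        fix r
        have "(\<lambda>\<tau>. exp (vline c \<tau> * complex_of_real r) * inverse ((vline c \<tau>)\<^sup>2)) integrable_on ?I"
          by (intro integrable_continuous_real continuous_intros) (use Re_v in auto)
        from integral_linear[OF this scaleC.bounded_linear_left[of "T (complex_of_real (s - r)) y"]]
        show "integral ?I (\<lambda>\<tau>. ?k \<tau> r) = p N r *\<^sub>C T (complex_of_real (s - r)) y"
          by (simp add: o_def p_def)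
      qed
      finally have eq: "?V - T (complex_of_real s) ?J = integral {0..s} (\<lambda>r. p N r *\<^sub>C T (complex_of_real (s - r)) y)" .
      have pc: "continuous_on {0..s} (p N)"
        unfolding p_def box_real[symmetric]
        by (rule integral_continuous_on_param) (use Re_v in \<open>auto intro!: continuous_intros simp: case_prod_beta\<close>)
      have "?W - (?V - T (complex_of_real s) ?J) = integral {0..s} (\<lambda>r. (complex_of_real (2 * pi * r) - p N r) *\<^sub>C T (complex_of_real (s - r)) y)"
      proof -
        have 1: "(\<lambda>r. complex_of_real (2 * pi * r) *\<^sub>C T (complex_of_real (s - r)) y) integrable_on {0..s}"
          by (intro integrable_continuous_real scaleC.continuous_on Tc continuous_intros)
        have 2: "(\<lambda>r. p N r *\<^sub>C T (complex_of_real (s - r)) y) integrable_on {0..s}"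
          by (intro integrable_continuous_real scaleC.continuous_on Tc pc)
        show ?thesis unfolding eq scaleC.diff_left Henstock_Kurzweil_Integration.integral_diff[OF 1 2] ..
      qed
      also have "norm \<dots> \<le> exp (c * s) * \<bar>\<delta> N\<bar> * B * (s - 0)"
      proof (rule integral_bound[OF s])
        show "continuous_on {0..s} (\<lambda>r. (complex_of_real (2 * pi * r) - p N r) *\<^sub>C T (complex_of_real (s - r)) y)"
          by (intro scaleC.continuous_on Tc pc continuous_intros)
        fix r assume r: "r \<in> {0..s}"
        have "cmod (complex_of_real (2 * pi * r) - p N r) \<le> exp (c * r) * \<delta> N"
          using \<delta>(2)[of r N] r by (simp add: p_def norm_minus_commute)
        also have "\<dots> \<le> exp (c * r) * \<bar>\<delta> N\<bar>" by (intro mult_left_mono) auto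
        also have "\<dots> \<le> exp (c * s) * \<bar>\<delta> N\<bar>"
          using r c by (intro mult_right_mono) auto
        finally show "norm ((complex_of_real (2 * pi * r) - p N r) *\<^sub>C T (complex_of_real (s - r)) y) \<le> exp (c * s) * \<bar>\<delta> N\<bar> * B"
          unfolding norm_scaleC by (intro mult_mono B[OF r]) auto
      qed
      finally have e1: "norm (?W - (?V - T (complex_of_real s) ?J)) \<le> exp (c * s) * \<bar>\<delta> N\<bar> * B * s" by simp
      have e2: "norm (T (complex_of_real s) ?J) \<le> norm (T (complex_of_real s)) * (4 * M * norm y / (real N)\<^sup>2)"
        using N by (intro order.trans[OF norm_blinfun] mult_left_mono H_line_integral_bound[OF M _ c]) auto
      \<comment> \<open>On this line |\<zeta>| is at least 1/2 and |\<zeta>|^2 at least (1 +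
        \<tau>^2)/4, so |\<zeta>|^3 is at least (1 + \<tau>^2)/8; the arctangent contributes at most
        pi.\<close>
      have e3: "norm ?V \<le> 8 * M * pi * exp (s / 2) * norm y"
      proof -
        let ?g = "\<lambda>\<tau>. 8 * M * exp (s / 2) * norm y * inverse (1 + \<tau>\<^sup>2)"
        have at: "(?g has_integral 8 * M * exp (s / 2) * norm y * (arctan (real N) - arctan (- real N))) ?I"
          by (intro has_integral_mult_right fundamental_theorem_of_calculus)
            (auto intro!: derivative_eq_intros simp: has_real_derivative_iff_has_vector_derivative[symmetric])
        have "norm ?V \<le> integral ?I ?g"
        proof (rule Henstock_Kurzweil_Integration.integral_norm_bound_integral)
          show "(\<lambda>\<tau>. exp (vline c \<tau> * complex_of_real s) *\<^sub>C H y (vline c \<tau>)) integrable_on ?I"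
            by (intro integrable_continuous_real scaleC.continuous_on Hc continuous_intros)
          show "?g integrable_on ?I" using at by blast
          fix \<tau>
          have z: "1 / 2 \<le> cmod (vline c \<tau>)" using abs_Re_le_cmod[of "vline c \<tau>"] by (simp add: c_def)
          have "(1 + \<tau>\<^sup>2) / 4 \<le> (cmod (vline c \<tau>))\<^sup>2" unfolding cmod_vline_square by (simp add: c_def power2_eq_square)
          then have "(1 / 2) * ((1 + \<tau>\<^sup>2) / 4) \<le> cmod (vline c \<tau>) * (cmod (vline c \<tau>))\<^sup>2"
            using z by (intro mult_mono) auto
          then have "(1 + \<tau>\<^sup>2) / 8 \<le> cmod (vline c \<tau>) ^ 3" by (simp add: power3_eq_cube power2_eq_square)
          then have "M * norm y / cmod (vline c \<tau>) ^ 3 \<le> M * norm y / ((1 + \<tau>\<^sup>2) / 8)"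
            using M z by (intro divide_left_mono mult_pos_pos zero_less_power) (auto simp: add_pos_nonneg)
          then have h: "norm (H y (vline c \<tau>)) \<le> M * norm y / ((1 + \<tau>\<^sup>2) / 8)"
            using H_norm[OF M Re_v(1)] order.trans by blast
          have "norm (exp (vline c \<tau> * complex_of_real s) *\<^sub>C H y (vline c \<tau>)) = exp (s / 2) * norm (H y (vline c \<tau>))"
            by (simp add: norm_scaleC c_def)
          also have "\<dots> \<le> exp (s / 2) * (M * norm y / ((1 + \<tau>\<^sup>2) / 8))" by (intro mult_left_mono h) simp
          also have "\<dots> = ?g \<tau>" by (simp add: field_simps)
          finally show "norm (exp (vline c \<tau> * complex_of_real s) *\<^sub>C H y (vline c \<tau>)) \<le> ?g \<tau>" .
        qed
        also have "\<dots> = 8 * M * exp (s / 2) * norm y * (arctan (real N) - arctan (- real N))" using at by (rule integral_unique)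
        also have "\<dots> \<le> 8 * M * exp (s / 2) * norm y * pi"
          using M arctan_ubound[of "real N"] by (intro mult_left_mono) (auto simp: arctan_minus)
        finally show ?thesis by (simp add: mult_ac)
      qed
      have tri: "norm w \<le> norm (w - (v - t)) + (norm v + norm t)" for w v t :: 'a
        using norm_triangle_ineq[of "w - (v - t)" "v - t"] norm_triangle_ineq4[of v t] by simp
      show ?thesis using tri[of ?W ?V "T (complex_of_real s) ?J"] e1 e2 e3 by linarith
    qed
    have "norm ?W \<le> 8 * M * pi * exp (s / 2) * norm y + (norm (T (complex_of_real s)) * 0 + exp (c * s) * 0 * B * s)"
    proof (rule LIMSEQ_le_const)
      have "(\<lambda>N. 4 * M * norm y * (inverse (real N))\<^sup>2) \<longlonglongrightarrow> 4 * M * norm y * 0\<^sup>2"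
        by (intro tendsto_mult tendsto_power tendsto_const lim_inverse_n)
      then have l1: "(\<lambda>N. 4 * M * norm y / (real N)\<^sup>2) \<longlonglongrightarrow> 0" by (simp add: divide_inverse power_inverse)
      have l2: "(\<lambda>N. \<bar>\<delta> N\<bar>) \<longlonglongrightarrow> 0" using tendsto_rabs[OF \<delta>(1)] by simp
      show "(\<lambda>N. 8 * M * pi * exp (s / 2) * norm y + (norm (T (complex_of_real s)) * (4 * M * norm y / (real N)\<^sup>2) + exp (c * s) * \<bar>\<delta> N\<bar> * B * s)) \<longlonglongrightarrow>
        8 * M * pi * exp (s / 2) * norm y + (norm (T (complex_of_real s)) * 0 + exp (c * s) * 0 * B * s)"
        by (intro tendsto_add tendsto_mult tendsto_const l1 l2)
    qed (use bound in blast)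
    then have W: "norm ?W \<le> 8 * M * pi * exp (s / 2) * norm y" by simp
    have "?W = (2 * pi) *\<^sub>R integral {0..s} (\<lambda>r. r *\<^sub>R T (complex_of_real (s - r)) y)"
      unfolding scaleC_of_real
      by (subst Henstock_Kurzweil_Integration.integral_cmul[symmetric]) simp
    then have "2 * pi * norm (integral {0..s} (\<lambda>r. r *\<^sub>R T (complex_of_real (s - r)) y)) \<le> 8 * M * pi * exp (s / 2) * norm y"
      using W by simp
    then have "pi * (2 * norm (integral {0..s} (\<lambda>r. r *\<^sub>R T (complex_of_real (s - r)) y))) \<le> pi * (8 * M * exp (s / 2) * norm y)"
      by (simp add: mult_ac)
    then have "2 * norm (integral {0..s} (\<lambda>r. r *\<^sub>R T (complex_of_real (s - r)) y)) \<le> 8 * M * exp (s / 2) * norm y"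
      by (rule mult_left_le_imp_le) simp
    then show ?thesis using norm_ge_zero[of "integral {0..s} (\<lambda>r. r *\<^sub>R T (complex_of_real (s - r)) y)"] by linarith
  qed
  show thesis by (rule that[of "8 * M"]) (use M(1) main in auto)
qed

text \<open>The vector g is the derivative of the orbit at time 1, which exists for every y by
  analyticity; later derivatives are its images under the semigroup.\<close>

lemma T_shifted_derivative:
  "\<exists>g. \<forall>r\<ge>0. ((\<lambda>r. T (complex_of_real (1 + r)) y) has_vector_derivative T (complex_of_real r) g) (at r)"
proof -
  obtain g where g: "((\<lambda>h. (1 / h) *\<^sub>R (T (1 + complex_of_real h) y - T 1 y)) \<longlongrightarrow> g) (at 0)"
    using T_real_derivative[of 1 y] by auto
  have "((\<lambda>r. T (complex_of_real (1 + r)) y) has_vector_derivative T (complex_of_real r) g) (at r)" if r: "0 \<le> r" for r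
    unfolding has_vector_derivative_iff_quotient
  proof (rule Lim_transform_eventually)
    show "((\<lambda>h. T (complex_of_real r) ((1 / h) *\<^sub>R (T (1 + complex_of_real h) y - T 1 y))) \<longlongrightarrow> T (complex_of_real r) g) (at 0)"
      by (intro tendsto_intros g)
    have "\<forall>\<^sub>F h in at (0::real). h \<in> {-1<..<1}" by (intro eventually_at_in_open') auto
    then show "\<forall>\<^sub>F h in at 0. T (complex_of_real r) ((1 / h) *\<^sub>R (T (1 + complex_of_real h) y - T 1 y)) =
      (1 / h) *\<^sub>R (T (complex_of_real (1 + (r + h))) y - T (complex_of_real (1 + r)) y)"
    proof eventually_elim
      case (elim h)
      have "complex_of_real r + (1 + complex_of_real h) = complex_of_real (1 + (r + h))" "complex_of_real r + 1 = complex_of_real (1 + r)"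
        by simp_all
      then show ?case using elim r
        by (simp add: blinfun.scaleR_right blinfun.diff_right T_add_apply less_le del: of_real_add)
    qed
  qed
  then show ?thesis by blast
qed

text \<open>Taylor's formula of order two from time 2 on: the second derivative of the orbit is
  again an orbit, that of \<open>g2\<close>, so the remainder is a ramp integral and
  \<open>ramp_bound\<close> applies. Since \<open>g1\<close> and \<open>g2\<close> depend on y
  without an explicit bound, the estimate is first pointwise, and uniform boundedness makes it
  uniform.\<close>

theorem T_growth:
  obtains K where "0 < K" "\<And>s. 0 \<le> s \<Longrightarrow> norm (T (complex_of_real s)) \<le> K * exp (s / 2)"
proof -
  obtain C where C: "0 < C" "\<And>s y. 0 \<le> s \<Longrightarrow>
    norm (integral {0..s} (\<lambda>r. r *\<^sub>R T (complex_of_real (s - r)) y)) \<le> C * exp (s / 2) * norm y"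
    using ramp_bound by blast
  have "\<exists>K. \<forall>s\<ge>0. norm (T (complex_of_real s) y) \<le> K * exp (s / 2)" for y
  proof -
    obtain g1 where g1: "\<And>r. 0 \<le> r \<Longrightarrow> ((\<lambda>r. T (complex_of_real (1 + r)) y) has_vector_derivative T (complex_of_real r) g1) (at r)"
      using T_shifted_derivative by blast
    obtain g2 where g2: "\<And>r. 0 \<le> r \<Longrightarrow> ((\<lambda>r. T (complex_of_real (1 + r)) g1) has_vector_derivative T (complex_of_real r) g2) (at r)"
      using T_shifted_derivative by blast
    have far: "norm (T (complex_of_real (2 + s)) y) \<le> (C * norm g2 + 2 * norm (T 1 g1) + norm (T 2 y)) * exp (s / 2)" if s: "0 \<le> s" for s
    proof -
      \<comment> \<open>The antiderivative of \<open>r *\<close> the orbit of \<open>g2\<close> at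
        time s - r, found by integrating by parts twice; its values at the ends give the Taylor
        polynomial.\<close>
      define Q where "Q r = - (r *\<^sub>R T (complex_of_real (1 + (s - r))) g1) - T (complex_of_real (1 + (1 + (s - r)))) y" for r
      have "((\<lambda>r. r *\<^sub>R T (complex_of_real (s - r)) g2) has_integral Q s - Q 0) {0..s}"
      proof (rule fundamental_theorem_of_calculus[OF s])
        fix r assume r: "r \<in> {0..s}"
        have m: "((\<lambda>r. s - r) has_vector_derivative - 1) (at r)" "((\<lambda>r. 1 + (s - r)) has_vector_derivative - 1) (at r)"
          by (auto intro!: derivative_eq_intros)
        have d2: "((\<lambda>r. T (complex_of_real (1 + (s - r))) g1) has_vector_derivative - T (complex_of_real (s - r)) g2) (at r)"
          using vector_diff_chain_at[OF m(1) g2[of "s - r"]] r by (simp add: o_def)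
        have d1: "((\<lambda>r. T (complex_of_real (1 + (1 + (s - r)))) y) has_vector_derivative - T (complex_of_real (1 + (s - r))) g1) (at r)"
          using vector_diff_chain_at[OF m(2) g1[of "1 + (s - r)"]] r by (simp add: o_def)
        have "(Q has_vector_derivative - (r *\<^sub>R (- T (complex_of_real (s - r)) g2) + 1 *\<^sub>R T (complex_of_real (1 + (s - r))) g1) -
          (- T (complex_of_real (1 + (s - r))) g1)) (at r)"
          unfolding Q_def by (intro has_vector_derivative_diff has_vector_derivative_minus has_vector_derivative_scaleR d1 d2 DERIV_ident)
        then show "(Q has_vector_derivative r *\<^sub>R T (complex_of_real (s - r)) g2) (at r within {0..s})"
          by (simp add: has_vector_derivative_at_within)
      qed
      from integral_unique[OF this] have "T (complex_of_real (2 + s)) y = T 2 y + s *\<^sub>R T 1 g1 + integral {0..s} (\<lambda>r. r *\<^sub>R T (complex_of_real (s - r)) g2)"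
        by (simp add: Q_def add.assoc[symmetric])
      also have "norm \<dots> \<le> norm (T 2 y) + s * norm (T 1 g1) + C * exp (s / 2) * norm g2"
        using s by (intro order.trans[OF norm_triangle_ineq] add_mono C(2)) auto
      also have "\<dots> \<le> norm (T 2 y) * exp (s / 2) + 2 * exp (s / 2) * norm (T 1 g1) + C * exp (s / 2) * norm g2"
      proof -
        have "s \<le> 2 * exp (s / 2)" using exp_ge_add_one_self[of "s / 2"] by linarith
        moreover have "1 \<le> exp (s / 2)" using s by simp
        ultimately show ?thesis by (intro add_mono mult_right_mono order_refl) (auto simp: mult_le_cancel_left1 not_less)
      qed
      finally show ?thesis by (simp add: algebra_simps)
    qed
    have "compact ((\<lambda>s. T (complex_of_real s) y) ` {0..2})"
      by (intro compact_continuous_image continuous_on_subset[OF T_continuous_real]) auto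
    then have "bounded ((\<lambda>s. T (complex_of_real s) y) ` {0..2})" by (rule compact_imp_bounded)
    then obtain B where B: "\<And>s. s \<in> {0..2} \<Longrightarrow> norm (T (complex_of_real s) y) \<le> B" unfolding bounded_iff by blast
    define K where "K = max \<bar>B\<bar> (C * norm g2 + 2 * norm (T 1 g1) + norm (T 2 y))"
    have K0: "0 \<le> K" by (simp add: K_def)
    have "norm (T (complex_of_real s) y) \<le> K * exp (s / 2)" if s: "0 \<le> s" for s
    proof (cases "s \<le> 2")
      case True
      then have "norm (T (complex_of_real s) y) \<le> K * 1" using B[of s] s by (auto simp: K_def)
      also have "\<dots> \<le> K * exp (s / 2)" using K0 s by (intro mult_left_mono) auto
      finally show ?thesis .
    next
      case False
      then have "norm (T (complex_of_real s) y) \<le> (C * norm g2 + 2 * norm (T 1 g1) + norm (T 2 y)) * exp ((s - 2) / 2)"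
        using far[of "s - 2"] by simp
      also have "\<dots> \<le> K * exp (s / 2)" using K0 by (intro mult_mono) (auto simp: K_def)
      finally show ?thesis .
    qed
    then show ?thesis by blast
  qed
  note pointwise = this
  have "\<exists>K. \<forall>S\<in>(\<lambda>s. exp (- s / 2) *\<^sub>R T (complex_of_real s)) ` {0..}. norm (S y) \<le> K" for y
  proof -
    obtain K where K: "\<And>s. 0 \<le> s \<Longrightarrow> norm (T (complex_of_real s) y) \<le> K * exp (s / 2)" using pointwise by blast
    have "norm ((exp (- s / 2) *\<^sub>R T (complex_of_real s)) y) \<le> K" if "0 \<le> s" for s
    proof -
      have "exp (- s / 2) * norm (T (complex_of_real s) y) \<le> exp (- s / 2) * (K * exp (s / 2))"
        by (intro mult_left_mono K that) simp
      also have "\<dots> = K" by (simp add: exp_minus)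
      finally show ?thesis by (simp add: blinfun.scaleR_left)
    qed
    then show ?thesis by auto
  qed
  then obtain K where K: "K > 0" "\<And>S. S \<in> (\<lambda>s. exp (- s / 2) *\<^sub>R T (complex_of_real s)) ` {0..} \<Longrightarrow> norm S \<le> K"
    by (rule uniform_boundedness) blast
  have "norm (T (complex_of_real s)) \<le> K * exp (s / 2)" if "0 \<le> s" for s
  proof -
    have "exp (- s / 2) * norm (T (complex_of_real s)) \<le> K" using K(2)[of "exp (- s / 2) *\<^sub>R T (complex_of_real s)"] that by auto
    then show ?thesis by (simp add: exp_minus field_simps)
  qed
  with K(1) show thesis using that by blast
qed

end

section \<open>Fractional powers\<close>

lemma integrable_Gamma_kernel:
  fixes a b :: real
  assumes "0 < b" "0 < a"
  shows "integrable lborel (\<lambda>t. indicator {0..} t * (t powr (b - 1) * exp (- (a * t))))"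
proof -
  have "integrable lborel (\<lambda>t. indicator {0..} t * t powr (b - 1) / exp t :: real)"
    using Gamma_conv_nn_integral_real[OF assms(1)]
    by (intro integrableI_nonneg) (auto simp flip: Gamma_conv_nn_integral_real[OF assms(1)])
  from lborel_integrable_real_affine[OF this, of a 0]
  have "integrable lborel (\<lambda>t. indicator {0..} (a * t) * (a * t) powr (b - 1) / exp (a * t))" using assms by simp
  then have "integrable lborel (\<lambda>t. a powr (1 - b) * (indicator {0..} (a * t) * (a * t) powr (b - 1) / exp (a * t)))"
    by (rule integrable_mult_right)
  also have "(\<lambda>t. a powr (1 - b) * (indicator {0..} (a * t) * (a * t) powr (b - 1) / exp (a * t))) =
    (\<lambda>t. indicator {0..} t * (t powr (b - 1) * exp (- (a * t))))"
  proof
    fix t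
    show "a powr (1 - b) * (indicator {0..} (a * t) * (a * t) powr (b - 1) / exp (a * t)) =
      indicator {0..} t * (t powr (b - 1) * exp (- (a * t)))"
    proof (cases "0 \<le> t")
      case True
      have "a powr (1 - b) * a powr (b - 1) = 1" using assms by (simp add: powr_add[symmetric])
      moreover have "(a * t) powr (b - 1) = a powr (b - 1) * t powr (b - 1)" using True assms by (simp add: powr_mult)
      ultimately show ?thesis using True assms by (simp add: indicator_def exp_minus field_simps)
    next
      case False
      then have "\<not> 0 \<le> a * t" using assms by (simp add: zero_le_mult_iff)
      then show ?thesis using False by simp
    qed
  qed
  finally show ?thesis .
qed

lemma Gamma_kernel_integrable_on:
  fixes a b :: real
  assumes "0 < b" "0 < a"
  shows "(\<lambda>t. t powr (b - 1) * exp (- (a * t))) integrable_on {0..}"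
  using integrable_Gamma_kernel[OF assms]
  by (intro set_borel_integral_eq_integral(1)) (simp add: set_integrable_def)

text \<open>The weight is singular at 0 when \<beta> < 1. The integral from t to b is uniformly
  continuous in t, its increments being bounded by those of
  \<open>K / \<beta> * t powr \<beta>\<close>; hence it extends continuously to 0, and the
  fundamental theorem with derivatives in the interior only yields integrability.\<close>

lemma integrable_powr_times_continuous_Icc:
  fixes Y :: "real \<Rightarrow> 'a::banach"
  assumes \<beta>: "0 < \<beta>" and b: "0 < b" and Y: "continuous_on {0..b} Y"
  shows "(\<lambda>s. s powr (\<beta> - 1) *\<^sub>R Y s) integrable_on {0..b}"
proof -
  let ?f = "\<lambda>s. s powr (\<beta> - 1) *\<^sub>R Y s"
  have "compact (Y ` {0..b})" by (intro compact_continuous_image Y) simp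
  then have "bounded (Y ` {0..b})" by (rule compact_imp_bounded)
  then obtain K where K: "\<And>s. s \<in> {0..b} \<Longrightarrow> norm (Y s) \<le> K" unfolding bounded_iff by blast
  have "0 \<in> {0..b}" using b by simp
  from order.trans[OF norm_ge_zero K[OF this]] have K0: "0 \<le> K" .
  have cf: "continuous_on {t..t'} ?f" if "0 < t" "t' \<le> b" for t t'
    using that by (intro continuous_intros continuous_on_subset[OF Y]) auto
  define F where "F t = integral {t..b} ?f" for t
  have step: "norm (F t - F t') \<le> K / \<beta> * (t' powr \<beta> - t powr \<beta>)" if "0 < t" "t \<le> t'" "t' \<le> b" for t t'
  proof -
    have "integral {t..t'} ?f + integral {t'..b} ?f = integral {t..b} ?f"
      using that by (intro Henstock_Kurzweil_Integration.integral_combine integrable_continuous_real cf) auto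
    then have "F t - F t' = integral {t..t'} ?f" by (simp add: F_def algebra_simps)
    moreover have g: "((\<lambda>s. K * s powr (\<beta> - 1)) has_integral K / \<beta> * t' powr \<beta> - K / \<beta> * t powr \<beta>) {t..t'}"
    proof (rule fundamental_theorem_of_calculus[OF that(2)])
      fix s assume s: "s \<in> {t..t'}"
      then have s0: "0 < s" using that by simp
      have "((\<lambda>s. K / \<beta> * s powr \<beta>) has_real_derivative K / \<beta> * (\<beta> * s powr (\<beta> - 1))) (at s within {t..t'})"
        by (rule has_field_derivative_at_within[OF DERIV_cmult[OF has_real_derivative_powr[OF s0]]])
      moreover have "K / \<beta> * (\<beta> * s powr (\<beta> - 1)) = K * s powr (\<beta> - 1)" using \<beta> by simp
      ultimately have "((\<lambda>s. K / \<beta> * s powr \<beta>) has_real_derivative K * s powr (\<beta> - 1)) (at s within {t..t'})" by simp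
      then show "((\<lambda>s. K / \<beta> * s powr \<beta>) has_vector_derivative K * s powr (\<beta> - 1)) (at s within {t..t'})"
        by (simp add: has_real_derivative_iff_has_vector_derivative)
    qed
    moreover have "norm (integral {t..t'} ?f) \<le> integral {t..t'} (\<lambda>s. K * s powr (\<beta> - 1))"
    proof (rule Henstock_Kurzweil_Integration.integral_norm_bound_integral[OF integrable_continuous_real[OF cf] has_integral_integrable[OF g]])
      fix s assume "s \<in> {t..t'}"
      then show "norm (s powr (\<beta> - 1) *\<^sub>R Y s) \<le> K * s powr (\<beta> - 1)"
        using K[of s] that by (simp add: mult.commute[of K] mult_left_mono)
    qed (use that in auto)
    ultimately show ?thesis using integral_unique[OF g] by (simp add: algebra_simps)
  qed
  have "uniformly_continuous_on {0<..b} F"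
    unfolding uniformly_continuous_on_def
  proof (intro allI impI)
    fix e :: real assume e: "0 < e"
    have "continuous_on {0..b} (\<lambda>t. t powr \<beta>)" using \<beta> by (intro continuous_on_powr' continuous_intros) auto
    then have "uniformly_continuous_on {0..b} (\<lambda>t. t powr \<beta>)" by (intro compact_uniformly_continuous) auto
    moreover have "0 < e / (K / \<beta> + 1)" using e K0 \<beta> by (simp add: add_nonneg_pos)
    ultimately obtain d where d: "0 < d" "\<And>t t'. t \<in> {0..b} \<Longrightarrow> t' \<in> {0..b} \<Longrightarrow> dist t' t < d \<Longrightarrow> dist (t' powr \<beta>) (t powr \<beta>) < e / (K / \<beta> + 1)"
      unfolding uniformly_continuous_on_def by meson
    have "dist (F t') (F t) < e" if tt: "t \<in> {0<..b}" "t' \<in> {0<..b}" "dist t' t < d" for t t'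
    proof -
      have "dist (F t') (F t) \<le> K / \<beta> * \<bar>t' powr \<beta> - t powr \<beta>\<bar>"
        using step[of t t'] step[of t' t] tt \<beta> by (cases "t \<le> t'") (auto simp: dist_norm norm_minus_commute powr_mono2)
      also have "\<dots> \<le> (K / \<beta> + 1) * \<bar>t' powr \<beta> - t powr \<beta>\<bar>" by (intro mult_right_mono) auto
      also have "\<dots> < (K / \<beta> + 1) * (e / (K / \<beta> + 1))"
        using d(2)[of t t'] tt K0 \<beta> by (intro mult_strict_left_mono) (auto simp: dist_real_def add_nonneg_pos)
      also have "\<dots> = e" using K0 \<beta> by (simp add: add_nonneg_pos less_imp_neq[symmetric])
      finally show ?thesis .
    qed
    with d(1) show "\<exists>d>0. \<forall>x\<in>{0<..b}. \<forall>x'\<in>{0<..b}. dist x' x < d \<longrightarrow> dist (F x') (F x) < e" by blast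
  qed
  from uniformly_continuous_on_extension_on_closure[OF this]
  obtain g where g: "uniformly_continuous_on (closure {0<..b}) g" "\<And>x. x \<in> {0<..b} \<Longrightarrow> F x = g x"
    by metis
  have "((\<lambda>s. - ?f s) has_integral g b - g 0) {0..b}"
  proof (rule fundamental_theorem_of_calculus_interior)
    show "continuous_on {0..b} g" using uniformly_continuous_imp_continuous[OF g(1)] unfolding closure_greaterThanAtMost[OF b] .
    fix t assume t: "t \<in> {0<..<b}"
    \<comment> \<open>Differentiation at t uses the base point t/2, away from the
      singularity.\<close>
    have "((\<lambda>u. integral {t/2..u} ?f) has_vector_derivative ?f t) (at t within {t/2..b})"
      using t by (intro integral_has_vector_derivative cf) auto
    moreover have "at t within {t/2..b} = at t" using t by (intro at_within_Icc_at) auto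
    ultimately have d: "((\<lambda>u. integral {t/2..u} ?f) has_vector_derivative ?f t) (at t)" by (simp only:)
    have "((\<lambda>u. integral {t/2..b} ?f - integral {t/2..u} ?f) has_vector_derivative 0 - ?f t) (at t)"
      by (rule has_vector_derivative_diff[OF has_vector_derivative_const d])
    then have "((\<lambda>u. integral {t/2..b} ?f - integral {t/2..u} ?f) has_vector_derivative - ?f t) (at t)" by (simp only: diff_0)
    then show "(g has_vector_derivative - ?f t) (at t)"
    proof (rule has_vector_derivative_transform_within_open[of _ _ _ "{t/2<..<b}"])
      fix u assume u: "u \<in> {t/2<..<b}"
      have "integral {t/2..u} ?f + integral {u..b} ?f = integral {t/2..b} ?f"
        using u t by (intro Henstock_Kurzweil_Integration.integral_combine integrable_continuous_real cf) auto
      then show "integral {t/2..b} ?f - integral {t/2..u} ?f = g u"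
        using g(2)[of u] u t by (simp add: F_def algebra_simps)
    qed (use t in auto)
  qed (use b in simp)
  then have "(\<lambda>s. - ?f s) integrable_on {0..b}" by blast
  from integrable_neg[OF this] show ?thesis by simp
qed

lemma
  fixes Y :: "real \<Rightarrow> 'a::banach"
  assumes \<beta>: "0 < \<beta>" and Y: "continuous_on {0..} Y" "\<And>s. 0 \<le> s \<Longrightarrow> norm (Y s) \<le> K * exp (s / 2)"
  shows gamma_weight_integrable: "(\<lambda>s. (s powr (\<beta> - 1) * exp (- s)) *\<^sub>R Y s) integrable_on {0..}"
    and gamma_weight_bound: "norm (integral {0..} (\<lambda>s. (s powr (\<beta> - 1) * exp (- s)) *\<^sub>R Y s)) \<le>
      K * integral {0..} (\<lambda>s. s powr (\<beta> - 1) * exp (- (1 / 2 * s)))"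
proof -
  let ?f = "\<lambda>s. (s powr (\<beta> - 1) * exp (- s)) *\<^sub>R Y s"
  let ?g = "\<lambda>s. K * (s powr (\<beta> - 1) * exp (- (1 / 2 * s)))"
  have g: "?g integrable_on {0..}" using integrable_cmul[OF Gamma_kernel_integrable_on[OF \<beta>, of "1/2"], of K] by simp
  have le: "norm (?f s) \<le> ?g s" if "s \<in> {0..}" for s
  proof -
    have "norm (?f s) \<le> s powr (\<beta> - 1) * exp (- s) * (K * exp (s / 2))"
      using Y(2)[of s] that by (simp add: mult_left_mono)
    also have "\<dots> = ?g s" by (simp add: exp_minus exp_add[symmetric] field_simps)
    finally show ?thesis .
  qed
  show f: "?f integrable_on {0..}"
  proof (rule integrable_on_all_intervals_integrable_bound[OF _ le g])
    fix a b :: real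
    show "(\<lambda>s. if s \<in> {0..} then ?f s else 0) integrable_on cbox a b"
      unfolding integrable_restrict_Int
    proof (cases "0 < b")
      case True
      have "(\<lambda>s. s powr (\<beta> - 1) *\<^sub>R (exp (- s) *\<^sub>R Y s)) integrable_on {0..b}"
        by (rule integrable_powr_times_continuous_Icc[OF \<beta> True]) (intro continuous_intros continuous_on_subset[OF Y(1)], auto)
      then have "?f integrable_on {0..b}" by simp
      moreover have "{0..} \<inter> cbox a b = {max 0 a..b}" by auto
      ultimately show "?f integrable_on {0..} \<inter> cbox a b"
        by (metis integrable_subinterval_real atLeastatMost_subset_iff max.cobounded1 order_refl)
    next
      case False
      then have "{0..} \<inter> cbox a b \<subseteq> {0}" by auto
      then have "negligible ({0..} \<inter> cbox a b)" using negligible_sing negligible_subset by blast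
      then show "?f integrable_on {0..} \<inter> cbox a b" by (rule integrable_negligible[rotated]) 
    qed
  qed
  show "norm (integral {0..} ?f) \<le> K * integral {0..} (\<lambda>s. s powr (\<beta> - 1) * exp (- (1 / 2 * s)))"
    using Henstock_Kurzweil_Integration.integral_norm_bound_integral[OF f g le] by simp
qed

section \<open>Convolution of Gamma weights\<close>

text \<open>The substitution s = u v extracts a power of u and leaves the Beta integral over [0, 1];
  the exponentials multiply to e^-u.\<close>

lemma beta_convolution:
  fixes b c u :: real
  assumes "0 < b" "0 < c"
  shows "(\<integral>s. (indicator {0..} s * (s powr (b - 1) * exp (- s))) * (indicator {0..} (u - s) * ((u - s) powr (c - 1) * exp (- (u - s)))) \<partial>lborel) =
    Beta b c * (indicator {0..} u * (u powr (b + c - 1) * exp (- u)))"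
proof (cases "0 < u")
  case True
  have "(\<integral>s. (indicator {0..} s * (s powr (b - 1) * exp (- s))) * (indicator {0..} (u - s) * ((u - s) powr (c - 1) * exp (- (u - s)))) \<partial>lborel) =
    u * (\<integral>v. (indicator {0..} (u * v) * ((u * v) powr (b - 1) * exp (- (u * v)))) * (indicator {0..} (u - u * v) * ((u - u * v) powr (c - 1) * exp (- (u - u * v)))) \<partial>lborel)"
    using True by (subst lborel_integral_real_affine[where c = u and t = 0]) auto
  also have "(\<lambda>v. (indicator {0..} (u * v) * ((u * v) powr (b - 1) * exp (- (u * v)))) * (indicator {0..} (u - u * v) * ((u - u * v) powr (c - 1) * exp (- (u - u * v))))) =
    (\<lambda>v. (u powr (b + c - 2) * exp (- u)) * (indicator {0..1} v *\<^sub>R (v powr (b - 1) * (1 - v) powr (c - 1))))"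
  proof
    fix v
    show "(indicator {0..} (u * v) * ((u * v) powr (b - 1) * exp (- (u * v)))) * (indicator {0..} (u - u * v) * ((u - u * v) powr (c - 1) * exp (- (u - u * v)))) =
      (u powr (b + c - 2) * exp (- u)) * (indicator {0..1} v *\<^sub>R (v powr (b - 1) * (1 - v) powr (c - 1)))"
    proof (cases "0 \<le> v \<and> v \<le> 1")
      case v: True
      have 1: "u - u * v = u * (1 - v)" by (simp add: algebra_simps)
      have 2: "(u * v) powr (b - 1) = u powr (b - 1) * v powr (b - 1)" "(u * (1 - v)) powr (c - 1) = u powr (c - 1) * (1 - v) powr (c - 1)"
        using True v by (simp_all add: powr_mult)
      have 3: "u powr (b + c - 2) = u powr (b - 1) * u powr (c - 1)" by (simp add: powr_add[symmetric])
      have 4: "exp (- u) = exp (- (u * v)) * exp (- (u * (1 - v)))" by (simp add: exp_add[symmetric] algebra_simps)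
      have "0 \<le> u * v" "0 \<le> u * (1 - v)" using True v by auto
      then show ?thesis unfolding 1 2 3 4 using v by (simp add: mult_ac)
    next
      case False
      then have "indicator {0..} (u * v) * indicator {0..} (u - u * v) = (0::real)"
        using True by (auto simp: indicator_def zero_le_mult_iff mult_le_cancel_left1)
      then show ?thesis using False by (auto simp: indicator_def split: if_splits)
    qed
  qed
  also have "(\<integral>v. (u powr (b + c - 2) * exp (- u)) * (indicator {0..1} v *\<^sub>R (v powr (b - 1) * (1 - v) powr (c - 1))) \<partial>lborel) =
    (u powr (b + c - 2) * exp (- u)) * Beta b c"
    using set_borel_integral_eq_integral(2)[OF integrable_Beta[OF assms]] integral_unique[OF has_integral_Beta_real[OF assms]]
    unfolding set_lebesgue_integral_def by simp
  also have "u * ((u powr (b + c - 2) * exp (- u)) * Beta b c) = Beta b c * (indicator {0..} u * (u powr (b + c - 1) * exp (- u)))"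
  proof -
    have "u powr (b + c - 1) = u powr 1 * u powr (b + c - 2)" unfolding powr_add[symmetric] by simp
    then show ?thesis using True by simp
  qed
  finally show ?thesis .
next
  case False
  have z: "(\<lambda>s. (indicator {0..} s * (s powr (b - 1) * exp (- s))) * (indicator {0..} (u - s) * ((u - s) powr (c - 1) * exp (- (u - s))))) = (\<lambda>_. 0)"
    using False by (auto simp: indicator_def fun_eq_iff)
  have "indicator {0..} u * (u powr (b + c - 1) * exp (- u)) = 0" using False by (auto simp: indicator_def)
  then show ?thesis unfolding z by simp
qed

text \<open>With u = s + r the double integral becomes one over u, with the convolution of the two
  weights as inner integral. \<open>F\<close> is scalar here so that Fubini on the plane is
  available.\<close>

lemma gamma_weight_convolution:
  fixes F :: "real \<Rightarrow> real" and b c :: real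
  assumes b: "0 < b" and c: "0 < c" and F: "continuous_on {0..} F" "\<And>u. 0 \<le> u \<Longrightarrow> \<bar>F u\<bar> \<le> K * exp (u / 2)"
  shows "integral {0..} (\<lambda>s. (s powr (b - 1) * exp (- s)) * integral {0..} (\<lambda>r. (r powr (c - 1) * exp (- r)) * F (s + r))) =
    Beta b c * integral {0..} (\<lambda>u. (u powr (b + c - 1) * exp (- u)) * F u)"
proof -
  \<comment> \<open>Half of each exponential is moved to \<open>F\<close>: \<open>k\<close> is the
    full weight, \<open>w\<close> the weight with half the rate, still integrable, and
    \<open>\<Phi>\<close> is \<open>F\<close> times e^(-u/2), bounded by K.\<close>
  define k where "k b s = indicator {0..} s * (s powr (b - 1) * exp (- s))" for b s :: real
  define w where "w b s = indicator {0..} s * (s powr (b - 1) * exp (- (1 / 2 * s)))" for b s :: real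
  define \<Phi> where "\<Phi> u = exp (- u / 2) * (indicator {0..} u *\<^sub>R F u)" for u
  have [measurable]: "w b \<in> borel_measurable borel" for b by (simp add: w_def[abs_def])
  have "(\<lambda>u. indicator {0..} u *\<^sub>R F u) \<in> borel_measurable borel"
    by (rule borel_measurable_continuous_on_indicator[OF _ F(1)]) simp
  then have [measurable]: "\<Phi> \<in> borel_measurable borel" unfolding \<Phi>_def[abs_def] by measurable
  have w_int: "integrable lborel (w b)" if "0 < b" for b
    using integrable_Gamma_kernel[OF that, of "1/2"] by (simp add: w_def[abs_def])
  have w0: "0 \<le> w b s" for b s by (simp add: w_def)
  have "\<bar>F 0\<bar> \<le> K" using F(2)[of 0] by simp
  then have K0: "0 \<le> K" by linarith
  have \<Phi>b: "\<bar>\<Phi> u\<bar> \<le> K" for u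
  proof (cases "0 \<le> u")
    case True
    have "exp (- u / 2) * \<bar>F u\<bar> \<le> exp (- u / 2) * (K * exp (u / 2))" by (intro mult_left_mono F True) simp
    also have "\<dots> = K" by (simp add: exp_minus)
    finally show ?thesis using True by (simp add: \<Phi>_def abs_mult)
  qed (simp add: \<Phi>_def K0)
  have kw: "k b s = w b s * exp (- s / 2)" for b s
    by (simp add: k_def w_def exp_add[symmetric])
  have kF: "k c r * (indicator {0..} (s + r) *\<^sub>R F (s + r)) = exp (s / 2) * (w c r * \<Phi> (s + r))" for r s
  proof -
    have "exp (s / 2) * (exp (- (s + r) / 2)) = exp (- r / 2)" by (simp add: exp_add[symmetric] add_divide_distrib diff_divide_distrib)
    then show ?thesis unfolding kw \<Phi>_def by (simp add: mult_ac)
  qed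
  have to_L: "integral {0..} g = (\<integral>s. indicator {0..} s *\<^sub>R g s \<partial>lborel)"
    if "integrable lborel (\<lambda>s. indicator {0..} s *\<^sub>R g s)" for g :: "real \<Rightarrow> real"
    using set_borel_integral_eq_integral(2)[of "{0..}" g] that by (simp add: set_integrable_def set_lebesgue_integral_def)
  have w\<Phi>_int: "integrable lborel (\<lambda>r. w c r * \<Phi> (s + r))" for s
    by (rule Bochner_Integration.integrable_bound[OF integrable_mult_right[OF w_int[OF c], of K]])
      (use \<Phi>b w0 K0 in \<open>auto simp: abs_mult mult.commute[of K] intro!: mult_left_mono\<close>)
  have inner: "integral {0..} (\<lambda>r. (r powr (c - 1) * exp (- r)) * F (s + r)) = exp (s / 2) * (\<integral>r. w c r * \<Phi> (s + r) \<partial>lborel)" if s: "0 \<le> s" for s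
  proof -
    have e: "indicator {0..} r *\<^sub>R ((r powr (c - 1) * exp (- r)) * F (s + r)) = exp (s / 2) * (w c r * \<Phi> (s + r))" for r
      using s unfolding kF[symmetric] by (auto simp: k_def indicator_def)
    then show ?thesis using w\<Phi>_int by (subst to_L) simp_all
  qed
  let ?P = "\<lambda>(s, u). w b s * (w c (u - s) * \<Phi> u)"
  have P_int: "integrable (lborel \<Otimes>\<^sub>M lborel) ?P"
  proof (rule lborel_pair.Fubini_integrable)
    have wshift: "integrable lborel (\<lambda>u. w c (u - s))" "(\<integral>u. w c (u - s) \<partial>lborel) = (\<integral>u. w c u \<partial>lborel)" for s
      using lborel_integrable_real_affine[OF w_int[OF c], of 1 "- s"] lborel_integral_real_affine[of 1 "w c" "- s"] by simp_all
    have bnd: "\<bar>w b s * (w c (u - s) * \<Phi> u)\<bar> \<le> K * w b s * w c (u - s)" for s u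
      using mult_left_mono[OF \<Phi>b[of u], of "w b s * w c (u - s)"] w0 by (simp add: abs_mult mult_ac)
    show "AE s in lborel. integrable lborel (\<lambda>u. ?P (s, u))"
      by (intro AE_I2, rule Bochner_Integration.integrable_bound[OF integrable_mult_right[OF wshift(1), of "K * w b _"]])
        (use bnd K0 w0 in \<open>auto intro: order.trans[OF _ abs_ge_self]\<close>)
    show "integrable lborel (\<lambda>s. \<integral>u. norm (?P (s, u)) \<partial>lborel)"
    proof (rule Bochner_Integration.integrable_bound)
      show "integrable lborel (\<lambda>s. w b s * (K * (\<integral>u. w c u \<partial>lborel)))" by (rule integrable_mult_left[OF w_int[OF b]])
      show "AE s in lborel. norm (\<integral>u. norm (?P (s, u)) \<partial>lborel) \<le> norm (w b s * (K * (\<integral>u. w c u \<partial>lborel)))"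
      proof (rule AE_I2)
        fix s
        have "(\<integral>u. norm (?P (s, u)) \<partial>lborel) \<le> (\<integral>u. K * w b s * w c (u - s) \<partial>lborel)"
          by (rule integral_mono') (use bnd K0 w0 wshift in auto)
        also have "\<dots> = w b s * (K * (\<integral>u. w c u \<partial>lborel))" by (simp add: wshift(2))
        finally have "(\<integral>u. norm (?P (s, u)) \<partial>lborel) \<le> w b s * (K * (\<integral>u. w c u \<partial>lborel))" .
        moreover have "0 \<le> (\<integral>u. norm (?P (s, u)) \<partial>lborel)" by (rule Bochner_Integration.integral_nonneg) simp
        ultimately show "norm (\<integral>u. norm (?P (s, u)) \<partial>lborel) \<le> norm (w b s * (K * (\<integral>u. w c u \<partial>lborel)))" by simp
      qed
    qed measurable
  qed measurable
  have shift: "(\<integral>r. w c r * \<Phi> (s + r) \<partial>lborel) = (\<integral>u. w c (u - s) * \<Phi> u \<partial>lborel)" for s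
    using lborel_integral_real_affine[of 1 "\<lambda>r. w c r * \<Phi> (s + r)" "- s"] by simp
  have outer: "indicator {0..} s *\<^sub>R ((s powr (b - 1) * exp (- s)) * integral {0..} (\<lambda>r. (r powr (c - 1) * exp (- r)) * F (s + r))) =
    (\<integral>u. ?P (s, u) \<partial>lborel)" for s
  proof (cases "0 \<le> s")
    case True
    have "indicator {0..} s *\<^sub>R ((s powr (b - 1) * exp (- s)) * integral {0..} (\<lambda>r. (r powr (c - 1) * exp (- r)) * F (s + r))) =
      k b s * (exp (s / 2) * (\<integral>u. w c (u - s) * \<Phi> u \<partial>lborel))"
      unfolding inner[OF True] shift k_def by simp
    also have "\<dots> = w b s * (\<integral>u. w c (u - s) * \<Phi> u \<partial>lborel)" unfolding kw by (simp add: exp_minus)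
    finally show ?thesis by simp
  qed (simp add: w_def)
  have "integral {0..} (\<lambda>s. (s powr (b - 1) * exp (- s)) * integral {0..} (\<lambda>r. (r powr (c - 1) * exp (- r)) * F (s + r))) =
    (\<integral>s. \<integral>u. ?P (s, u) \<partial>lborel \<partial>lborel)"
    using lborel_pair.integrable_fst'[OF P_int] by (subst to_L) (simp_all only: outer)
  also have "\<dots> = (\<integral>u. \<integral>s. ?P (s, u) \<partial>lborel \<partial>lborel)"
    using lborel_pair.Fubini_integral[of "\<lambda>s u. ?P (s, u)"] P_int by simp
  also have "(\<lambda>u. \<integral>s. ?P (s, u) \<partial>lborel) = (\<lambda>u. Beta b c * (indicator {0..} u *\<^sub>R ((u powr (b + c - 1) * exp (- u)) * F u)))"
  proof
    fix u
    have "(\<integral>s. ?P (s, u) \<partial>lborel) = (\<integral>s. (exp (u / 2) * \<Phi> u) * (k b s * k c (u - s)) \<partial>lborel)"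
    proof (rule Bochner_Integration.integral_cong[OF refl])
      fix s
      have "exp (u / 2) * (exp (- s / 2) * exp (- (u - s) / 2)) = 1" by (simp add: exp_add[symmetric] diff_divide_distrib)
      then show "?P (s, u) = (exp (u / 2) * \<Phi> u) * (k b s * k c (u - s))"
        unfolding kw by (simp add: mult_ac)
    qed
    also have "\<dots> = (exp (u / 2) * \<Phi> u) * (\<integral>s. k b s * k c (u - s) \<partial>lborel)" by simp
    also have "(\<integral>s. k b s * k c (u - s) \<partial>lborel) = Beta b c * (indicator {0..} u * (u powr (b + c - 1) * exp (- u)))"
      unfolding k_def by (rule beta_convolution[OF b c])
    finally show "(\<integral>s. ?P (s, u) \<partial>lborel) = Beta b c * (indicator {0..} u *\<^sub>R ((u powr (b + c - 1) * exp (- u)) * F u))"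
      by (simp add: \<Phi>_def exp_minus indicator_def)
  qed
  also have "(\<integral>u. Beta b c * (indicator {0..} u *\<^sub>R ((u powr (b + c - 1) * exp (- u)) * F u)) \<partial>lborel) =
    Beta b c * (\<integral>u. indicator {0..} u *\<^sub>R ((u powr (b + c - 1) * exp (- u)) * F u) \<partial>lborel)" by simp
  also have "(\<integral>u. indicator {0..} u *\<^sub>R ((u powr (b + c - 1) * exp (- u)) * F u) \<partial>lborel) = integral {0..} (\<lambda>u. (u powr (b + c - 1) * exp (- u)) * F u)"
  proof (rule to_L[symmetric])
    have "indicator {0..} u *\<^sub>R ((u powr (b + c - 1) * exp (- u)) * F u) = w (b + c) u * \<Phi> u" for u
      using kF[where s = 0 and r = u] 
      by (simp add: w_def \<Phi>_def indicator_def exp_add[symmetric])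
    moreover have "integrable lborel (\<lambda>u. w (b + c) u * \<Phi> u)"
      by (rule Bochner_Integration.integrable_bound[OF integrable_mult_right[where c = K and f = "w (b + c)"]])
        (use \<Phi>b w0 K0 b c w_int in \<open>auto simp: abs_mult mult.commute[of K] intro!: mult_left_mono\<close>)
    ultimately show "integrable lborel (\<lambda>u. indicator {0..} u *\<^sub>R ((u powr (b + c - 1) * exp (- u)) * F u))" by simp
  qed
  finally show ?thesis .
qed

section \<open>The regularised group\<close>

context sectorial_semigroup
begin

section \<open>Fractional powers as bounded operators\<close>

lemma orbit_bound:
  obtains K where "0 < K" "\<And>s x. 0 \<le> s \<Longrightarrow> norm (T (complex_of_real s) x) \<le> (K * norm x) * exp (s / 2)"
proof -
  obtain K where K: "0 < K" "\<And>s. 0 \<le> s \<Longrightarrow> norm (T (complex_of_real s)) \<le> K * exp (s / 2)"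
    by (rule T_growth) blast
  have "norm (T (complex_of_real s) x) \<le> (K * norm x) * exp (s / 2)" if "0 \<le> s" for s x
    using order.trans[OF norm_blinfun mult_right_mono[OF K(2)[OF that] norm_ge_zero]] by (simp add: mult_ac)
  with K(1) show thesis by (rule that)
qed

lemma frac_power_integrable:
  assumes "0 < \<beta>"
  shows "(\<lambda>s. (s powr (\<beta> - 1) * exp (- s)) *\<^sub>R T (complex_of_real s) x) integrable_on {0..}"
proof -
  obtain K where "0 < K" "\<And>s x. 0 \<le> s \<Longrightarrow> norm (T (complex_of_real s) x) \<le> (K * norm x) * exp (s / 2)"
    by (rule orbit_bound) blast
  then show ?thesis by (intro gamma_weight_integrable[OF assms T_continuous_real])
qed

lemma bounded_linear_frac_power:
  assumes "0 < \<beta>"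
  shows "bounded_linear (frac_power T \<beta>)"
proof -
  obtain K where K: "0 < K" "\<And>s x. 0 \<le> s \<Longrightarrow> norm (T (complex_of_real s) x) \<le> (K * norm x) * exp (s / 2)"
    by (rule orbit_bound) blast
  let ?I = "integral {0..} (\<lambda>s. s powr (\<beta> - 1) * exp (- (1 / 2 * s)))"
  let ?f = "\<lambda>x s. (s powr (\<beta> - 1) * exp (- s)) *\<^sub>R T (complex_of_real s) x"
  show ?thesis
  proof (rule bounded_linear_intro[where K = "\<bar>1 / Gamma \<beta>\<bar> * (K * ?I)"])
    fix x y :: 'a and r :: real
    have "integral {0..} (?f (x + y)) = integral {0..} (?f x) + integral {0..} (?f y)"
      by (simp add: blinfun.add_right scaleR_add_right Henstock_Kurzweil_Integration.integral_add frac_power_integrable[OF assms])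
    then show "frac_power T \<beta> (x + y) = frac_power T \<beta> x + frac_power T \<beta> y"
      by (simp add: frac_power_def scaleR_add_right)
    have "?f (r *\<^sub>R x) = (\<lambda>s. r *\<^sub>R ?f x s)"
      by (simp add: fun_eq_iff blinfun.scaleR_right mult_ac)
    then show "frac_power T \<beta> (r *\<^sub>R x) = r *\<^sub>R frac_power T \<beta> x"
      by (simp only: frac_power_def Henstock_Kurzweil_Integration.integral_cmul scaleR_left_commute)
    have "norm (integral {0..} (?f x)) \<le> (K * norm x) * ?I"
      by (rule gamma_weight_bound[OF assms T_continuous_real K(2)])
    then have "\<bar>1 / Gamma \<beta>\<bar> * norm (integral {0..} (?f x)) \<le> \<bar>1 / Gamma \<beta>\<bar> * ((K * norm x) * ?I)"
      by (rule mult_left_mono) simp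
    then show "norm (frac_power T \<beta> x) \<le> norm x * (\<bar>1 / Gamma \<beta>\<bar> * (K * ?I))"
      by (simp add: frac_power_def mult_ac)
  qed
qed

definition fp :: "real \<Rightarrow> 'a \<Rightarrow>\<^sub>L 'a"
  where "fp \<beta> = Blinfun (frac_power T \<beta>)"

lemma fp_apply: "0 < \<beta> \<Longrightarrow> fp \<beta> x = frac_power T \<beta> x"
  by (simp add: fp_def bounded_linear_Blinfun_apply[OF bounded_linear_frac_power])

lemma bounded_linear_fp:
  fixes l :: "'a \<Rightarrow> 'b::banach"
  assumes "0 < \<beta>" "bounded_linear l"
  shows "l (fp \<beta> x) = (1 / Gamma \<beta>) *\<^sub>R integral {0..} (\<lambda>s. (s powr (\<beta> - 1) * exp (- s)) *\<^sub>R l (T (complex_of_real s) x))"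
  using integral_linear[OF frac_power_integrable[OF assms(1), of x] assms(2)]
  by (simp add: fp_apply assms frac_power_def linear_scale[OF bounded_linear.linear] o_def)

lemma fp_linear:
  assumes "0 < \<beta>"
  shows "complex_linear (fp \<beta>)"
proof -
  have "c *\<^sub>C fp \<beta> x = fp \<beta> (c *\<^sub>C x)" for c x
    unfolding bounded_linear_fp[OF assms scaleC.bounded_linear_right[of c]] fp_apply[OF assms, of "c *\<^sub>C x"] frac_power_def
    by (intro arg_cong[where f = "scaleR _"] integral_cong) (auto simp: complex_linear_scaleC[OF T_linear] le_less)
  then show ?thesis by (simp add: complex_linear_def)
qed

lemma fp_commute:
  fixes S :: "'a \<Rightarrow>\<^sub>L 'a"
  assumes "0 < \<beta>" "\<And>s x. 0 \<le> s \<Longrightarrow> S (T (complex_of_real s) x) = T (complex_of_real s) (S x)"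
  shows "S (fp \<beta> x) = fp \<beta> (S x)"
  unfolding bounded_linear_fp[OF assms(1) blinfun.bounded_linear_right[of S]] fp_apply[OF assms(1), of "S x"] frac_power_def
  by (intro arg_cong[where f = "scaleR _"] integral_cong) (simp add: assms(2))

lemma T_fp: "0 < \<beta> \<Longrightarrow> z = 0 \<or> 0 < Re z \<Longrightarrow> T z (fp \<beta> x) = fp \<beta> (T z x)"
proof (rule fp_commute, assumption)
  fix s :: real and x assume "z = 0 \<or> 0 < Re z" "0 \<le> s"
  then show "T z (T (complex_of_real s) x) = T (complex_of_real s) (T z x)"
    by (subst (1 2) T_add_apply) (auto simp: add.commute)
qed

text \<open>The law of exponents for negative powers of 1 + A. Real functionals reduce it to scalar
  integrals, where \<open>Beta b c\<close> accounts for the three Gamma factors.\<close>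

lemma fp_fp:
  assumes b: "0 < b" and c: "0 < c"
  shows "fp b (fp c x) = fp (b + c) x"
proof (rule functionals_separate_points)
  fix l assume l: "bounded_linear (l :: 'a \<Rightarrow> real)"
  obtain K where K: "0 < K" "\<And>s x. 0 \<le> s \<Longrightarrow> norm (T (complex_of_real s) x) \<le> (K * norm x) * exp (s / 2)"
    by (rule orbit_bound) blast
  obtain L where L: "0 < L" "\<And>x. norm (l x) \<le> norm x * L" using bounded_linear.pos_bounded[OF l] by blast
  define F where "F u = l (T (complex_of_real u) x)" for u
  have F: "continuous_on {0..} F"
    unfolding F_def by (intro bounded_linear.continuous_on[OF l] T_continuous_real)
  have FK: "\<bar>F u\<bar> \<le> (L * (K * norm x)) * exp (u / 2)" if "0 \<le> u" for u
  proof -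
    have "\<bar>F u\<bar> \<le> norm (T (complex_of_real u) x) * L" using L(2) by (simp add: F_def)
    also have "\<dots> \<le> ((K * norm x) * exp (u / 2)) * L" by (intro mult_right_mono K(2) that less_imp_le[OF L(1)])
    finally show ?thesis by (simp add: mult_ac)
  qed
  have 1: "l (T (complex_of_real s) (fp c x)) = (1 / Gamma c) * integral {0..} (\<lambda>r. (r powr (c - 1) * exp (- r)) * F (s + r))"
    if "0 \<le> s" for s
  proof -
    have bl: "bounded_linear (\<lambda>v. l (T (complex_of_real s) v))"
      by (intro bounded_linear_compose[OF l] blinfun.bounded_linear_right)
    show ?thesis unfolding bounded_linear_fp[OF c bl] real_scaleR_def F_def
    proof (rule arg_cong[where f = "(*) _"], rule integral_cong)
      fix r :: real assume "r \<in> {0..}"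
      then show "r powr (c - 1) * exp (- r) * l (T (complex_of_real s) (T (complex_of_real r) x)) =
        r powr (c - 1) * exp (- r) * l (T (complex_of_real (s + r)) x)"
        using that by (subst T_add_apply) auto
    qed
  qed
  have "l (fp b (fp c x)) = (1 / Gamma b) * integral {0..} (\<lambda>s. (s powr (b - 1) * exp (- s)) * l (T (complex_of_real s) (fp c x)))"
    unfolding bounded_linear_fp[OF b l] by simp
  also have "integral {0..} (\<lambda>s. (s powr (b - 1) * exp (- s)) * l (T (complex_of_real s) (fp c x))) =
    integral {0..} (\<lambda>s. (1 / Gamma c) *\<^sub>R ((s powr (b - 1) * exp (- s)) * integral {0..} (\<lambda>r. (r powr (c - 1) * exp (- r)) * F (s + r))))"
    by (rule integral_cong) (simp add: 1)
  also have "\<dots> = (1 / Gamma c) * (Beta b c * integral {0..} (\<lambda>u. (u powr (b + c - 1) * exp (- u)) * F u))"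
    unfolding Henstock_Kurzweil_Integration.integral_cmul using gamma_weight_convolution[OF b c F FK] by simp
  also have "(1 / Gamma b) * \<dots> = (1 / Gamma (b + c)) * integral {0..} (\<lambda>u. (u powr (b + c - 1) * exp (- u)) * F u)"
    using Gamma_real_pos[OF b] Gamma_real_pos[OF c] by (simp add: Beta_def)
  also have "\<dots> = l (fp (b + c) x)"
    using b c by (subst bounded_linear_fp[OF _ l]) (simp_all add: F_def)
  finally show "l (fp b (fp c x)) = l (fp (b + c) x)" .
qed

section \<open>The operators \<open>(1+A)\<close> to the power -\<beta> times e^(itA)\<close>

lemma T_approximation: "(\<lambda>n. T (complex_of_real (inverse (real (Suc n)))) x) \<longlonglongrightarrow> x"
proof (rule filterlim_compose[OF T_at_zero])
  show "filterlim (\<lambda>n. inverse (real (Suc n))) (at_right 0) sequentially"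
    unfolding filterlim_at using LIMSEQ_inverse_real_of_nat by simp
qed

text \<open>The vectors \<open>T (1/(n+1)) x\<close> converge to \<open>x\<close>, so the ranges of
  the semigroup at positive times have dense union.\<close>

lemma eq_on_ranges:
  fixes U V :: "'a \<Rightarrow>\<^sub>L 'a"
  assumes "\<And>s x. 0 < s \<Longrightarrow> U (T (complex_of_real s) x) = V (T (complex_of_real s) x)"
  shows "U = V"
proof (rule blinfun_eqI)
  fix x
  have 1: "(\<lambda>n. U (T (complex_of_real (inverse (real (Suc n)))) x)) \<longlonglongrightarrow> U x"
    by (intro tendsto_intros T_approximation)
  have 2: "(\<lambda>n. V (T (complex_of_real (inverse (real (Suc n)))) x)) \<longlonglongrightarrow> V x"
    by (intro tendsto_intros T_approximation)
  have "(\<lambda>n. U (T (complex_of_real (inverse (real (Suc n)))) x)) = (\<lambda>n. V (T (complex_of_real (inverse (real (Suc n)))) x))"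
    by (intro ext assms) simp
  with 1 2 show "U x = V x" using LIMSEQ_unique by metis
qed

lemma reg_group_eq: "is_reg_group T \<beta> t U \<Longrightarrow> reg_group T \<beta> t = U"
  unfolding reg_group_def by (rule the_equality) (auto simp: is_reg_group_def intro!: eq_on_ranges)

lemma
  assumes "reg_group_bounded T \<beta> t"
  shows reg_group_linear: "complex_linear (reg_group T \<beta> t)"
    and reg_group_apply: "0 < \<beta> \<Longrightarrow> 0 < s \<Longrightarrow>
      reg_group T \<beta> t (T (complex_of_real s) x) = fp \<beta> (T (complex_of_real s - \<i> * complex_of_real t) x)"
proof -
  obtain U where U: "is_reg_group T \<beta> t U" using assms by (auto simp: reg_group_bounded_def)
  show "complex_linear (reg_group T \<beta> t)" using U reg_group_eq[OF U] by (simp add: is_reg_group_def)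
  show "0 < \<beta> \<Longrightarrow> 0 < s \<Longrightarrow>
      reg_group T \<beta> t (T (complex_of_real s) x) = fp \<beta> (T (complex_of_real s - \<i> * complex_of_real t) x)"
    using U reg_group_eq[OF U] by (simp add: is_reg_group_def fp_apply)
qed

lemma reg_group_T:
  assumes "reg_group_bounded T \<beta> t" "0 < \<beta>" "0 \<le> s"
  shows "reg_group T \<beta> t (T (complex_of_real s) x) = T (complex_of_real s) (reg_group T \<beta> t x)"
proof -
  have "reg_group T \<beta> t o\<^sub>L T (complex_of_real s) = T (complex_of_real s) o\<^sub>L reg_group T \<beta> t"
  proof (rule eq_on_ranges)
    fix r :: real and x assume r: "0 < r"
    have "reg_group T \<beta> t (T (complex_of_real s) (T (complex_of_real r) x)) = reg_group T \<beta> t (T (complex_of_real (s + r)) x)"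
      using r assms(3) by (subst T_add_apply) auto
    also have "\<dots> = fp \<beta> (T (complex_of_real s + (complex_of_real r - \<i> * complex_of_real t)) x)"
      using r assms by (subst reg_group_apply) (auto simp: algebra_simps)
    also have "\<dots> = fp \<beta> (T (complex_of_real s) (T (complex_of_real r - \<i> * complex_of_real t) x))"
      using r assms(3) by (subst T_add_apply) auto
    also have "\<dots> = T (complex_of_real s) (reg_group T \<beta> t (T (complex_of_real r) x))"
      using r assms by (subst reg_group_apply) (auto simp: T_fp le_less)
    finally show "(reg_group T \<beta> t o\<^sub>L T (complex_of_real s)) (T (complex_of_real r) x) =
      (T (complex_of_real s) o\<^sub>L reg_group T \<beta> t) (T (complex_of_real r) x)" by simp
  qed
  then show ?thesis by (metis blinfun_apply_blinfun_compose)
qed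

text \<open>Additional smoothing preserves existence and growth in t. It supplies the operators with
  the full exponent at all times, together with a crude bound.\<close>

lemma is_reg_group_fp:
  assumes "reg_group_bounded T b t" "0 < b" "0 < c"
  shows "is_reg_group T (b + c) t (reg_group T b t o\<^sub>L fp c)"
  unfolding is_reg_group_def
proof (intro conjI allI impI)
  show "complex_linear (reg_group T b t o\<^sub>L fp c)"
    using assms by (intro complex_linear_comp reg_group_linear fp_linear)
  fix s :: real and x assume s: "0 < s"
  have "reg_group T b t (fp c (T (complex_of_real s) x)) = reg_group T b t (T (complex_of_real s) (fp c x))"
    using s assms by (subst T_fp) auto
  also have "\<dots> = fp b (fp c (T (complex_of_real s - \<i> * complex_of_real t) x))"
    using s assms by (subst reg_group_apply) (auto simp: T_fp)
  finally show "(reg_group T b t o\<^sub>L fp c) (T (complex_of_real s) x) = frac_power T (b + c) (T (complex_of_real s - \<i> * complex_of_real t) x)"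
    using assms by (simp add: fp_fp fp_apply[symmetric])
qed

text \<open>The time s is divided into two halves, one for each factor, so that both complex times
  keep a positive real part.\<close>

lemma is_reg_group_comp:
  assumes "reg_group_bounded T b t" "reg_group_bounded T c t'" "0 < b" "0 < c"
  shows "is_reg_group T (b + c) (t + t') (reg_group T b t o\<^sub>L reg_group T c t')"
  unfolding is_reg_group_def
proof (intro conjI allI impI)
  show "complex_linear (reg_group T b t o\<^sub>L reg_group T c t')"
    using assms by (intro complex_linear_comp reg_group_linear)
  fix s :: real and x assume s: "0 < s"
  let ?z = "complex_of_real (s / 2) - \<i> * complex_of_real t" and ?w = "complex_of_real (s / 2) - \<i> * complex_of_real t'"
  have "reg_group T c t' (T (complex_of_real s) x) = reg_group T c t' (T (complex_of_real (s / 2)) (T (complex_of_real (s / 2)) x))"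
    using s by (subst T_add_apply) auto
  also have "\<dots> = T (complex_of_real (s / 2)) (fp c (T ?w x))"
    using s assms by (subst reg_group_T, simp_all del: of_real_divide) (subst reg_group_apply, simp_all)
  finally have "reg_group T b t (reg_group T c t' (T (complex_of_real s) x)) = fp b (T ?z (fp c (T ?w x)))"
    using s assms by (simp add: reg_group_apply del: of_real_divide)
  also have "\<dots> = fp b (fp c (T ?z (T ?w x)))" using s assms by (subst T_fp) auto
  also have "\<dots> = fp (b + c) (T (?z + ?w) x)" using s assms by (subst T_add_apply) (auto simp: fp_fp)
  also have "?z + ?w = complex_of_real s - \<i> * complex_of_real (t + t')" by (simp add: complex_eq_iff)
  finally show "(reg_group T b t o\<^sub>L reg_group T c t') (T (complex_of_real s) x) =
    frac_power T (b + c) (T (complex_of_real s - \<i> * complex_of_real (t + t')) x)"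
    using assms by (simp add: fp_apply)
qed

text \<open>On vectors smoothed by the semigroup, continuity in t is inherited from analytic orbits;
  a locally uniform operator bound makes the approximation uniform.\<close>

lemma reg_group_continuous:
  assumes "0 < \<beta>" "\<And>t. t \<in> I \<Longrightarrow> reg_group_bounded T \<beta> t" "\<And>t. t \<in> I \<Longrightarrow> norm (reg_group T \<beta> t) \<le> M"
  shows "continuous_on I (\<lambda>t. reg_group T \<beta> t x)"
proof (rule uniform_limit_theorem[where F = sequentially])
  let ?s = "\<lambda>n. inverse (real (Suc n))"
  let ?T = "\<lambda>n. T (complex_of_real (?s n)) x"
  show "\<forall>\<^sub>F n in sequentially. continuous_on I (\<lambda>t. reg_group T \<beta> t (?T n))"
  proof (rule always_eventually, rule allI)
    fix n
    have "continuous_on I (\<lambda>t. fp \<beta> (T (complex_of_real (?s n) - \<i> * complex_of_real t) x))"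
      by (intro continuous_intros T_continuous_on) auto
    then show "continuous_on I (\<lambda>t. reg_group T \<beta> t (?T n))"
      by (rule continuous_on_eq) (simp only: reg_group_apply[OF assms(2) assms(1)] inverse_positive_iff_positive of_nat_0_less_iff zero_less_Suc)
  qed
  show "uniform_limit I (\<lambda>n t. reg_group T \<beta> t (?T n)) (\<lambda>t. reg_group T \<beta> t x) sequentially"
  proof (rule uniform_limitI)
    fix e :: real assume e: "0 < e"
    have "(\<lambda>n. \<bar>M\<bar> * norm (?T n - x)) \<longlonglongrightarrow> \<bar>M\<bar> * 0"
      by (intro tendsto_mult tendsto_const tendsto_norm_zero LIM_zero T_approximation)
    then have "\<forall>\<^sub>F n in sequentially. \<bar>M\<bar> * norm (?T n - x) < e"
      using e by (intro order_tendstoD(2)) simp_all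
    then show "\<forall>\<^sub>F n in sequentially. \<forall>t\<in>I. dist (reg_group T \<beta> t (?T n)) (reg_group T \<beta> t x) < e"
    proof eventually_elim
      case (elim n)
      show ?case
      proof
        fix t assume t: "t \<in> I"
        have "dist (reg_group T \<beta> t (?T n)) (reg_group T \<beta> t x) = norm (reg_group T \<beta> t (?T n - x))"
          by (simp add: dist_norm blinfun.diff_right)
        also have "\<dots> \<le> \<bar>M\<bar> * norm (?T n - x)"
          using assms(3)[OF t] by (intro order.trans[OF norm_blinfun] mult_right_mono) auto
        finally show "dist (reg_group T \<beta> t (?T n)) (reg_group T \<beta> t x) < e" using elim by linarith
      qed
    qed
  qed
qed simp

end

section \<open>The transference estimate\<close>

lemma cmod_inv_fourier_shift:
  "cmod (inv_fourier (\<lambda>t. h (c + t)) x) = cmod (inv_fourier h x)"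
proof -
  have "(\<integral>t. h t * exp (\<i> * complex_of_real (x * t)) \<partial>lborel) =
    (\<integral>t. h (c + t) * exp (\<i> * complex_of_real (x * (c + t))) \<partial>lborel)"
    using lborel_integral_real_affine[of 1 "\<lambda>t. h t * exp (\<i> * complex_of_real (x * t))" c] by simp
  also have "(\<lambda>t. h (c + t) * exp (\<i> * complex_of_real (x * (c + t)))) =
    (\<lambda>t. exp (\<i> * complex_of_real (x * c)) * (h (c + t) * exp (\<i> * complex_of_real (x * t))))"
    by (simp add: fun_eq_iff distrib_left exp_add mult_ac)
  also have "(\<integral>t. exp (\<i> * complex_of_real (x * c)) * (h (c + t) * exp (\<i> * complex_of_real (x * t))) \<partial>lborel) =
    exp (\<i> * complex_of_real (x * c)) * (\<integral>t. h (c + t) * exp (\<i> * complex_of_real (x * t)) \<partial>lborel)" by simp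
  finally have "cmod (\<integral>t. h t * exp (\<i> * complex_of_real (x * t)) \<partial>lborel) =
    cmod (\<integral>t. h (c + t) * exp (\<i> * complex_of_real (x * t)) \<partial>lborel)"
    by (simp add: norm_mult)
  then show ?thesis by (simp add: inv_fourier_def norm_mult norm_divide)
qed

text \<open>\<open>U\<close>, \<open>U1\<close> and \<open>U2\<close> stand for the groups
  regularised with exponents \<open>\<beta>\<^sub>1 + 2 * \<beta>\<^sub>2\<close>,
  \<open>\<beta>\<^sub>1\<close> and \<open>\<beta>\<^sub>2\<close>. The bound \<open>B\<close> is
  used for convergence only; the final estimate contains just \<open>C\<close> and
  \<open>K\<close>.\<close>

locale regularised_family =
  fixes U U1 U2 :: "real \<Rightarrow> 'a::complex_banach \<Rightarrow>\<^sub>L 'a" and K C B \<alpha> :: real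
  assumes factor: "s \<in> {0..1} \<Longrightarrow> r \<in> {0..1} \<Longrightarrow> U (k + (s + r)) x = U1 k (U2 s (U2 r x))"
    and U_linear: "complex_linear (U t)"
    and U1_linear: "complex_linear (U1 t)"
    and U2_linear: "s \<in> {0..1} \<Longrightarrow> complex_linear (U2 s)"
    and K: "0 \<le> K"
    and U2_gamma: "(\<And>k. k < n \<Longrightarrow> R k \<in> U2 ` {0..1}) \<Longrightarrow>
      gauss_norm n (\<lambda>k. blinfun_apply (R k) (y k)) \<le> K * gauss_norm n y"
    and \<alpha>: "0 < \<alpha>"
    and U1_bound: "norm (U1 t) \<le> C * (1 + \<bar>t\<bar>) powr \<alpha>"
    and U_bound: "norm (U t) \<le> B * (1 + \<bar>t\<bar>) powr \<alpha>"
    and U_continuous: "continuous_on UNIV (\<lambda>t. U t x)"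
begin

text \<open>At the grid points s = i/N and r = j/N the factor \<open>U1 k\<close> comes out of the
  double sum, and the rest is the sum of \<open>gamma_bounded_transference\<close> with the matrix
  of \<open>hankel_bound\<close>.\<close>

lemma riemann_sum_bound:
  fixes N :: nat and g :: "real \<Rightarrow> complex"
  assumes N: "0 < N" and g: "integrable lborel g" and a: "0 < a" "\<And>x. cmod (inv_fourier g x) \<le> a"
  defines "M i j \<equiv> \<integral>t. g t * complex_of_real (tent (1 / real N) (t - real (i + j + 1) / real N)) \<partial>lborel"
  shows "norm (\<Sum>i<N. \<Sum>j<N. M i j *\<^sub>C U (k + real (i + j) / real N) x) \<le> C * (1 + \<bar>k\<bar>) powr \<alpha> * (4 * pi * K\<^sup>2 * a * norm x)"
proof -
  let ?S = "\<lambda>i. U2 (real i / real N)"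
  have I: "real i / real N \<in> {0..1}" if "i < N" for i using that by simp
  have "U (k + real (i + j) / real N) x = U1 k (?S i (?S j x))" if "i < N" "j < N" for i j
    using factor[OF I[OF that(1)] I[OF that(2)], of k x] by (simp add: add_divide_distrib)
  then have "(\<Sum>i<N. \<Sum>j<N. M i j *\<^sub>C U (k + real (i + j) / real N) x) = U1 k (\<Sum>i<N. \<Sum>j<N. M i j *\<^sub>C ?S i (?S j x))"
    by (simp add: blinfun.sum_right complex_linear_scaleC[OF U1_linear])
  also have "norm \<dots> \<le> norm (U1 k) * norm (\<Sum>i<N. \<Sum>j<N. M i j *\<^sub>C ?S i (?S j x))"
    by (rule norm_blinfun)
  also have "\<dots> \<le> (C * (1 + \<bar>k\<bar>) powr \<alpha>) * (4 * pi * K\<^sup>2 * a * norm x)"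
  proof (rule mult_mono[OF U1_bound])
    \<comment> \<open>The factor \<open>N\<close> of the transference estimate cancels the
      \<open>1/N\<close> in the Hankel norm, so the bound is independent of the mesh.\<close>
    have "norm (\<Sum>i<N. \<Sum>j<N. M i j *\<^sub>C ?S i (?S j x)) \<le> 2 * K\<^sup>2 * (2 * pi / real N * a) * real N * norm x"
    proof (rule gamma_bounded_transference[where \<tau> = "U2 ` {0..1}"])
      show "0 \<le> K" by (rule K)
      show "0 < 2 * pi / real N * a" using N a(1) by simp
      show "cmod (\<Sum>i<N. \<Sum>j<N. M i j * complex_of_real (u i * v j)) \<le>
        2 * pi / real N * a * ((\<Sum>i<N. (u i)\<^sup>2) + (\<Sum>j<N. (v j)\<^sup>2)) / 2" for u v
        unfolding M_def by (rule hankel_bound[OF N g a(2)])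
      show "gauss_norm n (\<lambda>k. blinfun_apply (R k) (y k)) \<le> K * gauss_norm n y"
        if "\<And>k. k < n \<Longrightarrow> R k \<in> U2 ` {0..1}" for n R y by (rule U2_gamma[OF that])
      show "U2 (real i / real N) \<in> U2 ` {0..1}" "complex_linear (U2 (real i / real N))" if "i < N" for i
        by (rule imageI[OF I[OF that]], rule U2_linear[OF I[OF that]])
    qed
    also have "\<dots> = 4 * pi * K\<^sup>2 * a * norm x" using N by simp
    finally show "norm (\<Sum>i<N. \<Sum>j<N. M i j *\<^sub>C ?S i (?S j x)) \<le> 4 * pi * K\<^sup>2 * a * norm x" .
    show "0 \<le> C * (1 + \<bar>k\<bar>) powr \<alpha>" using U1_bound[of k] norm_ge_zero[of "U1 k"] by linarith
  qed simp
  finally show ?thesis .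
qed

text \<open>\<open>tent_sum_grid\<close> splits the unit tent into small nonnegative tents, so
  replacing U at time t by its value at a nearby grid time costs at most the modulus of continuity e
  times G, integrated over an interval of length 2.\<close>

lemma riemann_sum_error:
  fixes N :: nat and g :: "real \<Rightarrow> complex" and k :: real
  assumes N: "0 < N" and g: "integrable lborel g" "continuous_on UNIV g" "\<And>t. t \<in> {0..2} \<Longrightarrow> cmod (g t) \<le> G"
    and e: "0 \<le> e" "\<And>t t'. t \<in> {0..2} \<Longrightarrow> t' \<in> {0..2} \<Longrightarrow> \<bar>t - t'\<bar> < 2 / real N \<Longrightarrow> norm (U (k + t) x - U (k + t') x) \<le> e"
  defines "M i j \<equiv> \<integral>t. g t * complex_of_real (tent (1 / real N) (t - real (i + j + 1) / real N)) \<partial>lborel"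
  shows "norm (integral {0..2} (\<lambda>t. (g t * complex_of_real (tent 1 (t - 1))) *\<^sub>C U (k + t) x) -
    (\<Sum>i<N. \<Sum>j<N. M i j *\<^sub>C U (k + real (i + j) / real N) x)) \<le> G * e * 2"
proof -
  define \<tau> where "\<tau> i j t = tent (1 / real N) (t - real (i + j + 1) / real N)" for i j :: nat and t
  have c\<tau>: "continuous_on S (\<tau> i j)" for S i j unfolding \<tau>_def by (intro continuous_intros)
  have cg: "continuous_on S g" for S using g(2) continuous_on_subset by blast
  have cU: "continuous_on S (\<lambda>t. U (k + t) x)" for S
    by (rule continuous_on_compose2[OF U_continuous]) (auto intro!: continuous_intros)
  \<comment> \<open>The small tent is centred at (i + j + 1)/N while U is evaluated at (i + j)/N;
    adding the half-width 1/N gives the distance 2/N.\<close>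
  have \<tau>_supp: "t \<in> {0..2} \<and> \<bar>t - real (i + j) / real N\<bar> < 2 / real N" if "i < N" "j < N" "\<tau> i j t \<noteq> 0" for i j t
  proof -
    have "\<bar>t - real (i + j + 1) / real N\<bar> < 1 / real N"
      using that(3) tent_zero[of "1 / real N" "t - real (i + j + 1) / real N"] unfolding \<tau>_def by linarith
    moreover have "real (i + j + 1) / real N = real (i + j) / real N + 1 / real N" by (simp add: add_divide_distrib)
    moreover have "real (i + j) / real N + 2 / real N \<le> 2"
    proof -
      have "real (i + j) + 2 \<le> 2 * real N" using that(1,2) by linarith
      then have "(real (i + j) + 2) / real N \<le> 2" using N by (simp add: field_simps)
      then show ?thesis by (simp add: add_divide_distrib)
    qed
    moreover have "0 \<le> real (i + j) / real N" by simp
    moreover have "2 / real N = 1 / real N + 1 / real N" by simp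
    ultimately show ?thesis unfolding atLeastAtMost_iff abs_less_iff by linarith
  qed
  have M: "((\<lambda>t. g t * complex_of_real (\<tau> i j t)) has_integral M i j) {0..2}" if "i < N" "j < N" for i j
  proof -
    have i: "integrable lborel (\<lambda>t. g t * complex_of_real (\<tau> i j t))"
    proof (rule Bochner_Integration.integrable_bound[OF g(1)])
      show "(\<lambda>t. g t * complex_of_real (\<tau> i j t)) \<in> borel_measurable lborel"
        using borel_measurable_continuous_onI[OF c\<tau>] borel_measurable_continuous_onI[OF cg] by simp
      have "1 / real N \<le> 1" using N by simp
      then have "0 \<le> \<tau> i j t" "\<tau> i j t \<le> 1" for t
        using tent_nonneg tent_le[of "1 / real N" "t - real (i + j + 1) / real N"] by (auto simp: \<tau>_def)
      then have "cmod (g t) * \<bar>\<tau> i j t\<bar> \<le> cmod (g t) * 1" for t by (intro mult_left_mono) simp_all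
      then show "AE t in lborel. norm (g t * complex_of_real (\<tau> i j t)) \<le> norm (g t)"
        by (simp add: norm_mult)
    qed
    have "(\<lambda>t. g t * complex_of_real (\<tau> i j t)) = (\<lambda>t. if t \<in> {0..2} then g t * complex_of_real (\<tau> i j t) else 0)"
    proof
      fix t show "g t * complex_of_real (\<tau> i j t) = (if t \<in> {0..2} then g t * complex_of_real (\<tau> i j t) else 0)"
        using \<tau>_supp[OF that, of t] by (cases "\<tau> i j t = 0") auto
    qed
    moreover have "((\<lambda>t. g t * complex_of_real (\<tau> i j t)) has_integral M i j) UNIV"
      using has_integral_integral_lborel[OF i] by (simp add: M_def \<tau>_def)
    ultimately have "((\<lambda>t. if t \<in> {0..2} then g t * complex_of_real (\<tau> i j t) else 0) has_integral M i j) UNIV" by (simp only:)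
    then show ?thesis by (simp only: has_integral_restrict_UNIV)
  qed
  have piece: "((\<lambda>t. (g t * complex_of_real (\<tau> i j t)) *\<^sub>C U (k + real (i + j) / real N) x) has_integral
    M i j *\<^sub>C U (k + real (i + j) / real N) x) {0..2}" if "i < N" "j < N" for i j
    using has_integral_linear[OF M[OF that] scaleC.bounded_linear_left] by (simp add: o_def)
  have sum_\<tau>: "(\<Sum>i<N. \<Sum>j<N. \<tau> i j t) = tent 1 (t - 1)" for t
    unfolding \<tau>_def by (rule tent_sum_grid[OF N])
  let ?d = "\<lambda>t. (\<Sum>i<N. \<Sum>j<N. (g t * complex_of_real (\<tau> i j t)) *\<^sub>C (U (k + t) x - U (k + real (i + j) / real N) x))"
  have split: "?d t = (g t * complex_of_real (tent 1 (t - 1))) *\<^sub>C U (k + t) x -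
    (\<Sum>i<N. \<Sum>j<N. (g t * complex_of_real (\<tau> i j t)) *\<^sub>C U (k + real (i + j) / real N) x)" for t
  proof -
    have "(g t * complex_of_real (tent 1 (t - 1))) *\<^sub>C U (k + t) x =
      (\<Sum>i<N. \<Sum>j<N. (g t * complex_of_real (\<tau> i j t)) *\<^sub>C U (k + t) x)"
      unfolding sum_\<tau>[symmetric] of_real_sum sum_distrib_left scaleC.sum_left ..
    then show ?thesis by (simp add: scaleC.diff_right sum_subtractf)
  qed
  have "((\<lambda>t. (g t * complex_of_real (tent 1 (t - 1))) *\<^sub>C U (k + t) x) has_integral
    integral {0..2} (\<lambda>t. (g t * complex_of_real (tent 1 (t - 1))) *\<^sub>C U (k + t) x)) {0..2}"
    by (intro integrable_integral integrable_continuous_real scaleC.continuous_on cU continuous_intros cg)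
  moreover have "((\<lambda>t. \<Sum>i<N. \<Sum>j<N. (g t * complex_of_real (\<tau> i j t)) *\<^sub>C U (k + real (i + j) / real N) x) has_integral
    (\<Sum>i<N. \<Sum>j<N. M i j *\<^sub>C U (k + real (i + j) / real N) x)) {0..2}"
    by (intro has_integral_sum piece) auto
  ultimately have d: "(?d has_integral (integral {0..2} (\<lambda>t. (g t * complex_of_real (tent 1 (t - 1))) *\<^sub>C U (k + t) x) -
    (\<Sum>i<N. \<Sum>j<N. M i j *\<^sub>C U (k + real (i + j) / real N) x))) {0..2}"
    unfolding split by (rule has_integral_diff)
  have "0 \<le> G" using order.trans[OF norm_ge_zero g(3)[of 0]] by simp
  have "norm (integral {0..2} (\<lambda>t. (g t * complex_of_real (tent 1 (t - 1))) *\<^sub>C U (k + t) x) -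
    (\<Sum>i<N. \<Sum>j<N. M i j *\<^sub>C U (k + real (i + j) / real N) x)) \<le> G * e * measure lborel {0..2::real}"
  proof (rule has_integral_bound_real[OF mult_nonneg_nonneg[OF \<open>0 \<le> G\<close> e(1)] finite.emptyI d])
    fix t :: real assume "t \<in> {0..2} - {}"
    then have t: "t \<in> {0..2}" by simp
    have "norm ((g t * complex_of_real (\<tau> i j t)) *\<^sub>C (U (k + t) x - U (k + real (i + j) / real N) x)) \<le> G * e * \<tau> i j t"
      if "i < N" "j < N" for i j
    proof (cases "\<tau> i j t = 0")
      case False
      have "real (i + j) \<le> 2 * real N" using that by linarith
      then have "real (i + j) / real N \<in> {0..2}" using N by (simp add: field_simps)
      from e(2)[OF t this] \<tau>_supp[OF that False]
      have 1: "norm (U (k + t) x - U (k + real (i + j) / real N) x) \<le> e" by blast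
      have 2: "0 \<le> \<tau> i j t" by (simp add: \<tau>_def tent_nonneg)
      have "cmod (g t) * \<tau> i j t * norm (U (k + t) x - U (k + real (i + j) / real N) x) \<le> (G * \<tau> i j t) * e"
        by (intro mult_mono mult_right_mono mult_nonneg_nonneg g(3) t 1 2 \<open>0 \<le> G\<close>) simp
      then show ?thesis using 2 by (simp add: norm_scaleC norm_mult mult_ac)
    qed (simp add: scaleC.zero_left)
    then have "norm (?d t) \<le> (\<Sum>i<N. \<Sum>j<N. G * e * \<tau> i j t)"
      by (intro sum_norm_le) auto
    also have "\<dots> = G * e * tent 1 (t - 1)" unfolding sum_\<tau>[symmetric] sum_distrib_left ..
    also have "\<dots> \<le> G * e * 1" using \<open>0 \<le> G\<close> e(1) tent_le[of 1 "t - 1"] by (intro mult_left_mono) auto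
    finally show "norm (?d t) \<le> G * e" by simp
  qed
  then show ?thesis by simp
qed

lemma transference_unit:
  fixes g :: "real \<Rightarrow> complex" and k :: real
  assumes g: "integrable lborel g" "continuous_on UNIV g" and a: "\<And>x. cmod (inv_fourier g x) \<le> a"
  shows "norm (integral {0..2} (\<lambda>t. (g t * complex_of_real (tent 1 (t - 1))) *\<^sub>C U (k + t) x)) \<le>
    C * (1 + \<bar>k\<bar>) powr \<alpha> * (4 * pi * K\<^sup>2 * a * norm x)" (is "norm ?I \<le> ?c * (?b * a * norm x)")
proof (rule field_le_epsilon)
  fix \<epsilon>' :: real assume "0 < \<epsilon>'"
  have c0: "0 \<le> ?c" using U1_bound[of k] norm_ge_zero[of "U1 k"] by linarith
  have "bounded (g ` {0..2})"
    by (intro compact_imp_bounded compact_continuous_image continuous_on_subset[OF g(2)]) auto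
  then obtain G where G: "\<And>t. t \<in> {0..2} \<Longrightarrow> cmod (g t) \<le> G" unfolding bounded_iff by blast
  have G0: "0 \<le> G" using order.trans[OF norm_ge_zero G[of 0]] by simp
  \<comment> \<open>This e controls two errors: the oscillation of U, entering as 2 G e, and the
    replacement of a by a + e, since \<open>riemann_sum_bound\<close> asks for a positive
    bound.\<close>
  define e where "e = \<epsilon>' / (2 * G + ?c * (?b * norm x) + 1)"
  have "0 \<le> ?c * (?b * norm x)" by (intro mult_nonneg_nonneg[OF c0]) simp
  then have den: "0 < 2 * G + ?c * (?b * norm x) + 1" using G0 by linarith
  have e0: "0 < e" using \<open>0 < \<epsilon>'\<close> den by (simp add: e_def)
  have "continuous_on {0..2} (\<lambda>t. U (k + t) x)"
    by (rule continuous_on_compose2[OF U_continuous]) (auto intro!: continuous_intros)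
  then have "uniformly_continuous_on {0..2} (\<lambda>t. U (k + t) x)" by (intro compact_uniformly_continuous) auto
  from this[unfolded uniformly_continuous_on_def, rule_format, OF e0]
  obtain d where d: "0 < d" "\<And>t t'. t \<in> {0..2} \<Longrightarrow> t' \<in> {0..2} \<Longrightarrow> dist t' t < d \<Longrightarrow> dist (U (k + t') x) (U (k + t) x) < e"
    by blast
  obtain N where N: "N \<noteq> 0" "inverse (real N) < d / 2" using real_arch_inverse[of "d / 2"] d(1) by auto
  then have N2: "2 / real N < d" by (simp add: field_simps)
  have N0: "0 < N" using N by simp
  let ?S = "\<Sum>i<N. \<Sum>j<N. (\<integral>t. g t * complex_of_real (tent (1 / real N) (t - real (i + j + 1) / real N)) \<partial>lborel) *\<^sub>C U (k + real (i + j) / real N) x"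
  have "norm (?I - ?S) \<le> G * e * 2"
  proof (rule riemann_sum_error[OF N0 g G less_imp_le[OF e0]])
    fix t t' :: real assume tt: "t \<in> {0..2}" "t' \<in> {0..2}" "\<bar>t - t'\<bar> < 2 / real N"
    then have "dist t t' < d" using N2 by (simp add: dist_real_def)
    from d(2)[OF tt(2,1) this] show "norm (U (k + t) x - U (k + t') x) \<le> e" by (simp add: dist_norm)
  qed
  moreover have "norm ?S \<le> ?c * (?b * (a + e) * norm x)"
  proof (rule riemann_sum_bound[OF N0 g(1)])
    have "0 \<le> a" using a norm_ge_zero order.trans by blast
    then show "0 < a + e" using e0 by simp
    show "cmod (inv_fourier g y) \<le> a + e" for y using a[of y] e0 by linarith
  qed
  moreover have "norm ?I \<le> norm (?I - ?S) + norm ?S" using norm_triangle_ineq[of "?I - ?S" ?S] by (simp only: diff_add_cancel)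
  moreover have "G * e * 2 + ?c * (?b * (a + e) * norm x) = ?c * (?b * a * norm x) + (2 * G + ?c * (?b * norm x)) * e"
    by (simp add: algebra_simps)
  moreover have "(2 * G + ?c * (?b * norm x)) * e \<le> (2 * G + ?c * (?b * norm x) + 1) * e" using e0 by (intro mult_right_mono) auto
  moreover have "(2 * G + ?c * (?b * norm x) + 1) * e = \<epsilon>'" using den by (simp add: e_def)
  ultimately show "norm ?I \<le> ?c * (?b * a * norm x) + \<epsilon>'" by linarith
qed

lemma transference_piece:
  fixes h :: "real \<Rightarrow> complex" and k :: real
  assumes h: "integrable lborel h" "continuous_on UNIV h" and a: "\<And>x. cmod (inv_fourier h x) \<le> a"
  shows "norm (integral {k..k+2} (\<lambda>t. (h t * complex_of_real (tent 1 (t - (k + 1)))) *\<^sub>C U t x)) \<le>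
    C * (1 + \<bar>k\<bar>) powr \<alpha> * (4 * pi * K\<^sup>2 * a * norm x)"
proof -
  have "integral {k..k+2} (\<lambda>t. (h t * complex_of_real (tent 1 (t - (k + 1)))) *\<^sub>C U t x) =
    integral {0..2} (\<lambda>t. (h (k + t) * complex_of_real (tent 1 (t - 1))) *\<^sub>C U (k + t) x)"
    using integral_shift_Icc_real[of 0 2 "\<lambda>t. (h t * complex_of_real (tent 1 (t - (k + 1)))) *\<^sub>C U t x" k]
    by (simp add: o_def add.commute[of 2])
  moreover have "norm (integral {0..2} (\<lambda>t. (h (k + t) * complex_of_real (tent 1 (t - 1))) *\<^sub>C U (k + t) x)) \<le>
    C * (1 + \<bar>k\<bar>) powr \<alpha> * (4 * pi * K\<^sup>2 * a * norm x)"
  proof (rule transference_unit)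
    show "integrable lborel (\<lambda>t. h (k + t))" using lborel_integrable_real_affine[OF h(1), of 1 k] by simp
    show "continuous_on UNIV (\<lambda>t. h (k + t))"
      by (rule continuous_on_compose2[OF h(2)]) (auto intro!: continuous_intros)
    show "cmod (inv_fourier (\<lambda>t. h (k + t)) y) \<le> a" for y using a by (simp add: cmod_inv_fourier_shift)
  qed
  ultimately show ?thesis by simp
qed

end

section \<open>Summation over the units of time\<close>

context regularised_family
begin

lemma constants_nonneg: "0 \<le> C" "0 \<le> B"
  using order.trans[OF norm_ge_zero U1_bound[of 0]] order.trans[OF norm_ge_zero U_bound[of 0]] by simp_all

context
  fixes \<phi> f :: "real \<Rightarrow> complex"
  assumes \<phi>: "unit_partition \<phi>" and f: "f \<in> E_space \<phi> \<alpha>" "compact_support_pos f"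
begin

lemma f_integrable: "integrable lborel f"
proof -
  obtain R where R: "\<And>x. \<bar>x\<bar> > real R \<Longrightarrow> f x = 0" using compact_support_posE[OF f(2)] by blast
  have "continuous_on UNIV f" using f(1) by (simp add: E_space_def)
  then show ?thesis by (rule integrable_continuous_compact_support[OF _ R])
qed

lemma F_continuous: "continuous_on S (fourier f)"
  by (rule continuous_on_subset[OF continuous_on_fourier[OF f_integrable]]) simp

lemma UC: "continuous_on S (\<lambda>t. U t x)"
  by (rule continuous_on_subset[OF U_continuous]) simp

lemma integrand_bound:
  "norm (fourier f t *\<^sub>C U t x) \<le> (B * norm x) * (cmod (fourier f t) * (1 + \<bar>t\<bar>) powr \<alpha>)"
proof -
  have "norm (U t x) \<le> (B * (1 + \<bar>t\<bar>) powr \<alpha>) * norm x"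
    by (intro order.trans[OF norm_blinfun] mult_right_mono U_bound) simp
  then have "cmod (fourier f t) * norm (U t x) \<le> cmod (fourier f t) * ((B * (1 + \<bar>t\<bar>) powr \<alpha>) * norm x)"
    by (rule mult_left_mono) simp
  then show ?thesis by (simp add: norm_scaleC mult_ac)
qed

lemma weight_integrable: "integrable lborel (\<lambda>t. (B * norm x) * (cmod (fourier f t) * (1 + \<bar>t\<bar>) powr \<alpha>))"
  by (intro integrable_mult_right weighted_fourier_integrable[OF \<phi> \<alpha> f])

lemma integrand_integrable:
  "(\<lambda>t. fourier f t *\<^sub>C U t x) integrable_on UNIV"
  "(\<lambda>t. norm (fourier f t *\<^sub>C U t x)) integrable_on UNIV"
proof -
  have c: "continuous_on S (\<lambda>t. fourier f t *\<^sub>C U t x)" for S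
    by (intro scaleC.continuous_on F_continuous UC)
  note w = integrable_on_lborel[OF weight_integrable]
  show "(\<lambda>t. fourier f t *\<^sub>C U t x) integrable_on UNIV"
    by (rule integrable_on_all_intervals_UNIV[OF _ integrand_bound w]) (simp add: integrable_continuous_real c)
  show "(\<lambda>t. norm (fourier f t *\<^sub>C U t x)) integrable_on UNIV"
  proof (rule integrable_on_all_intervals_UNIV[OF _ _ w])
    show "norm (norm (fourier f t *\<^sub>C U t x)) \<le> (B * norm x) * (cmod (fourier f t) * (1 + \<bar>t\<bar>) powr \<alpha>)" for t
      using integrand_bound by simp
    show "(\<lambda>t. norm (fourier f t *\<^sub>C U t x)) integrable_on cbox a b" for a b
      by (simp add: integrable_continuous_real continuous_on_norm c)
  qed
qed

text \<open>On the support of the tent only the frequency pieces with index within 2 of k are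
  present, and \<open>transference_piece\<close> applies to each of them. It is used with starting
  time k - 1 because its tent is centred one unit later.\<close>

lemma tent_piece_bound:
  fixes k :: int
  shows "norm (integral {of_int k - 1..of_int k + 1} (\<lambda>t. (fourier f t * complex_of_real (tent 1 (t - of_int k))) *\<^sub>C U t x)) \<le>
    (C * 4 powr \<alpha> * (4 * pi * K\<^sup>2) * norm x) * (\<Sum>j\<in>{k-2..k+2}. E_term \<phi> \<alpha> f j)"
proof -
  define h where "h j t = fourier f t * \<phi> (t - of_int j)" for j t
  note h = frequency_piece[OF \<phi> f_integrable, folded h_def]
  define r :: real where "r = of_int k - 1"
  have r: "{of_int k - 1..of_int k + 1} = {r..r+2}" "of_int k = r + 1" by (simp_all add: r_def)
  let ?g = "\<lambda>j t. (h j t * complex_of_real (tent 1 (t - (r + 1)))) *\<^sub>C U t x"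
  have "integral {r..r+2} (\<lambda>t. (fourier f t * complex_of_real (tent 1 (t - (r + 1)))) *\<^sub>C U t x) =
    integral {r..r+2} (\<lambda>t. \<Sum>j\<in>{k-2..k+2}. ?g j t)"
  proof (rule integral_cong)
    fix t assume "t \<in> {r..r+2}"
    then have "real_of_int (k - 2) \<le> t - 1" "t + 1 \<le> real_of_int (k + 2)" by (auto simp: r_def)
    from unit_partition_sum_interval[OF \<phi> this]
    have s: "(\<Sum>j\<in>{k-2..k+2}. \<phi> (t - of_int j)) = 1" by simp
    have "(\<Sum>j\<in>{k-2..k+2}. h j t) = fourier f t"
      unfolding h_def sum_distrib_left[symmetric] s by simp
    then have "(fourier f t * complex_of_real (tent 1 (t - (r + 1)))) *\<^sub>C U t x =
      ((\<Sum>j\<in>{k-2..k+2}. h j t) * complex_of_real (tent 1 (t - (r + 1)))) *\<^sub>C U t x" by (simp only:)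
    also have "\<dots> = (\<Sum>j\<in>{k-2..k+2}. ?g j t)"
      unfolding sum_distrib_right scaleC.sum_left ..
    finally show "(fourier f t * complex_of_real (tent 1 (t - (r + 1)))) *\<^sub>C U t x = (\<Sum>j\<in>{k-2..k+2}. ?g j t)" .
  qed
  also have "\<dots> = (\<Sum>j\<in>{k-2..k+2}. integral {r..r+2} (?g j))"
    by (intro Henstock_Kurzweil_Integration.integral_sum integrable_continuous_real scaleC.continuous_on UC continuous_intros
      continuous_on_subset[OF h(3)]) auto
  also have "norm \<dots> \<le> (\<Sum>j\<in>{k-2..k+2}. (C * 4 powr \<alpha> * (4 * pi * K\<^sup>2) * norm x) * E_term \<phi> \<alpha> f j)"
  proof (rule sum_norm_le)
    fix j :: int assume j: "j \<in> {k-2..k+2}"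
    define w :: real where "w = (1 + \<bar>of_int j\<bar>) powr \<alpha>"
    have w0: "0 < w" by (simp add: w_def add_pos_nonneg)
    have "cmod (inv_fourier (h j) y) \<le> E_term \<phi> \<alpha> f j / w" for y
      using h(4)[of j \<alpha> y] w0 by (simp add: w_def[symmetric] field_simps)
    from transference_piece[OF h(1) h(3) this]
    have "norm (integral {r..r+2} (?g j)) \<le> C * (1 + \<bar>r\<bar>) powr \<alpha> * (4 * pi * K\<^sup>2 * (E_term \<phi> \<alpha> f j / w) * norm x)" .
    also have "\<dots> = (1 + \<bar>r\<bar>) powr \<alpha> * (C * (4 * pi * K\<^sup>2) * (E_term \<phi> \<alpha> f j / w) * norm x)" by (simp only: mult_ac)
    also have "\<dots> \<le> (4 powr \<alpha> * w) * (C * (4 * pi * K\<^sup>2) * (E_term \<phi> \<alpha> f j / w) * norm x)"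
    proof (rule mult_right_mono)
      \<comment> \<open>From |j - k| \<le> 2 and r = k - 1 one has |r| \<le> |j| + 3. Thus the
        weight of the first factor is traded for the weight in the \<open>E\<close>-norm.\<close>
      have "1 + \<bar>r\<bar> \<le> 4 * (1 + \<bar>real_of_int j\<bar>)" using j by (auto simp: r_def abs_if)
      then have "(1 + \<bar>r\<bar>) powr \<alpha> \<le> (4 * (1 + \<bar>real_of_int j\<bar>)) powr \<alpha>" using \<alpha> by (intro powr_mono2) auto
      also have "\<dots> = 4 powr \<alpha> * w" unfolding w_def by (subst powr_mult) simp_all
      finally show "(1 + \<bar>r\<bar>) powr \<alpha> \<le> 4 powr \<alpha> * w" .
      show "0 \<le> C * (4 * pi * K\<^sup>2) * (E_term \<phi> \<alpha> f j / w) * norm x"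
        by (intro mult_nonneg_nonneg divide_nonneg_pos constants_nonneg h(5) w0) auto
    qed
    also have "\<dots> = (C * 4 powr \<alpha> * (4 * pi * K\<^sup>2) * norm x) * E_term \<phi> \<alpha> f j" using w0 by simp
    finally show "norm (integral {r..r+2} (?g j)) \<le> (C * 4 powr \<alpha> * (4 * pi * K\<^sup>2) * norm x) * E_term \<phi> \<alpha> f j" .
  qed
  also have "\<dots> = (C * 4 powr \<alpha> * (4 * pi * K\<^sup>2) * norm x) * (\<Sum>j\<in>{k-2..k+2}. E_term \<phi> \<alpha> f j)"
    by (rule sum_distrib_left[symmetric])
  finally show ?thesis unfolding r(1) unfolding r(2) .
qed

lemma E_term_nonneg: "0 \<le> E_term \<phi> \<alpha> f j"
  by (rule frequency_piece(5)[OF \<phi> f_integrable])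

text \<open>After reindexing, the double sum consists of five shifted partial sums of the
  \<open>E\<close>-norm.\<close>

lemma E_term_sum_le:
  "(\<Sum>k\<in>{-int n..int n}. \<Sum>j\<in>{k-2..k+2}. E_term \<phi> \<alpha> f j) \<le> 5 * E_norm \<phi> \<alpha> f"
proof -
  have "(\<Sum>k\<in>{-int n..int n}. \<Sum>j\<in>{k-2..k+2}. E_term \<phi> \<alpha> f j) = (\<Sum>k\<in>{-int n..int n}. \<Sum>i\<in>{-2..2}. E_term \<phi> \<alpha> f (k + i))"
  proof (rule sum.cong[OF refl])
    fix k :: int
    show "(\<Sum>j\<in>{k-2..k+2}. E_term \<phi> \<alpha> f j) = (\<Sum>i\<in>{-2..2}. E_term \<phi> \<alpha> f (k + i))"
      by (rule sum.reindex_bij_witness[where i = "\<lambda>i. k + i" and j = "\<lambda>j. j - k"]) auto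
  qed
  also have "\<dots> = (\<Sum>i\<in>{-2..2}. \<Sum>k\<in>{-int n..int n}. E_term \<phi> \<alpha> f (k + i))" by (rule sum.swap)
  also have "\<dots> \<le> (\<Sum>i\<in>{-2..2::int}. E_norm \<phi> \<alpha> f)"
  proof (rule sum_mono)
    fix i :: int
    have "(\<Sum>k\<in>{-int n..int n}. E_term \<phi> \<alpha> f (k + i)) = sum (E_term \<phi> \<alpha> f) ((\<lambda>k. k + i) ` {-int n..int n})"
      by (subst sum.reindex) (auto simp: inj_on_def)
    also have "\<dots> \<le> E_norm \<phi> \<alpha> f"
      unfolding E_norm_def using f(1) by (intro finite_sum_le_infsum E_term_nonneg) (auto simp: E_space_def)
    finally show "(\<Sum>k\<in>{-int n..int n}. E_term \<phi> \<alpha> f (k + i)) \<le> E_norm \<phi> \<alpha> f" .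
  qed
  finally show ?thesis by simp
qed

text \<open>The finite tent sums \<open>p n\<close> equal 1 on [-n, n] and lie between 0 and 1
  everywhere. Their part of the integral is bounded piece by piece; the rest is dominated by the
  integral of \<open>W * (1 - p n)\<close>, which tends to 0 by
  \<open>weighted_fourier_integrable\<close>.\<close>

lemma calculus_bound:
  "norm (integral UNIV (\<lambda>t. fourier f t *\<^sub>C U t x)) \<le> (C * 4 powr \<alpha> * (4 * pi * K\<^sup>2) * norm x) * (5 * E_norm \<phi> \<alpha> f)"
proof -
  let ?I = "integral UNIV (\<lambda>t. fourier f t *\<^sub>C U t x)" and ?c = "C * 4 powr \<alpha> * (4 * pi * K\<^sup>2) * norm x"
  define p where "p n t = (\<Sum>k=-int n..int n. tent 1 (t - of_int k))" for n t
  have p: "0 \<le> p n t" "p n t \<le> 1" for n t unfolding p_def by (intro sum_nonneg tent_nonneg, rule tent_partition_le)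
  have cp: "continuous_on S (p n)" for S n unfolding p_def by (intro continuous_intros)
  define W where "W t = (B * norm x) * (cmod (fourier f t) * (1 + \<bar>t\<bar>) powr \<alpha>)" for t
  have W_int: "integrable lborel W" unfolding W_def by (rule weight_integrable)
  note [measurable] = borel_measurable_integrable[OF W_int] borel_measurable_continuous_onI[OF cp]
  have W0: "0 \<le> W t" for t unfolding W_def by (intro mult_nonneg_nonneg constants_nonneg) auto
  have s_int: "integrable lborel (\<lambda>t. W t * (1 - p n t))" for n
  proof (rule Bochner_Integration.integrable_bound[OF W_int])
    have "W t * \<bar>1 - p n t\<bar> \<le> W t * 1" for t using p[where n = n and t = t] by (intro mult_left_mono W0) auto
    then show "AE t in lborel. norm (W t * (1 - p n t)) \<le> norm (W t)" using W0 by (simp add: abs_mult)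
  qed measurable
  have lim: "(\<lambda>n. \<integral>t. W t * (1 - p n t) \<partial>lborel) \<longlonglongrightarrow> integral\<^sup>L lborel (\<lambda>_::real. 0)"
  proof (rule integral_dominated_convergence[where w = W])
    show "AE t in lborel. (\<lambda>n. W t * (1 - p n t)) \<longlonglongrightarrow> 0"
    proof (rule AE_I2, rule tendsto_eventually)
      fix t :: real
      show "\<forall>\<^sub>F n in sequentially. W t * (1 - p n t) = 0"
        using eventually_ge_at_top[of "nat \<lceil>\<bar>t\<bar>\<rceil>"]
      proof eventually_elim
        case (elim n)
        then have "\<bar>t\<bar> \<le> real n" by linarith
        then show ?case unfolding p_def by (simp add: tent_partition)
      qed
    qed
    show "AE t in lborel. norm (W t * (1 - p n t)) \<le> W t" for n
    proof (rule AE_I2)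
      fix t
      have "W t * \<bar>1 - p n t\<bar> \<le> W t * 1" using p[where n = n and t = t] by (intro mult_left_mono W0) auto
      then show "norm (W t * (1 - p n t)) \<le> W t" using W0 by (simp add: abs_mult)
    qed
  qed (use W_int in measurable)
  have "norm ?I \<le> ?c * (5 * E_norm \<phi> \<alpha> f) + (\<integral>t. W t * (1 - p n t) \<partial>lborel)" for n
  proof -
    let ?g = "\<lambda>k t. (fourier f t * complex_of_real (tent 1 (t - of_int k))) *\<^sub>C U t x"
    let ?J = "\<lambda>k. integral {of_int k - 1..of_int k + 1} (?g k)"
    have piece: "(?g k has_integral ?J k) UNIV" for k :: int
    proof (rule has_integral_on_superset[of _ _ "{of_int k - 1..of_int k + 1}"])
      show "(?g k has_integral ?J k) {of_int k - 1..of_int k + 1}"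
        by (intro integrable_integral integrable_continuous_real scaleC.continuous_on UC continuous_intros F_continuous)
      fix t :: real assume "t \<notin> {of_int k - 1..of_int k + 1}"
      then have "1 \<le> \<bar>t - of_int k\<bar>" by auto
      then show "?g k t = 0" by (simp add: tent_zero scaleC.zero_left)
    qed simp
    have "((\<lambda>t. \<Sum>k=-int n..int n. ?g k t) has_integral (\<Sum>k=-int n..int n. ?J k)) UNIV"
      by (intro has_integral_sum piece) auto
    moreover have "((\<lambda>t. fourier f t *\<^sub>C U t x) has_integral ?I) UNIV"
      by (rule integrable_integral[OF integrand_integrable(1)])
    ultimately have d: "((\<lambda>t. fourier f t *\<^sub>C U t x - (\<Sum>k=-int n..int n. ?g k t)) has_integral ?I - (\<Sum>k=-int n..int n. ?J k)) UNIV"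
      by (rule has_integral_diff[rotated])
    have eq: "fourier f t *\<^sub>C U t x - (\<Sum>k=-int n..int n. ?g k t) = complex_of_real (1 - p n t) *\<^sub>C (fourier f t *\<^sub>C U t x)" for t
    proof -
      have "(\<Sum>k=-int n..int n. ?g k t) = (\<Sum>k=-int n..int n. complex_of_real (tent 1 (t - of_int k)) *\<^sub>C (fourier f t *\<^sub>C U t x))"
        by (simp add: scaleC_scaleC mult.commute)
      also have "\<dots> = complex_of_real (p n t) *\<^sub>C (fourier f t *\<^sub>C U t x)"
        unfolding p_def of_real_sum scaleC.sum_left ..
      finally show ?thesis by (simp add: scaleC.diff_left scaleC_one)
    qed
    have "norm (?I - (\<Sum>k=-int n..int n. ?J k)) \<le> integral UNIV (\<lambda>t. W t * (1 - p n t))"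
      unfolding integral_unique[OF d, symmetric]
    proof (rule Henstock_Kurzweil_Integration.integral_norm_bound_integral)
      show "(\<lambda>t. fourier f t *\<^sub>C U t x - (\<Sum>k=-int n..int n. ?g k t)) integrable_on UNIV" using d by blast
      show "(\<lambda>t. W t * (1 - p n t)) integrable_on UNIV" by (rule integrable_on_lborel[OF s_int])
      fix t :: real
      have "(1 - p n t) * norm (fourier f t *\<^sub>C U t x) \<le> (1 - p n t) * W t"
        unfolding W_def using p by (intro mult_left_mono integrand_bound) simp
      then show "norm (fourier f t *\<^sub>C U t x - (\<Sum>k=-int n..int n. ?g k t)) \<le> W t * (1 - p n t)"
        unfolding eq norm_scaleC[of "complex_of_real _"] norm_of_real using p(2)[of n t] by (simp add: mult.commute)
    qed
    also have "\<dots> = (\<integral>t. W t * (1 - p n t) \<partial>lborel)" by (rule integral_lborel[OF s_int])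
    finally have 1: "norm (?I - (\<Sum>k=-int n..int n. ?J k)) \<le> (\<integral>t. W t * (1 - p n t) \<partial>lborel)" .
    have "norm (\<Sum>k=-int n..int n. ?J k) \<le> (\<Sum>k=-int n..int n. ?c * (\<Sum>j\<in>{k-2..k+2}. E_term \<phi> \<alpha> f j))"
      by (intro sum_norm_le tent_piece_bound)
    also have "\<dots> \<le> ?c * (5 * E_norm \<phi> \<alpha> f)"
      unfolding sum_distrib_left[symmetric]
      by (intro mult_left_mono E_term_sum_le mult_nonneg_nonneg constants_nonneg) auto
    finally have 2: "norm (\<Sum>k=-int n..int n. ?J k) \<le> ?c * (5 * E_norm \<phi> \<alpha> f)" .
    show ?thesis using 1 2 norm_triangle_sub[of ?I "\<Sum>k=-int n..int n. ?J k"] by linarith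
  qed
  moreover have "(\<lambda>n. ?c * (5 * E_norm \<phi> \<alpha> f) + (\<integral>t. W t * (1 - p n t) \<partial>lborel)) \<longlonglongrightarrow> ?c * (5 * E_norm \<phi> \<alpha> f) + 0"
    using lim by (intro tendsto_add tendsto_const) simp
  ultimately have "norm ?I \<le> ?c * (5 * E_norm \<phi> \<alpha> f) + 0"
    by (intro LIMSEQ_le_const) auto
  then show ?thesis by simp
qed

lemma calculus_operator:
  obtains S where "complex_linear S" "\<And>x. S x = (1 / (2 * pi)) *\<^sub>R integral UNIV (\<lambda>t. fourier f t *\<^sub>C U t x)"
    "norm S \<le> C * 4 powr \<alpha> * (10 * K\<^sup>2) * E_norm \<phi> \<alpha> f"
proof -
  define I where "I x = integral UNIV (\<lambda>t. fourier f t *\<^sub>C U t x)" for x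
  define S' where "S' x = (1 / (2 * pi)) *\<^sub>R I x" for x
  let ?c = "C * 4 powr \<alpha> * (10 * K\<^sup>2) * E_norm \<phi> \<alpha> f"
  have E0: "0 \<le> E_norm \<phi> \<alpha> f" unfolding E_norm_def by (rule infsum_nonneg[OF E_term_nonneg])
  have c0: "0 \<le> ?c" by (intro mult_nonneg_nonneg constants_nonneg E0) auto
  have I_scaleC: "I (c *\<^sub>C x) = c *\<^sub>C I x" for c x
  proof -
    have "(\<lambda>t. fourier f t *\<^sub>C U t (c *\<^sub>C x)) = (\<lambda>t. c *\<^sub>C (fourier f t *\<^sub>C U t x))"
      by (simp add: complex_linear_scaleC[OF U_linear] scaleC_scaleC mult.commute)
    then show ?thesis
      using integral_linear[OF integrand_integrable(1)[of x] scaleC.bounded_linear_right[of c]] by (simp add: I_def o_def)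
  qed
  have bound: "norm (S' x) \<le> norm x * ?c" for x
  proof -
    have "norm (S' x) = (1 / (2 * pi)) * norm (I x)" by (simp add: S'_def)
    \<comment> \<open>The constant 10 in \<open>?c\<close> is
      \<open>4 * pi * 5 / (2 * pi)\<close>.\<close>
    also have "\<dots> \<le> (1 / (2 * pi)) * ((C * 4 powr \<alpha> * (4 * pi * K\<^sup>2) * norm x) * (5 * E_norm \<phi> \<alpha> f))"
      unfolding I_def by (intro mult_left_mono calculus_bound) simp
    also have "\<dots> = norm x * ?c" by simp
    finally show ?thesis .
  qed
  have bl: "bounded_linear S'"
  proof (rule bounded_linear_intro[OF _ _ bound])
    fix x y :: 'a and r :: real
    have "I (x + y) = I x + I y"
      by (simp add: I_def blinfun.add_right scaleC.add_right Henstock_Kurzweil_Integration.integral_add integrand_integrable(1))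
    then show "S' (x + y) = S' x + S' y" by (simp add: S'_def scaleR_add_right)
    have "I (r *\<^sub>R x) = r *\<^sub>R I x" using I_scaleC[of "complex_of_real r" x] by (simp add: scaleC_of_real)
    then show "S' (r *\<^sub>R x) = r *\<^sub>R S' x" by (simp add: S'_def)
  qed
  show thesis
  proof (rule that[of "Blinfun S'"])
    show "complex_linear (Blinfun S')"
      by (simp add: complex_linear_def bounded_linear_Blinfun_apply[OF bl] S'_def I_scaleC scaleC.scaleR_right)
    show "Blinfun S' x = (1 / (2 * pi)) *\<^sub>R integral UNIV (\<lambda>t. fourier f t *\<^sub>C U t x)" for x
      by (simp only: bounded_linear_Blinfun_apply[OF bl] S'_def I_def)
    show "norm (Blinfun S') \<le> ?c"
      by (rule norm_blinfun_bound[OF c0]) (use bound in \<open>simp add: bounded_linear_Blinfun_apply[OF bl] mult.commute\<close>)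
  qed
qed

end

end

section \<open>The smoothed functional calculus\<close>

theorem proposition3p5:
  fixes D :: "'a::complex_banach set"
    and A :: "'a \<Rightarrow> 'a"
    and T :: "complex \<Rightarrow> ('a \<Rightarrow>\<^sub>L 'a)"
    and \<phi> :: "real \<Rightarrow> complex"
    and \<alpha> \<beta>\<^sub>1 \<beta>\<^sub>2 C :: real
  assumes "zero_sectorial D A"
    and "analytic_semigroup_of D A T"
    and "unit_partition \<phi>"
    and "0 < \<alpha>" and "\<alpha> \<le> \<beta>\<^sub>1" and "\<alpha> \<le> \<beta>\<^sub>2"
    and "0 < C"
    and "\<forall>t. reg_group_bounded T \<beta>\<^sub>1 t \<and> norm (reg_group T \<beta>\<^sub>1 t) \<le> C * (1 + \<bar>t\<bar>) powr \<alpha>"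
    and "\<forall>t\<in>{0..1}. reg_group_bounded T \<beta>\<^sub>2 t"
    and "gamma_bounded (reg_group T \<beta>\<^sub>2 ` {0..1})"
  shows "(\<forall>t. reg_group_bounded T (\<beta>\<^sub>1 + 2 * \<beta>\<^sub>2) t) \<and>
    (\<exists>C'>0. \<forall>f\<in>E_space \<phi> \<alpha>. compact_support_pos f \<longrightarrow>
      (\<exists>S. is_smoothed_calculus T (\<beta>\<^sub>1 + 2 * \<beta>\<^sub>2) f S \<and> norm S \<le> C' * E_norm \<phi> \<alpha> f))"
proof -
  interpret sectorial_semigroup D A T by unfold_locales fact+
  have \<beta>: "0 < \<beta>\<^sub>1" "0 < \<beta>\<^sub>2" using assms(4-6) by simp_all
  have b1: "reg_group_bounded T \<beta>\<^sub>1 t" "norm (reg_group T \<beta>\<^sub>1 t) \<le> C * (1 + \<bar>t\<bar>) powr \<alpha>" for t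
    using assms(8) by simp_all
  have b2: "reg_group_bounded T \<beta>\<^sub>2 t" if "t \<in> {0..1}" for t using assms(9) that by blast
  let ?U = "reg_group T (\<beta>\<^sub>1 + 2 * \<beta>\<^sub>2)"
  \<comment> \<open>Splitting off the exponent \<open>\<beta>\<^sub>1\<close> alone works at every
    time t and gives existence and the bound \<open>B\<close>. The finer splitting with
    \<open>\<beta>\<^sub>2\<close>, used for \<open>factor\<close>, concerns times s and r in [0, 1]
    only.\<close>
  have isg: "is_reg_group T (\<beta>\<^sub>1 + 2 * \<beta>\<^sub>2) t (reg_group T \<beta>\<^sub>1 t o\<^sub>L fp (2 * \<beta>\<^sub>2))" for t
    using \<beta> by (intro is_reg_group_fp b1) auto
  then have bdd: "reg_group_bounded T (\<beta>\<^sub>1 + 2 * \<beta>\<^sub>2) t" for t by (auto simp: reg_group_bounded_def)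
  define B where "B = C * norm (fp (2 * \<beta>\<^sub>2))"
  have B: "norm (?U t) \<le> B * (1 + \<bar>t\<bar>) powr \<alpha>" for t
  proof -
    have "norm (?U t) \<le> norm (reg_group T \<beta>\<^sub>1 t) * norm (fp (2 * \<beta>\<^sub>2))"
      unfolding reg_group_eq[OF isg] by (rule norm_blinfun_compose)
    also have "\<dots> \<le> (C * (1 + \<bar>t\<bar>) powr \<alpha>) * norm (fp (2 * \<beta>\<^sub>2))" by (intro mult_right_mono b1) simp
    finally show ?thesis by (simp add: B_def mult_ac)
  qed
  have B0: "0 \<le> B" using assms(7) by (simp add: B_def)
  obtain K where K: "0 \<le> K" "\<And>n S x. (\<And>k. k < n \<Longrightarrow> S k \<in> reg_group T \<beta>\<^sub>2 ` {0..1}) \<Longrightarrow>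
    gauss_norm n (\<lambda>k. blinfun_apply (S k) (x k)) \<le> K * gauss_norm n x"
    using assms(10) unfolding gamma_bounded_def by blast
  interpret regularised_family ?U "reg_group T \<beta>\<^sub>1" "reg_group T \<beta>\<^sub>2" K C B \<alpha>
  proof
    show "0 \<le> K" "0 < \<alpha>" by fact+
    show "gauss_norm n (\<lambda>k. blinfun_apply (R k) (y k)) \<le> K * gauss_norm n y"
      if "\<And>k. k < n \<Longrightarrow> R k \<in> reg_group T \<beta>\<^sub>2 ` {0..1}" for n R y by (rule K(2)[OF that])
    show "norm (reg_group T \<beta>\<^sub>1 t) \<le> C * (1 + \<bar>t\<bar>) powr \<alpha>" "norm (?U t) \<le> B * (1 + \<bar>t\<bar>) powr \<alpha>" for t
      by (rule b1, rule B)
    show "complex_linear (?U t)" "complex_linear (reg_group T \<beta>\<^sub>1 t)" for t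
      by (rule reg_group_linear[OF bdd], rule reg_group_linear[OF b1(1)])
    show "complex_linear (reg_group T \<beta>\<^sub>2 s)" if "s \<in> {0..1}" for s by (rule reg_group_linear[OF b2[OF that]])
    show "?U (k + (s + r)) x = reg_group T \<beta>\<^sub>1 k (reg_group T \<beta>\<^sub>2 s (reg_group T \<beta>\<^sub>2 r x))"
      if "s \<in> {0..1}" "r \<in> {0..1}" for k s r x
    proof -
      note sr = is_reg_group_comp[OF b2[OF that(1)] b2[OF that(2)] \<beta>(2) \<beta>(2)]
      then have bb: "reg_group_bounded T (\<beta>\<^sub>2 + \<beta>\<^sub>2) (s + r)" unfolding reg_group_bounded_def by (rule exI)
      have e: "reg_group T (\<beta>\<^sub>1 + (\<beta>\<^sub>2 + \<beta>\<^sub>2)) (k + (s + r)) = reg_group T \<beta>\<^sub>1 k o\<^sub>L reg_group T (\<beta>\<^sub>2 + \<beta>\<^sub>2) (s + r)"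
        by (rule reg_group_eq, rule is_reg_group_comp[OF b1(1) bb \<beta>(1)]) (use \<beta> in simp)
      show ?thesis unfolding mult_2 e reg_group_eq[OF sr] blinfun_apply_blinfun_compose ..
    qed
    show "continuous_on UNIV (\<lambda>t. ?U t x)" for x
    proof (intro continuous_at_imp_continuous_on ballI)
      fix t :: real
      have "continuous_on {t - 1<..<t + 1} (\<lambda>t. ?U t x)"
      proof (rule reg_group_continuous[where M = "B * (2 + \<bar>t\<bar>) powr \<alpha>"])
        fix s assume "s \<in> {t - 1<..<t + 1}"
        then have "1 + \<bar>s\<bar> \<le> 2 + \<bar>t\<bar>" by (auto simp: abs_if split: if_splits)
        then have "(1 + \<bar>s\<bar>) powr \<alpha> \<le> (2 + \<bar>t\<bar>) powr \<alpha>" using assms(4) by (intro powr_mono2) auto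
        from mult_left_mono[OF this B0] show "norm (?U s) \<le> B * (2 + \<bar>t\<bar>) powr \<alpha>" using B[of s] by linarith
      qed (use \<beta> bdd in auto)
      then show "isCont (\<lambda>t. ?U t x) t" by (simp add: continuous_on_eq_continuous_at)
    qed
  qed
  \<comment> \<open>The summand 1 keeps the constant positive when \<open>K\<close> is 0.\<close>
  define C' where "C' = C * 4 powr \<alpha> * (10 * K\<^sup>2) + 1"
  have "0 < C'" unfolding C'_def using assms(7) by (intro add_nonneg_pos mult_nonneg_nonneg) auto
  moreover have "\<exists>S. is_smoothed_calculus T (\<beta>\<^sub>1 + 2 * \<beta>\<^sub>2) f S \<and> norm S \<le> C' * E_norm \<phi> \<alpha> f"
    if f: "f \<in> E_space \<phi> \<alpha>" "compact_support_pos f" for f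
  proof -
    obtain S where S: "complex_linear S" "\<And>x. S x = (1 / (2 * pi)) *\<^sub>R integral UNIV (\<lambda>t. fourier f t *\<^sub>C ?U t x)"
      "norm S \<le> C * 4 powr \<alpha> * (10 * K\<^sup>2) * E_norm \<phi> \<alpha> f"
      by (rule calculus_operator[OF assms(3) f]) blast
    have "0 \<le> E_norm \<phi> \<alpha> f" unfolding E_norm_def by (rule infsum_nonneg[OF E_term_nonneg[OF assms(3) f]])
    then have "norm S \<le> C' * E_norm \<phi> \<alpha> f" using S(3) by (simp add: C'_def distrib_right)
    moreover have "is_smoothed_calculus T (\<beta>\<^sub>1 + 2 * \<beta>\<^sub>2) f S"
      unfolding is_smoothed_calculus_def using S(1,2) integrand_integrable[OF assms(3) f] by blast
    ultimately show ?thesis by blast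
  qed
  ultimately show ?thesis using bdd by blast
qed

end
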